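(* Let $\Bbbk$ be an infinite field of characteristic $2$, let $G=\langle\sigma_1,\sigma_2\rangle\cong C_2\times C_2$, let $V$ be a faithful $\Bbbk G$-module isomorphic to one of the modules $V_{n,\lambda}$ ($n\ge 2$ even, $\lambda\in\Bbbk\cup\{\infty\}$), $\Omega^m(\Bbbk)$ ($m\in\mathbb{Z}$, $m\neq 0$) or $\Bbbk G$ described in the context, and let $R = \Bbbk[V]^G/\mathrm{Tr}^G(\Bbbk[V])$. Then: (1) if $V\cong V_{n,\lambda}$ with $\lambda\in\Bbbk\setminus\{0,1\}$, then $\operatorname{depth}(R)=n/2$ and $R$ is Cohen-Macaulay; (2) if $V\cong V_{n,\lambda}$ with $\lambda\in\{0,1,\infty\}$ (so that faithfulness means $n\ge 4$), then $\operatorname{depth}(R)=n/2$ and $R$ is not Cohen-Macaulay; (3) if $V\cong\Omega^{m}(\Bbbk)$ with $m<0$, then $\operatorname{depth}(R)=|m|+1$ and $R$ is Cohen-Macaulay; (4) if $V\cong\Omega^{m}(\Bbbk)$ with $m\ge 2$, then $\operatorname{depth}(R)=m$ and $R$ is not Cohen-Macaulay; (5) if $V\cong\Omega^{1}(\Bbbk)$, then $\operatorname{depth}(R)=2$ and $R$ is Cohen-Macaulay; (6) if $V\cong\Bbbk G$, then $\operatorname{depth}(R)=2$ and $R$ is Cohen-Macaulay.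
   Context: $\Bbbk[V]=S(V^* )$ is the symmetric algebra of $V^*$, with $G$ acting via $\sigma(f)=f\circ\sigma^{-1}$, and $\Bbbk[V]^G$ is the ring of invariants. The transfer is $\mathrm{Tr}^G:\Bbbk[V]\to\Bbbk[V]^G$, $f\mapsto\sum_{\sigma\in G}\sigma f$; its image is an ideal of $\Bbbk[V]^G$. The depth of a Noetherian commutative graded $\Bbbk$-algebra $A=\bigoplus_{i\ge0}A_i$ with $A_0=\Bbbk$ is the length of a maximal $A$-regular sequence contained in $A_+=\bigoplus_{i\ge1}A_i$, and $A$ is Cohen-Macaulay if its depth equals its Krull dimension. The modules (in each case $\sigma_1,\sigma_2$ fix every $v_j$): - $V_{n,\lambda}$ for $n=2k$ even and $\lambda\in\Bbbk$: basis $v_1,\dots,v_k,w_1,\dots,w_k$ with $\sigma_1(w_i)=w_i+v_i$ and $\sigma_2(w_i)=w_i+\lambda v_i+v_{i-1}$, where $v_0=0$. The module $V_{n,\infty}$ is obtained from $V_{n,0}$ by swapping the roles of $\sigma_1$ and $\sigma_2$. - $\Omega^{m}(\Bbbk)$ for $m<0$, writing $k=|m|$: basis $v_1,\dots,v_{k+1},w_1,\dots,w_k$ with $\sigma_1(w_i)=w_i+v_i$ and $\sigma_2(w_i)=w_i+v_{i+1}$. - $\Omega^{m}(\Bbbk)$ for $m>0$: basis $v_1,\dots,v_m,w_1,\dots,w_{m+1}$ with $\sigma_1(w_i)=w_i+v_i$ and $\sigma_2(w_i)=w_i+v_{i-1}$, where $v_0=v_{m+1}=0$. - $\Bbbk G$: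 the regular representation, of dimension $4$. *)

theory Defs
  imports
    "HOL-Algebra.Algebra"
    "HOL-Algebra.Algebraic_Closure_Type"
    "HOL-Library.Poly_Mapping"
    "HOL-Library.Function_Algebras"
    "HOL-Library.Extended_Nat"
begin

section \<open>Depth, Krull dimension and the Cohen-Macaulay property\<close>

text \<open>
  A graded ring is a ring \<open>A\<close> together with the family \<open>gr\<close> of its homogeneous components.
\<close>

definition irrelevant_ideal :: "('a, 'b) ring_scheme \<Rightarrow> (nat \<Rightarrow> 'a set) \<Rightarrow> 'a set" where
  "irrelevant_ideal A gr = generate (add_monoid A) (\<Union>i\<in>{1..}. gr i)"

definition regular_sequence :: "('a, 'b) ring_scheme \<Rightarrow> 'a list \<Rightarrow> bool" where
  "regular_sequence A xs \<longleftrightarrow>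
     set xs \<subseteq> carrier A \<and>
     (\<forall>i<length xs. \<forall>a\<in>carrier A.
        xs ! i \<otimes>\<^bsub>A\<^esub> a \<in> Idl\<^bsub>A\<^esub> (set (take i xs)) \<longrightarrow> a \<in> Idl\<^bsub>A\<^esub> (set (take i xs))) \<and>
     Idl\<^bsub>A\<^esub> (set xs) \<noteq> carrier A"

definition maximal_regular_sequence_in :: "('a, 'b) ring_scheme \<Rightarrow> 'a set \<Rightarrow> 'a list \<Rightarrow> bool" where
  "maximal_regular_sequence_in A I xs \<longleftrightarrow>
     set xs \<subseteq> I \<and> regular_sequence A xs \<and>
     (\<forall>x\<in>I. \<not> regular_sequence A (xs @ [x]))"

text \<open>
  For Noetherian \<open>A\<close> all maximal regular sequences in \<open>A\<^sub>+\<close> have the same length.  The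
  definite description means that establishing a value of \<open>depth\<close> includes establishing
  that uniqueness.
\<close>

definition depth :: "('a, 'b) ring_scheme \<Rightarrow> (nat \<Rightarrow> 'a set) \<Rightarrow> nat" where
  "depth A gr =
     (THE d. \<exists>xs. maximal_regular_sequence_in A (irrelevant_ideal A gr) xs \<and> length xs = d)"

definition krull_dim :: "('a, 'b) ring_scheme \<Rightarrow> enat" where
  "krull_dim A =
     (SUP d \<in> {d. \<exists>P :: nat \<Rightarrow> 'a set.
        (\<forall>i\<le>d. primeideal (P i) A) \<and> (\<forall>i<d. P i \<subset> P (Suc i))}. enat d)"

definition cohen_macaulay :: "('a, 'b) ring_scheme \<Rightarrow> (nat \<Rightarrow> 'a set) \<Rightarrow> bool" where
  "cohen_macaulay A gr \<longleftrightarrow> enat (depth A gr) = krull_dim A"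


section \<open>The symmetric algebra\<close>

type_synonym ('x, 'k) poly_over = "('x \<Rightarrow>\<^sub>0 nat) \<Rightarrow>\<^sub>0 'k"

definition Cst :: "'k::comm_ring_1 \<Rightarrow> ('x, 'k) poly_over" where
  "Cst c = Poly_Mapping.single 0 c"

definition Var :: "'x \<Rightarrow> ('x, 'k::comm_ring_1) poly_over" where
  "Var x = Poly_Mapping.single (Poly_Mapping.single x 1) 1"

definition mon_degree :: "('x \<Rightarrow>\<^sub>0 nat) \<Rightarrow> nat" where
  "mon_degree m = (\<Sum>x\<in>Poly_Mapping.keys m. Poly_Mapping.lookup m x)"

definition subst :: "('x \<Rightarrow> ('y, 'k) poly_over) \<Rightarrow> ('x, 'k) poly_over \<Rightarrow> ('y, 'k::comm_ring_1) poly_over"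
  where
  "subst h p = (\<Sum>m\<in>Poly_Mapping.keys p. Cst (Poly_Mapping.lookup p m) *
     (\<Prod>x\<in>Poly_Mapping.keys m. h x ^ Poly_Mapping.lookup m x))"

definition poly_ring_on :: "'x set \<Rightarrow> ('x, 'k::comm_ring_1) poly_over ring" where
  "poly_ring_on W =
     ring_of_type_algebra \<lparr>carrier := {p. \<forall>m\<in>Poly_Mapping.keys p. Poly_Mapping.keys m \<subseteq> W}\<rparr>"

text \<open>
  \<open>S(W)\<close> is presented as the free commutative algebra on the set \<open>W\<close> modulo the relations
  that make the canonical map \<open>Var : W \<rightarrow> S(W)\<close> linear.
\<close>

definition sym_ideal ::
  "('k::field \<Rightarrow> 'w::ab_group_add \<Rightarrow> 'w) \<Rightarrow> 'w set \<Rightarrow> ('w, 'k) poly_over set" where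
  "sym_ideal scl W = Idl\<^bsub>poly_ring_on W\<^esub>
     ({Var (a + b) - Var a - Var b | a b. a \<in> W \<and> b \<in> W} \<union>
      {Var (scl c a) - Cst c * Var a | c a. a \<in> W})"

definition sym_algebra ::
  "('k::field \<Rightarrow> 'w::ab_group_add \<Rightarrow> 'w) \<Rightarrow> 'w set \<Rightarrow> ('w, 'k) poly_over set ring" where
  "sym_algebra scl W = poly_ring_on W Quot sym_ideal scl W"

definition sym_grading ::
  "('k::field \<Rightarrow> 'w::ab_group_add \<Rightarrow> 'w) \<Rightarrow> 'w set \<Rightarrow> nat \<Rightarrow> ('w, 'k) poly_over set set" where
  "sym_grading scl W d = (\<lambda>p. sym_ideal scl W +>\<^bsub>poly_ring_on W\<^esub> p) `
     {p \<in> carrier (poly_ring_on W). \<forall>m\<in>Poly_Mapping.keys p. mon_degree m = d}"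

text \<open>
  The map induced on \<open>S(W)\<close> by a bijective linear map \<open>\<phi> : W \<rightarrow> W\<close>.  The substitution
  \<open>Var w \<mapsto> Var (\<phi> w)\<close> is then an automorphism of \<open>poly_ring_on W\<close> preserving \<open>sym_ideal\<close>, so
  the image of a coset is again a coset.
\<close>

definition sym_map ::
  "('w \<Rightarrow> 'w) \<Rightarrow> ('w, 'k::comm_ring_1) poly_over set \<Rightarrow> ('w, 'k) poly_over set" where
  "sym_map \<phi> C = subst (\<lambda>w. Var (\<phi> w)) ` C"


section \<open>Representations, invariants and the transfer\<close>

locale linear_rep =
  vector_space scale + group_action G "UNIV :: 'v set" \<rho>
  for scale :: "'k::field \<Rightarrow> 'v::ab_group_add \<Rightarrow> 'v"
    and G :: "('g, 'b) monoid_scheme" (structure)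
    and \<rho> :: "'g \<Rightarrow> 'v \<Rightarrow> 'v" +
  assumes linear_action: "\<And>\<sigma>. \<sigma> \<in> carrier G \<Longrightarrow> Vector_Spaces.linear scale scale (\<rho> \<sigma>)"

definition dual_space :: "('k::field \<Rightarrow> 'v::ab_group_add \<Rightarrow> 'v) \<Rightarrow> ('v \<Rightarrow> 'k) set" where
  "dual_space scale = {f. Vector_Spaces.linear scale (*) f}"

definition dual_scale :: "'k::field \<Rightarrow> ('v \<Rightarrow> 'k) \<Rightarrow> 'v \<Rightarrow> 'k" where
  "dual_scale c f = (\<lambda>v. c * f v)"

context linear_rep
begin

definition coord_ring :: "('v \<Rightarrow> 'k, 'k) poly_over set ring" where
  "coord_ring = sym_algebra dual_scale (dual_space scale)"

definition coord_grading :: "nat \<Rightarrow> ('v \<Rightarrow> 'k, 'k) poly_over set set" where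
  "coord_grading = sym_grading dual_scale (dual_space scale)"

definition coord_act :: "'g \<Rightarrow> ('v \<Rightarrow> 'k, 'k) poly_over set \<Rightarrow> ('v \<Rightarrow> 'k, 'k) poly_over set" where
  "coord_act \<sigma> = sym_map (\<lambda>f. f \<circ> \<rho> (inv \<sigma>))"

definition invariant_ring :: "('v \<Rightarrow> 'k, 'k) poly_over set ring" where
  "invariant_ring = coord_ring
     \<lparr>carrier := {f \<in> carrier coord_ring. \<forall>\<sigma>\<in>carrier G. coord_act \<sigma> f = f}\<rparr>"

definition transfer :: "('v \<Rightarrow> 'k, 'k) poly_over set \<Rightarrow> ('v \<Rightarrow> 'k, 'k) poly_over set" where
  "transfer f = (\<Oplus>\<^bsub>coord_ring\<^esub>\<sigma>\<in>carrier G. coord_act \<sigma> f)"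

definition transfer_image :: "('v \<Rightarrow> 'k, 'k) poly_over set set" where
  "transfer_image = transfer ` carrier coord_ring"

definition transfer_quotient :: "('v \<Rightarrow> 'k, 'k) poly_over set set ring" where
  "transfer_quotient = invariant_ring Quot transfer_image"

definition transfer_quotient_grading :: "nat \<Rightarrow> ('v \<Rightarrow> 'k, 'k) poly_over set set set" where
  "transfer_quotient_grading d = (\<lambda>f. transfer_image +>\<^bsub>invariant_ring\<^esub> f) `
     (coord_grading d \<inter> carrier invariant_ring)"

end


section \<open>The modules\<close>

definition (in vector_space) is_basis_family :: "('i \<Rightarrow> 'b) \<Rightarrow> 'i set \<Rightarrow> bool" where
  "is_basis_family b I \<longleftrightarrow> inj_on b I \<and> independent (b ` I) \<and> span (b ` I) = UNIV"

datatype 'k param = Fin 'k | Infinity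

text \<open>
  Each of the following predicates says that the representation is isomorphic to the named
  module: it has a basis on which \<open>\<sigma>\<^sub>1\<close> and \<open>\<sigma>\<^sub>2\<close> act by the formulas that define the module.
\<close>

context linear_rep
begin

definition iso_V_fin :: "'g \<Rightarrow> 'g \<Rightarrow> nat \<Rightarrow> 'k \<Rightarrow> bool" where
  "iso_V_fin \<sigma>\<^sub>1 \<sigma>\<^sub>2 n lam \<longleftrightarrow>
     (\<exists>v w :: nat \<Rightarrow> 'v.
        is_basis_family (case_sum v w) ({1..n div 2} <+> {1..n div 2}) \<and> v 0 = 0 \<and>
        (\<forall>j\<in>{1..n div 2}. \<rho> \<sigma>\<^sub>1 (v j) = v j \<and> \<rho> \<sigma>\<^sub>2 (v j) = v j) \<and>
        (\<forall>i\<in>{1..n div 2}. \<rho> \<sigma>\<^sub>1 (w i) = w i + v i \<and>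
           \<rho> \<sigma>\<^sub>2 (w i) = w i + scale lam (v i) + v (i - 1)))"

fun iso_V :: "'g \<Rightarrow> 'g \<Rightarrow> nat \<Rightarrow> 'k param \<Rightarrow> bool" where
  "iso_V \<sigma>\<^sub>1 \<sigma>\<^sub>2 n (Fin lam) \<longleftrightarrow> iso_V_fin \<sigma>\<^sub>1 \<sigma>\<^sub>2 n lam"
| "iso_V \<sigma>\<^sub>1 \<sigma>\<^sub>2 n Infinity \<longleftrightarrow> iso_V_fin \<sigma>\<^sub>2 \<sigma>\<^sub>1 n 0"

definition iso_Omega_neg :: "'g \<Rightarrow> 'g \<Rightarrow> nat \<Rightarrow> bool" where
  "iso_Omega_neg \<sigma>\<^sub>1 \<sigma>\<^sub>2 k \<longleftrightarrow>
     (\<exists>v w :: nat \<Rightarrow> 'v.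
        is_basis_family (case_sum v w) ({1..k + 1} <+> {1..k}) \<and>
        (\<forall>j\<in>{1..k + 1}. \<rho> \<sigma>\<^sub>1 (v j) = v j \<and> \<rho> \<sigma>\<^sub>2 (v j) = v j) \<and>
        (\<forall>i\<in>{1..k}. \<rho> \<sigma>\<^sub>1 (w i) = w i + v i \<and> \<rho> \<sigma>\<^sub>2 (w i) = w i + v (i + 1)))"

definition iso_Omega_pos :: "'g \<Rightarrow> 'g \<Rightarrow> nat \<Rightarrow> bool" where
  "iso_Omega_pos \<sigma>\<^sub>1 \<sigma>\<^sub>2 m \<longleftrightarrow>
     (\<exists>v w :: nat \<Rightarrow> 'v.
        is_basis_family (case_sum v w) ({1..m} <+> {1..m + 1}) \<and> v 0 = 0 \<and> v (m + 1) = 0 \<and>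
        (\<forall>j\<in>{1..m}. \<rho> \<sigma>\<^sub>1 (v j) = v j \<and> \<rho> \<sigma>\<^sub>2 (v j) = v j) \<and>
        (\<forall>i\<in>{1..m + 1}. \<rho> \<sigma>\<^sub>1 (w i) = w i + v i \<and> \<rho> \<sigma>\<^sub>2 (w i) = w i + v (i - 1)))"

definition iso_Omega :: "'g \<Rightarrow> 'g \<Rightarrow> int \<Rightarrow> bool" where
  "iso_Omega \<sigma>\<^sub>1 \<sigma>\<^sub>2 m \<longleftrightarrow>
     m < 0 \<and> iso_Omega_neg \<sigma>\<^sub>1 \<sigma>\<^sub>2 (nat \<bar>m\<bar>) \<or> m > 0 \<and> iso_Omega_pos \<sigma>\<^sub>1 \<sigma>\<^sub>2 (nat m)"

definition iso_regular :: bool where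
  "iso_regular \<longleftrightarrow>
     (\<exists>b :: 'g \<Rightarrow> 'v. is_basis_family b (carrier G) \<and>
        (\<forall>\<sigma>\<in>carrier G. \<forall>\<tau>\<in>carrier G. \<rho> \<sigma> (b \<tau>) = b (\<sigma> \<otimes> \<tau>)))"

end

end

theory Submission
  imports Defs
begin

text \<open>
  In coordinates dual to a basis, \<open>R\<close> becomes \<open>C / T\<close>, where \<open>C\<close> consists of the polynomials that are
  invariant under two commuting involutions and \<open>T\<close> is the image of the transfer.  All maximal regular
  sequences in an ideal of a noetherian ring have the same length, so for the depth it suffices to
  exhibit one.  Division with remainder shows that the norms of the coordinates \<open>y\<^sub>j\<close> that \<open>G\<close> does not
  fix form a regular sequence modulo \<open>T\<close>.

  For \<open>V\<^bsub>n,\<lambda>\<^esub>\<close> with \<open>\<lambda> \<noteq> 0, 1\<close> and for \<open>\<Omega>\<^sup>m\<close> with \<open>m < 0\<close> the fixed coordinates \<open>x\<^sub>i\<close> are nilpotent modulo \<open>T\<close>.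
  Then \<open>C\<close> is finite modulo \<open>T\<close> over the algebra generated by the norms, any larger number of elements
  is algebraically dependent, and this bounds the lengths of regular sequences and of chains of primes.

  For \<open>V\<^bsub>n,0\<^esub>\<close> and \<open>\<Omega>\<^sup>m\<close> with \<open>m \<ge> 2\<close> the element \<open>x\<^sub>2 (x\<^sub>1 + x\<^sub>2)\<close> shows that the norms are a maximal regular
  sequence, while restriction to subspaces of a space of fixed points yields a chain of primes that is
  longer by one.  The cases \<open>\<lambda> = 1\<close> and \<open>\<lambda> = \<infinity>\<close> follow by changing the generators of \<open>G\<close>.  For \<open>\<Omega>\<^sup>1\<close> and
  \<open>kG\<close> one norm can be extended by one further regular element, as seen on coefficients.
\<close>

section \<open>Regular sequences modulo ideals of a subring\<close>

text \<open>\<open>depth\<close> is a definite description, so a value requires that all maximal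
  regular sequences have equal length. Quotients are avoided: ideals of \<open>C\<close> are sets,
  and reducing modulo x means enlarging the ideal. Being unable to extend a sequence is recast as a
  socle condition (\<open>soc\<close>), which can be moved between regular sequences of equal
  length. Upper bounds on depth and on dimension share one source: a relation between r + 1 elements
  loses one element at each step along a regular sequence or a chain of primes, until a nonzero
  constant is left in a proper ideal. The norms are regular because the group preserves the degree
  in \<open>y j\<close>, in which the norm is monic of degree 4. The quotient of division by it is
  unique, hence commutes with the group, and so maps invariants to invariants and transfers to
  transfers. Finiteness and noetherianity of \<open>C\<close> come together: \<open>C\<close> is a
  module over the algebra of all coordinate norms, whose leading monomials are fourth powers of the
  variables. Where the x are not nilpotent modulo \<open>T\<close>, finiteness over the norms of the
  y fails. There a socle class bounds the depth, and a lower bound on the dimension is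
  enough.\<close>

locale comm_subring =
  fixes C :: "'a::comm_ring_1 set"
  assumes one_closed [simp, intro]: "1 \<in> C"
    and diff_closed [simp, intro]: "a \<in> C \<Longrightarrow> b \<in> C \<Longrightarrow> a - b \<in> C"
    and mult_closed [simp, intro]: "a \<in> C \<Longrightarrow> b \<in> C \<Longrightarrow> a * b \<in> C"
begin

lemma zero_closed [simp, intro]: "0 \<in> C"
  using diff_closed[OF one_closed one_closed] by simp

lemma uminus_closed [simp, intro]: "a \<in> C \<Longrightarrow> - a \<in> C"
  using diff_closed[OF zero_closed, of a] by simp

lemma add_closed [simp, intro]: "a \<in> C \<Longrightarrow> b \<in> C \<Longrightarrow> a + b \<in> C"
  using diff_closed[of a "- b"] by simp

lemma power_closed [simp, intro]: "a \<in> C \<Longrightarrow> a ^ n \<in> C"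
  by (induction n) auto

lemma sum_closed [intro]: "(\<And>i. i \<in> A \<Longrightarrow> f i \<in> C) \<Longrightarrow> sum f A \<in> C"
  by (induction A rule: infinite_finite_induct) auto

lemma prod_closed [intro]: "(\<And>i. i \<in> A \<Longrightarrow> f i \<in> C) \<Longrightarrow> prod f A \<in> C"
  by (induction A rule: infinite_finite_induct) auto

section \<open>Ideals of a subring, regular elements and the socle condition\<close>

definition idl :: "'a set \<Rightarrow> bool" where
  "idl J \<longleftrightarrow> J \<subseteq> C \<and> 0 \<in> J \<and> (\<forall>a\<in>J. \<forall>b\<in>J. a + b \<in> J) \<and> (\<forall>c\<in>C. \<forall>a\<in>J. c * a \<in> J)"

lemma idlD:
  assumes "idl J"
  shows "a \<in> J \<Longrightarrow> a \<in> C" "0 \<in> J" "a \<in> J \<Longrightarrow> b \<in> J \<Longrightarrow> a + b \<in> J"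
    "c \<in> C \<Longrightarrow> a \<in> J \<Longrightarrow> c * a \<in> J" "c \<in> C \<Longrightarrow> a \<in> J \<Longrightarrow> a * c \<in> J"
    "a \<in> J \<Longrightarrow> - a \<in> J" "a \<in> J \<Longrightarrow> b \<in> J \<Longrightarrow> a - b \<in> J"
proof -
  show *: "a \<in> J \<Longrightarrow> a \<in> C" "0 \<in> J" "\<And>a b. a \<in> J \<Longrightarrow> b \<in> J \<Longrightarrow> a + b \<in> J"
    "\<And>a c. c \<in> C \<Longrightarrow> a \<in> J \<Longrightarrow> c * a \<in> J" for a
    using assms unfolding idl_def by auto
  show "c \<in> C \<Longrightarrow> a \<in> J \<Longrightarrow> a * c \<in> J"
    using *(4)[of c a] by (simp add: mult.commute)
  show m: "a \<in> J \<Longrightarrow> - a \<in> J" for a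
    using *(4)[of "- 1" a] by simp
  show "a \<in> J \<Longrightarrow> b \<in> J \<Longrightarrow> a - b \<in> J"
    using *(3)[OF _ m, of a b] by simp
qed

lemma idl_sum: "idl J \<Longrightarrow> (\<And>i. i \<in> A \<Longrightarrow> f i \<in> J) \<Longrightarrow> sum f A \<in> J"
  by (induction A rule: infinite_finite_induct) (auto simp: idlD)

lemma idl_add_cancel: "idl J \<Longrightarrow> a \<in> J \<Longrightarrow> a + b \<in> J \<longleftrightarrow> b \<in> J"
  using idlD(3)[of J a b] idlD(7)[of J "a + b" a] by auto

text \<open>This is the ideal (J, x). A regular sequence is followed through the growing ideals
  \<open>exts J xs\<close> instead of successive quotient rings.\<close>

definition ext :: "'a set \<Rightarrow> 'a \<Rightarrow> 'a set" where
  "ext J x = {j + c * x | j c. j \<in> J \<and> c \<in> C}"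

lemma extI: "j \<in> J \<Longrightarrow> c \<in> C \<Longrightarrow> j + c * x \<in> ext J x"
  unfolding ext_def by blast

lemma extE: "a \<in> ext J x \<Longrightarrow> (\<And>j c. j \<in> J \<Longrightarrow> c \<in> C \<Longrightarrow> a = j + c * x \<Longrightarrow> thesis) \<Longrightarrow> thesis"
  unfolding ext_def by blast

lemma idl_ext:
  assumes "idl J" "x \<in> C"
  shows "idl (ext J x)"
  unfolding idl_def
proof (intro conjI ballI)
  show "ext J x \<subseteq> C"
    using assms idlD(1) by (auto elim!: extE)
  show "0 \<in> ext J x"
    using extI[OF idlD(2)[OF assms(1)] zero_closed, of x] by simp
next
  fix a b assume "a \<in> ext J x" "b \<in> ext J x"
  then obtain j c j' c' where *: "j \<in> J" "c \<in> C" "j' \<in> J" "c' \<in> C" "a = j + c * x" "b = j' + c' * x"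
    by (auto elim!: extE)
  then have "a + b = (j + j') + (c + c') * x"
    by (simp add: algebra_simps)
  with * show "a + b \<in> ext J x"
    using assms by (metis extI idlD(3) add_closed)
next
  fix b a assume "b \<in> C" "a \<in> ext J x"
  then obtain j c where *: "j \<in> J" "c \<in> C" "a = j + c * x"
    by (auto elim!: extE)
  then have "b * a = b * j + (b * c) * x"
    by (simp add: algebra_simps)
  with * show "b * a \<in> ext J x"
    using assms \<open>b \<in> C\<close> by (metis extI idlD(4) mult_closed)
qed

lemma ext_subset: "idl J \<Longrightarrow> J \<subseteq> ext J x"
  using extI[OF _ zero_closed] by fastforce

lemma ext_self: "idl J \<Longrightarrow> x \<in> ext J x"
  using extI[OF idlD(2) one_closed] by fastforce

lemma ext_least: "idl K \<Longrightarrow> J \<subseteq> K \<Longrightarrow> x \<in> K \<Longrightarrow> ext J x \<subseteq> K"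
  by (auto elim!: extE intro: idlD(3)[of K] idlD(4)[of K])

lemma ext_commute: "ext (ext J x) y = ext (ext J y) x"
proof -
  have "ext (ext J x) y \<subseteq> ext (ext J y) x" for x y
  proof
    fix a assume "a \<in> ext (ext J x) y"
    then obtain j c d where *: "j \<in> J" "c \<in> C" "d \<in> C" "a = (j + c * x) + d * y"
      by (auto elim!: extE)
    then have "a = (j + d * y) + c * x"
      by (simp add: algebra_simps)
    with * show "a \<in> ext (ext J y) x"
      by (metis extI)
  qed
  then show ?thesis by blast
qed

abbreviation exts :: "'a set \<Rightarrow> 'a list \<Rightarrow> 'a set" where
  "exts J xs \<equiv> foldl ext J xs"

lemma idl_exts: "idl J \<Longrightarrow> set xs \<subseteq> C \<Longrightarrow> idl (exts J xs)"
  by (induction xs arbitrary: J) (auto simp: idl_ext)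

lemma exts_subset: "idl J \<Longrightarrow> set xs \<subseteq> C \<Longrightarrow> J \<subseteq> exts J xs"
  by (induction xs arbitrary: J) (use ext_subset idl_ext in fastforce)+

lemma exts_self: "idl J \<Longrightarrow> set xs \<subseteq> C \<Longrightarrow> set xs \<subseteq> exts J xs"
proof (induction xs arbitrary: J)
  case (Cons x xs)
  then have "idl (ext J x)" "x \<in> ext J x"
    by (auto simp: idl_ext ext_self)
  with Cons show ?case
    using exts_subset[of "ext J x" xs] by auto
qed auto

lemma exts_least: "idl K \<Longrightarrow> J \<subseteq> K \<Longrightarrow> set xs \<subseteq> K \<Longrightarrow> exts J xs \<subseteq> K"
  by (induction xs arbitrary: J) (auto simp: ext_least)

lemma ext_exts: "ext (exts J xs) z = exts (ext J z) xs"
  by (induction xs arbitrary: J) (auto simp: ext_commute)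

definition nzd :: "'a set \<Rightarrow> 'a \<Rightarrow> bool" where
  "nzd J x \<longleftrightarrow> (\<forall>a\<in>C. x * a \<in> J \<longrightarrow> a \<in> J)"

primrec reg :: "'a set \<Rightarrow> 'a list \<Rightarrow> bool" where
  "reg J [] \<longleftrightarrow> True"
| "reg J (x # xs) \<longleftrightarrow> nzd J x \<and> reg (ext J x) xs"

lemma reg_append: "reg J (xs @ ys) \<longleftrightarrow> reg J xs \<and> reg (exts J xs) ys"
  by (induction xs arbitrary: J) auto

lemma reg_iff_nth: "reg J xs \<longleftrightarrow> (\<forall>i<length xs. nzd (exts J (take i xs)) (xs ! i))"
  by (induction xs arbitrary: J) (auto simp: less_Suc_eq_0_disj)

lemma nzd_power: "nzd J x \<Longrightarrow> x \<in> C \<Longrightarrow> nzd J (x ^ n)"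
proof (induction n)
  case (Suc n)
  show ?case
    unfolding nzd_def
  proof (intro ballI impI)
    fix a assume a: "a \<in> C" "x ^ Suc n * a \<in> J"
    then have "x * (x ^ n * a) \<in> J" by (simp add: mult.assoc)
    then have "x ^ n * a \<in> J"
      using Suc a unfolding nzd_def by (meson mult_closed power_closed)
    then show "a \<in> J" using Suc a unfolding nzd_def by blast
  qed
qed (simp add: nzd_def)

text \<open>A nonzero class of C/J is killed by \<open>I\<close>, that is, Hom(C/I, C/J) is
  nonzero.\<close>

definition soc :: "'a set \<Rightarrow> 'a set \<Rightarrow> bool" where
  "soc I J \<longleftrightarrow> (\<exists>u\<in>C. u \<notin> J \<and> (\<forall>f\<in>I. f * u \<in> J))"

lemma nzd_imp_not_soc: "nzd J x \<Longrightarrow> x \<in> I \<Longrightarrow> \<not> soc I J"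
  unfolding soc_def nzd_def by blast

text \<open>If x a = j + c z, then z c lies in (J, x), so c = j' + c' x because z is regular there.
  Substituting gives x (a - c' z) in \<open>J\<close>, and x can be cancelled.\<close>

lemma nzd_ext_swap:
  assumes "idl J" "x \<in> C" "z \<in> C" "nzd J z" "nzd (ext J x) z" "nzd J x"
  shows "nzd (ext J z) x"
  unfolding nzd_def
proof (intro ballI impI)
  fix a assume a: "a \<in> C" "x * a \<in> ext J z"
  then obtain j c where jc: "j \<in> J" "c \<in> C" "x * a = j + c * z"
    by (auto elim!: extE)
  then have "z * c = - j + a * x"
    by (simp add: algebra_simps)
  then have "z * c \<in> ext J x"
    using extI[OF idlD(6)[OF assms(1) jc(1)] a(1)] by simp
  then have "c \<in> ext J x"
    using assms(5) jc(2) unfolding nzd_def by blast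
  then obtain j' c' where jc': "j' \<in> J" "c' \<in> C" "c = j' + c' * x"
    by (auto elim!: extE)
  have "x * (a - c' * z) = j + z * j'"
    using jc(3) jc'(3) by (simp add: algebra_simps)
  moreover have "j + z * j' \<in> J"
    using jc jc' assms by (simp add: idlD)
  ultimately have "a - c' * z \<in> J"
    using assms(3,6) a(1) jc'(2) unfolding nzd_def by (metis diff_closed mult_closed)
  then show "a \<in> ext J z"
    using extI[OF _ jc'(2), of "a - c' * z" J z] by simp
qed

text \<open>By \<open>nzd_ext_swap\<close>, z is moved past the elements of the sequence one at a
  time; this is why z has to be regular at every stage.\<close>

lemma reg_Cons_of_nzd:
  assumes "idl J" "set xs \<subseteq> C" "z \<in> C" "reg J xs"
    "\<And>i. i \<le> length xs \<Longrightarrow> nzd (exts J (take i xs)) z"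
  shows "reg (ext J z) xs"
  using assms
proof (induction xs arbitrary: J)
  case (Cons x xs)
  have z: "nzd J z" "nzd (ext J x) z"
    using Cons.prems(5)[of 0] Cons.prems(5)[of 1] by auto
  have x: "x \<in> C" "nzd J x" "reg (ext J x) xs"
    using Cons.prems by auto
  have "nzd (ext J z) x"
    by (rule nzd_ext_swap) (use Cons.prems x z in auto)
  moreover have "reg (ext (ext J x) z) xs"
  proof (rule Cons.IH)
    show "nzd (exts (ext J x) (take i xs)) z" if "i \<le> length xs" for i
      using Cons.prems(5)[of "Suc i"] that by simp
  qed (use Cons.prems x idl_ext in auto)
  ultimately show ?case
    by (simp add: ext_commute)
qed simp

text \<open>For a socle class u modulo (J, x) write z u = j + v x. Then v is a socle class modulo
  (J, z), since x and z can be cancelled modulo \<open>J\<close>. Both sides express that Ext^1(C/I,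
  C/J) is nonzero.\<close>

lemma soc_ext_swap:
  assumes "idl J" "I \<subseteq> C" "x \<in> I" "z \<in> I" "nzd J x" "nzd J z" "soc I (ext J x)"
  shows "soc I (ext J z)"
proof -
  have C: "x \<in> C" "z \<in> C" using assms by auto
  obtain u where u: "u \<in> C" "u \<notin> ext J x" "\<And>f. f \<in> I \<Longrightarrow> f * u \<in> ext J x"
    using assms(7) unfolding soc_def by blast
  obtain j v where v: "j \<in> J" "v \<in> C" "z * u = j + v * x"
    using u(3)[OF assms(4)] by (auto elim!: extE)
  have "v \<notin> ext J z"
  proof
    assume "v \<in> ext J z"
    then obtain j' c where c: "j' \<in> J" "c \<in> C" "v = j' + c * z"
      by (auto elim!: extE)
    have "z * (u - c * x) = j + x * j'"
      using v(3) c(3) by (simp add: algebra_simps)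
    moreover have "j + x * j' \<in> J"
      using assms(1) v c C by (simp add: idlD)
    ultimately have "u - c * x \<in> J"
      using assms(6) u(1) c(2) C unfolding nzd_def by (metis diff_closed mult_closed)
    then have "u \<in> ext J x"
      using extI[OF _ c(2), of "u - c * x" J x] by simp
    with u(2) show False ..
  qed
  moreover have "f * v \<in> ext J z" if f: "f \<in> I" for f
  proof -
    have fC: "f \<in> C" using f assms(2) by auto
    obtain j' c where c: "j' \<in> J" "c \<in> C" "f * u = j' + c * x"
      using u(3)[OF f] by (auto elim!: extE)
    have "x * (f * v - c * z) = f * (v * x) - x * c * z"
      by (simp add: algebra_simps)
    also have "\<dots> = f * (z * u - j) - x * c * z"
      using v(3) by simp
    also have "\<dots> = z * (f * u) - f * j - x * c * z"
      by (simp add: algebra_simps)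
    also have "\<dots> = z * j' - f * j"
      using c(3) by (simp add: algebra_simps)
    finally have "x * (f * v - c * z) = z * j' - f * j" .
    moreover have "z * j' - f * j \<in> J"
      using assms(1) v c C fC by (simp add: idlD)
    ultimately have "f * v - c * z \<in> J"
      using assms(5) v(2) c(2) fC C unfolding nzd_def by (metis diff_closed mult_closed)
    then show ?thesis
      using extI[OF _ c(2), of "f * v - c * z" J z] by simp
  qed
  ultimately show ?thesis
    unfolding soc_def using v(2) by blast
qed

section \<open>Maximal annihilators and prime avoidance\<close>

definition noetherian :: bool where
  "noetherian \<longleftrightarrow> (\<forall>a. range a \<subseteq> C \<longrightarrow>
     (\<exists>n c. (\<forall>i<n. c i \<in> C) \<and> a n = (\<Sum>i<n::nat. c i * a i)))"

lemma noetherianD: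
  assumes "noetherian" "\<And>i. a i \<in> C"
  shows "\<exists>n c. (\<forall>i<n. c i \<in> C) \<and> a n = (\<Sum>i<n::nat. c i * a i)"
proof -
  have "range a \<subseteq> C" using assms(2) by auto
  then show ?thesis using assms(1) unfolding noetherian_def by simp
qed

definition ann :: "'a set \<Rightarrow> 'a \<Rightarrow> 'a set" where
  "ann J u = {c \<in> C. c * u \<in> J}"

text \<open>These are the maximal associated primes of C/J; in the noetherian case their union is
  the set of zero divisors.\<close>

definition max_ann :: "'a set \<Rightarrow> 'a set set" where
  "max_ann J = {ann J u | u. u \<in> C - J \<and> (\<forall>v \<in> C - J. ann J u \<subseteq> ann J v \<longrightarrow> ann J v = ann J u)}"

lemma idl_ann: "idl J \<Longrightarrow> u \<in> C \<Longrightarrow> idl (ann J u)"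
  unfolding idl_def ann_def by (auto simp: distrib_right mult.assoc)

lemma one_notin_ann: "u \<notin> J \<Longrightarrow> 1 \<notin> ann J u"
  unfolding ann_def by simp

definition prime_idl :: "'a set \<Rightarrow> bool" where
  "prime_idl P \<longleftrightarrow> idl P \<and> 1 \<notin> P \<and> (\<forall>a\<in>C. \<forall>b\<in>C. a * b \<in> P \<longrightarrow> a \<in> P \<or> b \<in> P)"

lemma prime_idl_prodD:
  assumes "prime_idl P" "finite A" "\<And>i. i \<in> A \<Longrightarrow> f i \<in> C" "prod f A \<in> P"
  shows "\<exists>i\<in>A. f i \<in> P"
  using assms(2-4)
proof (induction A)
  case empty
  then show ?case using assms(1) by (simp add: prime_idl_def)
next
  case (insert x F)
  have "prod f F \<in> C" using insert by auto
  then show ?case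
    using insert assms(1) by (auto simp: prime_idl_def)
qed

text \<open>If a b u lies in \<open>J\<close> but b u does not, then the annihilator of u is
  contained in that of b u. Maximality makes them equal, so a already kills u.\<close>

lemma prime_max_ann:
  assumes "idl J" "P \<in> max_ann J"
  shows "prime_idl P"
proof -
  obtain u where u: "P = ann J u" "u \<in> C" "u \<notin> J"
    "\<And>v. v \<in> C - J \<Longrightarrow> ann J u \<subseteq> ann J v \<Longrightarrow> ann J v = ann J u"
    using assms unfolding max_ann_def by blast
  have "a \<in> P" if ab: "a \<in> C" "b \<in> C" "a * b \<in> P" "b \<notin> P" for a b
  proof -
    have "b * u \<in> C - J"
      using ab u unfolding ann_def by auto
    moreover have "ann J u \<subseteq> ann J (b * u)"
      using ab(2) idlD(4)[OF assms(1), of b] unfolding ann_def by (auto simp: mult.left_commute[of _ b])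
    ultimately have "ann J (b * u) = ann J u"
      by (rule u(4))
    moreover have "a \<in> ann J (b * u)"
      using ab unfolding u(1) ann_def by (auto simp: mult.assoc)
    ultimately show ?thesis
      using u(1) by simp
  qed
  moreover have "idl P" "1 \<notin> P"
    using idl_ann[OF assms(1) u(2)] one_notin_ann[OF u(3)] u(1) by simp_all
  ultimately show ?thesis
    unfolding prime_idl_def by blast
qed

text \<open>Otherwise there is a strictly ascending chain of annihilators, and elements picked from
  the successive differences contradict \<open>noetherian\<close>.\<close>

lemma exists_max_ann:
  assumes "noetherian" "idl J" "u \<in> C - J" "z \<in> ann J u"
  shows "\<exists>P\<in>max_ann J. z \<in> P"
proof (rule ccontr)
  assume neg: "\<not> (\<exists>P\<in>max_ann J. z \<in> P)"
  define S where "S = {v \<in> C - J. z \<in> ann J v}"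
  have step: "\<exists>w. w \<in> S \<and> ann J v \<subset> ann J w" if "v \<in> S" for v
  proof -
    have "ann J v \<notin> max_ann J"
      using neg that unfolding S_def by blast
    with that obtain w where "w \<in> C - J" "ann J v \<subseteq> ann J w" "ann J w \<noteq> ann J v"
      unfolding max_ann_def S_def by blast
    with that show ?thesis
      unfolding S_def by blast
  qed
  have "u \<in> S" using assms unfolding S_def by blast
  obtain s where s: "\<And>n::nat. s n \<in> S" "\<And>n. ann J (s n) \<subset> ann J (s (Suc n))"
    using dependent_nat_choice[of "\<lambda>_ v. v \<in> S" "\<lambda>_ v w. ann J v \<subset> ann J w"] \<open>u \<in> S\<close> step by metis
  have "\<forall>n. \<exists>a. a \<in> ann J (s (Suc n)) \<and> a \<notin> ann J (s n)"
    using s(2) by blast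
  then obtain a where a: "\<And>n. a n \<in> ann J (s (Suc n))" "\<And>n. a n \<notin> ann J (s n)"
    by metis
  have mono: "m \<le> n \<Longrightarrow> ann J (s m) \<subseteq> ann J (s n)" for m n
    using lift_Suc_mono_le[of "\<lambda>n. ann J (s n)"] s(2) by blast
  have aC: "a n \<in> C" for n
    using a(1)[of n] unfolding ann_def by simp
  obtain n c where nc: "\<And>i. i < n \<Longrightarrow> c i \<in> C" "a n = (\<Sum>i<n. c i * a i)"
    using noetherianD[OF assms(1), of a] aC by metis
  have idl: "idl (ann J (s n))"
    using s(1)[of n] assms(2) unfolding S_def by (intro idl_ann) auto
  have "c i * a i \<in> ann J (s n)" if "i < n" for i
    using a(1)[of i] mono[of "Suc i" n] that nc(1)[OF that] idlD(4)[OF idl] by auto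
  then have "a n \<in> ann J (s n)"
    using idl_sum[OF idl, of "{..<n}"] nc(2) by simp
  with a(2) show False ..
qed

text \<open>Given distinct P_i = ann(u_i), some u_n is a combination of the earlier u_i. A product
  of elements of P_i outside P_n then kills every earlier u_i and hence u_n, against the primality
  of P_n.\<close>

lemma finite_max_ann:
  assumes "noetherian" "idl J"
  shows "finite (max_ann J)"
proof (rule ccontr)
  assume "infinite (max_ann J)"
  then obtain P :: "nat \<Rightarrow> 'a set" where P: "inj P" "range P \<subseteq> max_ann J"
    using infinite_countable_subset by blast
  have "\<forall>n. \<exists>u. P n = ann J u \<and> u \<in> C - J \<and> (\<forall>v \<in> C - J. ann J u \<subseteq> ann J v \<longrightarrow> ann J v = ann J u)"
    using P(2) unfolding max_ann_def by blast
  then obtain u where u: "\<And>n. P n = ann J (u n)" "\<And>n. u n \<in> C - J"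
    "\<And>n v. v \<in> C - J \<Longrightarrow> ann J (u n) \<subseteq> ann J v \<Longrightarrow> ann J v = ann J (u n)"
    by metis
  obtain n c where nc: "\<And>i. i < n \<Longrightarrow> c i \<in> C" "u n = (\<Sum>i<n. c i * u i)"
    using noetherianD[OF assms(1), of u] u(2) by (metis DiffD1)
  have ne: "P i \<noteq> P n" if "i < n" for i
    using P(1) that by (auto simp: inj_on_def)
  \<comment> \<open>Distinct maximal annihilators are incomparable.\<close>
  have "\<exists>a. a \<in> P i \<and> a \<notin> P n" if "i < n" for i
    using u(3)[OF u(2), of i n] ne[OF that] u(1) by auto
  then obtain a where a: "\<And>i. i < n \<Longrightarrow> a i \<in> P i" "\<And>i. i < n \<Longrightarrow> a i \<notin> P n"
    by metis
  have aC: "a i \<in> C" if "i < n" for i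
    using a(1)[OF that] u(1) unfolding ann_def by simp
  define p where "p = (\<Prod>i<n. a i)"
  have "p * u i \<in> J" if "i < n" for i
  proof -
    have "p = (\<Prod>j\<in>{..<n} - {i}. a j) * a i"
      unfolding p_def using that by (simp add: prod.remove[of _ i] mult.commute)
    moreover have "(\<Prod>j\<in>{..<n} - {i}. a j) * (a i * u i) \<in> J"
    proof (rule idlD(4)[OF assms(2)])
      show "(\<Prod>j\<in>{..<n} - {i}. a j) \<in> C" using aC by auto
      show "a i * u i \<in> J" using a(1)[OF that] unfolding u(1) ann_def by simp
    qed
    ultimately show ?thesis
      by (simp add: mult.assoc)
  qed
  then have "(\<Sum>i<n. c i * (p * u i)) \<in> J"
    using nc(1) assms(2) by (intro idl_sum) (auto simp: idlD)
  also have "(\<Sum>i<n. c i * (p * u i)) = p * u n"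
    unfolding nc(2) by (simp add: sum_distrib_left mult.left_commute)
  finally have "p \<in> P n"
    using aC unfolding u(1) ann_def p_def by auto
  then have "\<exists>i\<in>{..<n}. a i \<in> P n"
    unfolding p_def using aC P(2) prime_max_ann[OF assms(2)] by (intro prime_idl_prodD) auto
  with a(2) show False by auto
qed

lemma prime_avoidance:
  assumes "idl I" "finite F" "\<And>P. P \<in> F \<Longrightarrow> prime_idl P" "\<And>P. P \<in> F \<Longrightarrow> \<not> I \<subseteq> P"
  shows "\<exists>z\<in>I. \<forall>P\<in>F. z \<notin> P"
  using assms(2-)
proof (induction "card F" arbitrary: F rule: less_induct)
  case less
  show ?case
  proof (cases "F = {}")
    case True
    then show ?thesis using assms(1) idlD(2) by blast
  next
    case False
    then obtain P where P: "P \<in> F" by blast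
    define F' where "F' = F - {P}"
    have F': "finite F'" "card F' < card F" "F = insert P F'" "P \<notin> F'"
      using P less.prems(1) card_Diff1_less[OF less.prems(1) P] by (auto simp: F'_def)
    have IH': "\<exists>z\<in>I. \<forall>P\<in>F'. z \<notin> P"
      using less.prems F' by (intro less.hyps) auto
    show ?thesis
    proof (cases "\<exists>Q\<in>F'. Q \<subseteq> P")
      case True
      \<comment> \<open>Since Q is contained in P, avoiding P takes care of Q, and the induction
        hypothesis applies with Q removed.\<close>
      then obtain Q where Q: "Q \<in> F'" "Q \<subseteq> P" by blast
      have "card (F - {Q}) < card F"
        using Q F' by (metis card_Diff1_less insertI2 less.prems(1))
      then have "\<exists>z\<in>I. \<forall>P\<in>F - {Q}. z \<notin> P"
        using less.prems by (intro less.hyps) auto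
      then show ?thesis
        using Q F'(3,4) by blast
    next
      case nsub: False
      obtain z where z: "z \<in> I" "\<And>Q. Q \<in> F' \<Longrightarrow> z \<notin> Q"
        using IH' by blast
      show ?thesis
      proof (cases "z \<in> P")
        case False
        then show ?thesis using z F' by blast
      next
        case True
        have "\<forall>Q\<in>F'. \<exists>a. a \<in> Q \<and> a \<notin> P"
          using nsub by blast
        then obtain a where a: "\<And>Q. Q \<in> F' \<Longrightarrow> a Q \<in> Q" "\<And>Q. Q \<in> F' \<Longrightarrow> a Q \<notin> P"
          by metis
        obtain b where b: "b \<in> I" "b \<notin> P"
          using less.prems(3)[OF P] by blast
        have prime: "prime_idl P" "\<And>Q. Q \<in> F' \<Longrightarrow> prime_idl Q"
          using less.prems(2) F' by auto
        have idl: "idl P" "\<And>Q. Q \<in> F' \<Longrightarrow> idl Q"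
          using prime unfolding prime_idl_def by auto
        have aC: "a Q \<in> C" if "Q \<in> F'" for Q
          using a(1)[OF that] idlD(1)[OF idl(2)[OF that]] by simp
        have bC: "b \<in> C" using b assms(1) idlD(1) by blast
        \<comment> \<open>The correction term w lies in \<open>I\<close> and in every other prime
          but not in P, so adding it moves z out of P and changes nothing for the other
          primes.\<close>
        define w where "w = b * prod a F'"
        have wI: "w \<in> I"
          unfolding w_def using b(1) aC by (intro idlD(5)[OF assms(1)] prod_closed) auto
        have wP: "w \<notin> P"
        proof
          assume "w \<in> P"
          moreover have "prod a F' \<in> C" using aC by auto
          ultimately have "prod a F' \<in> P"
            using prime(1) bC b(2) unfolding w_def prime_idl_def by blast
          then have "\<exists>Q\<in>F'. a Q \<in> P"
            by (intro prime_idl_prodD[OF prime(1) F'(1)] aC)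
          with a(2) show False by auto
        qed
        have wQ: "w \<in> Q" if "Q \<in> F'" for Q
        proof -
          have "w = (b * prod a (F' - {Q})) * a Q"
            unfolding w_def using that F'(1) by (simp add: prod.remove[of _ Q] ac_simps)
          moreover have "b * prod a (F' - {Q}) \<in> C"
            using bC aC by (intro mult_closed prod_closed) auto
          ultimately show ?thesis
            using idlD(4)[OF idl(2)[OF that] _ a(1)[OF that]] by simp
        qed
        have "z + w \<notin> P"
          using idl_add_cancel[OF idl(1) True, of w] wP by simp
        moreover have "z + w \<notin> Q" if "Q \<in> F'" for Q
          using idl_add_cancel[OF idl(2)[OF that] wQ[OF that], of z] z(2)[OF that] by (simp add: add.commute)
        moreover have "z + w \<in> I"
          using idlD(3)[OF assms(1) z(1) wI] .
        ultimately show ?thesis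
          using F'(3) by blast
      qed
    qed
  qed
qed

text \<open>Avoid all maximal annihilators of all the given ideals at once. If \<open>I\<close> were
  contained in one of them, the corresponding class would be a socle class.\<close>

lemma exists_common_nzd:
  assumes "noetherian" "idl I" "finite \<J>" "\<And>J. J \<in> \<J> \<Longrightarrow> idl J" "\<And>J. J \<in> \<J> \<Longrightarrow> \<not> soc I J"
  shows "\<exists>z\<in>I. \<forall>J\<in>\<J>. nzd J z"
proof -
  define F where "F = (\<Union>J\<in>\<J>. max_ann J)"
  have "\<exists>z\<in>I. \<forall>P\<in>F. z \<notin> P"
  proof (rule prime_avoidance[OF assms(2)])
    show "finite F"
      unfolding F_def using assms finite_max_ann by blast
    show "prime_idl P" if "P \<in> F" for P
      using that prime_max_ann assms(4) unfolding F_def by blast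
    show "\<not> I \<subseteq> P" if P: "P \<in> F" for P
    proof
      assume "I \<subseteq> P"
      obtain J u where "J \<in> \<J>" "P = ann J u" "u \<in> C - J"
        using P unfolding F_def max_ann_def by blast
      then have "soc I J"
        using \<open>I \<subseteq> P\<close> unfolding soc_def ann_def by blast
      with assms(5) \<open>J \<in> \<J>\<close> show False by blast
    qed
  qed
  then obtain z where z: "z \<in> I" "\<And>P. P \<in> F \<Longrightarrow> z \<notin> P" by blast
  have "nzd J z" if J: "J \<in> \<J>" for J
    unfolding nzd_def
  proof (intro ballI impI, rule ccontr)
    fix a assume a: "a \<in> C" "z * a \<in> J" "a \<notin> J"
    then have "z \<in> ann J a"
      using z(1) assms(2) idlD(1) unfolding ann_def by blast
    then have "\<exists>P\<in>max_ann J. z \<in> P"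
      using exists_max_ann[OF assms(1) assms(4)[OF J]] a by blast
    then show False
      using z(2) J unfolding F_def by blast
  qed
  with z(1) show ?thesis by blast
qed

text \<open>Both sequences are exchanged, through a common non-zero-divisor \<open>z\<close>, for ones that start with \<open>z\<close>;
  this is an elementary form of \<open>Ext\<^sup>n(C/I, C/J) = Hom(C/I, C/(J, x\<^sub>1, \<dots>, x\<^sub>n))\<close>.\<close>

lemma soc_exts_exchange:
  assumes "noetherian" "idl I" "idl J" "set xs \<subseteq> I" "set ys \<subseteq> I" "reg J xs" "reg J ys"
    "length xs = length ys" "soc I (exts J xs)"
  shows "soc I (exts J ys)"
  using assms(3-)
proof (induction "length xs" arbitrary: J xs ys)
  case 0
  then show ?case by simp
next
  case (Suc n)
  have IC: "I \<subseteq> C" using assms(2) idlD(1) by blast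
  obtain xs' x where xs: "xs = xs' @ [x]"
    using Suc.hyps(2) by (metis length_Suc_conv_rev)
  obtain ys' y where ys: "ys = ys' @ [y]"
    using Suc.hyps(2) Suc.prems(6) by (metis length_Suc_conv_rev)
  have len: "length xs' = n" "length ys' = n"
    using Suc.hyps(2) Suc.prems(6) xs ys by auto
  have sub: "set xs' \<subseteq> I" "set ys' \<subseteq> I" "x \<in> I" "y \<in> I"
    using Suc.prems xs ys by auto
  have idls: "idl (exts J (take i zs))" if "set zs \<subseteq> I" for i zs
    using that IC set_take_subset[of i zs] Suc.prems(1) by (intro idl_exts) auto
  \<comment> \<open>All partial ideals of both sequences except the two final ones. None of these
    has a socle class for \<open>I\<close>, because the next element of the sequence is regular
    modulo it.\<close>
  define \<J> where "\<J> = (\<lambda>i. exts J (take i xs)) ` {..n} \<union> (\<lambda>i. exts J (take i ys)) ` {..n}"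
  have ns: "\<not> soc I (exts J (take i zs))" if "set zs \<subseteq> I" "reg J zs" "i < length zs" for i zs
  proof (rule nzd_imp_not_soc)
    show "nzd (exts J (take i zs)) (zs ! i)"
      using that reg_iff_nth by blast
    show "zs ! i \<in> I" using that nth_mem by blast
  qed
  have "\<exists>z\<in>I. \<forall>J\<in>\<J>. nzd J z"
  proof (rule exists_common_nzd[OF assms(1,2)])
    show "finite \<J>" unfolding \<J>_def by auto
    show "idl K" if "K \<in> \<J>" for K
      using that idls Suc.prems unfolding \<J>_def by auto
    show "\<not> soc I K" if "K \<in> \<J>" for K
      using that ns[of xs] ns[of ys] Suc.prems Suc.hyps(2) unfolding \<J>_def by auto
  qed
  then obtain z where z: "z \<in> I" "\<And>K. K \<in> \<J> \<Longrightarrow> nzd K z" by blast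
  have zx: "nzd (exts J (take i xs')) z" if "i \<le> n" for i
    using z(2)[of "exts J (take i xs)"] that len xs unfolding \<J>_def by auto
  have zy: "nzd (exts J (take i ys')) z" if "i \<le> n" for i
    using z(2)[of "exts J (take i ys)"] that len ys unfolding \<J>_def by auto
  have regs: "reg J xs'" "reg J ys'" "nzd (exts J xs') x" "nzd (exts J ys') y"
    using Suc.prems xs ys by (auto simp: reg_append)
  have idl': "idl (exts J xs')" "idl (exts J ys')"
    using idls[OF sub(1), of n] idls[OF sub(2), of n] len by auto
  \<comment> \<open>The last element x is traded for z, and z is then pulled to the front. The
    induction hypothesis applies to \<open>ext J z\<close> and the two shortened sequences, and the
    same trade is undone on the other side.\<close>
  have "soc I (ext (exts J xs') z)"
    using soc_ext_swap[OF idl'(1) IC sub(3) z(1) regs(3)] zx[of n] len Suc.prems(7) xs by simp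
  then have "soc I (exts (ext J z) xs')"
    by (simp add: ext_exts)
  then have "soc I (exts (ext J z) ys')"
  proof (rule Suc.hyps(1)[of xs' "ext J z" ys', rotated -1])
    show "idl (ext J z)" using Suc.prems(1) z(1) IC idl_ext by blast
    show "reg (ext J z) xs'"
      using sub IC Suc.prems(1) z(1) regs zx len by (intro reg_Cons_of_nzd) auto
    show "reg (ext J z) ys'"
      using sub IC Suc.prems(1) z(1) regs zy len by (intro reg_Cons_of_nzd) auto
  qed (use len sub in auto)
  then have "soc I (ext (exts J ys') z)"
    by (simp add: ext_exts)
  then show ?case
    using soc_ext_swap[OF idl'(2) IC z(1) sub(4) _ regs(4)] zy[of n] len ys by simp
qed

lemma soc_iff_no_nzd:
  assumes "noetherian" "idl I" "idl J"
  shows "soc I J \<longleftrightarrow> \<not> (\<exists>z\<in>I. nzd J z)"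
proof
  show "soc I J \<Longrightarrow> \<not> (\<exists>z\<in>I. nzd J z)"
    using nzd_imp_not_soc by blast
  show "soc I J" if "\<not> (\<exists>z\<in>I. nzd J z)"
  proof (rule ccontr)
    assume "\<not> soc I J"
    then have "\<exists>z\<in>I. \<forall>J\<in>{J}. nzd J z"
      using assms(3) by (intro exists_common_nzd[OF assms(1,2)]) auto
    with that show False by blast
  qed
qed

text \<open>If \<open>ys\<close> were shorter, the exchange would give a socle class modulo the
  prefix of \<open>xs\<close> of the same length, although the next element of \<open>xs\<close> is
  regular there.\<close>

lemma soc_exts_take:
  assumes "noetherian" "idl I" "idl J" "set xs \<subseteq> I" "set ys \<subseteq> I" "reg J xs" "reg J ys"
    "soc I (exts J xs)" "soc I (exts J ys)"
  shows "length xs \<le> length ys"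
proof (rule ccontr)
  assume "\<not> ?thesis"
  then have len: "length ys < length xs" by simp
  define zs where "zs = take (length ys) xs"
  have sub: "set zs \<subseteq> I"
    using assms(4) set_take_subset[of "length ys" xs] unfolding zs_def by blast
  have "reg J (zs @ drop (length ys) xs)"
    using assms(6) unfolding zs_def by simp
  then have "reg J zs" by (simp add: reg_append)
  then have "soc I (exts J zs)"
    using soc_exts_exchange[OF assms(1-3,5) sub assms(7)] assms(9) len unfolding zs_def by simp
  moreover have "\<not> soc I (exts J zs)"
  proof (rule nzd_imp_not_soc)
    show "nzd (exts J zs) (xs ! length ys)"
      using assms(6) len unfolding zs_def reg_iff_nth by blast
    show "xs ! length ys \<in> I"
      using assms(4) len by (meson nth_mem subsetD)
  qed
  ultimately show False by simp
qed

theorem maximal_reg_length_unique: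
  assumes "noetherian" "idl I" "idl J" "set xs \<subseteq> I" "set ys \<subseteq> I" "reg J xs" "reg J ys"
    "\<And>z. z \<in> I \<Longrightarrow> \<not> nzd (exts J xs) z" "\<And>z. z \<in> I \<Longrightarrow> \<not> nzd (exts J ys) z"
  shows "length xs = length ys"
proof -
  have IC: "I \<subseteq> C" using assms(2) idlD(1) by blast
  have "soc I (exts J xs)" "soc I (exts J ys)"
    using assms IC by (auto simp: soc_iff_no_nzd idl_exts)
  then show ?thesis
    using soc_exts_take[OF assms(1-3)] assms(4-7) by (meson le_antisym)
qed

end

section \<open>Algebraic dependence, regular sequences and chains of primes\<close>

text \<open>Elimination with unknowns indexed by \<open>E\<close> and equations by \<open>B\<close>:
  each equation is used to remove one unknown.\<close>

lemma homogeneous_system_solvable: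
  fixes A :: "'e \<Rightarrow> 'b \<Rightarrow> 'k::field"
  assumes "finite B" "finite E" "card B < card E"
  shows "\<exists>c. (\<exists>e\<in>E. c e \<noteq> 0) \<and> (\<forall>b\<in>B. (\<Sum>e\<in>E. c e * A e b) = 0)"
  using assms
proof (induction B arbitrary: E A rule: finite_induct)
  case empty
  then obtain e where "e \<in> E" by fastforce
  then show ?case by (intro exI[of _ "\<lambda>_. 1"]) auto
next
  case (insert b B)
  show ?case
  proof (cases "\<forall>e\<in>E. A e b = 0")
    case True
    have "\<exists>c. (\<exists>e\<in>E. c e \<noteq> 0) \<and> (\<forall>b\<in>B. (\<Sum>e\<in>E. c e * A e b) = 0)"
      using insert by (intro insert.IH) auto
    with True show ?thesis by auto
  next
    case False
    then obtain e0 where e0: "e0 \<in> E" "A e0 b \<noteq> 0" by blast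
    define E' where "E' = E - {e0}"
    \<comment> \<open>The unknown \<open>e0\<close> has been solved from equation \<open>b\<close>
      and substituted into the remaining equations.\<close>
    define A' where "A' = (\<lambda>e b'. A e b' - A e b / A e0 b * A e0 b')"
    have "\<exists>c. (\<exists>e\<in>E'. c e \<noteq> 0) \<and> (\<forall>b\<in>B. (\<Sum>e\<in>E'. c e * A' e b) = 0)"
      using insert e0 unfolding E'_def by (intro insert.IH) auto
    then obtain c where c: "\<exists>e\<in>E'. c e \<noteq> 0" "\<And>b'. b' \<in> B \<Longrightarrow> (\<Sum>e\<in>E'. c e * A' e b') = 0"
      by blast
    define c0 where "c0 = - (\<Sum>e\<in>E'. c e * (A e b / A e0 b))"
    define d where "d = c(e0 := c0)"
    have split: "(\<Sum>e\<in>E. d e * A e b') = c0 * A e0 b' + (\<Sum>e\<in>E'. c e * A e b')" for b'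
    proof -
      have "(\<Sum>e\<in>E. d e * A e b') = d e0 * A e0 b' + (\<Sum>e\<in>E'. d e * A e b')"
        unfolding E'_def using e0 insert.prems by (simp add: sum.remove)
      also have "(\<Sum>e\<in>E'. d e * A e b') = (\<Sum>e\<in>E'. c e * A e b')"
        unfolding d_def E'_def by (intro sum.cong) auto
      finally show ?thesis unfolding d_def by simp
    qed
    have "(\<Sum>e\<in>E. d e * A e b) = 0"
      unfolding split c0_def using e0 by (simp add: sum_distrib_right mult.assoc)
    moreover have "(\<Sum>e\<in>E. d e * A e b') = 0" if "b' \<in> B" for b'
    proof -
      have "0 = (\<Sum>e\<in>E'. c e * A e b' - c e * (A e b / A e0 b) * A e0 b')"
        using c(2)[OF that] unfolding A'_def by (simp add: algebra_simps)
      also have "\<dots> = (\<Sum>e\<in>E'. c e * A e b') + c0 * A e0 b'"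
        unfolding c0_def by (simp add: sum_subtractf sum_distrib_right)
      finally show ?thesis unfolding split by (simp add: add.commute)
    qed
    moreover have "\<exists>e\<in>E. d e \<noteq> 0"
      using c(1) unfolding d_def E'_def by auto
    ultimately show ?thesis
      by (intro exI[of _ d]) auto
  qed
qed

section \<open>Monomials with bounded exponents and algebraic dependence\<close>

definition exponent_box :: "nat \<Rightarrow> nat \<Rightarrow> nat list set" where
  "exponent_box n N = {e. set e \<subseteq> {..<N} \<and> length e = n}"

lemma finite_exponent_box [simp]: "finite (exponent_box n N)"
  unfolding exponent_box_def by (rule finite_lists_length_eq) simp

lemma card_exponent_box: "card (exponent_box n N) = N ^ n"
  unfolding exponent_box_def by (simp add: card_lists_length_eq)

lemma exponent_box_0 [simp]: "exponent_box 0 N = {[]}"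
  unfolding exponent_box_def by auto

lemma sum_exponent_box_Suc:
  "(\<Sum>e\<in>exponent_box (Suc n) N. F e) = (\<Sum>i<N. \<Sum>e\<in>exponent_box n N. F (i # e))"
proof -
  have "(\<Sum>i<N. \<Sum>e\<in>exponent_box n N. F (i # e)) =
      (\<Sum>(i, e)\<in>{..<N} \<times> exponent_box n N. F (i # e))"
    by (simp add: sum.cartesian_product)
  also have "\<dots> = (\<Sum>p\<in>{..<N} \<times> exponent_box n N. F (fst p # snd p))"
    by (simp add: case_prod_beta)
  also have "\<dots> = (\<Sum>e\<in>exponent_box (Suc n) N. F e)"
  proof (rule sum.reindex_bij_betw)
    have "(\<lambda>p. fst p # snd p) ` ({..<N} \<times> exponent_box n N) = exponent_box (Suc n) N"
    proof (intro equalityI subsetI)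
      fix e assume "e \<in> exponent_box (Suc n) N"
      then obtain i e' where "e = i # e'" "i < N" "e' \<in> exponent_box n N"
        unfolding exponent_box_def by (cases e) auto
      then show "e \<in> (\<lambda>p. fst p # snd p) ` ({..<N} \<times> exponent_box n N)"
        by (intro image_eqI[of _ _ "(i, e')"]) auto
    qed (auto simp: exponent_box_def)
    then show "bij_betw (\<lambda>p. fst p # snd p) ({..<N} \<times> exponent_box n N) (exponent_box (Suc n) N)"
      unfolding bij_betw_def by (auto simp: inj_on_def)
  qed
  finally show ?thesis ..
qed

text \<open>Exponent vectors are lists so that inductions along a sequence can split off its first
  element.\<close>

fun mono_at :: "'a::comm_ring_1 list \<Rightarrow> nat list \<Rightarrow> 'a" where
  "mono_at (a # as) (i # e) = a ^ i * mono_at as e"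
| "mono_at _ _ = 1"

lemma mono_at_mult:
  "length e = length e' \<Longrightarrow> mono_at as e * mono_at as e' = mono_at as (map2 (+) e e')"
proof (induction as e arbitrary: e' rule: mono_at.induct)
  case (1 a as i e)
  then obtain j f where "e' = j # f" by (cases e') auto
  with 1 show ?case by (simp add: power_add ac_simps flip: "1.IH")
qed auto

locale comm_algebra = comm_subring C
  for C :: "'a::comm_ring_1 set" +
  fixes cst :: "'k::field \<Rightarrow> 'a"
  assumes cst_add: "cst (a + b) = cst a + cst b"
    and cst_mult: "cst (a * b) = cst a * cst b"
    and cst_1 [simp]: "cst 1 = 1"
    and cst_closed [simp, intro]: "cst a \<in> C"
begin

lemma cst_0 [simp]: "cst 0 = 0"
  using cst_add[of 0 0] by simp

lemma cst_sum: "cst (sum f A) = (\<Sum>i\<in>A. cst (f i))"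
  by (induction A rule: infinite_finite_induct) (auto simp: cst_add)

lemma mono_at_closed: "set as \<subseteq> C \<Longrightarrow> mono_at as e \<in> C"
  by (induction as e rule: mono_at.induct) auto

text \<open>A nontrivial polynomial relation over the field that holds modulo \<open>J\<close>. The
  bound \<open>N\<close> on the exponents keeps the sum finite, as both the counting argument and
  the induction on the list require.\<close>

definition alg_dep :: "'a set \<Rightarrow> 'a list \<Rightarrow> bool" where
  "alg_dep J as \<longleftrightarrow> (\<exists>N c. (\<exists>e\<in>exponent_box (length as) N. c e \<noteq> (0::'k)) \<and>
     (\<Sum>e\<in>exponent_box (length as) N. cst (c e) * mono_at as e) \<in> J)"

text \<open>Dividing the relation by the largest possible power of the first element and reducing modulo that
  element leaves a nontrivial relation between the remaining ones.\<close>

lemma alg_dep_Cons: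
  assumes "alg_dep J (a # as)" "idl J" "nzd J a" "a \<in> C" "set as \<subseteq> C" "idl K" "J \<subseteq> K" "a \<in> K"
  shows "alg_dep K as"
proof -
  obtain N c where c: "\<exists>e\<in>exponent_box (Suc (length as)) N. c e \<noteq> (0::'k)"
    "(\<Sum>e\<in>exponent_box (Suc (length as)) N. cst (c e) * mono_at (a # as) e) \<in> J"
    using assms(1) unfolding alg_dep_def by auto
  define B where "B = exponent_box (length as) N"
  define G where "G i = (\<Sum>e\<in>B. cst (c (i # e)) * mono_at as e)" for i
  define i0 where "i0 = (LEAST i. \<exists>e\<in>B. c (i # e) \<noteq> 0)"
  obtain e where e: "e \<in> exponent_box (Suc (length as)) N" "c e \<noteq> 0" using c(1) by blast
  then obtain i e' where ie: "e = i # e'" "i < N" "e' \<in> B"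
    unfolding exponent_box_def B_def by (cases e) auto
  have ex: "\<exists>e\<in>B. c (i # e) \<noteq> 0" using e ie by blast
  have i0: "\<exists>e\<in>B. c (i0 # e) \<noteq> 0"
    unfolding i0_def using ex by (rule LeastI)
  have "i0 \<le> i" unfolding i0_def using ex by (rule Least_le)
  then have i0N: "i0 < N" using ie(2) by simp
  have G0: "G j = 0" if "j < i0" for j
  proof -
    have "\<not> (\<exists>e\<in>B. c (j # e) \<noteq> 0)"
      using not_less_Least that unfolding i0_def by blast
    then show ?thesis unfolding G_def by simp
  qed
  have GC: "G j \<in> C" for j
    unfolding G_def using assms(5) by (intro sum_closed mult_closed cst_closed mono_at_closed)
  have "(\<Sum>e\<in>exponent_box (Suc (length as)) N. cst (c e) * mono_at (a # as) e) = (\<Sum>i<N. a ^ i * G i)"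
    unfolding sum_exponent_box_Suc G_def B_def by (simp add: sum_distrib_left ac_simps)
  also have "\<dots> = (\<Sum>i\<in>{i0..<N}. a ^ i * G i)"
    by (rule sum.mono_neutral_right) (use G0 in auto)
  also have "\<dots> = (\<Sum>i\<in>{i0..<N}. a ^ i0 * (a ^ (i - i0) * G i))"
    by (intro sum.cong) (auto simp: mult.assoc[symmetric] power_add[symmetric])
  also have "\<dots> = a ^ i0 * (\<Sum>i\<in>{i0..<N}. a ^ (i - i0) * G i)"
    by (simp add: sum_distrib_left)
  finally have "a ^ i0 * (\<Sum>i\<in>{i0..<N}. a ^ (i - i0) * G i) \<in> J"
    using c(2) by simp
  moreover have "(\<Sum>i\<in>{i0..<N}. a ^ (i - i0) * G i) \<in> C"
    using assms(4) GC by (intro sum_closed) auto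
  ultimately have "(\<Sum>i\<in>{i0..<N}. a ^ (i - i0) * G i) \<in> J"
    using nzd_power[OF assms(3,4)] unfolding nzd_def by blast
  also have "(\<Sum>i\<in>{i0..<N}. a ^ (i - i0) * G i) = (\<Sum>i\<in>{Suc i0..<N}. a ^ (i - i0) * G i) + G i0"
    using i0N by (simp add: sum.atLeast_Suc_lessThan)
  finally have "(\<Sum>i\<in>{Suc i0..<N}. a ^ (i - i0) * G i) + G i0 \<in> K"
    using assms(7) by blast
  moreover have "(\<Sum>i\<in>{Suc i0..<N}. a ^ (i - i0) * G i) \<in> K"
  proof (rule idl_sum[OF assms(6)])
    fix i assume "i \<in> {Suc i0..<N}"
    then have "a ^ (i - i0) * G i = (a ^ (i - Suc i0) * G i) * a"
      using power_Suc[of a "i - Suc i0"] by (simp add: Suc_diff_Suc ac_simps del: power_Suc)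
    then show "a ^ (i - i0) * G i \<in> K"
      using idlD(4)[OF assms(6) _ assms(8)] assms(4) GC by auto
  qed
  ultimately have "G i0 \<in> K"
    using idl_add_cancel[OF assms(6)] by blast
  with i0 show ?thesis
    unfolding alg_dep_def G_def B_def by (intro exI[of _ N] exI[of _ "\<lambda>e. c (i0 # e)"]) auto
qed

text \<open>With no elements left, the relation is a nonzero field constant, which is a
  unit.\<close>

lemma alg_dep_Nil:
  assumes "alg_dep J []" "idl J"
  shows "1 \<in> J"
proof -
  obtain c where c: "c \<noteq> (0::'k)" "cst c \<in> J"
    using assms(1) unfolding alg_dep_def by auto
  have "cst (1 / c) * cst c \<in> J"
    using assms(2) c(2) by (intro idlD(4)) auto
  with c(1) show ?thesis by (simp flip: cst_mult)
qed

text \<open>The source of the upper bound on depth: a dependent regular sequence cannot lie in a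
  proper ideal containing \<open>J\<close>.\<close>

lemma alg_dep_reg:
  assumes "alg_dep J as" "idl J" "set as \<subseteq> C" "reg J as"
  shows "1 \<in> exts J as"
  using assms
proof (induction as arbitrary: J)
  case Nil
  then show ?case by (auto intro: alg_dep_Nil)
next
  case (Cons a as)
  have "alg_dep (ext J a) as"
    using Cons.prems by (intro alg_dep_Cons[OF Cons.prems(1,2)]) (auto simp: idl_ext ext_self ext_subset)
  with Cons show ?case by (auto simp: idl_ext)
qed

text \<open>The source of the upper bound on dimension. The i-th element is regular modulo the prime
  \<open>P i\<close> that it avoids, and it vanishes modulo the next prime, so the relation descends
  along the chain to a nonzero constant in the last prime.\<close>

lemma alg_dep_prime_chain:
  assumes "alg_dep (P 0) as" "length as = n" "set as \<subseteq> C" "\<And>i. i \<le> n \<Longrightarrow> prime_idl (P i)"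
    "\<And>i. i < n \<Longrightarrow> P i \<subseteq> P (Suc i)" "\<And>i. i < n \<Longrightarrow> as ! i \<in> P (Suc i)" "\<And>i. i < n \<Longrightarrow> as ! i \<notin> P i"
  shows False
  using assms
proof (induction as arbitrary: P n)
  case Nil
  then show ?case using alg_dep_Nil[of "P 0"] unfolding prime_idl_def by auto
next
  case (Cons a as)
  then obtain m where n: "n = Suc m" by auto
  have P: "prime_idl (P 0)" "prime_idl (P 1)"
    using Cons.prems(4)[of 0] Cons.prems(4)[of 1] n by auto
  have a: "a \<in> P 1" "a \<notin> P 0" "P 0 \<subseteq> P 1" "a \<in> C"
    using Cons.prems(3) Cons.prems(5)[of 0] Cons.prems(6)[of 0] Cons.prems(7)[of 0] n by auto
  have "nzd (P 0) a"
    using P(1) a unfolding nzd_def prime_idl_def by blast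
  then have "alg_dep (P 1) as"
    using P a Cons.prems(3) by (intro alg_dep_Cons[OF Cons.prems(1)]) (auto simp: prime_idl_def)
  then show False
  proof (intro Cons.IH[of "\<lambda>i. P (Suc i)" m])
    show "P (Suc i) \<subseteq> P (Suc (Suc i))" "as ! i \<in> P (Suc (Suc i))" "as ! i \<notin> P (Suc i)" if "i < m" for i
      using Cons.prems(5)[of "Suc i"] Cons.prems(6)[of "Suc i"] Cons.prems(7)[of "Suc i"] that n by auto
    show "prime_idl (P (Suc i))" if "i \<le> m" for i
      using Cons.prems(4)[of "Suc i"] that n by auto
  qed (use Cons.prems n in auto)
qed

section \<open>Finiteness over a subalgebra modulo an ideal, and counting dimensions\<close>

inductive_set fspan :: "'a set \<Rightarrow> 'a set \<Rightarrow> 'a set \<Rightarrow> 'a set" for T F H where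
  base: "t \<in> T \<Longrightarrow> t \<in> fspan T F H"
| gen: "h \<in> H \<Longrightarrow> h \<in> fspan T F H"
| cst: "x \<in> fspan T F H \<Longrightarrow> cst c * x \<in> fspan T F H"
| mult: "x \<in> fspan T F H \<Longrightarrow> f \<in> F \<Longrightarrow> f * x \<in> fspan T F H"
| add: "x \<in> fspan T F H \<Longrightarrow> y \<in> fspan T F H \<Longrightarrow> x + y \<in> fspan T F H"

lemma fspan_uminus: "x \<in> fspan T F H \<Longrightarrow> - x \<in> fspan T F H"
proof -
  have "cst (- 1) + 1 = 0" using cst_add[of "- 1" 1] by simp
  then have "cst (- 1) = - 1" by (simp add: eq_neg_iff_add_eq_0)
  then show "x \<in> fspan T F H \<Longrightarrow> - x \<in> fspan T F H"
    using fspan.cst[of x T F H "- 1"] by simp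
qed

lemma fspan_diff: "x \<in> fspan T F H \<Longrightarrow> y \<in> fspan T F H \<Longrightarrow> x - y \<in> fspan T F H"
  using fspan.add[OF _ fspan_uminus, of x T F H y] by simp

lemma fspan_mono: "x \<in> fspan T F H \<Longrightarrow> T \<subseteq> T' \<Longrightarrow> F \<subseteq> F' \<Longrightarrow> H \<subseteq> H' \<Longrightarrow> x \<in> fspan T' F' H'"
  by (induction rule: fspan.induct) (auto intro: fspan.intros)

lemma fspan_closed: "x \<in> fspan T F H \<Longrightarrow> T \<subseteq> C \<Longrightarrow> F \<subseteq> C \<Longrightarrow> H \<subseteq> C \<Longrightarrow> x \<in> C"
  by (induction rule: fspan.induct) auto

lemma fspan_mult_stable:
  assumes "idl T" "g \<in> C" "\<And>h. h \<in> H \<Longrightarrow> g * h \<in> fspan T F H" "x \<in> fspan T F H"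
  shows "g * x \<in> fspan T F H"
  using assms(4)
proof (induction rule: fspan.induct)
  case (cst x c)
  then show ?case using fspan.cst by (metis mult.left_commute)
next
  case (mult x f)
  then show ?case using fspan.mult by (metis mult.left_commute)
qed (use assms in \<open>auto simp: distrib_left idlD intro: fspan.intros\<close>)

lemma fspan_subset:
  assumes "\<And>h. h \<in> H \<Longrightarrow> h \<in> fspan T F' H'"
    "\<And>f x. f \<in> F \<Longrightarrow> x \<in> fspan T F' H' \<Longrightarrow> f * x \<in> fspan T F' H'"
  shows "fspan T F H \<subseteq> fspan T F' H'"
proof
  show "x \<in> fspan T F' H'" if "x \<in> fspan T F H" for x
    using that by (induction rule: fspan.induct) (auto intro: fspan.intros assms)
qed

text \<open>A generator that is integral modulo \<open>T\<close> over the others can be moved from the coefficient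
  algebra to the spanning set.\<close>

lemma fspan_eliminate:
  assumes "idl T" "g \<in> C" "H \<subseteq> C" "finite H" "0 < M"
    "\<And>h. h \<in> H \<Longrightarrow> g ^ M * h \<in> fspan T F ((\<lambda>(i, h). g ^ i * h) ` ({..<M} \<times> H))"
  shows "\<exists>H'. finite H' \<and> H' \<subseteq> C \<and> fspan T (insert g F) H \<subseteq> fspan T F H'"
proof (intro exI conjI)
  \<comment> \<open>Multiplication by g maps these generators among themselves except for the top
    power \<open>M - 1\<close>, where the hypothesis on \<open>g ^ M * h\<close> takes over.\<close>
  define H' where "H' = (\<lambda>(i, h). g ^ i * h) ` ({..<M} \<times> H)"
  show "finite H'" "H' \<subseteq> C"
    using assms unfolding H'_def by auto
  have in': "g ^ i * h \<in> fspan T F H'" if "i < M" "h \<in> H" for i h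
    using that unfolding H'_def by (intro fspan.gen) auto
  have g: "g * x \<in> fspan T F H'" if "x \<in> fspan T F H'" for x
  proof (rule fspan_mult_stable[OF assms(1,2) _ that])
    fix x assume "x \<in> H'"
    then obtain i h where *: "x = g ^ i * h" "i < M" "h \<in> H" unfolding H'_def by auto
    have "g ^ Suc i * h \<in> fspan T F H'"
    proof (cases "Suc i < M")
      case True
      then show ?thesis using *(3) by (rule in')
    next
      case False
      then have "Suc i = M" using *(2) by simp
      then show ?thesis using assms(6)[OF *(3)] unfolding H'_def by simp
    qed
    then show "g * x \<in> fspan T F H'" unfolding * by (simp add: mult.assoc)
  qed
  show "fspan T (insert g F) H \<subseteq> fspan T F H'"
  proof (rule fspan_subset)
    show "h \<in> fspan T F H'" if "h \<in> H" for h
      using in'[OF assms(5) that] by simp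
    show "f * x \<in> fspan T F H'" if "f \<in> insert g F" "x \<in> fspan T F H'" for f x
      using that g by (auto intro: fspan.mult)
  qed
qed

text \<open>A filtration of \<open>fspan\<close> by the size of the exponents. Each piece has finite
  dimension modulo \<open>T\<close>, of order n to the power \<open>length fs\<close>. The exponents
  are at most n, since \<open>exponent_box\<close> has a strict bound.\<close>

definition fspan_le :: "'a set \<Rightarrow> 'a list \<Rightarrow> 'a set \<Rightarrow> nat \<Rightarrow> 'a set" where
  "fspan_le T fs H n = {t + (\<Sum>p\<in>H \<times> exponent_box (length fs) (Suc n). cst (A p) * (mono_at fs (snd p) * fst p)) | t A.
     t \<in> T}"

lemma fspan_le_base: "t \<in> T \<Longrightarrow> t \<in> fspan_le T fs H n"
  unfolding fspan_le_def by (intro CollectI exI[of _ t] exI[of _ "\<lambda>_. 0"]) simp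

lemma fspan_le_gen:
  assumes "finite H" "h \<in> H" "e \<in> exponent_box (length fs) (Suc n)" "0 \<in> T"
  shows "mono_at fs e * h \<in> fspan_le T fs H n"
  unfolding fspan_le_def
proof (rule CollectI, rule exI[of _ 0], rule exI[of _ "\<lambda>p. if p = (h, e) then 1 else 0"], rule conjI)
  have "(\<Sum>p\<in>H \<times> exponent_box (length fs) (Suc n). cst (if p = (h, e) then 1 else 0) * (mono_at fs (snd p) * fst p))
    = (\<Sum>p\<in>H \<times> exponent_box (length fs) (Suc n). if p = (h, e) then mono_at fs e * h else 0)"
    by (intro sum.cong) auto
  then show "mono_at fs e * h = 0 + (\<Sum>p\<in>H \<times> exponent_box (length fs) (Suc n).
      cst (if p = (h, e) then 1 else 0) * (mono_at fs (snd p) * fst p))"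
    using assms by simp
qed (use assms in auto)

lemma fspan_le_cst:
  assumes "idl T" "x \<in> fspan_le T fs H n"
  shows "cst c * x \<in> fspan_le T fs H n"
proof -
  obtain t A where "t \<in> T" "x = t + (\<Sum>p\<in>H \<times> exponent_box (length fs) (Suc n). cst (A p) * (mono_at fs (snd p) * fst p))"
    using assms(2) unfolding fspan_le_def by blast
  then show ?thesis
    unfolding fspan_le_def using assms(1)
    by (intro CollectI exI[of _ "cst c * t"] exI[of _ "\<lambda>p. c * A p"])
      (simp add: distrib_left sum_distrib_left cst_mult mult.assoc idlD)
qed

lemma fspan_le_add:
  assumes "idl T" "x \<in> fspan_le T fs H n" "y \<in> fspan_le T fs H n"
  shows "x + y \<in> fspan_le T fs H n"
proof -
  let ?B = "H \<times> exponent_box (length fs) (Suc n)"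
  obtain t A where 1: "t \<in> T" "x = t + (\<Sum>p\<in>?B. cst (A p) * (mono_at fs (snd p) * fst p))"
    using assms(2) unfolding fspan_le_def by blast
  obtain s B where 2: "s \<in> T" "y = s + (\<Sum>p\<in>?B. cst (B p) * (mono_at fs (snd p) * fst p))"
    using assms(3) unfolding fspan_le_def by blast
  show ?thesis
    unfolding fspan_le_def using assms(1) 1 2
    by (intro CollectI exI[of _ "t + s"] exI[of _ "\<lambda>p. A p + B p"])
      (simp add: distrib_right sum.distrib cst_add idlD)
qed

lemma fspan_le_induct [consumes 2, case_names base gen cst add]:
  assumes "x \<in> fspan_le T fs H n" "idl T"
    "\<And>t. t \<in> T \<Longrightarrow> Q t" "\<And>h e. h \<in> H \<Longrightarrow> e \<in> exponent_box (length fs) (Suc n) \<Longrightarrow> Q (mono_at fs e * h)"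
    "\<And>c x. Q x \<Longrightarrow> Q (cst c * x)" "\<And>x y. Q x \<Longrightarrow> Q y \<Longrightarrow> Q (x + y)"
  shows "Q x"
proof -
  have *: "Q (sum f A)" if "\<And>i. i \<in> A \<Longrightarrow> Q (f i)" for f and A :: "('a \<times> nat list) set"
    using that by (induction A rule: infinite_finite_induct) (auto intro: assms idlD[OF assms(2)])
  obtain t A where x: "t \<in> T"
    "x = t + (\<Sum>p\<in>H \<times> exponent_box (length fs) (Suc n). cst (A p) * (mono_at fs (snd p) * fst p))"
    using assms(1) unfolding fspan_le_def by blast
  have "Q (\<Sum>p\<in>H \<times> exponent_box (length fs) (Suc n). cst (A p) * (mono_at fs (snd p) * fst p))"
    by (intro * assms(4,5)) auto
  with x show ?thesis
    using assms(3,6) by simp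
qed

text \<open>If multiplication by a sends each generator into level q, it raises every level by at
  most q. So exponents grow only linearly with the number of factors.\<close>

lemma fspan_le_shift:
  assumes T: "idl T" and fs: "set fs \<subseteq> C" and H: "finite H" "H \<subseteq> C" and a: "a \<in> C"
    "\<And>h. h \<in> H \<Longrightarrow> a * h \<in> fspan_le T fs H q" and x: "x \<in> fspan_le T fs H n"
  shows "a * x \<in> fspan_le T fs H (n + q)"
  using x T
proof (induction rule: fspan_le_induct)
  case (base t)
  then show ?case using T a by (auto intro: fspan_le_base idlD)
next
  case (gen h e)
  have "mono_at fs e * y \<in> fspan_le T fs H (n + q)" if "y \<in> fspan_le T fs H q" for y
    using that T
  proof (induction rule: fspan_le_induct)
    case (base t)
    then show ?case using T mono_at_closed[OF fs] by (auto intro: fspan_le_base idlD)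
  next
    case (gen h' e')
    have len: "length e = length e'" using gen \<open>e \<in> _\<close> unfolding exponent_box_def by simp
    have "map2 (+) e e' \<in> exponent_box (length fs) (Suc (n + q))"
    proof -
      have "i + j < Suc (n + q)" if "(i, j) \<in> set (zip e e')" for i j
      proof -
        have "i < Suc n" "j < Suc q"
          using set_zip_leftD[OF that] set_zip_rightD[OF that] gen \<open>e \<in> _\<close> unfolding exponent_box_def by auto
        then show ?thesis by simp
      qed
      then show ?thesis
        using gen \<open>e \<in> _\<close> unfolding exponent_box_def by auto
    qed
    then have "mono_at fs (map2 (+) e e') * h' \<in> fspan_le T fs H (n + q)"
      using gen H(1) idlD(2)[OF T] by (intro fspan_le_gen)
    then show ?case
      using mono_at_mult[OF len, of fs] by (simp add: mult.assoc[symmetric])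
  next
    case (cst c x)
    then show ?case using fspan_le_cst[OF T] by (metis mult.left_commute)
  next
    case (add x y)
    then show ?case using fspan_le_add[OF T] by (simp add: distrib_left)
  qed
  then have "mono_at fs e * (a * h) \<in> fspan_le T fs H (n + q)"
    using a(2) gen(1) by blast
  then show ?case by (simp add: mult.left_commute)
next
  case (cst c x)
  then show ?case using fspan_le_cst[OF T] by (metis mult.left_commute)
next
  case (add x y)
  then show ?case using fspan_le_add[OF T] by (simp add: distrib_left)
qed

lemma fspan_le_mono:
  assumes "idl T" "finite H" "x \<in> fspan_le T fs H n" "n \<le> m"
  shows "x \<in> fspan_le T fs H m"
  using assms(3,1)
proof (induction rule: fspan_le_induct)
  case (gen h e)
  have "e \<in> exponent_box (length fs) (Suc m)"
    using gen(2) assms(4) unfolding exponent_box_def by auto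
  then show ?case using gen(1) assms idlD(2) by (intro fspan_le_gen) auto
qed (auto intro: fspan_le_base fspan_le_cst fspan_le_add assms(1))

lemma mono_at_zeros: "mono_at fs (replicate (length fs) 0) = 1"
  by (induction fs) auto

lemma fspan_imp_fspan_le:
  assumes T: "idl T" and fs: "set fs \<subseteq> C" and H: "finite H" "H \<subseteq> C" and x: "x \<in> fspan T (set fs) H"
  shows "\<exists>n. x \<in> fspan_le T fs H n"
  using x
proof (induction rule: fspan.induct)
  case (base t)
  then show ?case using fspan_le_base by blast
next
  case (gen h)
  have "replicate (length fs) 0 \<in> exponent_box (length fs) (Suc 0)"
    unfolding exponent_box_def by auto
  then have "mono_at fs (replicate (length fs) 0) * h \<in> fspan_le T fs H 0"
    using gen H(1) idlD(2)[OF T] by (intro fspan_le_gen) auto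
  then show ?case by (auto simp: mono_at_zeros)
next
  case (cst x c)
  then show ?case using fspan_le_cst[OF T] by blast
next
  case (mult x f)
  obtain j where j: "j < length fs" "f = fs ! j" using mult(2) by (metis in_set_conv_nth)
  have f: "mono_at fs ((replicate (length fs) 0)[j := 1]) = f"
    using j
  proof (induction fs arbitrary: j)
    case (Cons a fs)
    then show ?case by (cases j) (auto simp: mono_at_zeros)
  qed simp
  have "f * h \<in> fspan_le T fs H 1" if "h \<in> H" for h
  proof -
    have "set ((replicate (length fs) 0)[j := 1]) \<subseteq> {0, 1::nat}"
      using set_update_subset_insert[of "replicate (length fs) (0::nat)" j 1] by auto
    then have "(replicate (length fs) 0)[j := 1] \<in> exponent_box (length fs) (Suc 1)"
      unfolding exponent_box_def by auto
    then have "mono_at fs ((replicate (length fs) 0)[j := 1]) * h \<in> fspan_le T fs H 1"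
      using that H(1) idlD(2)[OF T] by (intro fspan_le_gen) auto
    then show ?thesis unfolding f .
  qed
  then show ?case
    using mult fs fspan_le_shift[OF T fs H, of f 1 x] by blast
next
  case (add x y)
  then obtain n m where "x \<in> fspan_le T fs H n" "y \<in> fspan_le T fs H m" by blast
  then have "x \<in> fspan_le T fs H (max n m)" "y \<in> fspan_le T fs H (max n m)"
    using fspan_le_mono[OF T H(1)] by auto
  then show ?case using fspan_le_add[OF T] by blast
qed

text \<open>Counting: the \<open>N ^ Suc d\<close> monomials in the \<open>Suc d\<close> elements with exponents below \<open>N\<close> lie in a space
  spanned modulo \<open>T\<close> by \<open>O(N ^ d)\<close> elements.\<close>

theorem alg_dep_of_fspan:
  assumes T: "idl T" and fs: "set fs \<subseteq> C" and H: "finite H" "H \<subseteq> C" and C: "C \<subseteq> fspan T (set fs) H"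
    and as: "set as \<subseteq> C" "length as = Suc (length fs)"
  shows "alg_dep T as"
proof -
  let ?V = "fspan_le T fs H"
  define d where "d = length fs"
  have ex: "\<exists>n. x \<in> ?V n" if "x \<in> C" for x
    using fspan_imp_fspan_le[OF T fs H] C that by blast
  \<comment> \<open>Finitely many elements: the unit and all products of a given element with a
    module generator. A common level q for them controls all later products.\<close>
  define Y where "Y = {1} \<union> (\<lambda>p. fst p * snd p) ` (set as \<times> H)"
  have Y: "finite Y" "Y \<subseteq> C" unfolding Y_def using as H by (auto intro!: mult_closed)
  have "\<exists>q. \<forall>x\<in>Y. x \<in> ?V q"
    using Y
  proof (induction Y rule: finite_induct)
    case (insert x F)
    then obtain q where "\<forall>x\<in>F. x \<in> ?V q" by auto
    moreover obtain n where "x \<in> ?V n" using ex insert.prems by auto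
    ultimately have "\<forall>y\<in>insert x F. y \<in> ?V (max q n)"
      using fspan_le_mono[OF T H(1), of _ fs _ "max q n"] by fastforce
    then show ?case ..
  qed simp
  then obtain q where q: "\<And>x. x \<in> Y \<Longrightarrow> x \<in> ?V q" by blast
  have one: "1 \<in> ?V q" using q unfolding Y_def by auto
  have step: "a * x \<in> ?V (n + q)" if "a \<in> set as" "x \<in> ?V n" for a x n
  proof (rule fspan_le_shift[OF T fs H _ _ that(2)])
    show "a \<in> C" using that as by auto
    show "a * h \<in> ?V q" if "h \<in> H" for h
      using that \<open>a \<in> set as\<close> unfolding Y_def by (intro q, unfold Y_def) (auto intro!: image_eqI[of _ _ "(a, h)"])
  qed
  have pow: "a ^ i * x \<in> ?V (n + i * q)" if "a \<in> set as" "x \<in> ?V n" for a x n i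
  proof (induction i)
    case (Suc i)
    have "a * (a ^ i * x) \<in> ?V (n + i * q + q)"
      by (rule step[OF that(1) Suc.IH])
    then show ?case by (simp add: mult.assoc add_ac)
  qed (use that in simp)
  have mono: "mono_at bs e \<in> ?V (q + length bs * (N * q))"
    if "set bs \<subseteq> set as" "e \<in> exponent_box (length bs) N" for bs e N
    using that
  proof (induction bs arbitrary: e)
    case (Cons b bs)
    then obtain i e' where e: "e = i # e'" "i < N" "e' \<in> exponent_box (length bs) N"
      unfolding exponent_box_def by (cases e) auto
    have "b ^ i * mono_at bs e' \<in> ?V (q + length bs * (N * q) + i * q)"
      using Cons e by (intro pow) auto
    moreover have "q + length bs * (N * q) + i * q \<le> q + length (b # bs) * (N * q)"
      using e(2) by simp
    ultimately show ?case
      using fspan_le_mono[OF T H(1)] e(1) by auto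
  qed (use one in \<open>auto simp: exponent_box_def\<close>)
  \<comment> \<open>The spanning set \<open>B\<close> has at most K * N ^ d elements, so N = K + 1
    makes it smaller than the number N ^ (d + 1) of monomials.\<close>
  define K where "K = card H * (q + Suc d * q + 1) ^ d"
  define N where "N = Suc K"
  define n where "n = q + Suc d * (N * q)"
  define B where "B = H \<times> exponent_box d (Suc n)"
  have "Suc n \<le> (q + Suc d * q + 1) * N"
  proof -
    have "1 \<le> N" "q \<le> q * N" unfolding N_def by auto
    then have "1 + q + Suc d * (N * q) \<le> N + q * N + Suc d * (N * q)" by (intro add_mono) auto
    then show ?thesis unfolding n_def by (simp add: algebra_simps)
  qed
  then have "card B \<le> card H * ((q + Suc d * q + 1) * N) ^ d"
    unfolding B_def by (simp add: card_cartesian_product card_exponent_box power_mono)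
  also have "\<dots> = K * N ^ d"
    unfolding K_def by (simp only: power_mult_distrib mult.assoc)
  also have "\<dots> < N ^ Suc d"
    unfolding N_def by simp
  finally have card: "card B < card (exponent_box (Suc d) N)"
    by (simp add: card_exponent_box)
  have "\<forall>e\<in>exponent_box (Suc d) N. \<exists>t A. t \<in> T \<and>
      mono_at as e = t + (\<Sum>p\<in>B. cst (A p) * (mono_at fs (snd p) * fst p))"
  proof
    fix e assume "e \<in> exponent_box (Suc d) N"
    then have "mono_at as e \<in> ?V n"
      using mono[of as e N] as unfolding n_def d_def by simp
    then show "\<exists>t A. t \<in> T \<and> mono_at as e = t + (\<Sum>p\<in>B. cst (A p) * (mono_at fs (snd p) * fst p))"
      unfolding fspan_le_def B_def d_def by blast
  qed
  from bchoice[OF this] obtain t where "\<forall>e\<in>exponent_box (Suc d) N. \<exists>A. t e \<in> T \<and>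
      mono_at as e = t e + (\<Sum>p\<in>B. cst (A p) * (mono_at fs (snd p) * fst p))" by blast
  from bchoice[OF this] obtain A where tA: "\<And>e. e \<in> exponent_box (Suc d) N \<Longrightarrow> t e \<in> T"
    "\<And>e. e \<in> exponent_box (Suc d) N \<Longrightarrow> mono_at as e = t e + (\<Sum>p\<in>B. cst (A e p) * (mono_at fs (snd p) * fst p))"
    by blast
  \<comment> \<open>The combination is chosen so that the coefficients at all elements of
    \<open>B\<close> cancel; only the parts \<open>t e\<close> in \<open>T\<close> remain.\<close>
  have "finite B" unfolding B_def using H by simp
  then obtain c where c: "\<exists>e\<in>exponent_box (Suc d) N. c e \<noteq> 0"
    "\<And>p. p \<in> B \<Longrightarrow> (\<Sum>e\<in>exponent_box (Suc d) N. c e * A e p) = 0"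
    using homogeneous_system_solvable[of B "exponent_box (Suc d) N" A] card by auto
  have "(\<Sum>e\<in>exponent_box (Suc d) N. cst (c e) * mono_at as e) =
     (\<Sum>e\<in>exponent_box (Suc d) N. cst (c e) * t e) +
     (\<Sum>e\<in>exponent_box (Suc d) N. \<Sum>p\<in>B. cst (c e * A e p) * (mono_at fs (snd p) * fst p))"
    using tA by (simp add: sum.distrib[symmetric] distrib_left sum_distrib_left cst_mult mult.assoc)
  also have "(\<Sum>e\<in>exponent_box (Suc d) N. \<Sum>p\<in>B. cst (c e * A e p) * (mono_at fs (snd p) * fst p)) =
     (\<Sum>p\<in>B. cst (\<Sum>e\<in>exponent_box (Suc d) N. c e * A e p) * (mono_at fs (snd p) * fst p))"
    by (subst sum.swap) (simp add: cst_sum sum_distrib_right)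
  also have "\<dots> = 0" using c(2) by simp
  finally have "(\<Sum>e\<in>exponent_box (Suc d) N. cst (c e) * mono_at as e) =
     (\<Sum>e\<in>exponent_box (Suc d) N. cst (c e) * t e)" by simp
  moreover have "(\<Sum>e\<in>exponent_box (Suc d) N. cst (c e) * t e) \<in> T"
    using tA(1) by (intro idl_sum[OF T] idlD(4)[OF T]) auto
  ultimately show ?thesis
    unfolding alg_dep_def using c(1) as(2) d_def by (intro exI[of _ N] exI[of _ c]) simp
qed

lemma alg_dep_mono: "alg_dep J as \<Longrightarrow> J \<subseteq> K \<Longrightarrow> alg_dep K as"
  unfolding alg_dep_def by blast

end

section \<open>Polynomials\<close>

abbreviation keys where "keys \<equiv> Poly_Mapping.keys"
abbreviation lookup where "lookup \<equiv> Poly_Mapping.lookup"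
abbreviation single where "single \<equiv> Poly_Mapping.single"

lemma Cst_0 [simp]: "Cst 0 = 0" and Cst_1 [simp]: "Cst 1 = 1"
  by (simp_all add: Cst_def)

lemma Cst_add: "Cst (a + b) = Cst a + Cst b"
  by (simp add: Cst_def single_add)

lemma Cst_mult: "Cst (a * b) = Cst a * Cst b"
  by (simp add: Cst_def mult_single)

lemma Cst_times_single: "Cst c * single m d = single m (c * d)"
  by (simp add: Cst_def mult_single)

lemma poly_eq_sum_single:
  fixes p :: "'a \<Rightarrow>\<^sub>0 'b::comm_monoid_add"
  shows "finite A \<Longrightarrow> keys p \<subseteq> A \<Longrightarrow> (\<Sum>m\<in>A. single m (lookup p m)) = p"
  by (rule poly_mapping_eqI)
    (auto simp: lookup_sum lookup_single when_def sum.delta in_keys_iff intro: ccontr)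

lemma poly_keys_induct [case_names zero single add]:
  fixes p :: "'a \<Rightarrow>\<^sub>0 'b::comm_monoid_add"
  assumes "Q 0" "\<And>m c. m \<in> keys p \<Longrightarrow> Q (single m c)" "\<And>p q. Q p \<Longrightarrow> Q q \<Longrightarrow> Q (p + q)"
  shows "Q p"
proof -
  have "Q (\<Sum>m\<in>A. single m (lookup p m))" if "A \<subseteq> keys p" for A
    using that by (induction A rule: infinite_finite_induct) (auto intro: assms)
  from this[OF order_refl] show ?thesis
    using poly_eq_sum_single[OF finite_keys order_refl, of p] by simp
qed

lemma poly_induct [case_names single add]:
  fixes p :: "'a \<Rightarrow>\<^sub>0 'b::comm_monoid_add"
  assumes "\<And>m c. Q (single m c)" "\<And>p q. Q p \<Longrightarrow> Q q \<Longrightarrow> Q (p + q)"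
  shows "Q p"
  using assms(1)[of _ 0] by (induction p rule: poly_keys_induct) (auto intro: assms)

lemma lookup_single_times:
  fixes t m :: "'a::cancel_comm_monoid_add" and p :: "'a \<Rightarrow>\<^sub>0 'k::comm_ring_1"
  shows "lookup (single t c * p) (t + m) = c * lookup p m"
  by (induction p rule: poly_induct) (auto simp: mult_single lookup_single when_def distrib_left lookup_add)

lemma lookup_Cst_times: "lookup (Cst c * p) m = c * lookup p m"
  using lookup_single_times[of 0 c p m] by (simp add: Cst_def)

lemma keys_mult_elim:
  fixes p q :: "('i, 'k::comm_ring_1) poly_over"
  assumes "m \<in> keys (p * q)"
  obtains a b where "a \<in> keys p" "b \<in> keys q" "m = a + b"
  using keys_mult[of p q] assms by blast

lemma keys_add_elim:
  assumes "m \<in> keys (p + q)"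
  obtains "m \<in> keys p" | "m \<in> keys q"
  using Poly_Mapping.keys_add[of p q] assms by blast

section \<open>Evaluation of monomials and substitution homomorphisms\<close>

definition meval :: "('x \<Rightarrow> 'a::comm_ring_1) \<Rightarrow> ('x \<Rightarrow>\<^sub>0 nat) \<Rightarrow> 'a" where
  "meval h m = (\<Prod>x\<in>keys m. h x ^ lookup m x)"

lemma meval_superset: "finite A \<Longrightarrow> keys m \<subseteq> A \<Longrightarrow> meval h m = (\<Prod>x\<in>A. h x ^ lookup m x)"
  unfolding meval_def by (rule prod.mono_neutral_left) (auto simp: in_keys_iff)

lemma keys_add_nat: "keys (m + m') = keys m \<union> keys (m' :: 'x \<Rightarrow>\<^sub>0 nat)"
  by (auto simp: in_keys_iff lookup_add)

lemma meval_0 [simp]: "meval h 0 = 1"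
  by (simp add: meval_def)

lemma meval_add: "meval h (m + m') = meval h m * meval h m'"
proof -
  let ?A = "keys m \<union> keys m'"
  have "meval h (m + m') = (\<Prod>x\<in>?A. h x ^ lookup (m + m') x)"
    by (simp add: meval_def keys_add_nat)
  also have "\<dots> = (\<Prod>x\<in>?A. h x ^ lookup m x) * (\<Prod>x\<in>?A. h x ^ lookup m' x)"
    by (simp add: lookup_add power_add prod.distrib)
  also have "\<dots> = meval h m * meval h m'"
    by (simp add: meval_superset[of ?A])
  finally show ?thesis .
qed

lemma meval_single: "meval h (single x n) = h x ^ n"
  by (subst meval_superset[of "{x}"]) auto

lemma subst_superset:
  assumes "finite A" "keys p \<subseteq> A"
  shows "subst h p = (\<Sum>m\<in>A. Cst (lookup p m) * meval h m)"
  unfolding subst_def meval_def using assms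
  by (intro sum.mono_neutral_left) (auto simp: in_keys_iff)

lemma subst_single: "subst h (single m c) = Cst c * meval h m"
  by (subst subst_superset[of "{m}"]) auto

lemma subst_add: "subst h (p + q) = subst h p + subst h q"
proof -
  let ?A = "keys p \<union> keys q"
  have "subst h (p + q) = (\<Sum>m\<in>?A. Cst (lookup (p + q) m) * meval h m)"
    using Poly_Mapping.keys_add[of p q] by (intro subst_superset) auto
  also have "\<dots> = (\<Sum>m\<in>?A. Cst (lookup p m) * meval h m) + (\<Sum>m\<in>?A. Cst (lookup q m) * meval h m)"
    by (simp add: lookup_add Cst_add distrib_right sum.distrib)
  also have "\<dots> = subst h p + subst h q"
    by (simp add: subst_superset[of ?A])
  finally show ?thesis .
qed

lemma subst_0 [simp]: "subst h 0 = 0"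
  by (simp add: subst_def)

lemma subst_uminus: "subst h (- p) = - subst h p"
  using subst_add[of h p "- p"] by (simp add: eq_neg_iff_add_eq_0 add.commute)

lemma subst_diff: "subst h (p - q) = subst h p - subst h q"
  using subst_add[of h p "- q"] by (simp add: subst_uminus)

lemma subst_mult: "subst h (p * q) = subst h p * subst h q"
proof (induction p rule: poly_induct)
  case (single m c)
  show ?case
  proof (induction q rule: poly_induct)
    case (single m' c')
    show ?case by (simp add: mult_single subst_single Cst_mult meval_add ac_simps)
  qed (simp add: distrib_left subst_add)
qed (simp add: distrib_right subst_add)

lemma subst_Cst [simp]: "subst h (Cst c) = Cst c"
  using subst_single[of h 0 c] by (simp add: Cst_def)

lemma subst_1 [simp]: "subst h 1 = 1"
  using subst_Cst[of h 1] by simp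

lemma subst_Var [simp]: "subst h (Var x) = h x"
  by (simp add: Var_def subst_single meval_single)

lemma subst_power: "subst h (p ^ n) = subst h p ^ n"
  by (induction n) (auto simp: subst_mult)

lemma subst_sum: "subst h (sum f A) = (\<Sum>i\<in>A. subst h (f i))"
  by (induction A rule: infinite_finite_induct) (auto simp: subst_add)

lemma subst_prod: "subst h (prod f A) = (\<Prod>i\<in>A. subst h (f i))"
  by (induction A rule: infinite_finite_induct) (auto simp: subst_mult)

lemmas subst_hom = subst_add subst_diff subst_uminus subst_mult subst_power

lemma subst_meval: "subst g (meval h m) = meval (\<lambda>x. subst g (h x)) m"
  by (simp add: meval_def subst_prod subst_power)

lemma subst_subst: "subst g (subst h p) = subst (\<lambda>x. subst g (h x)) p"
  by (induction p rule: poly_induct) (auto simp: subst_single subst_mult subst_meval subst_add)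

lemma subst_cong: "(\<And>m x. m \<in> keys p \<Longrightarrow> x \<in> keys m \<Longrightarrow> g x = h x) \<Longrightarrow> subst g p = subst h p"
  unfolding subst_def by (intro sum.cong prod.cong arg_cong2[of _ _ _ _ times]) auto

lemma Var_power: "Var x ^ n = single (single x n) 1"
  by (induction n) (auto simp: Var_def mult_single simp flip: single_add)

lemma meval_Var: "meval Var m = single m 1"
proof -
  have "(\<Prod>x\<in>A. Var x ^ lookup m x) = single (\<Sum>x\<in>A. single x (lookup m x)) 1" if "finite A" for A
    using that by (induction A) (auto simp: Var_power mult_single)
  from this[of "keys m"] show ?thesis
    using poly_eq_sum_single[OF finite_keys order_refl, of m] by (simp add: meval_def)
qed

lemma subst_Var_id: "subst Var p = p"
  by (induction p rule: poly_induct) (auto simp: subst_single meval_Var Cst_times_single subst_add)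

definition polys_in :: "'x set \<Rightarrow> ('x, 'k::comm_ring_1) poly_over set" where
  "polys_in I = {p. \<forall>m\<in>keys p. keys m \<subseteq> I}"

interpretation polys_in: comm_algebra "polys_in I" "Cst :: 'k::field \<Rightarrow> ('x, 'k) poly_over" for I :: "'x set"
proof unfold_locales
  show "1 \<in> polys_in I" by (auto simp: polys_in_def)
  show "a - b \<in> polys_in I" if "a \<in> polys_in I" "b \<in> polys_in I" for a b :: "('x, 'k) poly_over"
    using that keys_diff[of a b] unfolding polys_in_def by blast
  show "a * b \<in> polys_in I" if "a \<in> polys_in I" "b \<in> polys_in I" for a b :: "('x, 'k) poly_over"
    using that unfolding polys_in_def by (fastforce elim!: keys_mult_elim simp: keys_add_nat)
  show "Cst a \<in> polys_in I" for a :: 'k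
    by (auto simp: polys_in_def Cst_def split: if_splits)
qed (simp_all add: Cst_add Cst_mult)

lemma Var_in_polys_in [simp, intro]: "x \<in> I \<Longrightarrow> Var x \<in> polys_in I"
  by (auto simp: polys_in_def Var_def split: if_splits)

lemma polys_in_induct [consumes 1, case_names single add]:
  assumes "p \<in> polys_in I" "\<And>m c. keys m \<subseteq> I \<Longrightarrow> Q (single m c)" "\<And>p q. Q p \<Longrightarrow> Q q \<Longrightarrow> Q (p + q)"
  shows "Q p"
proof (induction p rule: poly_keys_induct)
  case zero
  then show ?case using assms(2)[of 0 0] by simp
qed (use assms in \<open>auto simp: polys_in_def\<close>)

lemma subst_in_polys_in:
  fixes p :: "('x, 'k::field) poly_over" and I :: "'x set" and J :: "'y set"
  assumes "p \<in> polys_in I" "\<And>x. x \<in> I \<Longrightarrow> h x \<in> polys_in J"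
  shows "subst h p \<in> polys_in J"
  using assms(1)
proof (induction rule: polys_in_induct)
  case (single m c)
  then show ?case using assms(2) unfolding subst_single meval_def
    by (intro polys_in.mult_closed polys_in.cst_closed polys_in.prod_closed polys_in.power_closed) auto
qed (simp add: subst_add)

lemma subst_cong_in: "p \<in> polys_in I \<Longrightarrow> (\<And>x. x \<in> I \<Longrightarrow> g x = h x) \<Longrightarrow> subst g p = subst h p"
  by (rule subst_cong) (auto simp: polys_in_def)

section \<open>Degrees\<close>

lemma mon_degree_superset: "finite A \<Longrightarrow> keys m \<subseteq> A \<Longrightarrow> mon_degree m = (\<Sum>x\<in>A. lookup m x)"
  unfolding mon_degree_def by (rule sum.mono_neutral_left) (auto simp: in_keys_iff)

lemma mon_degree_add: "mon_degree (m + m') = mon_degree m + mon_degree m'"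
proof -
  let ?A = "keys m \<union> keys m'"
  have "mon_degree (m + m') = (\<Sum>x\<in>?A. lookup (m + m') x)"
    by (simp add: mon_degree_def keys_add_nat)
  then show ?thesis
    by (simp add: mon_degree_superset[of ?A] lookup_add sum.distrib)
qed

lemma mon_degree_single [simp]: "mon_degree (single x n) = n"
  by (subst mon_degree_superset[of "{x}"]) auto

lemma mon_degree_eq_0: "mon_degree m = 0 \<longleftrightarrow> m = 0"
proof
  assume "mon_degree m = 0"
  then have "\<forall>x\<in>keys m. lookup m x = 0" unfolding mon_degree_def by simp
  then have "lookup m x = 0" for x by (cases "x \<in> keys m") (auto simp: in_keys_iff)
  then have "keys m = {}" unfolding in_keys_iff[symmetric] by (metis all_not_in_conv in_keys_iff)
  then show "m = 0" by simp
qed (simp add: mon_degree_def)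

definition homog :: "nat \<Rightarrow> ('x, 'k::comm_ring_1) poly_over \<Rightarrow> bool" where
  "homog d p \<longleftrightarrow> (\<forall>m\<in>keys p. mon_degree m = d)"

lemma homog_0 [simp]: "homog d 0"
  and homog_Cst [simp]: "homog 0 (Cst c)"
  and homog_1 [simp]: "homog 0 1"
  and homog_Var [simp]: "homog 1 (Var x)"
  by (auto simp: homog_def Cst_def Var_def mon_degree_eq_0 split: if_splits)

lemma homog_add: "homog d p \<Longrightarrow> homog d q \<Longrightarrow> homog d (p + q)"
  unfolding homog_def by (auto elim!: keys_add_elim)

lemma homog_mult: "homog d p \<Longrightarrow> homog e q \<Longrightarrow> homog (d + e) (p * q)"
  unfolding homog_def by (auto elim!: keys_mult_elim simp: mon_degree_add)

lemma homog_power: "homog d p \<Longrightarrow> homog (n * d) (p ^ n)"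
proof (induction n)
  case 0
  show ?case by simp
next
  case (Suc n)
  then show ?case using homog_mult[of d p "n * d" "p ^ n"] by simp
qed

lemma homog_sum: "(\<And>i. i \<in> A \<Longrightarrow> homog d (f i)) \<Longrightarrow> homog d (sum f A)"
  by (induction A rule: infinite_finite_induct) (auto intro: homog_add)

lemma homog_prod: "(\<And>i. i \<in> A \<Longrightarrow> homog (d i) (f i)) \<Longrightarrow> homog (sum d A) (prod f A)"
  by (induction A rule: infinite_finite_induct) (auto intro: homog_mult)

definition hcomp :: "nat \<Rightarrow> ('x, 'k::comm_ring_1) poly_over \<Rightarrow> ('x, 'k) poly_over" where
  "hcomp d p = Poly_Mapping.mapp (\<lambda>m c. c when mon_degree m = d) p"

lemma lookup_hcomp: "lookup (hcomp d p) m = (lookup p m when mon_degree m = d)"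
  by (auto simp: hcomp_def lookup_mapp when_def in_keys_iff)

lemma hcomp_add: "hcomp d (p + q) = hcomp d p + hcomp d q"
  by (rule poly_mapping_eqI) (auto simp: lookup_hcomp lookup_add when_def)

lemma hcomp_0 [simp]: "hcomp d 0 = 0"
  by (rule poly_mapping_eqI) (auto simp: lookup_hcomp)

lemma keys_hcomp: "keys (hcomp d p) = {m \<in> keys p. mon_degree m = d}"
  by (auto simp: in_keys_iff lookup_hcomp when_def split: if_splits)

lemma homog_hcomp [simp]: "homog d (hcomp d p)"
  by (auto simp: homog_def keys_hcomp)

lemma hcomp_homog: "homog e p \<Longrightarrow> hcomp d p = (if d = e then p else 0)"
  by (rule poly_mapping_eqI) (auto simp: lookup_hcomp homog_def when_def in_keys_iff)

lemma hcomp_in_polys_in: "p \<in> polys_in I \<Longrightarrow> hcomp d p \<in> polys_in I"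
  by (auto simp: polys_in_def keys_hcomp)

lemma sum_hcomp:
  assumes "\<And>m. m \<in> keys p \<Longrightarrow> mon_degree m \<le> n"
  shows "(\<Sum>d\<le>n. hcomp d p) = p"
proof (rule poly_mapping_eqI)
  fix m
  show "lookup (\<Sum>d\<le>n. hcomp d p) m = lookup p m"
    using assms[of m] by (cases "m \<in> keys p") (auto simp: lookup_sum lookup_hcomp when_def in_keys_iff)
qed

lemma hcomp_mult_homog:
  assumes "homog e q"
  shows "hcomp (d + e) (p * q) = hcomp d p * q"
proof (induction p rule: poly_induct)
  case (single m c)
  have "homog (mon_degree m) (single m c)" by (auto simp: homog_def split: if_splits)
  then show ?case
    using hcomp_homog[OF homog_mult[OF _ assms], of _ "single m c" "d + e"]
      hcomp_homog[of "mon_degree m" "single m c" d] by auto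
qed (simp add: hcomp_add distrib_right)

lemma hcomp_mult_homog_less:
  assumes "homog e q" "d < e"
  shows "hcomp d (p * q) = 0"
proof (induction p rule: poly_induct)
  case (single m c)
  have "homog (mon_degree m) (single m c)" by (auto simp: homog_def split: if_splits)
  then show ?case
    using hcomp_homog[OF homog_mult[OF _ assms(1)], of _ "single m c" d] assms(2) by auto
qed (simp add: hcomp_add distrib_right)

lemma hcomp_subst:
  assumes "p \<in> polys_in I" "\<And>x. x \<in> I \<Longrightarrow> homog 1 (h x)"
  shows "hcomp d (subst h p) = subst h (hcomp d p)"
  using assms(1)
proof (induction rule: polys_in_induct)
  case (single m c)
  have "homog (\<Sum>x\<in>keys m. lookup m x * 1) (meval h m)"
    unfolding meval_def using single assms(2) by (intro homog_prod homog_power) auto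
  then have "homog (0 + mon_degree m) (subst h (single m c))"
    unfolding subst_single by (intro homog_mult) (auto simp: mon_degree_def)
  then have "hcomp d (subst h (single m c)) = (if d = mon_degree m then subst h (single m c) else 0)"
    by (intro hcomp_homog) simp
  moreover have "homog (mon_degree m) (single m c)" by (auto simp: homog_def split: if_splits)
  then have "hcomp d (single m c) = (if d = mon_degree m then single m c else 0)"
    by (rule hcomp_homog)
  ultimately show ?case by simp
qed (simp add: hcomp_add subst_add)

section \<open>Degree in one variable and division by monic polynomials\<close>

definition deg_lt :: "'x \<Rightarrow> nat \<Rightarrow> ('x, 'k::comm_ring_1) poly_over set" where
  "deg_lt v n = {p. \<forall>m\<in>keys p. lookup m v < n}"

lemma deg_lt_0 [simp]: "0 \<in> deg_lt v n"
  by (simp add: deg_lt_def)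

lemma deg_lt_mono: "p \<in> deg_lt v n \<Longrightarrow> n \<le> n' \<Longrightarrow> p \<in> deg_lt v n'"
  by (force simp: deg_lt_def)

lemma deg_lt_add: "p \<in> deg_lt v n \<Longrightarrow> q \<in> deg_lt v n \<Longrightarrow> p + q \<in> deg_lt v n"
  unfolding deg_lt_def by (auto elim!: keys_add_elim)

lemma deg_lt_uminus: "p \<in> deg_lt v n \<Longrightarrow> - p \<in> deg_lt v n"
  unfolding deg_lt_def by (auto simp: in_keys_iff)

lemma deg_lt_diff: "p \<in> deg_lt v n \<Longrightarrow> q \<in> deg_lt v n \<Longrightarrow> p - q \<in> deg_lt v n"
  using deg_lt_add[OF _ deg_lt_uminus, of p v n q] by simp

lemma deg_lt_mult: "p \<in> deg_lt v (Suc a) \<Longrightarrow> q \<in> deg_lt v b \<Longrightarrow> p * q \<in> deg_lt v (a + b)"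
  unfolding deg_lt_def by (fastforce elim!: keys_mult_elim simp: lookup_add)

lemma deg_lt_1_mult: "p \<in> deg_lt v 1 \<Longrightarrow> q \<in> deg_lt v b \<Longrightarrow> p * q \<in> deg_lt v b"
  using deg_lt_mult[of p v 0 q b] by simp

lemma deg_lt_Cst [simp]: "0 < n \<Longrightarrow> Cst c \<in> deg_lt v n"
  by (auto simp: deg_lt_def Cst_def split: if_splits)

lemma deg_lt_one [simp]: "0 < n \<Longrightarrow> 1 \<in> deg_lt v n"
  using deg_lt_Cst[of n 1 v] by simp

lemma deg_lt_Var: "x \<noteq> v \<Longrightarrow> Var x \<in> deg_lt v 1"
  by (auto simp: deg_lt_def Var_def lookup_single split: if_splits)

lemma deg_lt_Var_power: "Var v ^ n \<in> deg_lt v (Suc n)"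
  by (auto simp: deg_lt_def Var_power split: if_splits)

lemma deg_lt_1_power: "p \<in> deg_lt v 1 \<Longrightarrow> p ^ n \<in> deg_lt v 1"
  by (induction n) (auto intro: deg_lt_1_mult)

lemma deg_lt_1_prod: "(\<And>i. i \<in> A \<Longrightarrow> f i \<in> deg_lt v 1) \<Longrightarrow> prod f A \<in> deg_lt v 1"
  by (induction A rule: infinite_finite_induct) (auto intro: deg_lt_1_mult)

lemma exists_deg_lt: "\<exists>n. p \<in> deg_lt v n"
proof
  show "p \<in> deg_lt v (Suc (\<Sum>m\<in>keys p. lookup m v))"
    unfolding deg_lt_def by (auto intro!: le_imp_less_Suc member_le_sum)
qed

text \<open>Splits off the coefficient of the highest power of v. The last clause records that no
  new variables appear, so division stays inside each \<open>polys_in I\<close>.\<close>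

lemma deg_lt_top:
  fixes p :: "('x, 'k::field) poly_over"
  assumes "p \<in> deg_lt v (Suc n)"
  shows "\<exists>a b. p = Var v ^ n * a + b \<and> a \<in> deg_lt v 1 \<and> b \<in> deg_lt v n \<and>
    (\<forall>I. p \<in> polys_in I \<longrightarrow> a \<in> polys_in I \<and> b \<in> polys_in I)"
proof -
  let ?R = "\<lambda>q :: ('x, 'k) poly_over. \<exists>a b. q = Var v ^ n * a + b \<and> a \<in> deg_lt v 1 \<and> b \<in> deg_lt v n \<and>
    (\<forall>I. p \<in> polys_in I \<longrightarrow> a \<in> polys_in I \<and> b \<in> polys_in I)"
  show ?thesis
  proof (rule poly_keys_induct[of ?R p])
    show "?R 0" by (intro exI[of _ 0]) auto
  next
    fix m c assume m: "m \<in> keys p"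
    have m_in: "keys m \<subseteq> I" if "p \<in> polys_in I" for I
      using that m by (auto simp: polys_in_def)
    show "?R (single m c)"
    proof (cases "lookup m v = n")
      case False
      then have "lookup m v < n" using assms m by (auto simp: deg_lt_def less_Suc_eq)
      then show ?thesis
        using m_in by (intro exI[of _ 0] exI[of _ "single m c"]) (auto simp: deg_lt_def polys_in_def split: if_splits)
    next
      case True
      define m' where "m' = m - single v n"
      have m': "m = single v n + m'"
        unfolding m'_def by (rule poly_mapping_eqI) (auto simp: lookup_add lookup_minus lookup_single when_def True)
      have "lookup m' v = 0" using True by (simp add: m' lookup_add)
      moreover have "keys m' \<subseteq> keys m" by (simp add: m' keys_add_nat)
      moreover have "single m c = Var v ^ n * single m' c"
        by (simp add: m' Var_power mult_single)
      ultimately show ?thesis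
        using m_in by (intro exI[of _ "single m' c"] exI[of _ 0]) (auto simp: deg_lt_def polys_in_def split: if_splits)
    qed
  next
    fix q r assume "?R q" "?R r"
    then obtain a b a' b' where *: "q = Var v ^ n * a + b" "a \<in> deg_lt v 1" "b \<in> deg_lt v n"
       "r = Var v ^ n * a' + b'" "a' \<in> deg_lt v 1" "b' \<in> deg_lt v n"
       "\<forall>I. p \<in> polys_in I \<longrightarrow> a \<in> polys_in I \<and> b \<in> polys_in I"
       "\<forall>I. p \<in> polys_in I \<longrightarrow> a' \<in> polys_in I \<and> b' \<in> polys_in I" by metis
    then show "?R (q + r)"
      by (intro exI[of _ "a + a'"] exI[of _ "b + b'"])
        (auto simp: distrib_left intro: deg_lt_add polys_in.add_closed)
  qed
qed

lemma deg_lt_top_eq_0: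
  fixes a :: "('x, 'k::field) poly_over"
  assumes "Var v ^ n * a \<in> deg_lt v n"
  shows "a = 0"
proof (rule poly_mapping_eqI, rule ccontr)
  fix m assume "lookup a m \<noteq> lookup 0 m"
  then have "single v n + m \<in> keys (Var v ^ n * a)"
    by (simp add: in_keys_iff Var_power lookup_single_times)
  then show False
    using assms by (auto simp: deg_lt_def lookup_add)
qed

lemma monic_division:
  fixes p :: "('x, 'k::field) poly_over"
  assumes "r \<in> deg_lt v n"
  shows "\<exists>q. p - (Var v ^ n + r) * q \<in> deg_lt v n \<and>
     (\<forall>I. v \<in> I \<longrightarrow> r \<in> polys_in I \<longrightarrow> p \<in> polys_in I \<longrightarrow> q \<in> polys_in I)"
proof -
  let ?R = "\<lambda>p q. p - (Var v ^ n + r) * q \<in> deg_lt v n \<and>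
     (\<forall>I. v \<in> I \<longrightarrow> r \<in> polys_in I \<longrightarrow> p \<in> polys_in I \<longrightarrow> q \<in> polys_in I)"
  have "\<exists>q. ?R p q" if "p \<in> deg_lt v k" for k and p :: "('x, 'k) poly_over"
    using that
  proof (induction k arbitrary: p)
    case 0
    then have "keys p = {}" by (auto simp: deg_lt_def)
    then have "p = 0" by simp
    then show ?case by (intro exI[of _ 0]) auto
  next
    case (Suc k)
    show ?case
    proof (cases "k < n")
      case True
      then show ?thesis
        using deg_lt_mono[OF Suc.prems, of n] by (intro exI[of _ 0]) auto
    next
      case False
      obtain a b where ab: "p = Var v ^ k * a + b" "a \<in> deg_lt v 1" "b \<in> deg_lt v k"
        "\<And>I. p \<in> polys_in I \<Longrightarrow> a \<in> polys_in I \<and> b \<in> polys_in I"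
        using deg_lt_top[OF Suc.prems] by metis
      \<comment> \<open>The leading term of p in v is removed by this multiple of the divisor; the
        remainder has smaller degree in v.\<close>
      define q0 where "q0 = Var v ^ (k - n) * a"
      have k: "Var v ^ k = Var v ^ n * (Var v ^ (k - n) :: ('x, 'k) poly_over)"
        using False by (simp flip: power_add)
      have "Var v ^ (k - n) * r \<in> deg_lt v ((k - n) + n)"
        by (rule deg_lt_mult[OF deg_lt_Var_power assms])
      then have "a * (Var v ^ (k - n) * r) \<in> deg_lt v k"
        using deg_lt_1_mult[OF ab(2)] False by simp
      then have "r * q0 \<in> deg_lt v k"
        by (simp add: q0_def ac_simps)
      then have "b - r * q0 \<in> deg_lt v k"
        using ab(3) by (intro deg_lt_diff)
      then obtain q1 where q1: "?R (b - r * q0) q1"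
        using Suc.IH by blast
      have "p - (Var v ^ n + r) * (q0 + q1) = (b - r * q0) - (Var v ^ n + r) * q1"
        unfolding ab(1) k by (simp add: q0_def algebra_simps)
      moreover have "q0 + q1 \<in> polys_in I" if "v \<in> I" "r \<in> polys_in I" "p \<in> polys_in I" for I
      proof -
        have "q0 \<in> polys_in I" unfolding q0_def using that ab(4) by auto
        moreover have "b - r * q0 \<in> polys_in I" using that ab(4) \<open>q0 \<in> _\<close> by auto
        ultimately show ?thesis using q1 that by auto
      qed
      ultimately show ?thesis
        using q1 by (intro exI[of _ "q0 + q1"]) auto
    qed
  qed
  moreover obtain k where "p \<in> deg_lt v k" using exists_deg_lt[of p v] by blast
  ultimately show ?thesis by blast
qed

text \<open>The top coefficient of a nonzero q in v reappears in the product, n degrees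
  higher.\<close>

lemma monic_division_unique:
  fixes q :: "('x, 'k::field) poly_over"
  assumes "r \<in> deg_lt v n" "(Var v ^ n + r) * q \<in> deg_lt v n"
  shows "q = 0"
proof (rule ccontr)
  assume "q \<noteq> 0"
  define e where "e = (LEAST e. q \<in> deg_lt v e)"
  have e: "q \<in> deg_lt v e"
    unfolding e_def using exists_deg_lt[of q v] by (rule LeastI_ex)
  have "e \<noteq> 0"
  proof
    assume "e = 0"
    with e have "keys q = {}" by (auto simp: deg_lt_def)
    with \<open>q \<noteq> 0\<close> show False by simp
  qed
  then obtain k where k: "e = Suc k" by (cases e) auto
  obtain a b where ab: "q = Var v ^ k * a + b" "a \<in> deg_lt v 1" "b \<in> deg_lt v k"
    using deg_lt_top[of q v k] e k by metis
  have "Var v ^ n * b \<in> deg_lt v (n + k)"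
    by (rule deg_lt_mult[OF deg_lt_Var_power ab(3)])
  moreover have "q * r \<in> deg_lt v (k + n)"
    using e assms(1) unfolding k by (rule deg_lt_mult)
  moreover have "(Var v ^ n + r) * q \<in> deg_lt v (n + k)"
    using assms(2) by (rule deg_lt_mono) simp
  moreover have "Var v ^ (n + k) * a = (Var v ^ n + r) * q - Var v ^ n * b - q * r"
    unfolding ab(1) by (simp add: power_add algebra_simps)
  ultimately have "Var v ^ (n + k) * a \<in> deg_lt v (n + k)"
    by (simp add: deg_lt_diff add.commute)
  then have "a = 0" by (rule deg_lt_top_eq_0)
  then have "q \<in> deg_lt v k" using ab by simp
  then have "e \<le> k" unfolding e_def by (rule Least_le)
  with k show False by simp
qed

text \<open>Characterised by uniqueness, so additivity and compatibility with the group follow by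
  merely exhibiting a candidate quotient.\<close>

definition quot :: "'x \<Rightarrow> nat \<Rightarrow> ('x, 'k::field) poly_over \<Rightarrow> ('x, 'k) poly_over \<Rightarrow> ('x, 'k) poly_over" where
  "quot v n N p = (THE q. p - N * q \<in> deg_lt v n)"

lemma quot_unique:
  assumes "N - Var v ^ n \<in> deg_lt v n" "p - N * q \<in> deg_lt v n"
  shows "quot v n N p = q"
  unfolding quot_def
proof (rule the_equality)
  show "p - N * q \<in> deg_lt v n" by (rule assms(2))
next
  fix q' assume "p - N * q' \<in> deg_lt v n"
  then have "(p - N * q') - (p - N * q) \<in> deg_lt v n"
    using assms(2) by (rule deg_lt_diff)
  then have "(Var v ^ n + (N - Var v ^ n)) * (q - q') \<in> deg_lt v n"
    by (simp add: algebra_simps)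
  then show "q' = q" using monic_division_unique[OF assms(1)] by fastforce
qed

lemma quot_rem:
  assumes "N - Var v ^ n \<in> deg_lt v n"
  shows "p - N * quot v n N p \<in> deg_lt v n"
    and "v \<in> I \<Longrightarrow> N \<in> polys_in I \<Longrightarrow> p \<in> polys_in I \<Longrightarrow> quot v n N p \<in> polys_in I"
proof -
  obtain q where q: "p - (Var v ^ n + (N - Var v ^ n)) * q \<in> deg_lt v n"
    "\<And>I. v \<in> I \<Longrightarrow> N - Var v ^ n \<in> polys_in I \<Longrightarrow> p \<in> polys_in I \<Longrightarrow> q \<in> polys_in I"
    using monic_division[OF assms, of p] by metis
  have "quot v n N p = q" using q(1) by (intro quot_unique[OF assms]) simp
  then show "p - N * quot v n N p \<in> deg_lt v n"
    "v \<in> I \<Longrightarrow> N \<in> polys_in I \<Longrightarrow> p \<in> polys_in I \<Longrightarrow> quot v n N p \<in> polys_in I"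
    using q by auto
qed

section \<open>Finiteness of invariants\<close>

lemma nat_seq_mono_subseq:
  fixes s :: "nat \<Rightarrow> nat"
  shows "\<exists>f. strict_mono f \<and> incseq (s \<circ> f)"
proof -
  obtain f where f: "strict_mono f" "monoseq (s \<circ> f)"
    using seq_monosub[of s] unfolding comp_def by blast
  show ?thesis
  proof (cases "incseq (s \<circ> f)")
    case False
    then have dec: "decseq (s \<circ> f)" using f(2) by (simp add: monoseq_iff)
    \<comment> \<open>A decreasing sequence of natural numbers attains its minimum and is constant
      from there on, hence increasing in the weak sense.\<close>
    define n where "n = (LEAST k. k \<in> range (s \<circ> f))"
    have "n \<in> range (s \<circ> f)" unfolding n_def by (rule LeastI[of _ "(s \<circ> f) 0"]) simp
    then obtain k where k: "n = (s \<circ> f) k" by blast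
    have "(s \<circ> f) i = n" if "i \<ge> k" for i
    proof (rule antisym)
      show "(s \<circ> f) i \<le> n" using decseqD[OF dec that] k by simp
      show "n \<le> (s \<circ> f) i" unfolding n_def by (rule Least_le) simp
    qed
    then have "incseq (s \<circ> (\<lambda>i. f (i + k)))"
      by (simp add: incseq_def)
    moreover have "strict_mono (\<lambda>i. f (i + k))"
      using f(1) by (simp add: strict_mono_def)
    ultimately show ?thesis by blast
  qed (use f in blast)
qed

lemma dickson_subseq:
  fixes s :: "nat \<Rightarrow> 'a" and fs :: "('a \<Rightarrow> nat) list"
  shows "\<exists>f. strict_mono f \<and> (\<forall>h\<in>set fs. incseq (h \<circ> s \<circ> f))"
proof (induction fs)
  case Nil
  show ?case by (intro exI[of _ id]) (auto simp: strict_mono_def)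
next
  case (Cons h fs)
  then obtain f where f: "strict_mono f" "\<And>h. h \<in> set fs \<Longrightarrow> incseq (h \<circ> s \<circ> f)" by blast
  obtain g where g: "strict_mono g" "incseq ((h \<circ> s \<circ> f) \<circ> g)"
    using nat_seq_mono_subseq by blast
  have "incseq (h' \<circ> s \<circ> (f \<circ> g))" if "h' \<in> set (h # fs)" for h'
  proof (cases "h' = h")
    case True
    then show ?thesis using g(2) by (simp add: o_assoc)
  next
    case False
    then have "incseq (h' \<circ> s \<circ> f)" using that f(2) by simp
    moreover have "mono g" using g(1) by (rule strict_mono_mono)
    ultimately show ?thesis by (simp add: mono_def incseq_def)
  qed
  moreover have "strict_mono (f \<circ> g)"
    using f(1) g(1) by (simp add: strict_mono_def)
  ultimately show ?case by blast
qed

text \<open>Stated for arbitrary functions instead of exponents, because the application also has to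
  control exponents modulo a number.\<close>

lemma dickson:
  fixes s :: "nat \<Rightarrow> 'a" and fs :: "('a \<Rightarrow> nat) list"
  shows "\<exists>i j. i < j \<and> (\<forall>h\<in>set fs. h (s i) \<le> h (s j))"
proof -
  obtain f where f: "strict_mono f" "\<And>h. h \<in> set fs \<Longrightarrow> incseq (h \<circ> s \<circ> f)"
    using dickson_subseq[of fs s] by blast
  have "f 0 < f 1" using f(1) by (simp add: strict_mono_def)
  moreover have "h (s (f 0)) \<le> h (s (f 1))" if "h \<in> set fs" for h
    using f(2)[OF that] by (auto simp: incseq_def)
  ultimately show ?thesis by blast
qed

section \<open>The lexicographic order and leading monomials\<close>

definition mlex :: "'x list \<Rightarrow> (('x \<Rightarrow>\<^sub>0 nat) \<times> ('x \<Rightarrow>\<^sub>0 nat)) set" where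
  "mlex vs = measures (map (\<lambda>v m. lookup m v) vs)"

lemma wf_mlex: "wf (mlex vs)"
  unfolding mlex_def by simp

lemma mlex_irrefl: "(a, a) \<notin> mlex vs"
  using wf_mlex[of vs] by (meson wf_not_refl)

lemma mlex_add: "(a, b) \<in> mlex vs \<Longrightarrow> (a + c, b + c) \<in> mlex vs"
  by (induction vs) (auto simp: mlex_def lookup_add)

lemma mlex_trans: "(a, b) \<in> mlex vs \<Longrightarrow> (b, c) \<in> mlex vs \<Longrightarrow> (a, c) \<in> mlex vs"
  by (induction vs) (auto simp: mlex_def)

lemma mlex_total: "(\<exists>v\<in>set vs. lookup a v \<noteq> lookup b v) \<Longrightarrow> (a, b) \<in> mlex vs \<or> (b, a) \<in> mlex vs"
  by (induction vs) (auto simp: mlex_def)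

definition lead :: "'x list \<Rightarrow> ('x, 'k::comm_ring_1) poly_over \<Rightarrow> ('x \<Rightarrow>\<^sub>0 nat) \<Rightarrow> bool" where
  "lead vs p m \<longleftrightarrow> m \<in> keys p \<and> (\<forall>m'\<in>keys p. m' \<noteq> m \<longrightarrow> (m', m) \<in> mlex vs)"

lemma lead_exists:
  assumes "p \<noteq> 0" "p \<in> polys_in (set vs)"
  shows "\<exists>m. lead vs p m"
proof -
  have "\<exists>m\<in>A. \<forall>m'\<in>A. m' \<noteq> m \<longrightarrow> (m', m) \<in> mlex vs" if "finite A" "A \<noteq> {}" "A \<subseteq> keys p" for A
    using that
  proof (induction A rule: finite_ne_induct)
    case (insert x F)
    then obtain m where m: "m \<in> F" "\<And>m'. m' \<in> F \<Longrightarrow> m' \<noteq> m \<Longrightarrow> (m', m) \<in> mlex vs" by auto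
    have "x \<noteq> m" using insert m by auto
    then obtain v where v: "lookup x v \<noteq> lookup m v" using poly_mapping_eqI[of x m] by blast
    have "v \<in> keys x \<union> keys m" using v by (auto simp: in_keys_iff)
    then have "v \<in> set vs" using assms(2) insert m by (auto simp: polys_in_def)
    then have "(x, m) \<in> mlex vs \<or> (m, x) \<in> mlex vs" using v by (intro mlex_total) auto
    then show ?case
    proof
      assume "(m, x) \<in> mlex vs"
      then show ?thesis using m mlex_trans by (intro bexI[of _ x]) blast+
    qed (use m in blast)
  qed auto
  from this[OF finite_keys _ order_refl] show ?thesis
    using assms(1) unfolding lead_def by auto
qed

lemma lead_single: "c \<noteq> 0 \<Longrightarrow> lead vs (single m c) m"
  by (auto simp: lead_def)

text \<open>Splitting off the leading terms leaves a remainder whose monomials are all smaller,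
  since the order is compatible with addition; over a field the product of the leading coefficients
  is nonzero.\<close>

lemma lead_mult:
  fixes p q :: "('x, 'k::field) poly_over"
  assumes "lead vs p a" "lead vs q b"
  shows "lead vs (p * q) (a + b)"
proof -
  define p' where "p' = p - single a (lookup p a)"
  define q' where "q' = q - single b (lookup q b)"
  have p: "p = single a (lookup p a) + p'" and q: "q = single b (lookup q b) + q'"
    unfolding p'_def q'_def by auto
  have p': "(m, a) \<in> mlex vs" if "m \<in> keys p'" for m
    using that assms(1) unfolding p'_def lead_def
    by (auto simp: in_keys_iff lookup_minus lookup_single when_def split: if_splits)
  have q': "(m, b) \<in> mlex vs" if "m \<in> keys q'" for m
    using that assms(2) unfolding q'_def lead_def
    by (auto simp: in_keys_iff lookup_minus lookup_single when_def split: if_splits)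
  define r where "r = single a (lookup p a) * q' + p' * q"
  have r: "(m, a + b) \<in> mlex vs" if "m \<in> keys r" for m
  proof -
    have "m \<in> keys (single a (lookup p a) * q') \<or> m \<in> keys (p' * q)"
      using that Poly_Mapping.keys_add[of "single a (lookup p a) * q'" "p' * q"] unfolding r_def by blast
    then show ?thesis
    proof
      assume "m \<in> keys (single a (lookup p a) * q')"
      then obtain x y where "x \<in> keys (single a (lookup p a))" "y \<in> keys q'" "m = x + y"
        by (rule keys_mult_elim) blast
      then show ?thesis
        using mlex_add[OF q'[of y], of a] by (auto simp: add.commute split: if_splits)
    next
      assume "m \<in> keys (p' * q)"
      then obtain x y where *: "x \<in> keys p'" "y \<in> keys q" "m = x + y"
        by (rule keys_mult_elim) blast
      have 1: "(x + y, a + y) \<in> mlex vs" by (rule mlex_add[OF p'[OF *(1)]])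
      show ?thesis
      proof (cases "y = b")
        case False
        then have "(y + a, b + a) \<in> mlex vs" using *(2) assms(2) unfolding lead_def by (intro mlex_add) auto
        then show ?thesis using 1 *(3) mlex_trans by (metis add.commute)
      qed (use 1 * in simp)
    qed
  qed
  have "p * q = single (a + b) (lookup p a * lookup q b) + r"
    by (subst (1) p, subst (1) q) (simp add: r_def mult_single algebra_simps q'_def)
  moreover have "a + b \<notin> keys r" using r mlex_irrefl by blast
  moreover have "lookup p a \<noteq> 0" "lookup q b \<noteq> 0"
    using assms unfolding lead_def by (auto simp: in_keys_iff)
  ultimately have "a + b \<in> keys (p * q)" "keys (p * q) \<subseteq> insert (a + b) (keys r)"
    using Poly_Mapping.keys_add[of "single (a + b) (lookup p a * lookup q b)" r]
    by (auto simp: in_keys_iff lookup_add)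
  then show ?thesis
    using r unfolding lead_def by blast
qed

lemma lead_1 [simp]: "lead vs 1 0"
  by (auto simp: lead_def)

lemma lead_power: "lead vs p a \<Longrightarrow> lead vs (p ^ n) (\<Sum>i<n. a)" for p :: "('x, 'k::field) poly_over"
proof (induction n)
  case (Suc n)
  then show ?case using lead_mult[of vs "p ^ n" "\<Sum>i<n. a" p a] by (simp add: mult.commute)
qed simp

lemma lead_prod:
  fixes f :: "'i \<Rightarrow> ('x, 'k::field) poly_over"
  shows "(\<And>i. i \<in> A \<Longrightarrow> lead vs (f i) (d i)) \<Longrightarrow> lead vs (prod f A) (sum d A)"
  by (induction A rule: infinite_finite_induct) (auto intro: lead_mult)

lemma lead_cancel:
  fixes p q :: "('x, 'k::field) poly_over"
  assumes "lead vs p m" "lead vs q m" "q - Cst (lookup q m / lookup p m) * p \<noteq> 0"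
    "m' \<in> keys (q - Cst (lookup q m / lookup p m) * p)"
  shows "(m', m) \<in> mlex vs"
proof -
  have "lookup p m \<noteq> 0" using assms(1) by (auto simp: lead_def in_keys_iff)
  then have "m' \<noteq> m" using assms(4) by (auto simp: in_keys_iff lookup_minus lookup_Cst_times)
  moreover have "m' \<in> keys q \<or> m' \<in> keys p"
    using assms(4) by (auto simp: in_keys_iff lookup_minus lookup_Cst_times)
  ultimately show ?thesis using assms(1,2) unfolding lead_def by blast
qed

section \<open>Modules over an algebra whose generators have pure-power leading monomials\<close>

abbreviation pspan :: "('x, 'k::field) poly_over set \<Rightarrow> ('x, 'k) poly_over set \<Rightarrow> ('x, 'k) poly_over set" where
  "pspan \<equiv> polys_in.fspan {0}"

lemma pspan_0: "0 \<in> pspan G H"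
  by (rule polys_in.fspan.base) simp

lemma pspan_power: "x \<in> pspan G H \<Longrightarrow> g \<in> G \<Longrightarrow> g ^ n * x \<in> pspan G H"
  by (induction n) (auto simp: mult.assoc intro: polys_in.fspan.mult)

lemma pspan_prod: "x \<in> pspan G H \<Longrightarrow> (\<And>i. i \<in> A \<Longrightarrow> g i \<in> G) \<Longrightarrow> (\<Prod>i\<in>A. g i ^ n i) * x \<in> pspan G H"
  by (induction A arbitrary: x rule: infinite_finite_induct) (auto simp: mult.assoc intro: pspan_power)

text \<open>The Groebner basis proof of Hilbert's basis theorem, for modules over the subalgebra generated by
  polynomials \<open>g v\<close> whose leading monomials are powers of the variables \<open>v\<close>.\<close>

lemma pspan_seq:
  fixes g :: "'x \<Rightarrow> ('x, 'k::field) poly_over" and a :: "nat \<Rightarrow> ('x, 'k) poly_over"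
  assumes I: "set vs = I" and g: "\<And>v. v \<in> I \<Longrightarrow> g v \<in> polys_in I"
    "\<And>v. v \<in> I \<Longrightarrow> lead vs (g v) (single v (n v))" "\<And>v. v \<in> I \<Longrightarrow> 0 < n v"
    and a: "\<And>i. a i \<in> polys_in I"
  shows "\<exists>k. a k \<in> pspan (g ` I) (a ` {..<k})"
proof (rule ccontr)
  define L where "L k = pspan (g ` I) (a ` {..<k})" for k
  assume "\<not> ?thesis"
  then have not_in: "a k \<notin> L k" for k unfolding L_def by blast
  have L0: "0 \<in> L k" for k unfolding L_def by (rule pspan_0)
  have L_in: "x \<in> polys_in I" if "x \<in> L k" for x k
    using that g(1) a unfolding L_def by (intro polys_in.fspan_closed[of x "{0}" "g ` I" "a ` {..<k}"]) auto
  have L_diff: "x - y \<in> L k" if "x \<in> L k" "y \<in> L k" for x y k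
    using that unfolding L_def by (rule polys_in.fspan_diff)
  have L_add: "x + y \<in> L k" if "x \<in> L k" "y \<in> L k" for x y k
    using that unfolding L_def by (rule polys_in.fspan.add)
  have L_mono: "x \<in> L j" if "x \<in> L i" "i \<le> j" for x i j
    using that unfolding L_def by (intro polys_in.fspan_mono[OF that(1)[unfolded L_def]]) auto
  \<comment> \<open>In each coset a_k + L_k choose a representative whose leading monomial is least
    possible.\<close>
  have "\<exists>b m. b - a k \<in> L k \<and> lead vs b m \<and> (\<forall>b' m'. b' - a k \<in> L k \<longrightarrow> lead vs b' m' \<longrightarrow> (m', m) \<notin> mlex vs)" for k
  proof -
    define Q where "Q = {m. \<exists>b. b - a k \<in> L k \<and> lead vs b m}"
    have "a k \<noteq> 0" using not_in[of k] L0[of k] by metis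
    then obtain m where "lead vs (a k) m" using lead_exists a I by blast
    then have "m \<in> Q" using L0[of k] unfolding Q_def by (intro CollectI exI[of _ "a k"]) simp
    then obtain m0 where m0: "m0 \<in> Q" "\<And>m'. (m', m0) \<in> mlex vs \<Longrightarrow> m' \<notin> Q"
      using wfE_min[OF wf_mlex[of vs]] by metis
    then show ?thesis unfolding Q_def by blast
  qed
  then obtain b m where bm: "\<And>k. b k - a k \<in> L k" "\<And>k. lead vs (b k) (m k)"
    "\<And>k b' m'. b' - a k \<in> L k \<Longrightarrow> lead vs b' m' \<Longrightarrow> (m', m k) \<notin> mlex vs"
    by metis
  have b_in: "b k \<in> polys_in I" for k
    using polys_in.add_closed[OF L_in[OF bm(1)] a, of k k] by simp
  have keys_m: "keys (m k) \<subseteq> I" for k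
    using b_in[of k] bm(2)[of k] unfolding lead_def polys_in_def by blast
  \<comment> \<open>Comparing both the residue and \<open>n v\<close> minus the residue forces equal
    residues, so for i < j not only are the exponents of m_i at most those of m_j, but the
    differences are divisible by \<open>n v\<close>.\<close>
  define fs where "fs = concat (map (\<lambda>v. [\<lambda>m. lookup m v, \<lambda>m. lookup m v mod n v, \<lambda>m. n v - lookup m v mod n v]) vs)"
  obtain i j where ij: "i < j" "\<forall>h\<in>set fs. h (m i) \<le> h (m j)"
    using dickson[where s = m and fs = fs] by (elim exE conjE) (rule that)
  have le: "lookup (m i) v \<le> lookup (m j) v" "lookup (m i) v mod n v = lookup (m j) v mod n v" if "v \<in> I" for v
  proof -
    have *: "h (m i) \<le> h (m j)" if "h \<in> {\<lambda>m. lookup m v, \<lambda>m. lookup m v mod n v, \<lambda>m. n v - lookup m v mod n v}" for h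
      using ij(2) that \<open>v \<in> I\<close> I unfolding fs_def by auto
    show "lookup (m i) v \<le> lookup (m j) v"
      using *[of "\<lambda>m. lookup m v"] by simp
    have "lookup (m i) v mod n v \<le> lookup (m j) v mod n v"
      using *[of "\<lambda>m. lookup m v mod n v"] by simp
    moreover have "n v - lookup (m i) v mod n v \<le> n v - lookup (m j) v mod n v"
      using *[of "\<lambda>m. n v - lookup m v mod n v"] by simp
    moreover have "lookup (m j) v mod n v < n v" using g(3)[OF that] by simp
    ultimately show "lookup (m i) v mod n v = lookup (m j) v mod n v" by linarith
  qed
  define d where "d v = (lookup (m j) v - lookup (m i) v) div n v" for v
  have d: "lookup (m i) v + d v * n v = lookup (m j) v" if "v \<in> I" for v
  proof -
    have "n v dvd lookup (m j) v - lookup (m i) v"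
      using le[OF that] by (metis mod_eq_dvd_iff_nat)
    then show ?thesis unfolding d_def using le(1)[OF that] by simp
  qed
  \<comment> \<open>The leading monomial of this product of the \<open>g v\<close> is m_j - m_i, so
    \<open>p * b i\<close> lies in \<open>L j\<close> and has the same leading monomial as
    \<open>b j\<close>. Subtracting a multiple lowers it within the coset, against
    minimality.\<close>
  define p where "p = (\<Prod>v\<in>I. g v ^ d v)"
  have "lead vs p (\<Sum>v\<in>I. \<Sum>i<d v. single v (n v))"
    unfolding p_def by (intro lead_prod lead_power g(2))
  then have "lead vs (p * b i) ((\<Sum>v\<in>I. \<Sum>i<d v. single v (n v)) + m i)"
    using bm(2) by (rule lead_mult)
  also have "(\<Sum>v\<in>I. \<Sum>i<d v. single v (n v)) + m i = m j"
  proof (rule poly_mapping_eqI)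
    fix x
    have "finite I" using I by auto
    have "lookup (\<Sum>v\<in>I. \<Sum>i<d v. single v (n v)) x = (\<Sum>v\<in>I. if v = x then d v * n v else 0)"
      unfolding lookup_sum by (intro sum.cong) (auto simp: lookup_single when_def)
    also have "\<dots> = (if x \<in> I then d x * n x else 0)"
      using \<open>finite I\<close> by simp
    finally have *: "lookup (\<Sum>v\<in>I. \<Sum>i<d v. single v (n v)) x = (if x \<in> I then d x * n x else 0)" .
    show "lookup ((\<Sum>v\<in>I. \<Sum>i<d v. single v (n v)) + m i) x = lookup (m j) x"
    proof (cases "x \<in> I")
      case False
      then have "x \<notin> keys (m i)" "x \<notin> keys (m j)" using keys_m by auto
      then have "lookup (m i) x = 0" "lookup (m j) x = 0" by (simp_all add: in_keys_iff)
      with False * show ?thesis by (simp add: lookup_add)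
    qed (use d[of x] * in \<open>simp add: lookup_add\<close>)
  qed
  finally have lead: "lead vs (p * b i) (m j)" .
  define b' where "b' = b j - Cst (lookup (b j) (m j) / lookup (p * b i) (m j)) * (p * b i)"
  have "b i - a i \<in> L j" using bm(1) L_mono ij(1) by (meson less_imp_le)
  moreover have "a i \<in> L j" unfolding L_def using ij(1) by (intro polys_in.fspan.gen) auto
  ultimately have "b i \<in> L j" using L_add[of "b i - a i" j "a i"] by simp
  then have "p * b i \<in> L j" unfolding p_def L_def by (intro pspan_prod) auto
  then have "Cst (lookup (b j) (m j) / lookup (p * b i) (m j)) * (p * b i) \<in> L j"
    unfolding L_def by (rule polys_in.fspan.cst)
  from L_diff[OF bm(1)[of j] this] have b': "b' - a j \<in> L j"
    unfolding b'_def by (simp add: algebra_simps)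
  have "b' \<noteq> 0"
  proof
    assume "b' = 0"
    then have "a j \<in> L j" using L_diff[OF L0 b'] by simp
    with not_in show False by blast
  qed
  moreover have "b' \<in> polys_in I"
    using polys_in.add_closed[OF L_in[OF b'] a, of j] by simp
  ultimately obtain m' where m': "lead vs b' m'" using lead_exists I by blast
  then have "(m', m j) \<in> mlex vs"
    using lead_cancel[OF lead bm(2)] \<open>b' \<noteq> 0\<close> unfolding lead_def b'_def by blast
  with bm(3)[OF b' m'] show False by blast
qed

context comm_algebra
begin

lemma fspan_sum_form:
  assumes "x \<in> fspan {0} G (a ` {..<n::nat})" "G \<subseteq> C"
  shows "\<exists>c. (\<forall>i<n. c i \<in> C) \<and> x = (\<Sum>i<n. c i * a i)"
  using assms(1)
proof (induction rule: fspan.induct)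
  case (base t)
  then show ?case by (intro exI[of _ "\<lambda>_. 0"]) auto
next
  case (gen h)
  then obtain i where i: "i < n" "h = a i" by auto
  have "(\<Sum>j<n. (if j = i then 1 else 0) * a j) = (\<Sum>j<n. if j = i then a j else 0)"
    by (intro sum.cong) auto
  then show ?case using i by (intro exI[of _ "\<lambda>j. if j = i then 1 else 0"]) auto
next
  case (cst x b)
  then obtain c where "\<And>i. i < n \<Longrightarrow> c i \<in> C" "x = (\<Sum>i<n. c i * a i)" by blast
  then show ?case by (intro exI[of _ "\<lambda>i. cst b * c i"]) (auto simp: sum_distrib_left mult.assoc)
next
  case (mult x f)
  then obtain c where "\<And>i. i < n \<Longrightarrow> c i \<in> C" "x = (\<Sum>i<n. c i * a i)" by blast
  then show ?case using mult(2) assms(2)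
    by (intro exI[of _ "\<lambda>i. f * c i"]) (auto simp: sum_distrib_left mult.assoc)
next
  case (add x y)
  then obtain c c' where "\<And>i. i < n \<Longrightarrow> c i \<in> C" "x = (\<Sum>i<n. c i * a i)"
    "\<And>i. i < n \<Longrightarrow> c' i \<in> C" "y = (\<Sum>i<n. c' i * a i)" by blast
  then show ?case by (intro exI[of _ "\<lambda>i. c i + c' i"]) (auto simp: sum.distrib distrib_right)
qed

text \<open>Coefficients that are polynomials in elements of \<open>G\<close> lie in
  \<open>C\<close>, so a combination over the smaller algebra is one over \<open>C\<close>.\<close>

lemma noetherian_of_seq:
  assumes "G \<subseteq> C" "\<And>a. (\<And>i::nat. a i \<in> C) \<Longrightarrow> \<exists>k. a k \<in> fspan {0} G (a ` {..<k})"
  shows noetherian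
  unfolding noetherian_def
proof (intro allI impI)
  fix a :: "nat \<Rightarrow> 'a" assume a: "range a \<subseteq> C"
  then obtain k where "a k \<in> fspan {0} G (a ` {..<k})" using assms(2)[of a] by auto
  from fspan_sum_form[OF this assms(1)]
  show "\<exists>n c. (\<forall>i<n. c i \<in> C) \<and> a n = (\<Sum>i<n. c i * a i)" by blast
qed

text \<open>Otherwise one could go on choosing an element of \<open>C\<close> outside the span of
  the earlier ones.\<close>

lemma finite_generation_of_seq:
  assumes "\<And>a. (\<And>i::nat. a i \<in> C) \<Longrightarrow> \<exists>k. a k \<in> fspan {0} G (a ` {..<k})"
  shows "\<exists>H. finite H \<and> H \<subseteq> C \<and> C \<subseteq> fspan {0} G H"
proof (rule ccontr)
  assume neg: "\<not> ?thesis"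
  have "\<exists>a. \<forall>k. a k \<in> C \<and> a k \<notin> fspan {0} G (a ` {..<k::nat})"
  proof (rule dependent_wellorder_choice)
    fix r and f g :: "nat \<Rightarrow> 'a" and x :: nat
    assume "\<And>y. y < x \<Longrightarrow> f y = g y"
    then have "f ` {..<x} = g ` {..<x}" by (intro image_cong) auto
    then show "(r \<in> C \<and> r \<notin> fspan {0} G (f ` {..<x})) = (r \<in> C \<and> r \<notin> fspan {0} G (g ` {..<x}))" by simp
  next
    fix x :: nat and f :: "nat \<Rightarrow> 'a"
    assume "\<And>y. y < x \<Longrightarrow> f y \<in> C \<and> f y \<notin> fspan {0} G (f ` {..<y})"
    then have "finite (f ` {..<x})" "f ` {..<x} \<subseteq> C" by auto
    with neg have "\<not> C \<subseteq> fspan {0} G (f ` {..<x})" by blast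
    then show "\<exists>r. r \<in> C \<and> r \<notin> fspan {0} G (f ` {..<x})" by blast
  qed
  with assms show False by blast
qed

end

text \<open>This serves triangular actions: a variable is sent to itself plus a polynomial in later
  variables, which keeps its leading monomial.\<close>

lemma lead_Var_add:
  fixes l :: "('x, 'k::field) poly_over"
  assumes "l \<in> polys_in (set post)" "v \<notin> set post" "set pre \<inter> set post = {}" "v \<notin> set pre"
  shows "lead (pre @ v # post) (Var v + l) (single v 1)"
proof -
  have less: "(m, single v 1) \<in> mlex (pre @ v # post)" if "m \<in> keys l" for m
  proof -
    have m: "keys m \<subseteq> set post" using assms(1) that by (auto simp: polys_in_def)
    then have "lookup m v = 0" using assms(2) by (auto simp: in_keys_iff subset_iff)
    moreover have "lookup m u = 0 \<and> u \<noteq> v" if "u \<in> set pre" for u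
      using m assms(3,4) that by (auto simp: in_keys_iff subset_iff)
    ultimately have "(m, single v 1) \<in> measures (map (\<lambda>v m. lookup m v) (pre' @ v # post))"
      if "set pre' \<subseteq> set pre" for pre'
      using that by (induction pre') (auto simp: lookup_single when_def)
    then show ?thesis unfolding mlex_def by blast
  qed
  have "single v 1 \<notin> keys l" using less mlex_irrefl by blast
  then have "single v 1 \<in> keys (Var v + l)"
    by (simp add: in_keys_iff lookup_add Var_def)
  moreover have "keys (Var v + l) \<subseteq> insert (single v 1) (keys l)"
    using Poly_Mapping.keys_add[of "Var v" l] by (auto simp: Var_def)
  ultimately show ?thesis unfolding lead_def using less by blast
qed

section \<open>Depth and Krull dimension of a presented ring\<close>

text \<open>R is C/T, given by a surjection h with kernel \<open>T\<close>, so that every question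
  about R is settled on elements of \<open>C\<close>.\<close>

locale presented_ring = C: comm_subring C + R: cring R
  for C :: "'a::comm_ring_1 set" and R :: "('r, 'm) ring_scheme" (structure) +
  fixes T :: "'a set" and h :: "'a \<Rightarrow> 'r"
  assumes idl_T: "C.idl T"
    and h_image: "h ` C = carrier R"
    and h_add: "a \<in> C \<Longrightarrow> b \<in> C \<Longrightarrow> h (a + b) = h a \<oplus> h b"
    and h_mult: "a \<in> C \<Longrightarrow> b \<in> C \<Longrightarrow> h (a * b) = h a \<otimes> h b"
    and h_one: "h 1 = \<one>"
    and h_eq_zero: "a \<in> C \<Longrightarrow> h a = \<zero> \<longleftrightarrow> a \<in> T"
begin

lemma h_closed: "a \<in> C \<Longrightarrow> h a \<in> carrier R"
  using h_image by auto

lemma h_zero: "h 0 = \<zero>"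
  using h_eq_zero C.idlD(2)[OF idl_T] by simp

lemma h_uminus: "a \<in> C \<Longrightarrow> h (- a) = \<ominus> h a"
proof -
  assume a: "a \<in> C"
  then have "h (- a) \<oplus> h a = \<zero>"
    using h_add[of "- a" a] h_zero by simp
  then show ?thesis
    using a by (metis R.minus_equality h_closed C.uminus_closed)
qed

lemma h_eq_iff: "a \<in> C \<Longrightarrow> b \<in> C \<Longrightarrow> h a = h b \<longleftrightarrow> a - b \<in> T"
proof -
  assume ab: "a \<in> C" "b \<in> C"
  have "a - b \<in> T \<longleftrightarrow> h a \<oplus> (\<ominus> h b) = \<zero>"
    using ab h_eq_zero[of "a - b"] h_add[of a "- b"] h_uminus[of b] by simp
  also have "\<dots> \<longleftrightarrow> h a = h b"
    using ab h_closed by (metis R.r_neg R.minus_equality R.minus_minus R.add.inv_closed)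
  finally show ?thesis by simp
qed

lemma h_mem_iff:
  assumes "C.idl J" "T \<subseteq> J" "a \<in> C"
  shows "h a \<in> h ` J \<longleftrightarrow> a \<in> J"
proof
  assume "h a \<in> h ` J"
  then obtain b where b: "b \<in> J" "h a = h b" by auto
  then have "a - b \<in> J" using assms C.idlD(1)[OF assms(1)] h_eq_iff by blast
  then show "a \<in> J" using C.idlD(3)[OF assms(1), of "a - b" b] b(1) by simp
qed simp

lemma ideal_image:
  assumes "C.idl J"
  shows "ideal (h ` J) R"
proof (rule idealI)
  have JC: "a \<in> C" if "a \<in> J" for a using that assms C.idlD(1) by blast
  show "subgroup (h ` J) (add_monoid R)"
  proof (rule R.add.subgroupI)
    show "h ` J \<subseteq> carrier R" using JC h_closed by auto
    show "h ` J \<noteq> {}" using C.idlD(2)[OF assms] by auto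
    show "\<ominus> a \<in> h ` J" if a: "a \<in> h ` J" for a
    proof -
      obtain j where j: "j \<in> J" "a = h j" using a by auto
      then have "\<ominus> a = h (- j)" using h_uminus JC by simp
      then show ?thesis using C.idlD(6)[OF assms j(1)] by auto
    qed
    show "a \<oplus> b \<in> h ` J" if a: "a \<in> h ` J" "b \<in> h ` J" for a b
    proof -
      obtain i j where j: "i \<in> J" "j \<in> J" "a = h i" "b = h j" using a by auto
      then have "a \<oplus> b = h (i + j)" using h_add JC by simp
      then show ?thesis using C.idlD(3)[OF assms j(1,2)] by auto
    qed
  qed
  have *: "x \<otimes> a \<in> h ` J" if a: "a \<in> h ` J" "x \<in> carrier R" for a x
  proof -
    have "x \<in> h ` C" using a h_image by simp
    then obtain j c where j: "j \<in> J" "c \<in> C" "a = h j" "x = h c" using a by auto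
    then have "x \<otimes> a = h (c * j)" using h_mult JC by simp
    then show ?thesis using C.idlD(4)[OF assms j(2,1)] by auto
  qed
  then show "a \<in> h ` J \<Longrightarrow> x \<in> carrier R \<Longrightarrow> x \<otimes> a \<in> h ` J" for a x .
  show "a \<in> h ` J \<Longrightarrow> x \<in> carrier R \<Longrightarrow> a \<otimes> x \<in> h ` J" for a x
    using *[of a x] JC h_closed R.m_comm by (metis image_iff)
qed (rule R.ring_axioms)

lemma idl_vimage:
  assumes "ideal K R"
  shows "C.idl {a \<in> C. h a \<in> K}" "T \<subseteq> {a \<in> C. h a \<in> K}"
proof -
  interpret K: ideal K R by fact
  show "T \<subseteq> {a \<in> C. h a \<in> K}"
  proof
    fix t assume t: "t \<in> T"
    then have "t \<in> C" "h t = \<zero>" using C.idlD(1)[OF idl_T] h_eq_zero by auto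
    then show "t \<in> {a \<in> C. h a \<in> K}" using K.zero_closed by simp
  qed
  show "C.idl {a \<in> C. h a \<in> K}"
    unfolding C.idl_def
    by (auto simp: h_zero h_add h_mult h_closed K.I_l_closed K.a_closed)
qed

lemma genideal_image:
  assumes "set xs \<subseteq> C"
  shows "Idl (h ` set xs) = h ` C.exts T xs"
proof
  have sub: "h ` set xs \<subseteq> carrier R" using assms h_closed by auto
  show "Idl (h ` set xs) \<subseteq> h ` C.exts T xs"
    using assms idl_T C.exts_self[OF idl_T assms]
    by (intro R.genideal_minimal ideal_image C.idl_exts image_mono)
  have id: "ideal (Idl (h ` set xs)) R" using sub by (rule R.genideal_ideal)
  have "C.exts T xs \<subseteq> {a \<in> C. h a \<in> Idl (h ` set xs)}"
    using assms R.genideal_self[OF sub] idl_vimage[OF id] by (intro C.exts_least) auto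
  then show "h ` C.exts T xs \<subseteq> Idl (h ` set xs)" by auto
qed

lemma regular_sequence_iff:
  assumes "set xs \<subseteq> C"
  shows "regular_sequence R (map h xs) \<longleftrightarrow> C.reg T xs \<and> 1 \<notin> C.exts T xs"
proof -
  have idl: "C.idl (C.exts T (take i xs))" "T \<subseteq> C.exts T (take i xs)" for i
    using assms set_take_subset[of i xs] C.idl_exts[OF idl_T] C.exts_subset[OF idl_T] by (meson subset_trans)+
  have Idl: "Idl (set (take i (map h xs))) = h ` C.exts T (take i xs)" for i
    using genideal_image[of "take i xs"] assms set_take_subset[of i xs] by (simp add: take_map subset_trans)
  have nzd: "(\<forall>a\<in>carrier R. map h xs ! i \<otimes> a \<in> Idl (set (take i (map h xs))) \<longrightarrow> a \<in> Idl (set (take i (map h xs))))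
      \<longleftrightarrow> C.nzd (C.exts T (take i xs)) (xs ! i)" if "i < length xs" for i
  proof -
    have x: "xs ! i \<in> C" using assms that nth_mem by blast
    have "(\<forall>a\<in>carrier R. map h xs ! i \<otimes> a \<in> Idl (set (take i (map h xs))) \<longrightarrow> a \<in> Idl (set (take i (map h xs))))
      \<longleftrightarrow> (\<forall>c\<in>C. h (xs ! i * c) \<in> h ` C.exts T (take i xs) \<longrightarrow> h c \<in> h ` C.exts T (take i xs))"
      unfolding h_image[symmetric] Idl using that x by (auto simp: h_mult)
    also have "\<dots> \<longleftrightarrow> C.nzd (C.exts T (take i xs)) (xs ! i)"
      unfolding C.nzd_def using idl x by (simp add: h_mem_iff)
    finally show ?thesis .
  qed
  have "Idl (set (map h xs)) = carrier R \<longleftrightarrow> 1 \<in> C.exts T xs"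
  proof -
    have idl': "C.idl (C.exts T xs)" using C.idl_exts[OF idl_T assms] .
    have "h ` C.exts T xs = carrier R \<longleftrightarrow> \<one> \<in> h ` C.exts T xs"
      using ideal.one_imp_carrier[OF ideal_image[OF idl']] by auto
    also have "\<dots> \<longleftrightarrow> 1 \<in> C.exts T xs"
      using h_mem_iff[OF idl', of 1] C.exts_subset[OF idl_T assms] h_one by simp
    finally show ?thesis using genideal_image[OF assms] by simp
  qed
  then show ?thesis
    unfolding regular_sequence_def C.reg_iff_nth using nzd assms h_closed by auto
qed

text \<open>Inside a proper ideal the properness clause of \<open>regular_sequence\<close> holds
  automatically, so only regularity is left on both sides.\<close>

lemma maximal_regular_sequence_iff:
  assumes "C.idl I" "T \<subseteq> I" "1 \<notin> I" "set xs \<subseteq> I"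
  shows "maximal_regular_sequence_in R (h ` I) (map h xs) \<longleftrightarrow>
    C.reg T xs \<and> (\<forall>z\<in>I. \<not> C.nzd (C.exts T xs) z)"
proof -
  have IC: "I \<subseteq> C" using assms(1) C.idlD(1) by blast
  have rs: "regular_sequence R (map h ys) \<longleftrightarrow> C.reg T ys" if "set ys \<subseteq> I" for ys
    using regular_sequence_iff[of ys] that IC C.exts_least[OF assms(1,2) that] assms(3) by auto
  have "(\<forall>x\<in>h ` I. \<not> regular_sequence R (map h xs @ [x])) \<longleftrightarrow> (\<forall>z\<in>I. \<not> regular_sequence R (map h (xs @ [z])))"
    by simp
  also have "\<dots> \<longleftrightarrow> (\<forall>z\<in>I. \<not> C.reg T (xs @ [z]))"
    using assms(4) rs by (metis Un_insert_right append.right_neutral insert_subset list.set(1) list.set(2) set_append)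
  finally show ?thesis
    unfolding maximal_regular_sequence_in_def using rs[OF assms(4)] assms(4) by (auto simp: C.reg_append)
qed

text \<open>A competing maximal sequence lifts to elements of \<open>I\<close>; its length agrees by
  \<open>maximal_reg_length_unique\<close>, which settles the definite description.\<close>

theorem depth_eq:
  assumes "C.noetherian" "C.idl I" "T \<subseteq> I" "1 \<notin> I" "irrelevant_ideal R gr = h ` I"
    "set xs \<subseteq> I" "C.reg T xs" "\<And>z. z \<in> I \<Longrightarrow> \<not> C.nzd (C.exts T xs) z"
  shows "depth R gr = length xs"
  unfolding depth_def assms(5)
proof (rule the_equality)
  show "\<exists>ys. maximal_regular_sequence_in R (h ` I) ys \<and> length ys = length xs"
    using maximal_regular_sequence_iff[OF assms(2-4,6)] assms(7,8) by (intro exI[of _ "map h xs"]) auto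
next
  fix d assume "\<exists>ys. maximal_regular_sequence_in R (h ` I) ys \<and> length ys = d"
  then obtain ys where ys: "maximal_regular_sequence_in R (h ` I) ys" "length ys = d" by blast
  then have "set ys \<subseteq> h ` I" unfolding maximal_regular_sequence_in_def by blast
  then have "\<exists>zs. set zs \<subseteq> I \<and> ys = map h zs"
  proof (induction ys)
    case (Cons y ys)
    then obtain z zs where "z \<in> I" "y = h z" "set zs \<subseteq> I" "ys = map h zs" by auto
    then show ?case by (intro exI[of _ "z # zs"]) auto
  qed auto
  then obtain zs where zs: "set zs \<subseteq> I" "ys = map h zs" by blast
  with ys(1) have "C.reg T zs" "\<And>z. z \<in> I \<Longrightarrow> \<not> C.nzd (C.exts T zs) z"
    using maximal_regular_sequence_iff[OF assms(2-4) zs(1)] by auto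
  then have "length zs = length xs"
    using assms zs(1) idl_T by (intro C.maximal_reg_length_unique[of I T]) auto
  then show "d = length xs" using ys zs by simp
qed

lemma prime_vimage:
  assumes "primeideal P R"
  shows "C.prime_idl {a \<in> C. h a \<in> P}"
proof -
  interpret P: primeideal P R by fact
  have "1 \<notin> {a \<in> C. h a \<in> P}"
    using P.I_notcarr P.one_imp_carrier h_one by auto
  then show ?thesis
    unfolding C.prime_idl_def using idl_vimage(1)[OF P.is_ideal] P.I_prime h_closed by (auto simp: h_mult)
qed

lemma prime_image:
  assumes "C.prime_idl Q" "T \<subseteq> Q"
  shows "primeideal (h ` Q) R"
proof (rule primeidealI)
  have Q: "C.idl Q" "1 \<notin> Q" using assms(1) unfolding C.prime_idl_def by auto
  show "ideal (h ` Q) R" using Q(1) by (rule ideal_image)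
  show "carrier R \<noteq> h ` Q"
    using h_mem_iff[OF Q(1) assms(2), of 1] Q(2) h_closed by auto
  show "a \<in> h ` Q \<or> b \<in> h ` Q" if ab: "a \<in> carrier R" "b \<in> carrier R" "a \<otimes> b \<in> h ` Q" for a b
  proof -
    have "a \<in> h ` C" "b \<in> h ` C" using ab h_image by simp_all
    then obtain x y where xy: "x \<in> C" "y \<in> C" "a = h x" "b = h y" by auto
    then have "x * y \<in> Q" using ab h_mem_iff[OF Q(1) assms(2), of "x * y"] by (simp add: h_mult)
    then show ?thesis using xy assms(1) unfolding C.prime_idl_def by blast
  qed
qed (rule R.is_cring)

theorem krull_dim_ge:
  assumes "\<And>i. i \<le> d \<Longrightarrow> C.prime_idl (Q i)" "\<And>i. i \<le> d \<Longrightarrow> T \<subseteq> Q i" "\<And>i. i < d \<Longrightarrow> Q i \<subset> Q (Suc i)"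
  shows "enat d \<le> krull_dim R"
proof -
  have "h ` Q i \<subset> h ` Q (Suc i)" if i: "i < d" for i
  proof -
    obtain a where a: "a \<in> Q (Suc i)" "a \<notin> Q i" using assms(3)[OF i] by blast
    have idl: "C.idl (Q i)" "C.idl (Q (Suc i))" using assms(1) i unfolding C.prime_idl_def by auto
    then have "a \<in> C" using a C.idlD(1) by blast
    then have "h a \<notin> h ` Q i" using h_mem_iff[OF idl(1) assms(2)[of i]] a i by simp
    then show ?thesis using a assms(3)[OF i] by blast
  qed
  moreover have "primeideal (h ` Q i) R" if "i \<le> d" for i
    using assms that by (intro prime_image) auto
  ultimately show ?thesis
    unfolding krull_dim_def by (intro SUP_upper CollectI exI[of _ "\<lambda>i. h ` Q i"]) auto
qed

text \<open>From a chain of primes that is too long, pick one element from each successive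
  difference of preimages; the relation among them contradicts
  \<open>alg_dep_prime_chain\<close>.\<close>

theorem krull_dim_le:
  assumes "comm_algebra C (cst :: 'k::field \<Rightarrow> 'a)"
    and dep: "\<And>as. set as \<subseteq> C \<Longrightarrow> length as = Suc d \<Longrightarrow> comm_algebra.alg_dep cst T as"
  shows "krull_dim R \<le> enat d"
  unfolding krull_dim_def
proof (rule SUP_least)
  interpret A: comm_algebra C cst by fact
  fix e assume "e \<in> {d. \<exists>P. (\<forall>i\<le>d. primeideal (P i) R) \<and> (\<forall>i<d. P i \<subset> P (Suc i))}"
  then obtain P where P: "\<And>i. i \<le> e \<Longrightarrow> primeideal (P i) R" "\<And>i. i < e \<Longrightarrow> P i \<subset> P (Suc i)" by blast
  have "e \<le> d"
  proof (rule ccontr)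
    assume "\<not> e \<le> d"
    then have ed: "Suc d \<le> e" by simp
    define Q where "Q i = {a \<in> C. h a \<in> P i}" for i
    have "\<exists>a. a \<in> Q (Suc i) \<and> a \<notin> Q i" if i: "i < e" for i
    proof -
      obtain r where r: "r \<in> P (Suc i)" "r \<notin> P i" using P(2)[OF i] by blast
      have "ideal (P (Suc i)) R" using P(1)[of "Suc i"] i primeideal.axioms(1) by auto
      then have "r \<in> h ` C" using r(1) h_image ideal.Icarr by metis
      then show ?thesis using r unfolding Q_def by blast
    qed
    then obtain a where a: "\<And>i. i < e \<Longrightarrow> a i \<in> Q (Suc i)" "\<And>i. i < e \<Longrightarrow> a i \<notin> Q i" by metis
    define as where "as = map a [0..<Suc d]"
    have as: "set as \<subseteq> C" "length as = Suc d" "\<And>i. i < Suc d \<Longrightarrow> as ! i = a i"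
      using a(1) ed unfolding as_def Q_def by (auto simp del: upt_Suc)
    have id0: "ideal (P 0) R" using P(1)[of 0] primeideal.axioms(1) by auto
    have "A.alg_dep (Q 0) as"
      using A.alg_dep_mono[OF dep[OF as(1,2)]] idl_vimage(2)[OF id0] unfolding Q_def by blast
    then show False
    proof (rule A.alg_dep_prime_chain[of Q as "Suc d"])
      show "C.prime_idl (Q i)" if "i \<le> Suc d" for i
        unfolding Q_def using P(1) ed that by (intro prime_vimage) auto
      show "Q i \<subseteq> Q (Suc i)" if "i < Suc d" for i
        unfolding Q_def using P(2)[of i] ed that by auto
    qed (use as a ed in auto)
  qed
  then show "enat e \<le> enat d" by simp
qed

end

section \<open>The transfer quotient in coordinates\<close>

lemma poly_ring_on_simps [simp]:
  "carrier (poly_ring_on W) = polys_in W" "p \<oplus>\<^bsub>poly_ring_on W\<^esub> q = p + q"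
  "p \<otimes>\<^bsub>poly_ring_on W\<^esub> q = p * q" "\<zero>\<^bsub>poly_ring_on W\<^esub> = 0" "\<one>\<^bsub>poly_ring_on W\<^esub> = 1"
  by (simp_all add: poly_ring_on_def ring_of_type_algebra_def polys_in_def)

lemma cring_poly_ring_on: "cring (poly_ring_on W :: ('x, 'k::field) poly_over ring)"
proof (rule cringI)
  show "abelian_group (poly_ring_on W :: ('x, 'k) poly_over ring)"
  proof (rule abelian_groupI)
    fix p :: "('x, 'k) poly_over" assume "p \<in> carrier (poly_ring_on W)"
    then show "\<exists>q\<in>carrier (poly_ring_on W). q \<oplus>\<^bsub>poly_ring_on W\<^esub> p = \<zero>\<^bsub>poly_ring_on W\<^esub>"
      by (intro bexI[of _ "- p"]) auto
  qed (auto simp: ac_simps)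
  show "comm_monoid (poly_ring_on W :: ('x, 'k) poly_over ring)"
    by (rule comm_monoidI) (auto simp: ac_simps)
qed (auto simp: distrib_right)

lemma ideal_poly_ring_on_idl:
  assumes "ideal J (poly_ring_on W)"
  shows "polys_in.idl W (J :: ('x, 'k::field) poly_over set)"
proof -
  interpret J: ideal J "poly_ring_on W" by fact
  show ?thesis
    unfolding polys_in.idl_def
  proof (intro conjI ballI)
    show "J \<subseteq> polys_in W" using J.Icarr by auto
    show "0 \<in> J" using additive_subgroup.zero_closed[OF J.is_additive_subgroup] by simp
    show "a + b \<in> J" if "a \<in> J" "b \<in> J" for a b
      using additive_subgroup.a_closed[OF J.is_additive_subgroup that] by simp
    show "c * a \<in> J" if "c \<in> polys_in W" "a \<in> J" for c a using J.I_l_closed[of a c] that by simp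
  qed
qed

lemma idl_ideal_poly_ring_on:
  fixes J :: "('x, 'k::field) poly_over set"
  assumes "polys_in.idl W J"
  shows "ideal J (poly_ring_on W)"
proof -
  interpret cring "poly_ring_on W :: ('x, 'k) poly_over ring" by (rule cring_poly_ring_on)
  have uminus: "\<ominus>\<^bsub>poly_ring_on W\<^esub> p = - p" if "p \<in> polys_in W" for p :: "('x, 'k) poly_over"
    using that by (intro minus_equality) auto
  show ?thesis
  proof (rule idealI)
    show "subgroup J (add_monoid (poly_ring_on W))"
      using polys_in.idlD[OF assms] by (intro add.subgroupI) (auto simp: uminus)
  qed (use polys_in.idlD[OF assms] ring_axioms in auto)
qed

text \<open>Used to replace each generator \<open>Var f\<close> of the symmetric algebra by its
  expansion in a basis.\<close>

lemma subst_cong_mod: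
  fixes p :: "('x, 'k::field) poly_over" and J :: "('y, 'k) poly_over set"
  assumes J: "polys_in.idl W J" and gh: "\<And>x. x \<in> I \<Longrightarrow> g x \<in> polys_in W" "\<And>x. x \<in> I \<Longrightarrow> h x \<in> polys_in W"
    "\<And>x. x \<in> I \<Longrightarrow> g x - h x \<in> J" and p: "p \<in> polys_in I"
  shows "subst g p - subst h p \<in> J"
proof -
  have mult: "a * b - c * d \<in> J"
    if "a \<in> polys_in W" "b \<in> polys_in W" "c \<in> polys_in W" "d \<in> polys_in W" "a - c \<in> J" "b - d \<in> J" for a b c d
  proof -
    have "a * b - c * d = b * (a - c) + c * (b - d)" by (simp add: algebra_simps)
    then show ?thesis using that polys_in.idlD(3,4)[OF J] by metis
  qed
  have pow: "a ^ n - b ^ n \<in> J" if "a \<in> polys_in W" "b \<in> polys_in W" "a - b \<in> J" for a b and n :: nat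
    using that mult by (induction n) (auto simp: polys_in.idlD[OF J])
  have prod: "prod f A - prod f' A \<in> J"
    if "\<And>i. i \<in> A \<Longrightarrow> f i \<in> polys_in W \<and> f' i \<in> polys_in W \<and> f i - f' i \<in> J" for f f' and A :: "'x set"
    using that
  proof (induction A rule: infinite_finite_induct)
    case (insert x F)
    then show ?case using polys_in.prod_closed[of F f W] polys_in.prod_closed[of F f' W] by (auto intro!: mult)
  qed (auto simp: polys_in.idlD[OF J])
  show ?thesis
    using p
  proof (induction rule: polys_in_induct)
    case (single m c)
    have "meval g m - meval h m \<in> J"
      unfolding meval_def using single gh pow by (intro prod) (auto simp: subset_iff)
    then have "Cst c * (meval g m - meval h m) \<in> J"
      by (intro polys_in.idlD(4)[OF J]) auto
    then show ?case by (simp add: subst_single algebra_simps)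
  next
    case (add p q)
    then have "(subst g p - subst h p) + (subst g q - subst h q) \<in> J" using polys_in.idlD(3)[OF J] by blast
    then show ?case by (simp add: subst_add algebra_simps)
  qed
qed

lemma homog_Cst_mult: "homog d p \<Longrightarrow> homog d (Cst c * p)"
  using homog_mult[OF homog_Cst, of d p c] by simp

lemma homog_subst:
  assumes "homog d p" "p \<in> polys_in I" "\<And>x. x \<in> I \<Longrightarrow> homog 1 (h x)"
  shows "homog d (subst h p)"
proof -
  have "hcomp d p = p" using assms(1) by (simp add: hcomp_homog)
  then have "hcomp d (subst h p) = subst h p" using hcomp_subst[of p I h d] assms(2,3) by simp
  then show ?thesis using homog_hcomp by metis
qed

locale rep_basis = linear_rep scale G \<rho>
  for scale :: "'k::field \<Rightarrow> 'v::ab_group_add \<Rightarrow> 'v"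
    and G :: "('g, 'b) monoid_scheme" (structure)
    and \<rho> :: "'g \<Rightarrow> 'v \<Rightarrow> 'v" +
  fixes b :: "'i \<Rightarrow> 'v" and I :: "'i set"
  assumes finite_I: "finite I" and basis: "is_basis_family b I" and finite_G: "finite (carrier G)"
begin

abbreviation W where "W \<equiv> dual_space scale"

text \<open>The dual basis.\<close>

definition coord :: "'i \<Rightarrow> 'v \<Rightarrow> 'k" where
  "coord i v = representation (b ` I) v (b i)"

lemma independent_b: "independent (b ` I)" and span_b: "span (b ` I) = UNIV" and inj_b: "inj_on b I"
  using basis unfolding is_basis_family_def by auto

lemma sum_apply: "sum g A v = (\<Sum>i\<in>A. g i v)" for g :: "'x \<Rightarrow> 'v \<Rightarrow> 'k"
  by (induction A rule: infinite_finite_induct) auto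

lemma mem_W: "f \<in> W \<longleftrightarrow> (\<forall>u v. f (u + v) = f u + f v) \<and> (\<forall>c v. f (scale c v) = c * f v)"
proof -
  have "vector_space ((*) :: 'k \<Rightarrow> 'k \<Rightarrow> 'k)"
    by unfold_locales (auto simp: algebra_simps)
  then show ?thesis
    unfolding dual_space_def mem_Collect_eq Vector_Spaces.linear_iff using vector_space_axioms by blast
qed

lemma coord_in_W: "coord i \<in> W"
  unfolding mem_W coord_def
  using representation_add[OF independent_b] representation_scale[OF independent_b] span_b by (auto simp: add.commute)

lemma coord_basis: "i \<in> I \<Longrightarrow> j \<in> I \<Longrightarrow> coord i (b j) = (if i = j then 1 else 0)"
  unfolding coord_def using representation_basis[OF independent_b, of "b j"] inj_b by (auto simp: inj_on_def)

lemma expand: "v = (\<Sum>i\<in>I. scale (coord i v) (b i))"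
proof -
  have "(\<Sum>x\<in>b ` I. scale (representation (b ` I) v x) x) = v"
    using finite_I span_b by (intro sum_representation_eq[OF independent_b]) auto
  then show ?thesis
    unfolding coord_def by (simp add: sum.reindex[OF inj_b])
qed

lemma W_sum: "f \<in> W \<Longrightarrow> f (sum g A) = (\<Sum>i\<in>A. f (g i))"
proof -
  assume f: "f \<in> W"
  then have "f (scale 0 0) = 0 * f 0" unfolding mem_W by blast
  then have "f 0 = 0" by simp
  then show ?thesis using f unfolding mem_W by (induction A rule: infinite_finite_induct) auto
qed

lemma dual_expand: "f \<in> W \<Longrightarrow> f = (\<Sum>i\<in>I. dual_scale (f (b i)) (coord i))"
proof
  fix v assume f: "f \<in> W"
  have "f v = f (\<Sum>i\<in>I. scale (coord i v) (b i))" using expand[of v] by simp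
  also have "\<dots> = (\<Sum>i\<in>I. coord i v * f (b i))" using f unfolding W_sum[OF f] mem_W by simp
  also have "\<dots> = (\<Sum>i\<in>I. dual_scale (f (b i)) (coord i)) v"
    by (simp add: sum_apply dual_scale_def mult.commute)
  finally show "f v = (\<Sum>i\<in>I. dual_scale (f (b i)) (coord i)) v" .
qed

lemma add_in_W: "f \<in> W \<Longrightarrow> g \<in> W \<Longrightarrow> f + g \<in> W"
  and zero_in_W: "0 \<in> W"
  and scale_in_W: "f \<in> W \<Longrightarrow> dual_scale c f \<in> W"
  by (auto simp: mem_W algebra_simps dual_scale_def)

lemma sum_in_W: "(\<And>i. i \<in> A \<Longrightarrow> g i \<in> W) \<Longrightarrow> sum g A \<in> W"
  by (induction A rule: infinite_finite_induct) (auto intro: add_in_W zero_in_W)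

section \<open>The symmetric algebra of the dual space as a polynomial ring\<close>

definition rels :: "('v \<Rightarrow> 'k, 'k) poly_over set" where
  "rels = {Var (f + g) - Var f - Var g | f g. f \<in> W \<and> g \<in> W} \<union>
      {Var (dual_scale c f) - Cst c * Var f | c f. f \<in> W}"

definition J :: "('v \<Rightarrow> 'k, 'k) poly_over set" where
  "J = sym_ideal dual_scale W"

lemma J_eq: "J = Idl\<^bsub>poly_ring_on W\<^esub> rels"
  unfolding J_def sym_ideal_def rels_def ..

lemma rels_subset: "rels \<subseteq> polys_in W"
  unfolding rels_def using add_in_W scale_in_W by auto

lemma ideal_J: "ideal J (poly_ring_on W)"
proof -
  interpret P: cring "poly_ring_on W :: ('v \<Rightarrow> 'k, 'k) poly_over ring" by (rule cring_poly_ring_on)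
  show ?thesis unfolding J_eq using rels_subset by (intro P.genideal_ideal) simp
qed

lemma idl_J: "polys_in.idl W J"
  using ideal_J by (rule ideal_poly_ring_on_idl)

lemma rels_in_J: "rels \<subseteq> J"
proof -
  interpret P: cring "poly_ring_on W :: ('v \<Rightarrow> 'k, 'k) poly_over ring" by (rule cring_poly_ring_on)
  show ?thesis unfolding J_eq using rels_subset by (intro P.genideal_self) simp
qed

lemma J_least: "polys_in.idl W K \<Longrightarrow> rels \<subseteq> K \<Longrightarrow> J \<subseteq> K"
proof -
  interpret P: cring "poly_ring_on W :: ('v \<Rightarrow> 'k, 'k) poly_over ring" by (rule cring_poly_ring_on)
  show "polys_in.idl W K \<Longrightarrow> rels \<subseteq> K \<Longrightarrow> J \<subseteq> K"
    unfolding J_eq using idl_ideal_poly_ring_on[of W K] by (intro P.genideal_minimal) simp_all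
qed

lemma Var_zero_mod: "Var 0 \<in> J"
proof -
  have "Var (0 + 0) - Var 0 - Var 0 \<in> J"
    using rels_in_J zero_in_W unfolding rels_def by blast
  then have "- Var 0 \<in> J"
    by (simp only: add_0_left diff_self diff_0)
  from polys_in.idlD(6)[OF idl_J this] show ?thesis by (simp only: minus_minus)
qed

lemma Var_sum_mod: "(\<And>i. i \<in> A \<Longrightarrow> g i \<in> W) \<Longrightarrow> Var (sum g A) - (\<Sum>i\<in>A. Var (g i)) \<in> J"
proof (induction A rule: infinite_finite_induct)
  case (insert x F)
  have "Var (g x + sum g F) - Var (g x) - Var (sum g F) \<in> J"
    using rels_in_J insert sum_in_W[of F g] unfolding rels_def by blast
  moreover have "Var (sum g F) - (\<Sum>i\<in>F. Var (g i)) \<in> J" using insert by simp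
  ultimately have "(Var (g x + sum g F) - Var (g x) - Var (sum g F)) + (Var (sum g F) - (\<Sum>i\<in>F. Var (g i))) \<in> J"
    by (rule polys_in.idlD(3)[OF idl_J])
  moreover have "(a - b - c) + (c - d) = a - (b + d)" for a b c d :: "('v \<Rightarrow> 'k, 'k) poly_over"
    by simp
  ultimately have "Var (g x + sum g F) - (Var (g x) + (\<Sum>i\<in>F. Var (g i))) \<in> J"
    by (simp only:)
  then show ?case using insert by (simp only: sum.insert not_False_eq_True)
qed (use Var_zero_mod in simp_all)

text \<open>The linearity relations reduce every generator, one for each linear form, to the
  finitely many generators of the dual basis.\<close>

lemma Var_mod:
  assumes "f \<in> W"
  shows "Var f - (\<Sum>i\<in>I. Cst (f (b i)) * Var (coord i)) \<in> J"
proof -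
  have 1: "Var f - (\<Sum>i\<in>I. Var (dual_scale (f (b i)) (coord i))) \<in> J"
    using Var_sum_mod[of I "\<lambda>i. dual_scale (f (b i)) (coord i)"] dual_expand[OF assms] coord_in_W scale_in_W by simp
  have "Var (dual_scale (f (b i)) (coord i)) - Cst (f (b i)) * Var (coord i) \<in> J" for i
    using rels_in_J coord_in_W unfolding rels_def by blast
  then have "(\<Sum>i\<in>I. Var (dual_scale (f (b i)) (coord i)) - Cst (f (b i)) * Var (coord i)) \<in> J"
    by (intro polys_in.idl_sum[OF idl_J]) simp
  from polys_in.idlD(3)[OF idl_J 1 this] show ?thesis
    by (simp add: sum_subtractf)
qed

text \<open>\<open>lift\<close> and \<open>proj\<close> induce mutually inverse isomorphisms between
  the polynomial ring in the variables \<open>I\<close> and the symmetric algebra;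
  \<open>proj\<close> expands a linear form in the dual basis.\<close>

definition lift :: "('i, 'k) poly_over \<Rightarrow> ('v \<Rightarrow> 'k, 'k) poly_over" where
  "lift = subst (\<lambda>i. Var (coord i))"

definition proj :: "('v \<Rightarrow> 'k, 'k) poly_over \<Rightarrow> ('i, 'k) poly_over" where
  "proj = subst (\<lambda>f. \<Sum>i\<in>I. Cst (f (b i)) * Var i)"

lemma lift_in: "lift p \<in> polys_in W"
  unfolding lift_def using coord_in_W
  by (intro subst_in_polys_in[of p UNIV]) (auto simp: polys_in_def[of UNIV])

lemma proj_in: "proj p \<in> polys_in I"
proof -
  have "(\<Sum>i\<in>I. Cst (f (b i)) * Var i) \<in> polys_in I" for f :: "'v \<Rightarrow> 'k"
    by (intro polys_in.sum_closed) auto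
  then show ?thesis
    unfolding proj_def by (intro subst_in_polys_in[of p UNIV]) (auto simp: polys_in_def[of UNIV])
qed

lemma proj_lift: "p \<in> polys_in I \<Longrightarrow> proj (lift p) = p"
proof -
  assume p: "p \<in> polys_in I"
  have "proj (Var (coord i)) = Var i" if "i \<in> I" for i
  proof -
    have "(\<Sum>j\<in>I. Cst (coord i (b j)) * Var j) = (\<Sum>j\<in>I. if i = j then Var j else 0)"
      using that by (intro sum.cong) (auto simp: coord_basis)
    then show ?thesis using that finite_I by (simp add: proj_def)
  qed
  then have "subst (\<lambda>i. proj (Var (coord i))) p = subst Var p"
    by (intro subst_cong_in[OF p]) simp
  then show ?thesis
    unfolding lift_def by (simp add: proj_def subst_subst subst_Var_id)
qed

lemma lift_proj: "p \<in> polys_in W \<Longrightarrow> p - lift (proj p) \<in> J"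
proof -
  assume p: "p \<in> polys_in W"
  have "subst Var p - subst (\<lambda>f. \<Sum>i\<in>I. Cst (f (b i)) * Var (coord i)) p \<in> J"
    using coord_in_W Var_mod
    by (intro subst_cong_mod[OF idl_J _ _ _ p] polys_in.sum_closed polys_in.mult_closed) auto
  then show ?thesis
    by (simp add: lift_def proj_def subst_subst subst_Var_id subst_sum subst_mult)
qed

text \<open>The kernel of \<open>proj\<close> is an ideal that contains the defining
  relations.\<close>

lemma proj_J: "p \<in> J \<Longrightarrow> proj p = 0"
proof -
  have "J \<subseteq> {p \<in> polys_in W. proj p = 0}"
  proof (rule J_least)
    show "polys_in.idl W {p \<in> polys_in W. proj p = 0}"
      unfolding polys_in.idl_def by (auto simp: proj_def subst_add subst_mult)
    show "rels \<subseteq> {p \<in> polys_in W. proj p = 0}"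
    proof
      fix p assume p: "p \<in> rels"
      then have "proj p = 0"
        unfolding rels_def
        by (auto simp: proj_def subst_hom Cst_add Cst_mult dual_scale_def distrib_right sum.distrib sum_distrib_left mult.assoc)
      then show "p \<in> {p \<in> polys_in W. proj p = 0}" using p rels_subset by auto
    qed
  qed
  then show "p \<in> J \<Longrightarrow> proj p = 0" by blast
qed

lemma lift_in_J_iff: "p \<in> polys_in I \<Longrightarrow> lift p \<in> J \<longleftrightarrow> p = 0"
  using proj_J[of "lift p"] proj_lift[of p] polys_in.idlD(2)[OF idl_J] by (auto simp: lift_def)

text \<open>The resulting isomorphism from polynomials in the coordinates onto
  \<open>coord_ring\<close>, with values in cosets.\<close>

definition kap :: "('i, 'k) poly_over \<Rightarrow> ('v \<Rightarrow> 'k, 'k) poly_over set" where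
  "kap p = J +>\<^bsub>poly_ring_on W\<^esub> lift p"

lemma coset_eq: "J +>\<^bsub>poly_ring_on W\<^esub> p = {j + p | j. j \<in> J}"
  by (auto simp: a_r_coset_def')

lemma coset_eq_iff:
  assumes "p \<in> polys_in W" "q \<in> polys_in W"
  shows "J +>\<^bsub>poly_ring_on W\<^esub> p = J +>\<^bsub>poly_ring_on W\<^esub> q \<longleftrightarrow> p - q \<in> J"
proof
  assume "J +>\<^bsub>poly_ring_on W\<^esub> p = J +>\<^bsub>poly_ring_on W\<^esub> q"
  moreover have "p \<in> J +>\<^bsub>poly_ring_on W\<^esub> p"
    unfolding coset_eq using polys_in.idlD(2)[OF idl_J] by force
  ultimately show "p - q \<in> J" unfolding coset_eq by auto
next
  have *: "{j + p | j. j \<in> J} \<subseteq> {j + q | j. j \<in> J}" if "p - q \<in> J" for p q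
  proof
    fix x assume "x \<in> {j + p | j. j \<in> J}"
    then obtain j where "j \<in> J" "x = j + p" by blast
    then have "j + (p - q) \<in> J" "x = (j + (p - q)) + q" using that polys_in.idlD(3)[OF idl_J] by auto
    then show "x \<in> {j + q | j. j \<in> J}" by blast
  qed
  assume "p - q \<in> J"
  moreover from polys_in.idlD(6)[OF idl_J this] have "q - p \<in> J" by simp
  ultimately show "J +>\<^bsub>poly_ring_on W\<^esub> p = J +>\<^bsub>poly_ring_on W\<^esub> q"
    unfolding coset_eq using * by blast
qed

lemma coord_ring_eq: "coord_ring = poly_ring_on W Quot J"
  unfolding coord_ring_def sym_algebra_def J_def ..

lemma cring_coord_ring: "cring coord_ring"
  unfolding coord_ring_eq by (rule ideal.quotient_is_cring[OF ideal_J cring_poly_ring_on])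

lemma coset_hom: "(+>\<^bsub>poly_ring_on W\<^esub>) J \<in> ring_hom (poly_ring_on W) coord_ring"
  unfolding coord_ring_eq by (rule ideal.rcos_ring_hom[OF ideal_J])

lemma kap_add: "kap (p + q) = kap p \<oplus>\<^bsub>coord_ring\<^esub> kap q"
  using ring_hom_add[OF coset_hom, of "lift p" "lift q"] lift_in by (simp add: kap_def lift_def subst_add)

lemma kap_mult: "kap (p * q) = kap p \<otimes>\<^bsub>coord_ring\<^esub> kap q"
  using ring_hom_mult[OF coset_hom, of "lift p" "lift q"] lift_in by (simp add: kap_def lift_def subst_mult)

lemma kap_one: "kap 1 = \<one>\<^bsub>coord_ring\<^esub>"
  using ring_hom_one[OF coset_hom] by (simp add: kap_def lift_def)

lemma kap_closed: "kap p \<in> carrier coord_ring"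
  using ring_hom_closed[OF coset_hom, of "lift p"] lift_in by (simp add: kap_def)

lemma kap_zero: "kap 0 = \<zero>\<^bsub>coord_ring\<^esub>"
proof -
  interpret R: cring coord_ring by (rule cring_coord_ring)
  have "kap 0 \<oplus>\<^bsub>coord_ring\<^esub> kap 0 = kap 0" using kap_add[of 0 0] by simp
  then show ?thesis using kap_closed by (metis R.add.l_cancel_one)
qed

lemma kap_eq_iff: "p \<in> polys_in I \<Longrightarrow> q \<in> polys_in I \<Longrightarrow> kap p = kap q \<longleftrightarrow> p = q"
  unfolding kap_def using coset_eq_iff[OF lift_in lift_in, of p q] lift_in_J_iff[of "p - q"]
  by (simp add: lift_def subst_diff)

lemma coset_kap: "p \<in> polys_in W \<Longrightarrow> J +>\<^bsub>poly_ring_on W\<^esub> p = kap (proj p)"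
  unfolding kap_def using coset_eq_iff[OF _ lift_in] lift_proj by simp

lemma carrier_coord_ring: "carrier coord_ring = kap ` polys_in I"
proof
  show "carrier coord_ring \<subseteq> kap ` polys_in I"
  proof
    fix x assume "x \<in> carrier coord_ring"
    then obtain p where "p \<in> polys_in W" "x = J +>\<^bsub>poly_ring_on W\<^esub> p"
      unfolding coord_ring_eq FactRing_def A_RCOSETS_def' by auto
    then show "x \<in> kap ` polys_in I" using coset_kap proj_in by blast
  qed
qed (use kap_closed in auto)

lemma coord_grading_eq: "coord_grading d = kap ` {p \<in> polys_in I. homog d p}"
proof -
  have "coord_grading d = (\<lambda>p. J +>\<^bsub>poly_ring_on W\<^esub> p) ` {p \<in> polys_in W. homog d p}"
    unfolding coord_grading_def sym_grading_def J_def homog_def by simp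
  also have "\<dots> = kap ` {p \<in> polys_in I. homog d p}"
  proof
    have "homog d (proj p)" if "homog d p" for p
    proof -
      have "homog 1 (\<Sum>i\<in>I. Cst (f (b i)) * Var i)" for f :: "'v \<Rightarrow> 'k"
        by (intro homog_sum homog_Cst_mult homog_Var)
      then show ?thesis unfolding proj_def using that
        by (intro homog_subst[of d p UNIV]) (auto simp: polys_in_def)
    qed
    then show "(\<lambda>p. J +>\<^bsub>poly_ring_on W\<^esub> p) ` {p \<in> polys_in W. homog d p} \<subseteq> kap ` {p \<in> polys_in I. homog d p}"
      using coset_kap proj_in by auto
    have "homog d (lift p)" if "homog d p" for p
      unfolding lift_def using that by (intro homog_subst[of d p UNIV] homog_Var) (auto simp: polys_in_def)
    then show "kap ` {p \<in> polys_in I. homog d p} \<subseteq> (\<lambda>p. J +>\<^bsub>poly_ring_on W\<^esub> p) ` {p \<in> polys_in W. homog d p}"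
      using lift_in unfolding kap_def by auto
  qed
  finally show ?thesis .
qed

section \<open>The group action in coordinates\<close>

definition act :: "'g \<Rightarrow> 'i \<Rightarrow> ('i, 'k) poly_over" where
  "act \<sigma> i = (\<Sum>j\<in>I. Cst (coord i (\<rho> (inv \<sigma>) (b j))) * Var j)"

lemma comp_in_W: "\<tau> \<in> carrier G \<Longrightarrow> f \<in> W \<Longrightarrow> f \<circ> \<rho> \<tau> \<in> W"
  using linear_action[of \<tau>] unfolding mem_W by (auto simp: Vector_Spaces.linear_iff)

lemma act_in: "act \<sigma> i \<in> polys_in I"
  unfolding act_def by (intro polys_in.sum_closed) auto

lemma homog_act: "homog 1 (act \<sigma> i)"
  unfolding act_def by (intro homog_sum homog_Cst_mult homog_Var)

lemma subst_J:
  assumes "\<tau> \<in> carrier G" "p \<in> J"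
  shows "subst (\<lambda>f. Var (f \<circ> \<rho> \<tau>)) p \<in> J"
proof -
  let ?s = "subst (\<lambda>f. Var (f \<circ> \<rho> \<tau>)) :: ('v \<Rightarrow> 'k, 'k) poly_over \<Rightarrow> _"
  have W: "?s p \<in> polys_in W" if "p \<in> polys_in W" for p
    using that comp_in_W[OF assms(1)] by (intro subst_in_polys_in) auto
  have "J \<subseteq> {p \<in> polys_in W. ?s p \<in> J}"
  proof (rule J_least)
    show "polys_in.idl W {p \<in> polys_in W. ?s p \<in> J}"
      unfolding polys_in.idl_def using polys_in.idlD[OF idl_J] W by (auto simp: subst_add subst_mult)
    have "?s p \<in> rels" if "p \<in> rels" for p
    proof -
      have add: "(f + g) \<circ> \<rho> \<tau> = (f \<circ> \<rho> \<tau>) + (g \<circ> \<rho> \<tau>)" for f g :: "'v \<Rightarrow> 'k"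
        by (rule ext) simp
      have sc: "dual_scale c f \<circ> \<rho> \<tau> = dual_scale c (f \<circ> \<rho> \<tau>)" for c f
        by (rule ext) (simp add: dual_scale_def)
      show ?thesis
        using that unfolding rels_def
      proof (elim UnE CollectE exE conjE)
        fix f g assume "p = Var (f + g) - Var f - Var g" "f \<in> W" "g \<in> W"
        then show "?s p \<in> {Var (f + g) - Var f - Var g | f g. f \<in> W \<and> g \<in> W} \<union>
            {Var (dual_scale c f) - Cst c * Var f | c f. f \<in> W}"
          using comp_in_W[OF assms(1)] by (intro UnI1 CollectI exI[of _ "f \<circ> \<rho> \<tau>"] exI[of _ "g \<circ> \<rho> \<tau>"])
            (simp add: subst_hom add del: plus_fun_apply)
      next
        fix c f assume "p = Var (dual_scale c f) - Cst c * Var f" "f \<in> W"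
        then show "?s p \<in> {Var (f + g) - Var f - Var g | f g. f \<in> W \<and> g \<in> W} \<union>
            {Var (dual_scale c f) - Cst c * Var f | c f. f \<in> W}"
          using comp_in_W[OF assms(1)] by (intro UnI2 CollectI exI[of _ c] exI[of _ "f \<circ> \<rho> \<tau>"])
            (simp add: subst_hom sc)
      qed
    qed
    then show "rels \<subseteq> {p \<in> polys_in W. ?s p \<in> J}" using rels_in_J rels_subset by blast
  qed
  then show ?thesis using assms(2) by blast
qed

lemma rho_inv: "\<sigma> \<in> carrier G \<Longrightarrow> \<rho> \<sigma> \<circ> \<rho> (inv \<sigma>) = id" "\<sigma> \<in> carrier G \<Longrightarrow> \<rho> (inv \<sigma>) \<circ> \<rho> \<sigma> = id"
  using orbit_sym_aux[of \<sigma>] group.inv_closed[OF group_hom.axioms(1)[OF group_hom], of \<sigma>]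
    group.inv_inv[OF group_hom.axioms(1)[OF group_hom], of \<sigma>] orbit_sym_aux[of "inv \<sigma>"]
  by (auto simp: fun_eq_iff)

lemma coord_act_kap:
  assumes "\<sigma> \<in> carrier G" "p \<in> polys_in I"
  shows "coord_act \<sigma> (kap p) = kap (subst (act \<sigma>) p)"
proof -
  let ?s = "subst (\<lambda>f. Var (f \<circ> \<rho> (inv \<sigma>))) :: ('v \<Rightarrow> 'k, 'k) poly_over \<Rightarrow> _"
  have inv: "inv \<sigma> \<in> carrier G"
    using assms(1) group.inv_closed[OF group_hom.axioms(1)[OF group_hom]] by blast
  \<comment> \<open>The substitution maps \<open>J\<close> onto itself, its inverse being the
    substitution for the inverse element. Hence the elementwise image of a coset, which is how
    \<open>sym_map\<close> is defined, is again a full coset.\<close>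
  have sJ: "?s ` J = J"
  proof
    show "?s ` J \<subseteq> J" using subst_J[OF inv] by blast
    show "J \<subseteq> ?s ` J"
    proof
      fix p assume p: "p \<in> J"
      let ?q = "subst (\<lambda>f. Var (f \<circ> \<rho> \<sigma>)) p"
      have "(f \<circ> \<rho> \<sigma>) \<circ> \<rho> (inv \<sigma>) = f" for f :: "'v \<Rightarrow> 'k"
        using rho_inv(1)[OF assms(1)] by (metis comp_id o_assoc)
      then have "?s ?q = p" by (simp add: subst_subst subst_Var_id)
      then show "p \<in> ?s ` J" using subst_J[OF assms(1) p] by (metis image_eqI)
    qed
  qed
  have sl: "?s (lift p) \<in> polys_in W"
    using comp_in_W[OF inv] by (intro subst_in_polys_in[OF lift_in]) auto
  have "coord_act \<sigma> (kap p) = ?s ` {j + lift p | j. j \<in> J}"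
    unfolding coord_act_def sym_map_def kap_def coset_eq ..
  also have "\<dots> = (\<lambda>j. j + ?s (lift p)) ` (?s ` J)"
    by (auto simp: subst_add image_iff) (metis subst_add)
  also have "\<dots> = J +>\<^bsub>poly_ring_on W\<^esub> ?s (lift p)"
    unfolding sJ coset_eq by auto
  also have "\<dots> = kap (subst (act \<sigma>) p)"
    unfolding kap_def
  proof (subst coset_eq_iff[OF sl lift_in])
    have "?s (lift p) = subst (\<lambda>i. Var (coord i \<circ> \<rho> (inv \<sigma>))) p"
      by (simp add: lift_def subst_subst)
    moreover have "lift (subst (act \<sigma>) p) = subst (\<lambda>i. \<Sum>j\<in>I. Cst ((coord i \<circ> \<rho> (inv \<sigma>)) (b j)) * Var (coord j)) p"
      by (simp add: lift_def subst_subst act_def subst_sum subst_mult)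
    moreover have "subst (\<lambda>i. Var (coord i \<circ> \<rho> (inv \<sigma>))) p
        - subst (\<lambda>i. \<Sum>j\<in>I. Cst ((coord i \<circ> \<rho> (inv \<sigma>)) (b j)) * Var (coord j)) p \<in> J"
      using comp_in_W[OF inv coord_in_W] coord_in_W Var_mod[OF comp_in_W[OF inv coord_in_W]]
      by (intro subst_cong_mod[OF idl_J _ _ _ assms(2)] polys_in.sum_closed polys_in.mult_closed) auto
    ultimately show "?s (lift p) - lift (subst (act \<sigma>) p) \<in> J" by simp
  qed
  finally show ?thesis .
qed

section \<open>Invariants, transfer and the quotient ring in coordinates\<close>

definition inv_polys :: "('i, 'k) poly_over set" where
  "inv_polys = {p \<in> polys_in I. \<forall>\<sigma>\<in>carrier G. subst (act \<sigma>) p = p}"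

definition tr :: "('i, 'k) poly_over \<Rightarrow> ('i, 'k) poly_over" where
  "tr p = (\<Sum>\<sigma>\<in>carrier G. subst (act \<sigma>) p)"

definition tr_image :: "('i, 'k) poly_over set" where
  "tr_image = tr ` polys_in I"

definition pos_polys :: "('i, 'k) poly_over set" where
  "pos_polys = {p \<in> inv_polys. lookup p 0 = 0}"

lemma subst_act_in: "p \<in> polys_in I \<Longrightarrow> subst (act \<sigma>) p \<in> polys_in I"
  using act_in by (intro subst_in_polys_in) auto

lemma inv_polys_algebra: "comm_algebra inv_polys (Cst :: 'k \<Rightarrow> ('i, 'k) poly_over)"
  by unfold_locales (auto simp: inv_polys_def subst_diff subst_mult Cst_add Cst_mult)

lemma carrier_invariant_ring: "carrier invariant_ring = kap ` inv_polys"
proof -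
  have "kap p \<in> carrier invariant_ring \<longleftrightarrow> p \<in> inv_polys" if "p \<in> polys_in I" for p
    unfolding invariant_ring_def inv_polys_def using that kap_closed coord_act_kap[OF _ that]
    by (simp add: kap_eq_iff subst_act_in)
  moreover have "carrier invariant_ring \<subseteq> kap ` polys_in I"
    unfolding invariant_ring_def carrier_coord_ring by auto
  moreover have "inv_polys \<subseteq> polys_in I" unfolding inv_polys_def by auto
  ultimately show ?thesis by blast
qed

lemma invariant_ring_simps [simp]:
  "x \<oplus>\<^bsub>invariant_ring\<^esub> y = x \<oplus>\<^bsub>coord_ring\<^esub> y" "x \<otimes>\<^bsub>invariant_ring\<^esub> y = x \<otimes>\<^bsub>coord_ring\<^esub> y"
  "\<zero>\<^bsub>invariant_ring\<^esub> = \<zero>\<^bsub>coord_ring\<^esub>" "\<one>\<^bsub>invariant_ring\<^esub> = \<one>\<^bsub>coord_ring\<^esub>"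
  by (simp_all add: invariant_ring_def)

lemma cring_invariant_ring: "cring invariant_ring"
proof -
  interpret C: comm_algebra inv_polys "Cst :: 'k \<Rightarrow> ('i, 'k) poly_over" by (rule inv_polys_algebra)
  interpret R: cring coord_ring by (rule cring_coord_ring)
  have uminus: "\<ominus>\<^bsub>coord_ring\<^esub> kap p = kap (- p)" for p
    using kap_closed kap_add[of "- p" p] by (intro R.minus_equality) (simp_all add: kap_zero)
  have "subring (kap ` inv_polys) coord_ring"
  proof (rule R.subringI)
    show "\<one>\<^bsub>coord_ring\<^esub> \<in> kap ` inv_polys" using kap_one C.one_closed by (metis image_eqI)
  qed (use kap_closed in \<open>auto simp: uminus simp flip: kap_mult kap_add\<close>)
  then have "cring (coord_ring\<lparr>carrier := kap ` inv_polys\<rparr>)"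
    using R.subcringI' R.subcring_iff kap_closed by (metis image_subsetI)
  then show ?thesis
    unfolding carrier_invariant_ring[symmetric] by (simp add: invariant_ring_def)
qed

lemma presented_invariant_ring: "presented_ring inv_polys invariant_ring {0} kap"
proof -
  interpret C: comm_algebra inv_polys "Cst :: 'k \<Rightarrow> ('i, 'k) poly_over" by (rule inv_polys_algebra)
  have sub: "p \<in> polys_in I" if "p \<in> inv_polys" for p using that by (simp add: inv_polys_def)
  show ?thesis
  proof (intro presented_ring.intro presented_ring_axioms.intro)
    show "comm_subring inv_polys" by (rule C.comm_subring_axioms)
    show "cring invariant_ring" by (rule cring_invariant_ring)
    show "C.idl {0}" by (simp add: C.idl_def)
    show "kap ` inv_polys = carrier invariant_ring" by (simp add: carrier_invariant_ring)
    show "kap p = \<zero>\<^bsub>invariant_ring\<^esub> \<longleftrightarrow> p \<in> {0}" if "p \<in> inv_polys" for p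
      using kap_eq_iff[OF sub[OF that], of 0] by (simp flip: kap_zero)
  qed (simp_all add: kap_add kap_mult kap_one)
qed

lemma transfer_kap:
  assumes "p \<in> polys_in I"
  shows "transfer (kap p) = kap (tr p)"
proof -
  interpret R: cring coord_ring by (rule cring_coord_ring)
  have "(\<Oplus>\<^bsub>coord_ring\<^esub>\<sigma>\<in>A. coord_act \<sigma> (kap p)) = kap (\<Sum>\<sigma>\<in>A. subst (act \<sigma>) p)"
    if "finite A" "A \<subseteq> carrier G" for A
    using that
  proof (induction A)
    case (insert \<sigma> F)
    have "(\<lambda>\<sigma>. coord_act \<sigma> (kap p)) \<in> insert \<sigma> F \<rightarrow> carrier coord_ring"
      using insert.prems coord_act_kap[OF _ assms] kap_closed by auto
    then show ?case using insert coord_act_kap[OF _ assms] by (simp add: R.finsum_insert kap_add)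
  qed (simp add: kap_zero)
  then show ?thesis unfolding transfer_def tr_def using finite_G by blast
qed

lemma transfer_image_eq: "transfer_image = kap ` tr_image"
  unfolding transfer_image_def tr_image_def carrier_coord_ring image_image
  using transfer_kap by (intro image_cong) auto

lemma tr_add: "tr (p + q) = tr p + tr q"
  unfolding tr_def by (simp add: subst_add sum.distrib)

lemma tr_mult_inv: "c \<in> inv_polys \<Longrightarrow> tr (c * p) = c * tr p"
  unfolding tr_def inv_polys_def by (simp add: subst_mult sum_distrib_left)

interpretation inv: comm_algebra inv_polys "Cst :: 'k \<Rightarrow> ('i, 'k) poly_over"
  by (rule inv_polys_algebra)

lemma inv_polys_subset: "inv_polys \<subseteq> polys_in I"
  by (auto simp: inv_polys_def)

lemma tr_image_idl:
  assumes "\<And>p. p \<in> polys_in I \<Longrightarrow> tr p \<in> inv_polys"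
  shows "inv.idl tr_image"
  unfolding inv.idl_def tr_image_def
proof (intro conjI ballI)
  show "tr ` polys_in I \<subseteq> inv_polys" using assms by blast
  show "0 \<in> tr ` polys_in I" by (rule image_eqI[of _ _ 0]) (auto simp: tr_def)
  show "a + c \<in> tr ` polys_in I" if "a \<in> tr ` polys_in I" "c \<in> tr ` polys_in I" for a c
    using that by (auto simp flip: tr_add)
  show "c * a \<in> tr ` polys_in I" if "c \<in> inv_polys" "a \<in> tr ` polys_in I" for c a
    using that inv_polys_subset by (auto simp flip: tr_mult_inv)
qed

definition pres :: "('i, 'k) poly_over \<Rightarrow> ('v \<Rightarrow> 'k, 'k) poly_over set set" where
  "pres p = transfer_image +>\<^bsub>invariant_ring\<^esub> kap p"

lemma presented_transfer_quotient:
  assumes "\<And>p. p \<in> polys_in I \<Longrightarrow> tr p \<in> inv_polys"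
  shows "presented_ring inv_polys transfer_quotient tr_image pres"
proof -
  interpret P: presented_ring inv_polys invariant_ring "{0}" kap
    by (rule presented_invariant_ring)
  have id: "ideal transfer_image invariant_ring"
    unfolding transfer_image_eq by (rule P.ideal_image[OF tr_image_idl[OF assms]])
  interpret Id: ideal transfer_image invariant_ring by (rule id)
  have hom: "(+>\<^bsub>invariant_ring\<^esub>) transfer_image \<in> ring_hom invariant_ring transfer_quotient"
    unfolding transfer_quotient_def by (rule Id.rcos_ring_hom)
  have car: "p \<in> inv_polys \<Longrightarrow> kap p \<in> carrier invariant_ring" for p
    unfolding carrier_invariant_ring by blast
  show ?thesis
  proof (intro presented_ring.intro presented_ring_axioms.intro)
    show "comm_subring inv_polys" by (rule inv.comm_subring_axioms)
    show "cring transfer_quotient"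
      unfolding transfer_quotient_def by (rule Id.quotient_is_cring[OF cring_invariant_ring])
    show "inv.idl tr_image" by (rule tr_image_idl[OF assms])
    show "pres ` inv_polys = carrier transfer_quotient"
      unfolding transfer_quotient_def FactRing_def A_RCOSETS_def' pres_def[abs_def] using carrier_invariant_ring by auto
    show "pres 1 = \<one>\<^bsub>transfer_quotient\<^esub>"
      using ring_hom_one[OF hom] by (simp add: pres_def kap_one)
    show "pres (p + q) = pres p \<oplus>\<^bsub>transfer_quotient\<^esub> pres q" if "p \<in> inv_polys" "q \<in> inv_polys" for p q
      using ring_hom_add[OF hom car[OF that(1)] car[OF that(2)]] by (simp add: pres_def kap_add)
    show "pres (p * q) = pres p \<otimes>\<^bsub>transfer_quotient\<^esub> pres q" if "p \<in> inv_polys" "q \<in> inv_polys" for p q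
      using ring_hom_mult[OF hom car[OF that(1)] car[OF that(2)]] by (simp add: pres_def kap_mult)
    show "pres p = \<zero>\<^bsub>transfer_quotient\<^esub> \<longleftrightarrow> p \<in> tr_image" if "p \<in> inv_polys" for p
    proof -
      have "\<zero>\<^bsub>transfer_quotient\<^esub> = transfer_image"
        by (simp add: transfer_quotient_def FactRing_def)
      then have "pres p = \<zero>\<^bsub>transfer_quotient\<^esub> \<longleftrightarrow> kap p \<in> transfer_image"
        unfolding pres_def using Id.a_rcos_const[of "kap p"] Id.a_rcos_self[OF car[OF that]] by auto
      also have "\<dots> \<longleftrightarrow> p \<in> tr_image"
      proof -
        have "tr_image \<subseteq> polys_in I" using assms inv_polys_subset unfolding tr_image_def by blast
        then show ?thesis
          unfolding transfer_image_eq using kap_eq_iff that inv_polys_subset by (auto simp: image_iff)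
      qed
      finally show ?thesis .
    qed
  qed
qed

lemma homog_in_inv: "p \<in> inv_polys \<Longrightarrow> hcomp d p \<in> inv_polys"
  unfolding inv_polys_def using hcomp_subst[of p I "act _" d] homog_act by (auto simp: hcomp_in_polys_in) metis

lemma transfer_quotient_grading_eq:
  "transfer_quotient_grading d = pres ` {p \<in> inv_polys. homog d p}"
proof -
  have "coord_grading d \<inter> carrier invariant_ring = kap ` {p \<in> inv_polys. homog d p}"
  proof -
    have "inj_on kap (polys_in I)" using kap_eq_iff by (auto simp: inj_on_def)
    then have "kap ` ({p \<in> polys_in I. homog d p} \<inter> inv_polys) = kap ` {p \<in> polys_in I. homog d p} \<inter> kap ` inv_polys"
      using inv_polys_subset by (intro inj_on_image_Int[of kap "polys_in I"]) auto
    moreover have "{p \<in> polys_in I. homog d p} \<inter> inv_polys = {p \<in> inv_polys. homog d p}"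
      using inv_polys_subset by auto
    ultimately show ?thesis unfolding coord_grading_eq carrier_invariant_ring by simp
  qed
  then show ?thesis
    unfolding transfer_quotient_grading_def pres_def by (simp add: image_image)
qed

lemma idl_pos_polys: "inv.idl pos_polys"
proof -
  have "lookup (c * p) 0 = lookup c 0 * lookup p 0" for c p :: "('i, 'k) poly_over"
  proof (induction c rule: poly_induct)
    case (single m a)
    show ?case
    proof (cases "m = 0")
      case True
      then show ?thesis using lookup_single_times[of 0 a p 0] by simp
    next
      case False
      then have "0 \<notin> keys (single m a * p)"
        by (auto elim!: keys_mult_elim split: if_splits simp: poly_mapping_eq_iff lookup_add fun_eq_iff)
      then show ?thesis using False by (simp add: in_keys_iff lookup_single)
    qed
  qed (simp add: lookup_add distrib_right)
  then show ?thesis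
    unfolding inv.idl_def pos_polys_def by (auto simp: lookup_add)
qed

text \<open>The irrelevant ideal is only the additive group generated by the components of positive
  degree. Homogeneous components of invariants are invariant because the action is linear, so every
  invariant without constant term is a sum of such components.\<close>

lemma irrelevant_ideal_eq:
  assumes "\<And>p. p \<in> polys_in I \<Longrightarrow> tr p \<in> inv_polys"
  shows "irrelevant_ideal transfer_quotient transfer_quotient_grading = pres ` pos_polys"
proof -
  interpret Q: presented_ring inv_polys transfer_quotient tr_image pres
    by (rule presented_transfer_quotient[OF assms])
  define U where "U = (\<Union>i\<in>{1..}. transfer_quotient_grading i)"
  have Usub: "U \<subseteq> pres ` pos_polys"
  proof
    fix x assume "x \<in> U"
    then obtain d p where "d \<ge> 1" "p \<in> inv_polys" "homog d p" "x = pres p"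
      unfolding U_def transfer_quotient_grading_eq by auto
    moreover have "lookup p 0 = 0"
    proof (rule ccontr)
      assume "lookup p 0 \<noteq> 0"
      then have "mon_degree (0 :: 'i \<Rightarrow>\<^sub>0 nat) = d" using \<open>homog d p\<close> unfolding homog_def by (auto simp: in_keys_iff)
      moreover have "mon_degree (0 :: 'i \<Rightarrow>\<^sub>0 nat) = 0" by (simp add: mon_degree_def)
      ultimately show False using \<open>d \<ge> 1\<close> by simp
    qed
    ultimately show "x \<in> pres ` pos_polys" unfolding pos_polys_def by blast
  qed
  have id: "ideal (pres ` pos_polys) transfer_quotient"
    by (rule Q.ideal_image[OF idl_pos_polys])
  have sub: "subgroup (pres ` pos_polys) (add_monoid transfer_quotient)"
    using ideal.axioms(1)[OF id] additive_subgroup.a_subgroup by blast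
  have grp: "group (add_monoid transfer_quotient)" by (rule Q.R.add.is_group)
  have 1: "generate (add_monoid transfer_quotient) U \<subseteq> pres ` pos_polys"
    by (rule group.generate_subgroup_incl[OF grp Usub sub])
  have Ucar: "U \<subseteq> carrier (add_monoid transfer_quotient)"
    using Usub subgroup.subset[OF sub] by blast
  have gsub: "subgroup (generate (add_monoid transfer_quotient) U) (add_monoid transfer_quotient)"
    by (rule group.generate_is_subgroup[OF grp Ucar])
  have 2: "pres p \<in> generate (add_monoid transfer_quotient) U" if p: "p \<in> pos_polys" for p
  proof -
    have pinv: "p \<in> inv_polys" "lookup p 0 = 0" using p unfolding pos_polys_def by auto
    define n where "n = (\<Sum>m\<in>keys p. mon_degree m)"
    have "(\<Sum>d\<le>n. hcomp d p) = p"
      unfolding n_def by (intro sum_hcomp) (auto intro: member_le_sum)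
    moreover have "pres (\<Sum>d\<in>D. hcomp d p) \<in> generate (add_monoid transfer_quotient) U" if "finite D" for D
      using that
    proof (induction D rule: finite_induct)
      case empty
      then show ?case using subgroup.one_closed[OF gsub] by (simp add: Q.h_zero)
    next
      case (insert d D)
      have "pres (hcomp d p) \<in> generate (add_monoid transfer_quotient) U"
      proof (cases "d = 0")
        case True
        have "hcomp 0 p = 0"
          using pinv(2) by (intro poly_mapping_eqI) (auto simp: lookup_hcomp when_def mon_degree_eq_0)
        then show ?thesis using True subgroup.one_closed[OF gsub] by (simp add: Q.h_zero)
      next
        case False
        then have "pres (hcomp d p) \<in> U"
          unfolding U_def transfer_quotient_grading_eq using homog_in_inv[OF pinv(1)] by (intro UN_I[of d]) auto
        then show ?thesis by (rule generate.incl)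
      qed
      from subgroup.m_closed[OF gsub this insert.IH] show ?case
        using insert homog_in_inv[OF pinv(1)] by (simp add: Q.h_add inv.sum_closed)
    qed
    ultimately show ?thesis by (metis finite_atMost)
  qed
  show ?thesis
    unfolding irrelevant_ideal_def U_def[symmetric] using 1 2 by blast
qed

end

section \<open>Actions of the Klein four-group on polynomials\<close>

text \<open>Only what the argument needs of the action is kept: two commuting linear involutions in
  characteristic 2. Without reference to a representation, the locale also fits the auxiliary action
  that serves for the regular representation.\<close>

locale klein =
  fixes I :: "nat set" and h1 h2 :: "nat \<Rightarrow> (nat, 'k::field) poly_over"
  assumes finite_I: "finite I" and char2: "(2::'k) = 0"
    and h1_in: "i \<in> I \<Longrightarrow> h1 i \<in> polys_in I" and h2_in: "i \<in> I \<Longrightarrow> h2 i \<in> polys_in I"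
    and h1_homog: "i \<in> I \<Longrightarrow> homog 1 (h1 i)" and h2_homog: "i \<in> I \<Longrightarrow> homog 1 (h2 i)"
    and h1_h1: "i \<in> I \<Longrightarrow> subst h1 (h1 i) = Var i" and h2_h2: "i \<in> I \<Longrightarrow> subst h2 (h2 i) = Var i"
    and h1_h2: "i \<in> I \<Longrightarrow> subst h1 (h2 i) = subst h2 (h1 i)"
begin

abbreviation "t1 \<equiv> subst h1"
abbreviation "t2 \<equiv> subst h2"

lemma two_poly: "(2 :: (nat, 'k) poly_over) = 0"
proof -
  have "(2 :: (nat, 'k) poly_over) = Cst 1 + Cst 1" by simp
  also have "\<dots> = Cst 2" by (simp only: Cst_add[symmetric] one_add_one)
  finally show ?thesis using char2 by simp
qed

lemma add_self [simp]: "p + p = (0 :: (nat, 'k) poly_over)"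
  using two_poly by (metis mult_2 mult_zero_left)

lemma add_self_left [simp]: "p + (p + q) = (q :: (nat, 'k) poly_over)"
  by (simp flip: add.assoc)

lemma uminus_char2 [simp]: "- p = (p :: (nat, 'k) poly_over)"
  using add_self[of p] by (simp add: neg_eq_iff_add_eq_0)

lemma minus_char2: "p - q = p + (q :: (nat, 'k) poly_over)"
  using diff_conv_add_uminus[of p q] by simp

lemma eq_iff_add_eq_0: "p = q \<longleftrightarrow> p + q = (0 :: (nat, 'k) poly_over)"
  using minus_char2[of p q] by (metis right_minus_eq)

lemma t1_in: "p \<in> polys_in I \<Longrightarrow> t1 p \<in> polys_in I" and t2_in: "p \<in> polys_in I \<Longrightarrow> t2 p \<in> polys_in I"
  using subst_in_polys_in h1_in h2_in by blast+

lemma t1_t1: "p \<in> polys_in I \<Longrightarrow> t1 (t1 p) = p"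
  unfolding subst_subst using subst_cong_in[of p I "\<lambda>x. t1 (h1 x)" Var] h1_h1 by (simp add: subst_Var_id)

lemma t2_t2: "p \<in> polys_in I \<Longrightarrow> t2 (t2 p) = p"
  unfolding subst_subst using subst_cong_in[of p I "\<lambda>x. t2 (h2 x)" Var] h2_h2 by (simp add: subst_Var_id)

lemma t1_t2: "p \<in> polys_in I \<Longrightarrow> t1 (t2 p) = t2 (t1 p)"
  unfolding subst_subst using h1_h2 by (intro subst_cong_in) auto

definition C :: "(nat, 'k) poly_over set" where
  "C = {p \<in> polys_in I. t1 p = p \<and> t2 p = p}"

definition tr :: "(nat, 'k) poly_over \<Rightarrow> (nat, 'k) poly_over" where
  "tr p = p + t1 p + t2 p + t1 (t2 p)"

definition T :: "(nat, 'k) poly_over set" where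
  "T = tr ` polys_in I"

definition Pos :: "(nat, 'k) poly_over set" where
  "Pos = {p \<in> C. lookup p 0 = 0}"

lemma C_algebra: "comm_algebra C (Cst :: 'k \<Rightarrow> (nat, 'k) poly_over)"
  by unfold_locales (auto simp: C_def subst_diff subst_mult Cst_add Cst_mult)

sublocale C: comm_algebra C "Cst :: 'k \<Rightarrow> (nat, 'k) poly_over"
  by (rule C_algebra)

lemma C_sub: "p \<in> C \<Longrightarrow> p \<in> polys_in I"
  by (simp add: C_def)

lemma tr_in_C: "p \<in> polys_in I \<Longrightarrow> tr p \<in> C"
proof -
  assume p: "p \<in> polys_in I"
  have 1: "t1 (tr p) = tr p"
    unfolding tr_def subst_add by (simp add: t1_t1 p t2_in ac_simps)
  have 2: "t2 (tr p) = tr p"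
    unfolding tr_def subst_add t1_t2[OF p] by (simp add: t2_t2 p t1_in ac_simps)
  have "tr p \<in> polys_in I"
    unfolding tr_def using p t1_in t2_in by (intro polys_in.add_closed) auto
  with 1 2 show ?thesis by (simp add: C_def)
qed

lemma tr_add: "tr (p + q) = tr p + tr q"
  unfolding tr_def by (simp add: subst_add ac_simps)

lemma tr_mult_C: "c \<in> C \<Longrightarrow> tr (c * p) = c * tr p"
  unfolding tr_def C_def by (simp add: subst_mult distrib_left)

lemma tr_T: "p \<in> polys_in I \<Longrightarrow> tr p \<in> T"
  by (simp add: T_def)

lemma idl_T: "C.idl T"
  unfolding C.idl_def T_def
proof (intro conjI ballI)
  show "tr ` polys_in I \<subseteq> C" using tr_in_C by blast
  show "0 \<in> tr ` polys_in I" by (rule image_eqI[of _ _ 0]) (auto simp: tr_def)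
  show "a + c \<in> tr ` polys_in I" if "a \<in> tr ` polys_in I" "c \<in> tr ` polys_in I" for a c
    using that by (auto simp flip: tr_add)
  show "c * a \<in> tr ` polys_in I" if "c \<in> C" "a \<in> tr ` polys_in I" for c a
    using that C_sub by (auto simp flip: tr_mult_C)
qed

lemma hcomp_0_eq: "hcomp 0 p = Cst (lookup p 0)"
  by (rule poly_mapping_eqI) (auto simp: lookup_hcomp Cst_def lookup_single when_def mon_degree_eq_0)

lemma lookup_subst_0:
  fixes h :: "nat \<Rightarrow> (nat, 'k) poly_over"
  assumes "p \<in> polys_in I" "\<And>i. i \<in> I \<Longrightarrow> homog 1 (h i)"
  shows "lookup (subst h p) 0 = lookup p 0"
proof -
  have "(Cst (lookup (subst h p) 0) :: (nat, 'k) poly_over) = Cst (lookup p 0)"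
    using hcomp_subst[of p I h 0] assms by (simp add: hcomp_0_eq)
  then show ?thesis unfolding Cst_def by (metis lookup_single_eq)
qed

lemma T_sub_Pos: "T \<subseteq> Pos"
proof
  fix x assume "x \<in> T"
  then obtain p where p: "p \<in> polys_in I" "x = tr p" unfolding T_def by blast
  have "lookup x 0 = lookup p 0 + lookup p 0 + lookup p 0 + lookup p 0"
    unfolding p(2) tr_def lookup_add using p(1) t2_in h1_homog h2_homog by (simp add: lookup_subst_0)
  also have "\<dots> = 2 * (2 * lookup p 0)" by simp
  finally show "x \<in> Pos" unfolding Pos_def using tr_in_C p char2 by simp
qed

lemma lookup_0_mult: "lookup (c * p) 0 = lookup c 0 * lookup (p :: (nat, 'k) poly_over) 0"
proof -
  have "hcomp 0 (c * p) = hcomp 0 (c * (p - hcomp 0 p)) + hcomp 0 (c * hcomp 0 p)"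
    by (simp add: algebra_simps flip: hcomp_add)
  also have "hcomp 0 (c * hcomp 0 p) = hcomp 0 c * hcomp 0 p"
    using hcomp_mult_homog[of 0 "hcomp 0 p" 0 c] by simp
  also have "hcomp 0 (c * (p - hcomp 0 p)) = 0"
  proof -
    have "0 \<notin> keys (c * (p - hcomp 0 p))"
    proof
      assume "0 \<in> keys (c * (p - hcomp 0 p))"
      then obtain a b where ab: "a \<in> keys c" "b \<in> keys (p - hcomp 0 p)" "0 = a + b"
        by (rule keys_mult_elim) blast
      have "mon_degree a + mon_degree b = 0" using ab(3) mon_degree_add[of a b] by (simp add: mon_degree_def)
      then have "b = 0" by (simp add: mon_degree_eq_0)
      with ab(2) show False by (simp add: in_keys_iff lookup_minus hcomp_0_eq Cst_def)
    qed
    then show ?thesis by (simp add: hcomp_0_eq in_keys_iff)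
  qed
  finally have "(Cst (lookup (c * p) 0) :: (nat, 'k) poly_over) = Cst (lookup c 0 * lookup p 0)" unfolding hcomp_0_eq Cst_mult by simp
  then show ?thesis unfolding Cst_def by (metis lookup_single_eq)
qed

lemma idl_Pos: "C.idl Pos"
  unfolding C.idl_def Pos_def by (auto simp: lookup_add lookup_0_mult)

lemma one_notin_Pos: "1 \<notin> Pos"
  by (simp add: Pos_def)

lemma homog_in_Pos: "p \<in> C \<Longrightarrow> homog d p \<Longrightarrow> 0 < d \<Longrightarrow> p \<in> Pos"
  unfolding Pos_def homog_def using mon_degree_eq_0[of "0 :: nat \<Rightarrow>\<^sub>0 nat"]
  by (cases "0 \<in> keys p") (auto simp: in_keys_iff)

lemma hcomp_C: "p \<in> C \<Longrightarrow> hcomp d p \<in> C"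
  unfolding C_def using hcomp_subst[of p I h1 d] hcomp_subst[of p I h2 d] h1_homog h2_homog
  by (auto simp: hcomp_in_polys_in)

lemma hcomp_tr: "p \<in> polys_in I \<Longrightarrow> hcomp d (tr p) = tr (hcomp d p)"
  unfolding tr_def hcomp_add using h1_homog h2_homog by (simp add: hcomp_subst[where I = I] t2_in hcomp_in_polys_in)

section \<open>Norms of the coordinates and finiteness over them\<close>

definition nrm :: "nat \<Rightarrow> (nat, 'k) poly_over" where
  "nrm i = Var i * h1 i * h2 i * t1 (h2 i)"

lemma nrm_C: "i \<in> I \<Longrightarrow> nrm i \<in> C"
proof -
  assume i: "i \<in> I"
  have "t1 (nrm i) = nrm i"
    unfolding nrm_def subst_mult using i h1_h1 t1_t1 h2_in by (simp add: ac_simps)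
  moreover have "t2 (nrm i) = nrm i"
    unfolding nrm_def subst_mult using i h2_h2 t2_t2 h1_in h1_h2 by (simp add: ac_simps)
  moreover have "nrm i \<in> polys_in I"
    unfolding nrm_def using i h1_in h2_in t1_in by (intro polys_in.mult_closed) auto
  ultimately show ?thesis by (simp add: C_def)
qed

lemma homog_nrm: "i \<in> I \<Longrightarrow> homog 4 (nrm i)"
proof -
  assume i: "i \<in> I"
  have "homog 1 (t1 (h2 i))" by (rule homog_subst[OF h2_homog[OF i] h2_in[OF i] h1_homog])
  then have "homog (1 + 1 + 1 + 1) (nrm i)"
    unfolding nrm_def using h1_homog[OF i] h2_homog[OF i] by (intro homog_mult homog_Var)
  moreover have "1 + 1 + 1 + 1 = (4 :: nat)" by simp
  ultimately show ?thesis by (simp only:)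
qed

lemma nrm_Pos: "i \<in> I \<Longrightarrow> nrm i \<in> Pos"
  using homog_in_Pos[OF nrm_C homog_nrm] by simp

text \<open>For some ordering of the variables every group element keeps the leading monomial of
  each variable, so the norm of the variable i has leading monomial i^4.\<close>

definition triangular :: "nat list \<Rightarrow> bool" where
  "triangular vs \<longleftrightarrow> set vs = I \<and> (\<forall>i\<in>I. lead vs (h1 i) (single i 1) \<and> lead vs (h2 i) (single i 1) \<and>
     lead vs (t1 (h2 i)) (single i 1))"

lemma lead_nrm: "triangular vs \<Longrightarrow> i \<in> I \<Longrightarrow> lead vs (nrm i) (single i 4)"
proof -
  assume tri: "triangular vs" and i: "i \<in> I"
  have "lead vs (Var i :: (nat, 'k) poly_over) (single i 1)"
    unfolding Var_def by (rule lead_single) simp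
  then have "lead vs (nrm i) (single i 1 + single i 1 + single i 1 + single i 1)"
    unfolding nrm_def using tri i unfolding triangular_def by (intro lead_mult) auto
  moreover have "single i 1 + single i 1 + single i 1 + single i 1 = single i (4 :: nat)"
    unfolding single_add[symmetric] by (simp add: eval_nat_numeral)
  ultimately show ?thesis by (simp only:)
qed

text \<open>Holds for sequences of arbitrary polynomials, hence for sequences in \<open>C\<close>.
  That yields both that \<open>C\<close> is noetherian and that it is finite over the algebra of
  norms.\<close>

lemma C_seq:
  assumes "triangular vs" "\<And>i::nat. a i \<in> polys_in I"
  shows "\<exists>k. a k \<in> C.fspan {0} (nrm ` I) (a ` {..<k})"
  using assms lead_nrm nrm_C C_sub unfolding triangular_def
  by (intro pspan_seq[of vs I nrm "\<lambda>_. 4"]) auto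

lemma noetherian_C: "triangular vs \<Longrightarrow> C.noetherian"
  using nrm_C C_seq C_sub by (intro C.noetherian_of_seq[of "nrm ` I"]) auto

lemma finite_C: "triangular vs \<Longrightarrow> \<exists>H. finite H \<and> H \<subseteq> C \<and> C \<subseteq> C.fspan {0} (nrm ` I) H"
  using C_seq C_sub by (intro C.finite_generation_of_seq) auto

text \<open>Under this condition the group preserves the degree in v, on which the equivariance of
  division by \<open>nrm v\<close> rests.\<close>

definition top_var :: "nat \<Rightarrow> bool" where
  "top_var v \<longleftrightarrow> v \<in> I \<and> h1 v - Var v \<in> deg_lt v 1 \<and> h2 v - Var v \<in> deg_lt v 1 \<and>
     (\<forall>x\<in>I. x \<noteq> v \<longrightarrow> h1 x \<in> deg_lt v 1 \<and> h2 x \<in> deg_lt v 1)"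

lemma subst_deg_lt:
  assumes h: "h v - Var v \<in> deg_lt v 1" "\<And>x. x \<in> I \<Longrightarrow> x \<noteq> v \<Longrightarrow> h x \<in> deg_lt v 1"
    and p: "p \<in> polys_in I" "p \<in> deg_lt v n"
  shows "subst h p \<in> deg_lt v n"
proof (induction p rule: poly_keys_induct)
  case (single m c)
  have m: "keys m \<subseteq> I" "lookup m v < n" using single p by (auto simp: polys_in_def deg_lt_def)
  have "Var v \<in> deg_lt v (Suc 1)" using deg_lt_Var_power[of v 1] by simp
  then have "(h v - Var v) + Var v \<in> deg_lt v (Suc 1)"
    using deg_lt_mono[OF h(1), of "Suc 1"] by (intro deg_lt_add) simp_all
  then have hv: "h v \<in> deg_lt v (Suc 1)" by simp
  have pw: "h v ^ e \<in> deg_lt v (Suc e)" for e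
  proof (induction e)
    case (Suc e)
    then show ?case using deg_lt_mult[OF hv Suc] by simp
  qed simp
  have "meval h m = (\<Prod>x\<in>keys m - {v}. h x ^ lookup m x) * h v ^ lookup m v"
  proof (cases "v \<in> keys m")
    case True
    then show ?thesis unfolding meval_def by (simp add: prod.remove mult.commute)
  next
    case False
    then show ?thesis unfolding meval_def by (simp add: in_keys_iff)
  qed
  also have "\<dots> \<in> deg_lt v (Suc (lookup m v))"
    using h(2) m(1) pw by (intro deg_lt_1_mult deg_lt_1_prod deg_lt_1_power) auto
  finally have "Cst c * meval h m \<in> deg_lt v (Suc (lookup m v))"
    by (intro deg_lt_1_mult) simp_all
  then show ?case unfolding subst_single using m(2) by (auto intro: deg_lt_mono)
qed (auto simp: subst_add intro: deg_lt_add)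

lemma t_deg_lt:
  assumes "top_var v" "p \<in> polys_in I" "p \<in> deg_lt v n"
  shows "t1 p \<in> deg_lt v n" "t2 p \<in> deg_lt v n"
  using assms subst_deg_lt unfolding top_var_def by blast+

lemma nrm_deg_lt: "top_var v \<Longrightarrow> i \<in> I \<Longrightarrow> i \<noteq> v \<Longrightarrow> nrm i \<in> deg_lt v 1"
proof -
  assume v: "top_var v" and i: "i \<in> I" "i \<noteq> v"
  have "Var i \<in> deg_lt v 1" using deg_lt_Var[OF i(2)] .
  moreover have h: "h1 i \<in> deg_lt v 1" "h2 i \<in> deg_lt v 1"
    using v i unfolding top_var_def by auto
  moreover have "t1 (h2 i) \<in> deg_lt v 1"
    using t_deg_lt(1)[OF v h2_in[OF i(1)] h(2)] .
  ultimately show ?thesis unfolding nrm_def by (intro deg_lt_1_mult)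
qed

lemma nrm_monic:
  assumes "top_var v"
  shows "nrm v - Var v ^ 4 \<in> deg_lt v 4"
proof -
  have v: "v \<in> I" using assms unfolding top_var_def by blast
  define a where "a = h1 v - Var v"
  define b where "b = h2 v - Var v"
  have ab: "a \<in> deg_lt v 1" "b \<in> deg_lt v 1" using assms unfolding top_var_def a_def b_def by auto
  define d where "d = t1 (h2 v) - Var v"
  have "b \<in> polys_in I" unfolding b_def using h2_in[OF v] v by auto
  then have "t1 b \<in> deg_lt v 1" using t_deg_lt(1)[OF assms _ ab(2)] by blast
  moreover have "d = a + t1 b"
    unfolding d_def a_def b_def by (simp add: subst_diff)
  ultimately have d: "d \<in> deg_lt v 1" using ab by (simp add: deg_lt_add)
  define x :: "(nat, 'k) poly_over" where "x = Var v"
  \<comment> \<open>All four factors are x plus a term free of v, so the product is monic of degree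
    4 in v.\<close>
  have "nrm v = x * (x + a) * (x + b) * (x + d)"
    unfolding nrm_def a_def b_def d_def x_def by simp
  then have "nrm v - Var v ^ 4 = (a + b + d) * x ^ 3 + (a * b + a * d + b * d) * x ^ 2 + a * b * d * x ^ 1"
    unfolding x_def[symmetric] by (simp add: algebra_simps power2_eq_square power3_eq_cube power4_eq_xxxx)
  also have "\<dots> \<in> deg_lt v 4"
  proof -
    have x: "x ^ i \<in> deg_lt v 4" if "i < 4" for i
      unfolding x_def using deg_lt_mono[OF deg_lt_Var_power[of v i], of 4] that by simp
    show ?thesis
      by (intro deg_lt_add deg_lt_1_mult ab d x) simp_all
  qed
  finally show ?thesis .
qed

section \<open>Division by the norm of a top variable\<close>

context
  fixes v assumes v: "top_var v"
begin

abbreviation "qt \<equiv> quot v 4 (nrm v)"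

lemma v_in: "v \<in> I" using v unfolding top_var_def by blast

lemma qt_unique: "p - nrm v * q \<in> deg_lt v 4 \<Longrightarrow> qt p = q"
  by (rule quot_unique[OF nrm_monic[OF v]])

lemma qt_rem: "p - nrm v * qt p \<in> deg_lt v 4"
  by (rule quot_rem(1)[OF nrm_monic[OF v]])

lemma qt_in: "p \<in> polys_in I \<Longrightarrow> qt p \<in> polys_in I"
  by (rule quot_rem(2)[OF nrm_monic[OF v] v_in C_sub[OF nrm_C[OF v_in]]])

lemma qt_add: "qt (p + q) = qt p + qt q"
  using deg_lt_add[OF qt_rem[of p] qt_rem[of q]] by (intro qt_unique) (simp add: algebra_simps)

lemma qt_mult_low: "c \<in> deg_lt v 1 \<Longrightarrow> qt (c * p) = c * qt p"
  using deg_lt_1_mult[OF _ qt_rem[of p], of c] by (intro qt_unique) (simp add: algebra_simps)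

lemma qt_nrm: "qt (nrm v * p) = p"
  by (rule qt_unique) simp

text \<open>Apply a generator to the division of p: the norm is fixed and the remainder still has
  degree below 4 in v, so uniqueness identifies the new quotient.\<close>

lemma qt_equivariant:
  assumes "p \<in> polys_in I"
  shows "qt (t1 p) = t1 (qt p)" "qt (t2 p) = t2 (qt p)"
proof -
  have r: "p - nrm v * qt p \<in> polys_in I"
    using assms qt_in C_sub[OF nrm_C[OF v_in]] by auto
  have N: "t1 (nrm v) = nrm v" "t2 (nrm v) = nrm v" using nrm_C[OF v_in] by (auto simp: C_def)
  show "qt (t1 p) = t1 (qt p)"
    using t_deg_lt(1)[OF v r qt_rem] N by (intro qt_unique) (simp add: subst_diff subst_mult)
  show "qt (t2 p) = t2 (qt p)"
    using t_deg_lt(2)[OF v r qt_rem] N by (intro qt_unique) (simp add: subst_diff subst_mult)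
qed

lemma qt_C: "p \<in> C \<Longrightarrow> qt p \<in> C"
  using qt_equivariant[of p] qt_in[of p] by (auto simp: C_def)

lemma qt_T: "t \<in> T \<Longrightarrow> qt t \<in> T"
proof -
  assume "t \<in> T"
  then obtain p where p: "p \<in> polys_in I" "t = tr p" unfolding T_def by blast
  have "qt t = tr (qt p)"
    unfolding p(2) tr_def qt_add using p(1) by (simp add: qt_equivariant t2_in)
  then show ?thesis using tr_T[OF qt_in[OF p(1)]] by simp
qed

text \<open>The norms of the other variables do not involve v, so taking quotients is linear over
  them.\<close>

lemma qt_exts:
  assumes "\<And>x. x \<in> J \<Longrightarrow> qt x \<in> J" "set ys \<subseteq> I - {v}" "x \<in> C.exts J (map nrm ys)"
  shows "qt x \<in> C.exts J (map nrm ys)"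
  using assms
proof (induction ys arbitrary: J)
  case (Cons y ys)
  have "qt a \<in> C.ext J (nrm y)" if "a \<in> C.ext J (nrm y)" for a
  proof -
    obtain j c where *: "j \<in> J" "c \<in> C" "a = j + c * nrm y" using \<open>a \<in> _\<close> by (rule C.extE) blast
    have "nrm y \<in> deg_lt v 1" using Cons.prems(2) nrm_deg_lt[OF v] by auto
    then have "qt a = qt j + qt c * nrm y"
      unfolding * qt_add using qt_mult_low[of "nrm y" c] by (simp add: mult.commute)
    then show ?thesis using C.extI[OF Cons.prems(1)[OF *(1)] qt_C[OF *(2)]] by simp
  qed
  then show ?case using Cons.IH[of "C.ext J (nrm y)"] Cons.prems by simp
qed simp

text \<open>The quotient map is a left inverse of multiplication by \<open>nrm v\<close> and
  preserves the ideal.\<close>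

lemma nzd_nrm: "set ys \<subseteq> I - {v} \<Longrightarrow> C.nzd (C.exts T (map nrm ys)) (nrm v)"
  unfolding C.nzd_def using qt_exts[of T ys, OF qt_T] qt_nrm by metis

end

lemma reg_nrm:
  assumes "distinct ys" "\<And>y. y \<in> set ys \<Longrightarrow> top_var y"
  shows "C.reg T (map nrm ys)"
  unfolding C.reg_iff_nth
proof (intro allI impI)
  fix i assume i: "i < length (map nrm ys)"
  have "set (take i ys) \<subseteq> I - {ys ! i}"
  proof
    fix x assume "x \<in> set (take i ys)"
    then obtain j where j: "j < i" "j < length ys" "x = ys ! j" by (auto simp: in_set_conv_nth)
    then have "x \<in> set ys" "x \<noteq> ys ! i" using i assms(1) by (auto simp: nth_eq_iff_index_eq)
    then show "x \<in> I - {ys ! i}" using assms(2) unfolding top_var_def by blast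
  qed
  then show "C.nzd (C.exts T (take i (map nrm ys))) (map nrm ys ! i)"
    using nzd_nrm[OF assms(2)[of "ys ! i"]] i by (simp add: take_map)
qed

section \<open>Criteria for dimension, depth and the Cohen-Macaulay property\<close>

lemma krull_dim_ge:
  assumes R: "presented_ring C R T h"
    and T: "\<And>p. p \<in> polys_in I \<Longrightarrow> subst (k 0) (tr p) = (0 :: (nat, 'k) poly_over)"
    and chain: "\<And>i x. i < d \<Longrightarrow> k (Suc i) x = subst (z i) (k i x)"
    and g: "\<And>i. i < d \<Longrightarrow> g i \<in> C" "\<And>i. i < d \<Longrightarrow> subst (k (Suc i)) (g i) = 0"
      "\<And>i. i < d \<Longrightarrow> subst (k i) (g i) \<noteq> 0"
  shows "enat d \<le> krull_dim R"
proof -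
  interpret R: presented_ring C R T h by (rule R)
  \<comment> \<open>The kernels on \<open>C\<close> of substitutions into a polynomial ring are
    prime. They increase because each substitution factors through the previous one, and
    \<open>g i\<close> witnesses strictness.\<close>
  define Q where "Q i = {c \<in> C. subst (k i) c = 0}" for i
  have step: "subst (k (Suc i)) c = subst (z i) (subst (k i) c)" if "i < d" for i c
    unfolding subst_subst by (intro subst_cong) (simp add: chain[OF that])
  have sub: "Q i \<subseteq> Q (Suc i)" if "i < d" for i
    unfolding Q_def using step[OF that] by auto
  show ?thesis
  proof (rule R.krull_dim_ge)
    show "C.prime_idl (Q i)" for i
      unfolding C.prime_idl_def C.idl_def Q_def by (auto simp: subst_add subst_mult)
    show "T \<subseteq> Q i" if "i \<le> d" for i
      using that
    proof (induction i)
      case 0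
      then show ?case using T tr_in_C unfolding Q_def T_def by auto
    next
      case (Suc i)
      then show ?case using sub[of i] by auto
    qed
    show "Q i \<subset> Q (Suc i)" if "i < d" for i
      using sub[OF that] g[OF that] unfolding Q_def by blast
  qed
qed

text \<open>If \<open>C\<close> is finite modulo \<open>T\<close> over the algebra generated by
  \<open>fs\<close>, any \<open>Suc (length fs)\<close> elements are dependent. This bounds the
  dimension and also forbids extending \<open>xs\<close>, since an extended sequence would generate
  1 inside the proper ideal \<open>Pos\<close>.\<close>

lemma depth_CM:
  assumes R: "presented_ring C R T h" and irr: "irrelevant_ideal R gr = h ` Pos"
    and noeth: "C.noetherian"
    and fs: "set fs \<subseteq> C" "finite H" "H \<subseteq> C" "C \<subseteq> C.fspan T (set fs) H"
    and xs: "set xs \<subseteq> Pos" "C.reg T xs" "length xs = length fs"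
    and ge: "enat (length fs) \<le> krull_dim R"
  shows "depth R gr = length fs \<and> cohen_macaulay R gr"
proof -
  interpret R: presented_ring C R T h by (rule R)
  have PosC: "Pos \<subseteq> C" by (auto simp: Pos_def)
  have dep: "C.alg_dep T as" if "set as \<subseteq> C" "length as = Suc (length fs)" for as
    using that fs by (intro C.alg_dep_of_fspan[OF idl_T]) auto
  have "\<not> C.nzd (C.exts T xs) z" if z: "z \<in> Pos" for z
  proof
    assume "C.nzd (C.exts T xs) z"
    then have "C.reg T (xs @ [z])" using xs(2) by (simp add: C.reg_append)
    moreover have "C.alg_dep T (xs @ [z])" using xs PosC z by (intro dep) auto
    ultimately have "1 \<in> C.exts T (xs @ [z])"
      using xs PosC z by (intro C.alg_dep_reg[OF _ idl_T]) auto
    moreover have "C.exts T (xs @ [z]) \<subseteq> Pos"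
      using xs z by (intro C.exts_least[OF idl_Pos T_sub_Pos]) auto
    ultimately show False using one_notin_Pos by blast
  qed
  then have "depth R gr = length xs"
    using R.depth_eq[OF noeth idl_Pos T_sub_Pos one_notin_Pos irr xs(1,2)] by blast
  moreover have "krull_dim R \<le> enat (length fs)"
    using dep by (intro R.krull_dim_le[OF C_algebra]) auto
  ultimately show ?thesis
    unfolding cohen_macaulay_def using ge xs(3) by auto
qed

lemma depth_not_CM:
  assumes R: "presented_ring C R T h" and irr: "irrelevant_ideal R gr = h ` Pos"
    and noeth: "C.noetherian"
    and xs: "set xs \<subseteq> Pos" "C.reg T xs" "\<And>z. z \<in> Pos \<Longrightarrow> \<not> C.nzd (C.exts T xs) z"
    and ge: "enat (Suc (length xs)) \<le> krull_dim R"
  shows "depth R gr = length xs \<and> \<not> cohen_macaulay R gr"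
proof -
  interpret R: presented_ring C R T h by (rule R)
  have "depth R gr = length xs"
    using R.depth_eq[OF noeth idl_Pos T_sub_Pos one_notin_Pos irr xs(1,2)] xs(3) by blast
  moreover have "enat (length xs) < krull_dim R" using ge by (metis Suc_ile_eq)
  ultimately show ?thesis
    unfolding cohen_macaulay_def by auto
qed

text \<open>Modulo the norms, \<open>C\<close> is a finite-dimensional graded algebra, so its positive part is nilpotent.\<close>

lemma Pos_nilpotent:
  assumes tri: "triangular vs" and p: "p \<in> Pos"
  shows "\<exists>n. p ^ n \<in> C.exts {0} (map nrm vs)"
proof -
  define K where "K = C.exts {0} (map nrm vs)"
  have vs: "set vs = I" using tri unfolding triangular_def by blast
  have idl0: "C.idl {0}" by (simp add: C.idl_def)
  have nC: "set (map nrm vs) \<subseteq> C" using vs nrm_C by auto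
  have idlK: "C.idl K" unfolding K_def by (rule C.idl_exts[OF idl0 nC])
  have nK: "nrm i \<in> K" if "i \<in> I" for i
    using C.exts_self[OF idl0 nC] vs that unfolding K_def by auto
  \<comment> \<open>\<open>K\<close> is generated by homogeneous elements of degree 4, so it
    contains all homogeneous components of its elements.\<close>
  have hK: "hcomp d x \<in> K" if "x \<in> K" for d x
  proof -
    have "hcomp d x \<in> C.exts J (map nrm ys)"
      if "\<And>x d. x \<in> J \<Longrightarrow> hcomp d x \<in> J" "set ys \<subseteq> I" "C.idl J" "x \<in> C.exts J (map nrm ys)" for J ys
      using that
    proof (induction ys arbitrary: J)
      case (Cons y ys)
      have y: "y \<in> I" using Cons.prems by simp
      have "hcomp d a \<in> C.ext J (nrm y)" if "a \<in> C.ext J (nrm y)" for a d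
      proof -
        obtain j c where *: "j \<in> J" "c \<in> C" "a = j + c * nrm y" using \<open>a \<in> _\<close> by (rule C.extE) blast
        have "hcomp d (c * nrm y) = (if d < 4 then 0 else hcomp (d - 4) c * nrm y)"
          using hcomp_mult_homog[OF homog_nrm[OF y], of "d - 4" c] hcomp_mult_homog_less[OF homog_nrm[OF y], of d c] by auto
        then have "hcomp d a = hcomp d j + (if d < 4 then 0 else hcomp (d - 4) c) * nrm y"
          unfolding * hcomp_add by simp
        then show ?thesis
          using C.extI[OF Cons.prems(1)[OF *(1), of d], of "if d < 4 then 0 else hcomp (d - 4) c" "nrm y"] hcomp_C[OF *(2)] by simp
      qed
      moreover have "C.idl (C.ext J (nrm y))" using Cons.prems(3) nrm_C[OF y] by (rule C.idl_ext)
      ultimately show ?case using Cons.IH[of "C.ext J (nrm y)"] Cons.prems by simp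
    qed simp
    from this[of "{0}" vs] show ?thesis using that vs idl0 unfolding K_def by simp
  qed
  obtain H where H: "finite H" "H \<subseteq> C" "C \<subseteq> C.fspan {0} (nrm ` I) H"
    using finite_C[OF tri] by blast
  \<comment> \<open>N exceeds the degree of every module generator, so in degrees from N on a
    generator contributes nothing by itself and only multiples of norms remain.\<close>
  define N where "N = (\<Sum>h\<in>H. \<Sum>m\<in>keys h. Suc (mon_degree m))"
  have degH: "mon_degree m < N" if "h \<in> H" "m \<in> keys h" for h m
  proof -
    have "Suc (mon_degree m) \<le> (\<Sum>m\<in>keys h. Suc (mon_degree m))"
      using that by (intro member_le_sum) auto
    also have "\<dots> \<le> N" unfolding N_def using that H by (intro member_le_sum[where f = "\<lambda>h. \<Sum>m\<in>keys h. Suc (mon_degree m)"]) auto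
    finally show ?thesis by simp
  qed
  have high: "hcomp d c \<in> K" if "c \<in> C.fspan {0} (nrm ` I) H" "N \<le> d" for c d
    using that(1)
  proof (induction rule: C.fspan.induct)
    case (base t)
    then show ?case using C.idlD(2)[OF idlK] by simp
  next
    case (gen h)
    have "hcomp d h = 0"
      using degH[OF gen] that(2) by (intro poly_mapping_eqI) (fastforce simp: lookup_hcomp when_def in_keys_iff)
    then show ?case using C.idlD(2)[OF idlK] by simp
  next
    case (cst x c)
    have "hcomp d (x * Cst c) = hcomp d x * Cst c" using hcomp_mult_homog[OF homog_Cst, of d x c] by simp
    then show ?case using C.idlD(5)[OF idlK _ cst.IH] by (simp add: mult.commute)
  next
    case (mult x f)
    have "x \<in> C" using mult(1) H(2) nrm_C by (intro C.fspan_closed[of x "{0}" "nrm ` I" H]) auto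
    then have "f * x \<in> K" using mult(2) nK C.idlD(5)[OF idlK] by auto
    then show ?case by (rule hK)
  next
    case (add x y)
    then show ?case using C.idlD(3)[OF idlK] by (simp add: hcomp_add)
  qed
  have nil_add: "\<exists>n. (a + b) ^ n \<in> K" if "a \<in> C" "b \<in> C" "a ^ m \<in> K" "b ^ n \<in> K" for a b m n
  proof
    have "(a + b) ^ (m + n) = (\<Sum>i\<le>m + n. of_nat ((m + n) choose i) * a ^ i * b ^ (m + n - i))"
      by (rule binomial_ring)
    also have "\<dots> \<in> K"
    proof (rule C.idl_sum[OF idlK])
      fix i assume "i \<in> {..m + n}"
      have nat_C: "of_nat k \<in> C" for k by (induction k) auto
      show "of_nat ((m + n) choose i) * a ^ i * b ^ (m + n - i) \<in> K"
      proof (cases "m \<le> i")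
        case True
        then have "a ^ i = a ^ (i - m) * a ^ m" by (simp flip: power_add)
        then have "a ^ i \<in> K" using C.idlD(4)[OF idlK _ that(3)] that(1) by auto
        then show ?thesis using that nat_C by (intro C.idlD(5)[OF idlK] C.idlD(4)[OF idlK]) auto
      next
        case False
        then have "b ^ (m + n - i) = b ^ (m - i) * b ^ n" by (simp flip: power_add)
        then have "b ^ (m + n - i) \<in> K" using C.idlD(4)[OF idlK _ that(4)] that(2) by auto
        then show ?thesis using that nat_C by (intro C.idlD(4)[OF idlK]) auto
      qed
    qed
    finally show "(a + b) ^ (m + n) \<in> K" .
  qed
  have nil_hom: "\<exists>n. (hcomp d p) ^ n \<in> K" for d
  proof (cases "d = 0")
    case True
    then have "hcomp d p ^ 1 \<in> K" using p C.idlD(2)[OF idlK] unfolding Pos_def by (simp add: hcomp_0_eq)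
    then show ?thesis ..
  next
    case False
    have pC: "hcomp d p ^ N \<in> C" using p hcomp_C unfolding Pos_def by auto
    \<comment> \<open>For d > 0 the N-th power is homogeneous of degree N * d, which is at least
      N.\<close>
    have "hcomp (N * d) (hcomp d p ^ N) \<in> K" using H(3) pC False by (intro high) auto
    moreover have "homog (N * d) (hcomp d p ^ N)" by (intro homog_power homog_hcomp)
    ultimately have "hcomp d p ^ N \<in> K" by (simp add: hcomp_homog)
    then show ?thesis ..
  qed
  have "\<exists>n. (\<Sum>d\<in>D. hcomp d p) ^ n \<in> K" if "finite D" for D
    using that
  proof (induction D rule: finite_induct)
    case empty
    have "(\<Sum>d\<in>{}. hcomp d p) ^ 1 \<in> K" using C.idlD(2)[OF idlK] by simp
    then show ?case ..
  next
    case (insert d D)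
    obtain m n where "hcomp d p ^ m \<in> K" "(\<Sum>d\<in>D. hcomp d p) ^ n \<in> K" using insert.IH nil_hom by blast
    moreover have "hcomp d p \<in> C" "(\<Sum>d\<in>D. hcomp d p) \<in> C" using p hcomp_C unfolding Pos_def by auto
    ultimately show ?case using nil_add insert by simp
  qed
  moreover have "(\<Sum>d\<le>(\<Sum>m\<in>keys p. mon_degree m). hcomp d p) = p"
    by (intro sum_hcomp) (auto intro: member_le_sum)
  ultimately show ?thesis unfolding K_def by (metis finite_atMost)
qed

text \<open>Some power of z lies in the ideal of the norms and therefore kills u; if z were regular,
  u would lie in \<open>J\<close>.\<close>

lemma socle_zero_divisor:
  assumes tri: "triangular vs" and J: "C.idl J" and u: "u \<in> C" "u \<notin> J" "\<And>i. i \<in> I \<Longrightarrow> nrm i * u \<in> J"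
    and z: "z \<in> Pos"
  shows "\<not> C.nzd J z"
proof
  assume nzd: "C.nzd J z"
  have vs: "set vs = I" using tri unfolding triangular_def by blast
  obtain n where n: "z ^ n \<in> C.exts {0} (map nrm vs)" using Pos_nilpotent[OF tri z] by blast
  have "C.exts {0} (map nrm vs) \<subseteq> C.ann J u"
    using u nrm_C vs C.idlD(2)[OF J] by (intro C.exts_least C.idl_ann[OF J]) (auto simp: C.ann_def)
  then have "z ^ n * u \<in> J" using n unfolding C.ann_def by blast
  moreover have "C.nzd J (z ^ n)" using nzd z by (intro C.nzd_power) (auto simp: Pos_def)
  ultimately show False using u unfolding C.nzd_def by blast
qed

end

section \<open>Unipotent actions\<close>

context comm_algebra
begin

text \<open>An element nilpotent modulo \<open>T\<close> is trivially integral modulo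
  \<open>T\<close>, so \<open>fspan_eliminate\<close> removes such elements one by one.\<close>

lemma fspan_eliminate_nilpotent:
  assumes "idl T" "finite E" "\<And>g. g \<in> E \<Longrightarrow> g \<in> C \<and> (\<exists>M. g ^ M \<in> T)" "finite H" "H \<subseteq> C"
  shows "\<exists>H'. finite H' \<and> H' \<subseteq> C \<and> fspan T (E \<union> F) H \<subseteq> fspan T F H'"
  using assms(2-)
proof (induction E arbitrary: H rule: finite_induct)
  case empty
  then show ?case by auto
next
  case (insert g E)
  obtain M where M: "g ^ M \<in> T" and g: "g \<in> C" using insert.prems(1) by auto
  \<comment> \<open>The exponent is raised by one because elimination needs it to be
    positive.\<close>
  have gM: "g ^ Suc M \<in> T" using M g assms(1) by (auto simp: idlD)
  have "g ^ Suc M * h \<in> fspan T (E \<union> F) ((\<lambda>(i, h). g ^ i * h) ` ({..<Suc M} \<times> H))" if "h \<in> H" for h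
    using that insert.prems(3) gM by (intro fspan.base idlD(5)[OF assms(1)]) auto
  from fspan_eliminate[OF assms(1) g insert.prems(3,2) zero_less_Suc this]
  obtain H1 where H1: "finite H1" "H1 \<subseteq> C" "fspan T (insert g (E \<union> F)) H \<subseteq> fspan T (E \<union> F) H1" by blast
  have "\<exists>H'. finite H' \<and> H' \<subseteq> C \<and> fspan T (E \<union> F) H1 \<subseteq> fspan T F H'"
    using insert.prems(1) H1 by (intro insert.IH) auto
  then obtain H2 where "finite H2" "H2 \<subseteq> C" "fspan T (E \<union> F) H1 \<subseteq> fspan T F H2" by (elim exE conjE) (rule that)
  then show ?case using subset_trans[OF H1(3)] by (intro exI[of _ H2]) simp
qed

lemma nilpotent_add:
  assumes "idl T" "t \<in> T" "a \<in> C" "a ^ M \<in> T"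
  shows "(t + a) ^ M \<in> T"
proof -
  have tC: "t \<in> C" using assms(1,2) idlD(1) by blast
  have *: "(t + a) ^ n - a ^ n \<in> T" for n
  proof (induction n)
    case (Suc n)
    have "(t + a) ^ Suc n - a ^ Suc n = (t + a) * ((t + a) ^ n - a ^ n) + t * a ^ n" by (simp add: algebra_simps)
    then show ?case using Suc assms tC by (simp add: idlD)
  qed (simp add: idlD assms)
  from idlD(3)[OF assms(1) *[of M] assms(4)] show ?thesis by simp
qed

end

text \<open>The variables \<open>yi j\<close> are the coordinates dual to the basis vectors \<open>v\<^sub>j\<close>, and the variables \<open>xi j\<close>, which
  the group fixes, those dual to the \<open>w\<^sub>j\<close>.\<close>

definition yi :: "nat \<Rightarrow> nat" where "yi j = 2 * j"
definition xi :: "nat \<Rightarrow> nat" where "xi j = 2 * j + 1"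

lemma yi_xi [simp]: "yi i = yi j \<longleftrightarrow> i = j" "xi i = xi j \<longleftrightarrow> i = j" "yi i \<noteq> xi j" "xi j \<noteq> yi i"
  unfolding yi_def xi_def by presburger+

lemma homog_1_subst_0:
  fixes p :: "('x, 'k::field) poly_over"
  assumes "homog 1 p" "p \<in> polys_in I" "\<And>x. x \<in> I \<Longrightarrow> h x = 0"
  shows "subst h p = 0"
proof (rule poly_keys_induct[of "\<lambda>q. subst h q = 0" p])
  fix m c assume m: "m \<in> keys p"
  then have "mon_degree m = 1" using assms(1) unfolding homog_def by blast
  then have "keys m \<noteq> {}" by (auto simp: mon_degree_def)
  then obtain x where x: "x \<in> keys m" by blast
  then have "h x = 0" using assms(2,3) m by (auto simp: polys_in_def)
  moreover have "lookup m x \<noteq> 0" using x by (simp add: in_keys_iff)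
  ultimately have "h x ^ lookup m x = 0" by (simp add: zero_power)
  then have "meval h m = 0"
    unfolding meval_def using x by (intro prod_zero) auto
  then show "subst h (single m c) = 0" by (simp add: subst_single)
qed (simp_all add: subst_add)

text \<open>The action on linear forms dual to the modules other than kG: the x are fixed, and the
  generators add to \<open>y j\<close> the linear forms \<open>A j\<close> and \<open>B j\<close> in
  the x.\<close>

locale unip = klein I h1 h2 for I and h1 h2 :: "nat \<Rightarrow> (nat, 'k::field) poly_over" +
  fixes r s :: nat and A B :: "nat \<Rightarrow> (nat, 'k) poly_over"
  assumes I_eq: "I = yi ` {1..r} \<union> xi ` {1..s}"
    and h1_y: "j \<in> {1..r} \<Longrightarrow> h1 (yi j) = Var (yi j) + A j"
    and h2_y: "j \<in> {1..r} \<Longrightarrow> h2 (yi j) = Var (yi j) + B j"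
    and h1_x: "j \<in> {1..s} \<Longrightarrow> h1 (xi j) = Var (xi j)"
    and h2_x: "j \<in> {1..s} \<Longrightarrow> h2 (xi j) = Var (xi j)"
    and A_in: "j \<in> {1..r} \<Longrightarrow> A j \<in> polys_in (xi ` {1..s})"
    and B_in: "j \<in> {1..r} \<Longrightarrow> B j \<in> polys_in (xi ` {1..s})"
begin

abbreviation "y j \<equiv> Var (yi j) :: (nat, 'k) poly_over"
abbreviation "x j \<equiv> Var (xi j) :: (nat, 'k) poly_over"
abbreviation "XS \<equiv> polys_in (xi ` {1..s}) :: (nat, 'k) poly_over set"

lemma yi_in: "j \<in> {1..r} \<Longrightarrow> yi j \<in> I" and xi_in: "j \<in> {1..s} \<Longrightarrow> xi j \<in> I"
  using I_eq by auto

lemma y_in: "j \<in> {1..r} \<Longrightarrow> y j \<in> polys_in I"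
  using yi_in by blast

lemma XS_sub: "p \<in> XS \<Longrightarrow> p \<in> polys_in I"
  unfolding I_eq polys_in_def by auto

lemma XS_fixed: "p \<in> XS \<Longrightarrow> t1 p = p" and XS_fixed2: "p \<in> XS \<Longrightarrow> t2 p = p"
proof -
  assume p: "p \<in> XS"
  have "t1 p = subst Var p" "t2 p = subst Var p"
    by (rule subst_cong_in[OF p], use h1_x h2_x in blast)+
  then show "t1 p = p" "t2 p = p" by (simp_all add: subst_Var_id)
qed

lemma XS_C: "p \<in> XS \<Longrightarrow> p \<in> C"
  unfolding C_def using XS_sub XS_fixed XS_fixed2 by auto

lemma x_XS: "j \<in> {1..s} \<Longrightarrow> x j \<in> XS"
  by auto

lemma x_C: "j \<in> {1..s} \<Longrightarrow> x j \<in> C"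
  using XS_C x_XS by blast

lemma t_y: "j \<in> {1..r} \<Longrightarrow> t1 (y j) = y j + A j" "j \<in> {1..r} \<Longrightarrow> t2 (y j) = y j + B j"
  by (simp_all add: h1_y h2_y)

lemma t_AB: "j \<in> {1..r} \<Longrightarrow> t1 (A j) = A j" "j \<in> {1..r} \<Longrightarrow> t2 (A j) = A j"
  "j \<in> {1..r} \<Longrightarrow> t1 (B j) = B j" "j \<in> {1..r} \<Longrightarrow> t2 (B j) = B j"
  using XS_fixed XS_fixed2 A_in B_in by auto

lemma homog_AB: "j \<in> {1..r} \<Longrightarrow> homog 1 (A j)" "j \<in> {1..r} \<Longrightarrow> homog 1 (B j)"
proof -
  assume j: "j \<in> {1..r}"
  have "A j = h1 (yi j) + y j" "B j = h2 (yi j) + y j"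
    using h1_y[OF j] h2_y[OF j] by (simp_all add: ac_simps)
  then show "homog 1 (A j)" "homog 1 (B j)"
    using h1_homog[OF yi_in[OF j]] h2_homog[OF yi_in[OF j]] homog_add homog_Var by metis+
qed

lemma nrm_x: "j \<in> {1..s} \<Longrightarrow> nrm (xi j) = x j ^ 4"
  unfolding nrm_def by (simp add: h1_x h2_x power4_eq_xxxx)

lemma nrm_y: "j \<in> {1..r} \<Longrightarrow> nrm (yi j) = y j * (y j + A j) * (y j + B j) * (y j + A j + B j)"
  unfolding nrm_def by (simp add: h1_y h2_y subst_add t_AB)

text \<open>The 2 x 2 minors of the matrix with rows A and B. These and the two cubic transfers
  below supply the relations modulo \<open>T\<close> for the unipotent modules.\<close>

lemma tr_y2:
  assumes "i \<in> {1..r}" "j \<in> {1..r}"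
  shows "tr (y i * y j) = A i * B j + A j * B i"
  unfolding tr_def using assms by (simp add: subst_mult subst_add h1_y h2_y t_AB algebra_simps two_poly)

lemma tr_y21:
  assumes "i \<in> {1..r}" "j \<in> {1..r}"
  shows "tr (y i ^ 2 * y j) = A i ^ 2 * B j + A j * B i ^ 2"
  unfolding tr_def power2_eq_square using assms
  by (simp add: subst_mult subst_add h1_y h2_y t_AB algebra_simps two_poly)

lemma tr_y3:
  assumes "i \<in> {1..r}"
  shows "tr (y i ^ 3) = A i * B i * (A i + B i)"
  unfolding tr_def power3_eq_cube using assms
  by (simp add: subst_mult subst_add h1_y h2_y t_AB algebra_simps two_poly)

lemma AB2_T: "i \<in> {1..r} \<Longrightarrow> j \<in> {1..r} \<Longrightarrow> A i * B j + A j * B i \<in> T"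
  using tr_T[of "y i * y j"] tr_y2[of i j] y_in[of i] y_in[of j] by simp

lemma AB21_T: "i \<in> {1..r} \<Longrightarrow> j \<in> {1..r} \<Longrightarrow> A i ^ 2 * B j + A j * B i ^ 2 \<in> T"
  using tr_T[of "y i ^ 2 * y j"] tr_y21[of i j] y_in[of i] y_in[of j] by simp

lemma AB3_T: "i \<in> {1..r} \<Longrightarrow> A i * B i * (A i + B i) \<in> T"
  using tr_T[of "y i ^ 3"] tr_y3[of i] y_in[of i] by simp

text \<open>The y come before the x, so each image of \<open>y j\<close> is \<open>y j\<close> plus
  a form in later variables.\<close>

definition vs :: "nat list" where
  "vs = map yi [1..<Suc r] @ map xi [1..<Suc s]"

lemma triangular_vs: "triangular vs"
proof -
  have set: "set vs = I" unfolding vs_def I_eq by (auto simp: atLeastLessThanSuc_atLeastAtMost)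
  have lead: "lead vs (y j + l) (single (yi j) 1)" if j: "j \<in> {1..r}" and l: "l \<in> XS" for j l
  proof -
    define post where "post = map yi [Suc j..<Suc r] @ map xi [1..<Suc s]"
    have "[1..<Suc r] = [1..<j] @ j # [Suc j..<Suc r]"
      using j by (metis atLeastAtMost_iff less_Suc_eq_le upt_add_eq_append upt_conv_Cons le_add_diff_inverse less_imp_le_nat)
    then have vs: "vs = map yi [1..<j] @ yi j # post" unfolding vs_def post_def by simp
    have "set [1..<Suc s] = {1..s}" by auto
    then have "l \<in> polys_in (set post)" using l unfolding post_def polys_in_def by (auto simp del: upt_Suc)
    then show ?thesis unfolding vs by (rule lead_Var_add) (auto simp: post_def)
  qed
  have lead_x: "lead vs (x j) (single (xi j) 1)" for j
    unfolding Var_def by (rule lead_single) simp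
  show ?thesis
    unfolding triangular_def
  proof (intro conjI ballI set)
    fix i assume "i \<in> I"
    then consider j where "i = yi j" "j \<in> {1..r}" | j where "i = xi j" "j \<in> {1..s}" unfolding I_eq by auto
    then have "lead vs (h1 i) (single i 1) \<and> lead vs (h2 i) (single i 1) \<and> lead vs (t1 (h2 i)) (single i 1)"
    proof cases
      case 1
      have "t1 (h2 i) = y j + (A j + B j)"
        using 1 by (simp add: h1_y h2_y subst_add t_AB add.assoc)
      then show ?thesis using 1 lead[OF 1(2), of "A j"] lead[OF 1(2), of "B j"] lead[OF 1(2), of "A j + B j"] A_in B_in
        by (simp add: h1_y h2_y polys_in.add_closed)
    next
      case 2
      then show ?thesis using lead_x by (simp add: h1_x h2_x)
    qed
    then show "lead vs (h1 i) (single i 1)" "lead vs (h2 i) (single i 1)" "lead vs (t1 (h2 i)) (single i 1)" by auto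
  qed
qed

lemma XS_deg_lt: "p \<in> XS \<Longrightarrow> p \<in> deg_lt (yi j) 1"
  unfolding polys_in_def deg_lt_def by (fastforce simp: in_keys_iff)

lemma top_var_y: "j \<in> {1..r} \<Longrightarrow> top_var (yi j)"
  unfolding top_var_def
proof (intro conjI ballI impI)
  assume j: "j \<in> {1..r}"
  show "yi j \<in> I" using yi_in[OF j] .
  show "h1 (yi j) - y j \<in> deg_lt (yi j) 1" "h2 (yi j) - y j \<in> deg_lt (yi j) 1"
    using j h1_y h2_y XS_deg_lt A_in B_in by auto
  fix i assume "i \<in> I" "i \<noteq> yi j"
  then consider l where "i = yi l" "l \<in> {1..r}" "l \<noteq> j" | l where "i = xi l" "l \<in> {1..s}" unfolding I_eq by auto
  then have "h1 i \<in> deg_lt (yi j) 1 \<and> h2 i \<in> deg_lt (yi j) 1"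
  proof cases
    case 1
    have "y l \<in> deg_lt (yi j) 1" using 1 by (intro deg_lt_Var) simp
    then show ?thesis
      using 1 deg_lt_add[OF _ XS_deg_lt[OF A_in[OF 1(2)], of j]] deg_lt_add[OF _ XS_deg_lt[OF B_in[OF 1(2)], of j]]
        h1_y[OF 1(2)] h2_y[OF 1(2)] by simp
  next
    case 2
    then show ?thesis using deg_lt_Var[of "xi l" "yi j"] by (simp add: h1_x h2_x)
  qed
  then show "h1 i \<in> deg_lt (yi j) 1" "h2 i \<in> deg_lt (yi j) 1" by auto
qed

definition norms :: "(nat, 'k) poly_over list" where
  "norms = map nrm (map yi [1..<Suc r])"

lemma length_norms [simp]: "length norms = r"
  unfolding norms_def by simp

lemma set_norms: "set norms = nrm ` yi ` {1..r}"
  unfolding norms_def by (simp add: atLeastLessThanSuc_atLeastAtMost image_image del: upt_Suc)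

lemma norms_Pos: "set norms \<subseteq> Pos"
  unfolding set_norms using nrm_Pos yi_in by auto

lemma Pos_C: "Pos \<subseteq> C"
  by (auto simp: Pos_def)

lemma reg_norms: "C.reg T norms"
  unfolding norms_def using top_var_y by (intro reg_nrm) (auto simp: distinct_map inj_on_def)

section \<open>Chains of primes from restriction to subspaces\<close>

lemma krull_ge_aux:
  assumes k: "\<And>j. j \<in> {1..s} \<Longrightarrow> k (xi j) = 0" "k (yi j) = y j" and j: "j \<in> {1..r}"
  shows "subst k (nrm (yi j)) \<noteq> (0 :: (nat, 'k) poly_over)"
proof -
  have "subst k (A j) = 0" "subst k (B j) = 0"
    using homog_AB[OF j] A_in[OF j] B_in[OF j] k(1) by (auto intro!: homog_1_subst_0[where I = "xi ` {1..s}"])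
  then have "subst k (nrm (yi j)) = y j * y j * y j * y j"
    by (simp add: nrm_y[OF j] subst_mult subst_add k(2))
  moreover have "y j \<noteq> 0" by (metis Var_def lookup_single_eq lookup_zero zero_neq_one)
  ultimately show ?thesis by simp
qed

lemma krull_ge_r:
  assumes R: "presented_ring C R T h"
  shows "enat r \<le> krull_dim R"
proof (rule krull_dim_ge[OF R])
  \<comment> \<open>Odd indices are the x, which all vanish; even indices up to 2 i are the
    variables y_1, ..., y_i, which are killed one after another.\<close>
  define k :: "nat \<Rightarrow> nat \<Rightarrow> (nat, 'k) poly_over" where
    "k i v = (if odd v \<or> v div 2 \<le> i then 0 else Var v)" for i v
  define z :: "nat \<Rightarrow> nat \<Rightarrow> (nat, 'k) poly_over" where
    "z i v = (if v div 2 = Suc i then 0 else Var v)" for i v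
  have kx: "k i (xi j) = 0" and ky: "k i (yi j) = (if j \<le> i then 0 else y j)" for i j
    unfolding k_def xi_def yi_def by auto
  show "k (Suc i) v = subst (z i) (k i v)" for i v
    unfolding k_def z_def by auto
  \<comment> \<open>Where all x vanish, both generators act trivially, so the transfer restricts to
    a sum of four equal terms.\<close>
  have inv: "subst (k 0) (h1 v) = k 0 v" "subst (k 0) (h2 v) = k 0 v" if v: "v \<in> I" for v
  proof -
    consider j where "v = yi j" "j \<in> {1..r}" | j where "v = xi j" "j \<in> {1..s}" using v unfolding I_eq by blast
    then have "subst (k 0) (h1 v) = k 0 v \<and> subst (k 0) (h2 v) = k 0 v"
    proof cases
      case 1
      have "subst (k 0) (A j) = 0" "subst (k 0) (B j) = 0"
        using homog_AB[OF 1(2)] A_in[OF 1(2)] B_in[OF 1(2)] kx by (auto intro!: homog_1_subst_0[where I = "xi ` {1..s}"])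
      then show ?thesis using 1 by (simp add: h1_y h2_y subst_add)
    qed (simp add: h1_x h2_x)
    then show "subst (k 0) (h1 v) = k 0 v" "subst (k 0) (h2 v) = k 0 v" by auto
  qed
  have inv': "subst (k 0) (t1 p) = subst (k 0) p" "subst (k 0) (t2 p) = subst (k 0) p" if "p \<in> polys_in I" for p
    unfolding subst_subst using inv by (auto intro!: subst_cong_in[OF that])
  show "subst (k 0) (tr p) = 0" if "p \<in> polys_in I" for p
    unfolding tr_def using that inv' t2_in by (simp add: subst_add add.assoc)
  show "nrm (yi (Suc i)) \<in> C" if "i < r" for i
    using that by (intro nrm_C yi_in) auto
  show "subst (k (Suc i)) (nrm (yi (Suc i))) = 0" if "i < r" for i
    unfolding nrm_def subst_mult by (simp add: ky)
  show "subst (k i) (nrm (yi (Suc i))) \<noteq> 0" if "i < r" for i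
    using that by (intro krull_ge_aux) (simp_all add: kx ky)
qed

text \<open>No \<open>B j\<close> involves x_1, so the second generator still acts trivially where
  only x_2, ..., x_s vanish. This already cancels the terms of the transfer in pairs and leaves a
  space of one dimension more.\<close>

lemma krull_ge_Suc_r:
  assumes R: "presented_ring C R T h" and s: "1 \<le> s"
    and B: "\<And>j. j \<in> {1..r} \<Longrightarrow> B j \<in> polys_in (xi ` {2..s})"
  shows "enat (Suc r) \<le> krull_dim R"
proof (rule krull_dim_ge[OF R])
  \<comment> \<open>At i = 0 all y and x_1 survive, at i = 1 only the y, and from there y_1, y_2,
    ... are killed one by one.\<close>
  define k :: "nat \<Rightarrow> nat \<Rightarrow> (nat, 'k) poly_over" where
    "k i v = (if odd v \<and> (0 < i \<or> v \<noteq> xi 1) \<or> even v \<and> v div 2 < i then 0 else Var v)" for i v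
  define z :: "nat \<Rightarrow> nat \<Rightarrow> (nat, 'k) poly_over" where
    "z i v = (if i = 0 \<and> v = xi 1 \<or> v = yi i then 0 else Var v)" for i v
  have kx: "k i (xi j) = (if 0 < i \<or> j \<noteq> 1 then 0 else x j)" and ky: "k i (yi j) = (if j < i then 0 else y j)" for i j
    unfolding k_def xi_def yi_def by auto
  show "k (Suc i) v = subst (z i) (k i v)" for i v
    unfolding k_def z_def xi_def yi_def by (auto elim!: evenE oddE)
  have inv: "subst (k 0) (h2 v) = k 0 v" if v: "v \<in> I" for v
  proof -
    consider j where "v = yi j" "j \<in> {1..r}" | j where "v = xi j" "j \<in> {1..s}" using v unfolding I_eq by blast
    then show ?thesis
    proof cases
      case 1
      have "subst (k 0) (B j) = 0"
        using homog_AB[OF 1(2)] B[OF 1(2)] kx by (auto intro!: homog_1_subst_0[where I = "xi ` {2..s}"])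
      then show ?thesis using 1 by (simp add: h2_y subst_add)
    qed (simp add: h2_x)
  qed
  have inv': "subst (k 0) (t2 p) = subst (k 0) p" if "p \<in> polys_in I" for p
    unfolding subst_subst using inv by (auto intro!: subst_cong_in[OF that])
  show "subst (k 0) (tr p) = 0" if "p \<in> polys_in I" for p
    unfolding tr_def t1_t2[OF that] using that inv' t1_in by (simp add: subst_add ac_simps)
  define g where "g i = (if i = 0 then x 1 else nrm (yi i))" for i
  show "g i \<in> C" if "i < Suc r" for i
    using that s x_C[of 1] by (auto simp: g_def intro!: nrm_C yi_in)
  show "subst (k (Suc i)) (g i) = 0" if "i < Suc r" for i
    unfolding g_def nrm_def by (simp add: subst_mult kx ky)
  show "subst (k i) (g i) \<noteq> 0" if "i < Suc r" for i
  proof (cases "i = 0")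
    case True
    have "x 1 \<noteq> 0" by (metis Var_def lookup_single_eq lookup_zero zero_neq_one)
    then show ?thesis using True by (simp add: g_def kx)
  next
    case False
    then show ?thesis unfolding g_def using that krull_ge_aux[of "k i" i] by (simp add: kx ky)
  qed
qed

text \<open>The norm of \<open>x j\<close> is its fourth power and thus nilpotent modulo
  \<open>T\<close>. Eliminating these norms leaves \<open>C\<close> finite modulo \<open>T\<close>
  over the r norms of the y, which also form a regular sequence.\<close>

lemma depth_CM_of_nilpotent:
  assumes R: "presented_ring C R T h" and irr: "irrelevant_ideal R gr = h ` Pos"
    and nil: "\<And>j. j \<in> {1..s} \<Longrightarrow> \<exists>M. x j ^ M \<in> T"
  shows "depth R gr = r \<and> cohen_macaulay R gr"
proof -
  obtain H where H: "finite H" "H \<subseteq> C" "C \<subseteq> C.fspan {0} (nrm ` I) H"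
    using finite_C[OF triangular_vs] by blast
  have sub: "C.fspan {0} (nrm ` I) H \<subseteq> C.fspan T (nrm ` xi ` {1..s} \<union> set norms) H"
    using C.idlD(2)[OF idl_T] unfolding set_norms I_eq by (intro subsetI) (erule C.fspan_mono, auto)
  have "\<exists>H'. finite H' \<and> H' \<subseteq> C \<and> C.fspan T (nrm ` xi ` {1..s} \<union> set norms) H \<subseteq> C.fspan T (set norms) H'"
  proof (rule C.fspan_eliminate_nilpotent[OF idl_T _ _ H(1,2)])
    fix g assume "g \<in> nrm ` xi ` {1..s}"
    then obtain j where j: "j \<in> {1..s}" "g = x j ^ 4" using nrm_x by auto
    obtain M where M: "x j ^ M \<in> T" using nil[OF j(1)] by blast
    have "g ^ M = (x j ^ M) ^ 3 * x j ^ M"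
      unfolding j(2) by (simp flip: power_mult power_add add: mult.commute)
    then have "g ^ M \<in> T" using M C.idlD(1,4)[OF idl_T] by auto
    then show "g \<in> C \<and> (\<exists>M. g ^ M \<in> T)" using x_C[OF j(1)] j(2) by auto
  qed simp
  then obtain H' where H': "finite H'" "H' \<subseteq> C"
    "C.fspan T (nrm ` xi ` {1..s} \<union> set norms) H \<subseteq> C.fspan T (set norms) H'" by (elim exE conjE) (rule that)
  then have "C \<subseteq> C.fspan T (set norms) H'" using H(3) sub by (meson subset_trans)
  then show ?thesis
    using depth_CM[OF R irr noetherian_C[OF triangular_vs], of norms H' norms] H' norms_Pos Pos_C reg_norms krull_ge_r[OF R] by auto
qed

end

lemma single_add_single_eq:
  assumes "c \<noteq> d"
  shows "single a (1::nat) + single b 1 = single c 1 + single d 1 \<longleftrightarrow> a = c \<and> b = d \<or> a = d \<and> b = c"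
proof
  assume eq: "single a (1::nat) + single b 1 = single c 1 + single d 1"
  have "lookup (single a (1::nat) + single b 1) c = 1" "lookup (single a (1::nat) + single b 1) d = 1"
    unfolding eq using assms by (simp_all add: lookup_add lookup_single)
  then show "a = c \<and> b = d \<or> a = d \<and> b = c"
    using assms by (auto simp: lookup_add lookup_single when_def split: if_splits)
qed (auto simp: add.commute)

lemma lookup_Var_times_Var:
  assumes "c \<noteq> d"
  shows "lookup (Var a * Var b :: ('x, 'k::field) poly_over) (single c 1 + single d 1) =
    (if a = c \<and> b = d \<or> a = d \<and> b = c then 1 else 0)"
  using single_add_single_eq[OF assms, of a b] by (auto simp: Var_def mult_single lookup_single when_def)

lemma mon_degree_Suc:
  assumes "mon_degree m = Suc n"
  shows "\<exists>a m'. m = single a 1 + m' \<and> mon_degree m' = n \<and> a \<in> keys m"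
proof -
  have "keys m \<noteq> {}" using assms by (auto simp: mon_degree_def)
  then obtain a where a: "a \<in> keys m" by blast
  define m' where "m' = m - single a 1"
  have m: "m = single a 1 + m'"
    unfolding m'_def using a
    by (intro poly_mapping_eqI) (auto simp: lookup_add lookup_minus lookup_single when_def in_keys_iff)
  then have "mon_degree m' = n" using assms by (metis mon_degree_add mon_degree_single plus_1_eq_Suc nat.inject)
  with m a show ?thesis by blast
qed

context unip
begin

text \<open>The value 0 out of range reflects the conventions v_0 = 0 and v_(m+1) = 0, which
  truncate the shifted indices.\<close>

definition xx :: "nat \<Rightarrow> (nat, 'k) poly_over" where
  "xx j = (if 1 \<le> j \<and> j \<le> s then x j else 0)"

lemma xx_XS: "xx j \<in> XS"
  by (auto simp: xx_def)

lemma xx_C: "xx j \<in> C"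
  using XS_C xx_XS by blast

text \<open>Downward induction on j. The transfer of y_j^3 equals lam (1 + lam) x_j^3 plus a
  multiple of x_(j+1), and in characteristic 2 the coefficient vanishes only for lam = 0 and lam =
  1.\<close>

lemma depth_V:
  assumes R: "presented_ring C R T h" and irr: "irrelevant_ideal R gr = h ` Pos"
    and rs: "r = s" and lam: "lam \<noteq> 0" "lam \<noteq> 1"
    and A: "\<And>j. j \<in> {1..r} \<Longrightarrow> A j = x j" and B: "\<And>j. j \<in> {1..r} \<Longrightarrow> B j = Cst lam * x j + xx (Suc j)"
  shows "depth R gr = r \<and> cohen_macaulay R gr"
proof (rule depth_CM_of_nilpotent[OF R irr])
  fix j assume "j \<in> {1..s}"
  then show "\<exists>M. x j ^ M \<in> T"
  proof (induction "s - j" arbitrary: j rule: less_induct)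
    case less
    have j: "j \<in> {1..r}" using less.prems rs by simp
    \<comment> \<open>For the last index, \<open>xx (Suc j)\<close> is 0, which starts the
      induction.\<close>
    have Z: "\<exists>M. xx (Suc j) ^ M \<in> T"
    proof (cases "j < s")
      case True
      then show ?thesis using less.hyps[of "Suc j"] by (simp add: xx_def)
    next
      case False
      then have "xx (Suc j) ^ 1 \<in> T" using C.idlD(2)[OF idl_T] by (simp add: xx_def)
      then show ?thesis ..
    qed
    then obtain M where M: "xx (Suc j) ^ M \<in> T" by blast
    define p where "p = x j"
    define z where "z = xx (Suc j)"
    define w where "w = p ^ 2 + p * z"
    define t where "t = A j * B j * (A j + B j)"
    have tT: "t \<in> T" unfolding t_def by (rule AB3_T[OF j])
    have "t = p * (Cst lam * p + z) * (p + (Cst lam * p + z))"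
      unfolding t_def A[OF j] B[OF j] p_def z_def ..
    also have "\<dots> = Cst lam * (1 + Cst lam) * p ^ 3 + z * w"
      unfolding w_def by (simp add: algebra_simps power2_eq_square power3_eq_cube two_poly)
    finally have eq: "Cst (lam * (1 + lam)) * p ^ 3 = t + z * w"
      by (simp add: Cst_mult Cst_add two_poly)
    have pC: "p \<in> C" "z \<in> C" "w \<in> C"
      unfolding w_def p_def z_def using xx_C x_C j rs by auto
    \<comment> \<open>The cube of p is, up to a unit, an element of \<open>T\<close> plus a
      nilpotent element, hence nilpotent modulo \<open>T\<close>.\<close>
    have "(z * w) ^ M \<in> T"
      unfolding power_mult_distrib using M pC C.idlD(5)[OF idl_T] unfolding z_def[symmetric] by auto
    then have "(Cst (lam * (1 + lam)) * p ^ 3) ^ M \<in> T"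
      unfolding eq using tT pC by (intro C.nilpotent_add[OF idl_T]) auto
    then have "Cst (1 / (lam * (1 + lam))) ^ M * (Cst (lam * (1 + lam)) * p ^ 3) ^ M \<in> T"
      by (intro C.idlD(4)[OF idl_T]) auto
    also have "Cst (1 / (lam * (1 + lam))) ^ M * (Cst (lam * (1 + lam)) * p ^ 3) ^ M =
        (Cst (1 / (lam * (1 + lam)) * (lam * (1 + lam))) * p ^ 3) ^ M"
      unfolding power_mult_distrib[symmetric] Cst_mult by (simp add: mult.assoc)
    also have "1 / (lam * (1 + lam)) * (lam * (1 + lam)) = 1"
    proof -
      have "(1 + lam) \<noteq> 0"
        using lam(2) char2 by (metis add_diff_cancel_right' diff_0 minus_equation_iff one_add_one add.inverse_inverse add_eq_0_iff)
      then show ?thesis using lam(1) by simp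
    qed
    finally have "p ^ (3 * M) \<in> T" by (simp add: power_mult)
    then show ?case unfolding p_def by blast
  qed
qed

text \<open>The quadratic transfers give x_(i+1) x_j = x_i x_(j+1) modulo \<open>T\<close>. Lowering
  the first index until it reaches 0 shows that all products of two x lie in
  \<open>T\<close>.\<close>

lemma depth_Omega_neg:
  assumes R: "presented_ring C R T h" and irr: "irrelevant_ideal R gr = h ` Pos"
    and rs: "r = Suc s"
    and A: "\<And>j. j \<in> {1..r} \<Longrightarrow> A j = xx j" and B: "\<And>j. j \<in> {1..r} \<Longrightarrow> B j = xx (j - 1)"
  shows "depth R gr = r \<and> cohen_macaulay R gr"
proof (rule depth_CM_of_nilpotent[OF R irr])
  have prod: "xx i * xx j \<in> T" for i j
  proof (induction i arbitrary: j)
    case 0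
    then show ?case using C.idlD(2)[OF idl_T] by (simp add: xx_def)
  next
    case (Suc i)
    show ?case
    proof (cases "Suc i \<le> s \<and> j \<le> s")
      case True
      then have "A (Suc i) * B (Suc j) + A (Suc j) * B (Suc i) \<in> T" using rs by (intro AB2_T) auto
      then have "xx (Suc i) * xx j + xx i * xx (Suc j) \<in> T" using True rs A B by (simp add: mult.commute)
      from C.idlD(7)[OF idl_T this Suc.IH[of "Suc j"]] show ?thesis by simp
    next
      case False
      then show ?thesis using C.idlD(2)[OF idl_T] by (auto simp: xx_def)
    qed
  qed
  fix j assume "j \<in> {1..s}"
  then have "x j ^ 2 \<in> T" using prod[of j j] by (simp add: xx_def power2_eq_square)
  then show "\<exists>M. x j ^ M \<in> T" ..
qed

text \<open>The norms have degree 4, so adding them to \<open>T\<close> changes nothing in degree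
  2.\<close>

lemma hcomp_2_exts_norms: "p \<in> C.exts T norms \<Longrightarrow> hcomp 2 p \<in> T"
proof -
  have "hcomp 2 p \<in> T" if "\<And>p. p \<in> J \<Longrightarrow> hcomp 2 p \<in> T" "set zs \<subseteq> I" "p \<in> C.exts J (map nrm zs)" for J zs p
    using that
  proof (induction zs arbitrary: J)
    case (Cons z zs)
    have "hcomp 2 a \<in> T" if a: "a \<in> C.ext J (nrm z)" for a
    proof -
      obtain j c where *: "j \<in> J" "c \<in> C" "a = j + c * nrm z" using a by (rule C.extE) blast
      have "hcomp 2 (c * nrm z) = 0"
        using Cons.prems(2) by (intro hcomp_mult_homog_less[OF homog_nrm]) auto
      then show ?thesis using Cons.prems(1)[OF *(1)] unfolding * hcomp_add by simp
    qed
    then show ?case using Cons.IH[of "C.ext J (nrm z)"] Cons.prems by simp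
  qed simp
  moreover have "hcomp 2 p \<in> T" if "p \<in> T" for p
    using that unfolding T_def by (auto simp: hcomp_tr hcomp_in_polys_in)
  moreover have "set (map yi [1..<Suc r]) \<subseteq> I" using yi_in by (auto simp del: upt_Suc)
  ultimately show "p \<in> C.exts T norms \<Longrightarrow> hcomp 2 p \<in> T"
    unfolding norms_def by blast
qed

lemma tr_Var: "v \<in> I \<Longrightarrow> tr (Var v) = 0"
proof -
  assume v: "v \<in> I"
  then consider j where "v = yi j" "j \<in> {1..r}" | j where "v = xi j" "j \<in> {1..s}" unfolding I_eq by blast
  then show ?thesis
  proof cases
    case 1
    then show ?thesis unfolding tr_def by (simp add: h1_y h2_y subst_add t_AB algebra_simps two_poly)
  next
    case 2
    then show ?thesis unfolding tr_def by (simp add: h1_x h2_x add.assoc)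
  qed
qed

text \<open>The element \<open>x\<^sub>2 (x\<^sub>1 + x\<^sub>2)\<close> is annihilated by every \<open>x\<^sub>l\<close> modulo \<open>T\<close> but lies outside \<open>T\<close> plus the
  norms, so the norms cannot be extended to a longer regular sequence.\<close>

lemma depth_hankel:
  assumes R: "presented_ring C R T h" and irr: "irrelevant_ideal R gr = h ` Pos"
    and r: "2 \<le> r" and s: "s = r \<or> s = Suc r"
    and A: "\<And>j. j \<in> {1..r} \<Longrightarrow> A j = x j" and B: "\<And>j. j \<in> {1..r} \<Longrightarrow> B j = xx (Suc j)"
  shows "depth R gr = r \<and> \<not> cohen_macaulay R gr"
proof -
  define u where "u = x 1 * x 2 + x 2 ^ 2"
  have Q: "x i * xx (Suc j) + x j * xx (Suc i) \<in> T" if "i \<in> {1..r}" "j \<in> {1..r}" for i j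
    using AB2_T[OF that] A B that by simp
  have E: "x i ^ 2 * xx (Suc j) + x j * xx (Suc i) ^ 2 \<in> T" if "i \<in> {1..r}" "j \<in> {1..r}" for i j
    using AB21_T[OF that] A B that by simp
  have xC: "x j \<in> C" if "j \<in> {1..r}" for j using that s by (intro x_C) auto
  have uC: "u \<in> C" unfolding u_def using xC[of 1] xC[of 2] r by auto
  have x2: "xx (Suc 1) = x 2" "xx 2 = x 2" using r s by (auto simp: xx_def numeral_2_eq_2)
  have xu: "x l * u \<in> T" if l: "l \<in> {1..s}" for l
  proof (cases "l \<le> r")
    case True
    then have l': "l \<in> {1..r}" "1 \<in> {1..r}" using l r by auto
    \<comment> \<open>For l at most r the quadratic and the cubic transfer of the pair (1, l)
      suffice.\<close>
    have "x l * u = x 1 * (x 1 * xx (Suc l) + x l * xx (Suc 1)) + (x 1 ^ 2 * xx (Suc l) + x l * xx (Suc 1) ^ 2)"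
      unfolding u_def x2 by (simp add: algebra_simps power2_eq_square two_poly)
    also have "\<dots> \<in> T"
      by (rule C.idlD(3)[OF idl_T C.idlD(4)[OF idl_T xC[OF l'(2)] Q[OF l'(2,1)]] E[OF l'(2,1)]])
    finally show ?thesis .
  next
    case False
    then have l': "l = Suc r" using l s by auto
    have mem: "1 \<in> {1..r}" "2 \<in> {1..r}" "r \<in> {1..r}" "r - 1 \<in> {1..r}" using r by auto
    have eqs: "xx (Suc r) = x l" "xx (Suc (r - 1)) = x r" using l' l r s unfolding xx_def by auto
    \<comment> \<open>The variable x_(r+1) is no \<open>A j\<close> but equals \<open>B r\<close>,
      so the transfers of the pairs (1, r), (2, r) and (2, r - 1) are combined.\<close>
    have "x l * u = x 2 * (x 1 * xx (Suc r) + x r * xx (Suc 1)) + x 2 * (x 2 * xx (Suc r) + x r * xx (Suc 2))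
        + (x 2 ^ 2 * xx (Suc (r - 1)) + x (r - 1) * xx (Suc 2) ^ 2)
        + xx (Suc 2) * (x 2 * xx (Suc (r - 1)) + x (r - 1) * xx (Suc 2))"
      unfolding u_def eqs x2 by (simp add: algebra_simps power2_eq_square two_poly)
    also have "\<dots> \<in> T"
      by (intro C.idlD(3)[OF idl_T] C.idlD(4)[OF idl_T] Q E xC xx_C mem)
    finally show ?thesis .
  qed
  have idlJ: "C.idl (C.exts T norms)" using norms_Pos Pos_C by (intro C.idl_exts[OF idl_T]) auto
  have TJ: "T \<subseteq> C.exts T norms" using norms_Pos Pos_C by (intro C.exts_subset[OF idl_T]) auto
  \<comment> \<open>The monomial x_1 x_2 occurs in u with coefficient 1. It is shown to have
    coefficient 0 in the transfer of every quadratic form.\<close>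
  define e where "e = single (xi 1) (1::nat) + single (xi 2) 1"
  have ne: "xi 1 \<noteq> xi 2" by simp
  have uJ: "u \<notin> C.exts T norms"
  proof
    assume "u \<in> C.exts T norms"
    moreover have "homog 2 u"
    proof -
      have "homog (1 + 1) (Var a * Var b :: (nat, 'k) poly_over)" for a b by (intro homog_mult homog_Var)
      then have "homog 2 (Var a * Var b :: (nat, 'k) poly_over)" for a b by (simp only: one_add_one)
      then show ?thesis unfolding u_def power2_eq_square by (intro homog_add) simp_all
    qed
    ultimately have "u \<in> T" using hcomp_2_exts_norms[of u] by (simp add: hcomp_homog)
    then obtain p where p: "p \<in> polys_in I" "u = tr p" unfolding T_def by blast
    then have u: "u = tr (hcomp 2 p)" using hcomp_tr[OF p(1), of 2] \<open>homog 2 u\<close> by (simp add: hcomp_homog)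
    have "lookup (tr q) e = 0" if q: "homog 2 q" "q \<in> polys_in I" for q
    proof (rule poly_keys_induct[of "\<lambda>q. lookup (tr q) e = 0" q])
      fix m and c :: 'k assume m: "m \<in> keys q"
      then have "mon_degree m = Suc 1" using q(1) by (auto simp: homog_def)
      then obtain a m' where a: "m = single a 1 + m'" "mon_degree m' = 1" "a \<in> keys m"
        using mon_degree_Suc by blast
      then obtain b m'' where b: "m' = single b 1 + m''" "mon_degree m'' = 0" "b \<in> keys m'"
        using mon_degree_Suc[of m' 0] by auto
      have mm: "m = single a 1 + single b 1" using a b by (simp add: mon_degree_eq_0)
      have I: "a \<in> I" "b \<in> I" using a b m q(2) by (auto simp: polys_in_def keys_add_nat)
      have sing: "single m c = Cst c * (Var a * Var b)"
        unfolding mm Var_def by (simp add: mult_single Cst_times_single)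
      have "lookup (tr (Var a * Var b)) e = 0"
      proof -
        consider i j where "a = yi i" "b = yi j" "i \<in> {1..r}" "j \<in> {1..r}"
          | i where "a = xi i" "i \<in> {1..s}" | i where "b = xi i" "i \<in> {1..s}"
          using I unfolding I_eq by blast
        then show ?thesis
        proof cases
          case 1
          \<comment> \<open>In the transfer of y_i y_j the monomial x_1 x_2 arises only for i = j =
            1, and then twice.\<close>
          have "lookup (x i * xx (Suc j)) e = (if i = 1 \<and> j = 1 then 1 else 0)" if "i \<in> {1..r}" "j \<in> {1..r}" for i j
            unfolding xx_def e_def using that lookup_Var_times_Var[OF ne, of "xi i" "xi (Suc j)", where 'k = 'k] s r by auto
          then have "lookup (tr (Var a * Var b)) e = (if i = 1 \<and> j = 1 then 1 else 0) + (if i = 1 \<and> j = 1 then 1 else 0)"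
            unfolding 1(1,2) tr_y2[OF 1(3,4)] lookup_add using 1 A B by auto
          then show ?thesis using char2 by simp
        next
          case 2
          then show ?thesis using tr_mult_C[OF x_C[OF 2(2)], of "Var b"] tr_Var[OF I(2)] by simp
        next
          case 3
          then show ?thesis using tr_mult_C[OF x_C[OF 3(2)], of "Var a"] tr_Var[OF I(1)] by (simp add: mult.commute)
        qed
      qed
      then show "lookup (tr (single m c)) e = 0"
        unfolding sing by (simp add: tr_mult_C lookup_Cst_times)
    next
      show "lookup (tr 0) e = 0" by (simp add: tr_def)
    qed (simp add: tr_add lookup_add)
    then have "lookup u e = 0" unfolding u using p(1) by (simp add: hcomp_in_polys_in)
    moreover have "lookup u e = 1"
      unfolding u_def e_def lookup_add power2_eq_square lookup_Var_times_Var[OF ne] by simp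
    ultimately show False by simp
  qed
  have ge: "enat (Suc r) \<le> krull_dim R"
  proof (rule krull_ge_Suc_r[OF R])
    show "B j \<in> polys_in (xi ` {2..s})" if "j \<in> {1..r}" for j
      using B[OF that] that by (auto simp: xx_def)
  qed (use r s in auto)
  have "\<not> C.nzd (C.exts T norms) z" if "z \<in> Pos" for z
  proof (rule socle_zero_divisor[OF triangular_vs idlJ uC uJ _ that])
    fix i assume i: "i \<in> I"
    then consider j where "i = yi j" "j \<in> {1..r}" | j where "i = xi j" "j \<in> {1..s}" unfolding I_eq by blast
    then show "nrm i * u \<in> C.exts T norms"
    proof cases
      case 1
      then have "nrm i \<in> C.exts T norms"
        using C.exts_self[OF idl_T subset_trans[OF norms_Pos Pos_C]] set_norms by auto
      then show ?thesis using uC by (intro C.idlD(5)[OF idlJ])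
    next
      case 2
      have "nrm i * u = x j ^ 3 * (x j * u)"
        unfolding 2(1) nrm_x[OF 2(2)] by (simp add: power4_eq_xxxx power3_eq_cube mult.assoc)
      moreover have "x j ^ 3 * (x j * u) \<in> T" using xu[OF 2(2)] x_C[OF 2(2)] by (intro C.idlD(4)[OF idl_T, of "x j ^ 3"]) simp_all
      ultimately have "nrm i * u \<in> T" by (simp only:)
      then show ?thesis using TJ by blast
    qed
  qed
  then show ?thesis
    using depth_not_CM[OF R irr noetherian_C[OF triangular_vs] norms_Pos reg_norms] ge by simp
qed

text \<open>An invariant is a polynomial in x_1, x_2 plus an invariant multiple of the norm N, and
  \<open>T\<close> becomes the ideal of d = x_1 x_2 (x_1 + x_2) when y is set to 0. So R modulo N is
  k[x_1, x_2]/(d), which has no socle; this gives a second regular element without naming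
  it.\<close>

lemma depth_Omega_1:
  assumes R: "presented_ring C R T h" and irr: "irrelevant_ideal R gr = h ` Pos"
    and rs: "r = 1" "s = 2" and A: "A 1 = x 1" and B: "B 1 = x 2"
  shows "depth R gr = 2 \<and> cohen_macaulay R gr"
proof -
  define v where "v = yi 1"
  define N where "N = nrm v"
  define Y where "Y = y 1"
  have one: "1 \<in> {1..r}" "1 \<in> {1..s}" "2 \<in> {1..s}" using rs by auto
  have top: "top_var v" unfolding v_def by (rule top_var_y[OF one(1)])
  have vI: "v \<in> I" unfolding v_def by (rule yi_in[OF one(1)])
  have NC: "N \<in> C" unfolding N_def by (rule nrm_C[OF vI])
  have norms: "norms = [N]" unfolding norms_def unfolding N_def v_def rs by simp
  have I: "I = {v, xi 1, xi 2}" unfolding I_eq rs v_def by (auto simp: numeral_2_eq_2 atLeastAtMostSuc_conv)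
  have low_XS: "p \<in> XS" if "p \<in> polys_in I" "p \<in> deg_lt v 1" for p
  proof -
    have "v \<notin> keys m" if "m \<in> keys p" for m using that \<open>p \<in> deg_lt v 1\<close> by (auto simp: deg_lt_def in_keys_iff)
    then have "keys m \<subseteq> {xi 1, xi 2}" if "m \<in> keys p" for m using that \<open>p \<in> polys_in I\<close> unfolding I polys_in_def by blast
    then show ?thesis unfolding polys_in_def rs by (fastforce simp: numeral_2_eq_2 atLeastAtMostSuc_conv)
  qed
  have XS_low: "p \<in> deg_lt v 1" if "p \<in> XS" for p using XS_deg_lt[OF that] unfolding v_def .
  have decomp: "\<exists>a0 a1 a2 a3. a0 \<in> XS \<and> a1 \<in> XS \<and> a2 \<in> XS \<and> a3 \<in> XS \<and> p = Y ^ 3 * a3 + Y ^ 2 * a2 + Y * a1 + a0"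
    if p: "p \<in> polys_in I" "p \<in> deg_lt v 4" for p
  proof -
    have top: "\<exists>a b. q = Y ^ n * a + b \<and> a \<in> XS \<and> b \<in> deg_lt v n \<and> b \<in> polys_in I"
      if q: "q \<in> polys_in I" "q \<in> deg_lt v (Suc n)" for q n
      using deg_lt_top[OF q(2)] q(1) low_XS unfolding Y_def v_def by blast
    obtain a3 b3 where 3: "p = Y ^ 3 * a3 + b3" "a3 \<in> XS" "b3 \<in> deg_lt v 3" "b3 \<in> polys_in I"
      using top[of p 3] p by auto
    obtain a2 b2 where 2: "b3 = Y ^ 2 * a2 + b2" "a2 \<in> XS" "b2 \<in> deg_lt v 2" "b2 \<in> polys_in I"
      using top[of b3 2] 3 by auto
    obtain a1 b1 where 1: "b2 = Y ^ 1 * a1 + b1" "a1 \<in> XS" "b1 \<in> deg_lt v 1" "b1 \<in> polys_in I"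
      using top[of b2 1] 2 by (auto simp: numeral_2_eq_2)
    show ?thesis using 1 2 3 low_XS[OF 1(4,3)]
      by (intro exI[of _ b1] exI[of _ a1] exI[of _ a2] exI[of _ a3]) (simp add: add.assoc)
  qed
  have tY: "t1 Y = Y + x 1" "t2 Y = Y + x 2"
    unfolding Y_def using t_y[OF one(1)] A B by simp_all
  \<comment> \<open>This d is the transfer of y^3. Modulo N, the transfer is determined by the
    coefficient of y^3.\<close>
  define d where "d = x 1 * x 2 * (x 1 + x 2)"
  have dT: "d \<in> T" using AB3_T[OF one(1)] unfolding A B d_def .
  have trY: "tr Y = 0" "tr (Y ^ 2) = 0" "tr (Y ^ 3) = d" "tr 1 = 0"
  proof -
    show "tr Y = 0" unfolding Y_def using tr_Var[OF yi_in[OF one(1)]] .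
    show "tr (Y ^ 2) = 0" using tr_y2[OF one(1) one(1)] unfolding Y_def power2_eq_square by simp
    show "tr (Y ^ 3) = d" using tr_y3[OF one(1)] A B unfolding Y_def d_def by simp
    show "tr 1 = 0" unfolding tr_def by (simp add: add.assoc)
  qed
  have xne: "x 1 \<noteq> 0" "x 2 \<noteq> 0" "x 1 + x 2 \<noteq> 0"
  proof -
    show "x j \<noteq> 0" for j by (metis Var_def lookup_single_eq lookup_zero zero_neq_one)
    then show "x 2 \<noteq> 0" .
    show "x 1 + x 2 \<noteq> 0"
    proof
      assume "x 1 + x 2 = 0"
      then have "x 1 = x 2" using eq_iff_add_eq_0 by blast
      then have "single (xi 1) (1::nat) = single (xi 2) 1" unfolding Var_def
        by (metis lookup_single_eq lookup_single_not_eq zero_neq_one)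
      then show False by (metis lookup_single_eq lookup_single_not_eq zero_neq_one yi_xi(2) one_eq_numeral_iff num.distinct(1))
    qed
  qed
  \<comment> \<open>Comparing powers of y in t p = p for both generators makes the coefficients a3,
    a2 and a1 vanish in turn.\<close>
  have low_C: "p \<in> XS" if p: "p \<in> C" "p \<in> deg_lt v 4" for p
  proof -
    obtain a0 a1 a2 a3 where a: "a0 \<in> XS" "a1 \<in> XS" "a2 \<in> XS" "a3 \<in> XS"
      "p = Y ^ 3 * a3 + Y ^ 2 * a2 + Y * a1 + a0"
      using decomp[OF C_sub[OF p(1)] p(2)] by blast
    have t: "t1 p + p = Y ^ 2 * (a3 * x 1) + (Y * (a3 * x 1 ^ 2) + (a3 * x 1 ^ 3 + a2 * x 1 ^ 2 + a1 * x 1))"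
      "t2 p + p = Y ^ 2 * (a3 * x 2) + (Y * (a3 * x 2 ^ 2) + (a3 * x 2 ^ 3 + a2 * x 2 ^ 2 + a1 * x 2))"
      unfolding a(5) subst_hom tY XS_fixed[OF a(1)] XS_fixed[OF a(2)] XS_fixed[OF a(3)] XS_fixed[OF a(4)]
        XS_fixed2[OF a(1)] XS_fixed2[OF a(2)] XS_fixed2[OF a(3)] XS_fixed2[OF a(4)]
      by (simp_all add: algebra_simps power2_eq_square power3_eq_cube two_poly)
    have z: "t1 p + p = 0" "t2 p + p = 0" using p(1) by (auto simp: C_def)
    have low: "a \<in> XS \<Longrightarrow> a * x 1 ^ n \<in> deg_lt v 1" for a n
      using one by (intro XS_low polys_in.mult_closed polys_in.power_closed) auto
    have "Y ^ 2 * (a3 * x 1) = Y * (a3 * x 1 ^ 2) + (a3 * x 1 ^ 3 + a2 * x 1 ^ 2 + a1 * x 1 ^ 1)"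
      using z(1) unfolding t(1) using eq_iff_add_eq_0 by simp
    also have "\<dots> \<in> deg_lt v 2"
    proof (intro deg_lt_add)
      have "Y \<in> deg_lt v (Suc 1)" unfolding Y_def v_def using deg_lt_Var_power[of "yi 1" 1] by simp
      from deg_lt_mult[OF this low[OF a(4), of 2]] show "Y * (a3 * x 1 ^ 2) \<in> deg_lt v 2"
        by (simp add: numeral_2_eq_2)
    qed (use low[OF a(4), of 3] low[OF a(3), of 2] low[OF a(2), of 1] in \<open>auto intro: deg_lt_mono\<close>)
    finally have "a3 * x 1 = 0" unfolding Y_def v_def by (rule deg_lt_top_eq_0)
    then have a3: "a3 = 0" using xne by simp
    have "x 1 * (a2 * x 1 + a1) = 0" "x 2 * (a2 * x 2 + a1) = 0"
      using z unfolding t a3 by (simp_all add: algebra_simps power2_eq_square)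
    then have e: "a2 * x 1 + a1 = 0" "a2 * x 2 + a1 = 0" using xne by auto
    have "a2 * (x 1 + x 2) = (a2 * x 1 + a1) + (a2 * x 2 + a1)" by (simp add: algebra_simps)
    then have "a2 * (x 1 + x 2) = 0" unfolding e by simp
    then have "a2 = 0" using xne by simp
    with e a3 a show ?thesis by simp
  qed
  have C_decomp: "\<exists>a\<in>XS. \<exists>q\<in>C. p = a + q * N" if p: "p \<in> C" for p
  proof -
    let ?q = "quot v 4 (nrm v) p"
    have q: "?q \<in> C" by (rule qt_C[OF top p])
    have "p - nrm v * ?q \<in> XS"
      using q p NC unfolding N_def by (intro low_C qt_rem[OF top]) auto
    then show ?thesis using q unfolding N_def by (intro bexI[of _ "p - nrm v * ?q"] bexI[of _ ?q]) (simp_all add: mult.commute)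
  qed
  \<comment> \<open>Setting y = 0 kills N and is the identity on polynomials in the x.\<close>
  define ev :: "(nat, 'k) poly_over \<Rightarrow> (nat, 'k) poly_over" where "ev = subst (\<lambda>i. if i = v then 0 else Var i)"
  have evN: "ev N = 0" unfolding ev_def N_def nrm_def by (simp add: subst_mult)
  have evXS: "ev p = p" if "p \<in> XS" for p
  proof -
    have "ev p = subst Var p"
      unfolding ev_def by (rule subst_cong_in[OF that]) (auto simp: v_def)
    then show ?thesis by (simp add: subst_Var_id)
  qed
  \<comment> \<open>Only y^3 has a nonzero transfer among 1, y, y^2, y^3, so restricting a transfer
    to y = 0 leaves a multiple of d.\<close>
  have evT: "\<exists>w\<in>XS. ev t = w * d" if t: "t \<in> T" for t
  proof -
    obtain p where p: "p \<in> polys_in I" "t = tr p" using t unfolding T_def by blast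
    let ?q = "quot v 4 (nrm v) p"
    have qI: "?q \<in> polys_in I" by (rule qt_in[OF top p(1)])
    have "p - nrm v * ?q \<in> polys_in I" using qI p NC C_sub unfolding N_def by auto
    then obtain a0 a1 a2 a3 where a: "a0 \<in> XS" "a1 \<in> XS" "a2 \<in> XS" "a3 \<in> XS"
      "p - nrm v * ?q = Y ^ 3 * a3 + Y ^ 2 * a2 + Y * a1 + a0"
      using decomp[OF _ qt_rem[OF top, of p]] by metis
    have peq: "p = a3 * Y ^ 3 + a2 * Y ^ 2 + a1 * Y + a0 * 1 + N * ?q"
      using a(5) unfolding N_def by (simp add: algebra_simps)
    have "tr p = a3 * d + N * tr ?q"
      by (subst peq) (simp add: tr_add tr_mult_C[OF NC] tr_mult_C[OF XS_C[OF a(1)]] tr_mult_C[OF XS_C[OF a(2)]]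
        tr_mult_C[OF XS_C[OF a(3)]] tr_mult_C[OF XS_C[OF a(4)]] trY del: mult_1_right)
    moreover have "d \<in> XS" unfolding d_def using one by (intro polys_in.mult_closed polys_in.add_closed) auto
    ultimately have "ev t = a3 * d"
      unfolding p(2) using evN evXS[OF a(4)] evXS[of d] by (simp add: ev_def subst_add subst_mult)
    then show ?thesis using a(4) by blast
  qed
  have "\<not> C.soc Pos (C.exts T [N])"
  proof
    assume "C.soc Pos (C.exts T [N])"
    then obtain u where u: "u \<in> C" "u \<notin> C.ext T N" "\<And>f. f \<in> Pos \<Longrightarrow> f * u \<in> C.ext T N"
      unfolding C.soc_def by auto
    obtain a q where aq: "a \<in> XS" "q \<in> C" "u = a + q * N" using C_decomp[OF u(1)] by blast
    \<comment> \<open>A socle class may be represented by a polynomial a in the x; then both x_1 a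
      and x_2 a are multiples of d.\<close>
    have key: "\<exists>w\<in>XS. x j * a = w * d" if j: "j \<in> {1..s}" for j
    proof -
      have "x j \<in> Pos" using homog_in_Pos[OF x_C[OF j] homog_Var] by simp
      then have "x j * u \<in> C.ext T N" using u(3) by blast
      then obtain t c where tc: "t \<in> T" "c \<in> C" "x j * u = t + c * N" by (rule C.extE) blast
      have "ev (x j * u) = x j * a"
        unfolding aq(3) using evN evXS[OF aq(1)] evXS[OF x_XS[OF j]] by (simp add: ev_def subst_add subst_mult)
      moreover have "ev (x j * u) = ev t"
        unfolding tc(3) using evN by (simp add: ev_def subst_add subst_mult)
      ultimately show ?thesis using evT[OF tc(1)] by auto
    qed
    obtain w1 where w1: "w1 \<in> XS" "x 1 * a = w1 * d" using key[OF one(2)] by blast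
    obtain w2 where w2: "w2 \<in> XS" "x 2 * a = w2 * d" using key[OF one(3)] by blast
    have dne: "d \<noteq> 0" unfolding d_def using xne by simp
    have "d * (x 2 * w1) = d * (x 1 * w2)"
    proof -
      have "d * (x 2 * w1) = x 2 * (x 1 * a)" unfolding w1(2) by (simp add: ac_simps)
      also have "\<dots> = x 1 * (x 2 * a)" by (rule mult.left_commute)
      also have "\<dots> = d * (x 1 * w2)" unfolding w2(2) by (simp add: ac_simps)
      finally show ?thesis .
    qed
    then have eq: "x 2 * w1 = x 1 * w2" using dne by simp
    \<comment> \<open>Division of w1 by x_1. From x_2 w1 = x_1 w2 the remainder turns out to be 0,
      so x_1 divides w1 and hence d divides a.\<close>
    define g where "g = quot (xi 1) 1 (x 1) w1"
    have mon: "x 1 - Var (xi 1) ^ 1 \<in> deg_lt (xi 1) 1" by simp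
    define b where "b = w1 - x 1 * g"
    have b: "b \<in> deg_lt (xi 1) 1" unfolding b_def g_def by (rule quot_rem(1)[OF mon])
    have gXS: "g \<in> XS" unfolding g_def using w1(1) one by (intro quot_rem(2)[OF mon]) auto
    have "x 2 * b \<in> deg_lt (xi 1) 1" using b deg_lt_Var[of "xi 2" "xi 1"] by (intro deg_lt_1_mult) auto
    moreover have "x 2 * b = (Var (xi 1) ^ 1 + 0) * (w2 - x 2 * g)"
      unfolding b_def using eq by (simp add: algebra_simps)
    ultimately have "w2 - x 2 * g = 0"
      using monic_division_unique[of 0 "xi 1" 1 "w2 - x 2 * g"] by simp
    then have "x 1 * w2 = x 1 * (x 2 * g)" by simp
    then have "x 2 * w1 = x 2 * (x 1 * g)" using eq by (simp add: mult.left_commute)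
    then have "w1 = x 1 * g" using xne by simp
    then have "x 1 * a = x 1 * (g * d)" using w1(2) by (simp add: mult.assoc)
    then have "a = g * d" using xne by simp
    then have "a \<in> T" using dT gXS XS_C C.idlD(4)[OF idl_T] by blast
    then have "u \<in> C.ext T N" unfolding aq(3) using aq(2) by (rule C.extI)
    with u(2) show False ..
  qed
  moreover have idl1: "C.idl (C.exts T [N])" using NC by (intro C.idl_exts[OF idl_T]) auto
  ultimately obtain z where z: "z \<in> Pos" "C.nzd (C.exts T [N]) z"
    using C.soc_iff_no_nzd[OF noetherian_C[OF triangular_vs] idl_Pos idl1] by blast
  \<comment> \<open>The Dickson invariant of degree 2 of the plane spanned by x_1 and x_2, d being
    the one of degree 3: each x_j satisfies x^3 = \<sigma> x + d.\<close>
  define \<sigma> where "\<sigma> = x 1 ^ 2 + x 1 * x 2 + x 2 ^ 2"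
  have \<sigma>C: "\<sigma> \<in> C" unfolding \<sigma>_def using x_C[OF one(2)] x_C[OF one(3)] by auto
  obtain H where H: "finite H" "H \<subseteq> C" "C \<subseteq> C.fspan {0} (nrm ` I) H"
    using finite_C[OF triangular_vs] by blast
  \<comment> \<open>The fourth power of that cubic equation. It makes the norms x_j^4 integral
    modulo \<open>T\<close> over \<sigma>, so N and \<sigma> suffice as coefficients.\<close>
  have cube: "(x j ^ 4) ^ 3 = \<sigma> ^ 4 * x j ^ 4 + d ^ 4" if j: "j \<in> {1, 2}" for j
  proof -
    have "x j ^ 3 = \<sigma> * x j + d"
      using j unfolding \<sigma>_def d_def by (auto simp: algebra_simps power2_eq_square power3_eq_cube two_poly)
    then have "(x j ^ 3) ^ 4 = (\<sigma> * x j + d) ^ 4" by simp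
    also have "\<dots> = ((\<sigma> * x j + d) ^ 2) ^ 2" by (simp flip: power_mult)
    also have "\<dots> = \<sigma> ^ 4 * x j ^ 4 + d ^ 4"
      by (simp add: power2_eq_square power4_eq_xxxx algebra_simps two_poly)
    finally show ?thesis by (simp add: mult.commute flip: power_mult)
  qed
  have elim: "\<exists>H'. finite H' \<and> H' \<subseteq> C \<and> C.fspan T (insert (x j ^ 4) F) H \<subseteq> C.fspan T F H'"
    if j: "j \<in> {1, 2}" and F: "\<sigma> \<in> F" and H: "finite H" "H \<subseteq> C" for j F H
  proof (rule C.fspan_eliminate[OF idl_T _ H(2,1), where M = 3])
    have jx: "x j \<in> C" using j x_C one by auto
    then show "x j ^ 4 \<in> C" by auto
    fix h' assume h': "h' \<in> H"
    let ?H = "(\<lambda>(i, h). (x j ^ 4) ^ i * h) ` ({..<3} \<times> H)"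
    have "(x j ^ 4) ^ 1 * h' \<in> ?H" using h' by (intro image_eqI[of _ _ "(1, h')"]) simp_all
    then have "x j ^ 4 * h' \<in> C.fspan T F ?H" by (intro C.fspan.gen) simp
    then have "\<sigma> * (\<sigma> * (\<sigma> * (\<sigma> * (x j ^ 4 * h')))) \<in> C.fspan T F ?H"
      by (intro C.fspan.mult[OF _ F])
    moreover have "d ^ 4 * h' \<in> T"
      using dT h' H(2) C.idlD(1,4,5)[OF idl_T] by (auto simp: power4_eq_xxxx)
    then have "d ^ 4 * h' \<in> C.fspan T F ?H" by (rule C.fspan.base)
    ultimately have "\<sigma> * (\<sigma> * (\<sigma> * (\<sigma> * (x j ^ 4 * h')))) + d ^ 4 * h' \<in> C.fspan T F ?H"
      by (rule C.fspan.add)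
    moreover have "\<sigma> * (\<sigma> * (\<sigma> * (\<sigma> * (x j ^ 4 * h')))) + d ^ 4 * h' = (x j ^ 4) ^ 3 * h'"
      unfolding cube[OF j] by (simp add: power4_eq_xxxx algebra_simps)
    ultimately show "(x j ^ 4) ^ 3 * h' \<in> C.fspan T F ?H" by simp
  qed simp
  have "nrm ` I = insert (x 1 ^ 4) (insert (x 2 ^ 4) {N})"
    unfolding I N_def using nrm_x[OF one(2)] nrm_x[OF one(3)] by auto
  then have "C.fspan {0} (nrm ` I) H \<subseteq> C.fspan T (insert (x 1 ^ 4) (insert (x 2 ^ 4) {N, \<sigma>})) H"
    using C.idlD(2)[OF idl_T] by (intro subsetI) (erule C.fspan_mono, auto)
  moreover obtain H1 where H1: "finite H1" "H1 \<subseteq> C"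
    "C.fspan T (insert (x 1 ^ 4) (insert (x 2 ^ 4) {N, \<sigma>})) H \<subseteq> C.fspan T (insert (x 2 ^ 4) {N, \<sigma>}) H1"
    using elim[of 1 "insert (x 2 ^ 4) {N, \<sigma>}" H] H by auto
  moreover obtain H2 where H2: "finite H2" "H2 \<subseteq> C"
    "C.fspan T (insert (x 2 ^ 4) {N, \<sigma>}) H1 \<subseteq> C.fspan T {N, \<sigma>} H2"
    using elim[of 2 "{N, \<sigma>}" H1] H1 by auto
  ultimately have span: "C \<subseteq> C.fspan T (set [N, \<sigma>]) H2" using H(3) by (metis (no_types, lifting) list.set(1,2) subset_trans)
  have "enat (Suc r) \<le> krull_dim R"
  proof (rule krull_ge_Suc_r[OF R])
    show "B j \<in> polys_in (xi ` {2..s})" if "j \<in> {1..r}" for j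
      using that B unfolding rs by (auto simp: numeral_2_eq_2)
  qed (use rs in auto)
  then have ge: "enat (length [N, \<sigma>]) \<le> krull_dim R" using rs by (simp add: numeral_2_eq_2)
  have "C.reg T ([N] @ [z])"
    unfolding C.reg_append using reg_norms z(2) unfolding norms by simp
  moreover have "set ([N] @ [z]) \<subseteq> Pos" using norms_Pos z(1) unfolding norms by simp
  ultimately show ?thesis
    using depth_CM[OF R irr noetherian_C[OF triangular_vs] _ H2(1,2) span, of "[N, z]"] NC \<sigma>C ge by (simp add: numeral_2_eq_2)
qed

end

section \<open>The regular representation\<close>

declare One_nat_def [simp del]

text \<open>The variables 0, 1, 2, 3 belong to the group elements 1, s1, s2, s1 s2;
  \<open>sw1\<close> and \<open>sw2\<close> are multiplication by s1 and s2.\<close>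

definition sw1 :: "nat \<Rightarrow> nat" where
  "sw1 n = (if n = 0 then 1 else if n = 1 then 0 else if n = 2 then 3 else if n = 3 then 2 else n)"

definition sw2 :: "nat \<Rightarrow> nat" where
  "sw2 n = (if n = 0 then 2 else if n = 2 then 0 else if n = 1 then 3 else if n = 3 then 1 else n)"

lemma sw_simps [simp]:
  "sw1 0 = 1" "sw1 1 = 0" "sw1 2 = 3" "sw1 3 = 2" "sw2 0 = 2" "sw2 1 = 3" "sw2 2 = 0" "sw2 3 = 1"
  "sw1 (sw1 n) = n" "sw2 (sw2 n) = n" "sw1 (sw2 n) = sw2 (sw1 n)"
  by (auto simp: sw1_def sw2_def)

lemma inj_sw: "inj sw1" "inj sw2"
  by (metis injI sw_simps(9)) (metis injI sw_simps(10))

lemma lookup_map_key: "inj f \<Longrightarrow> lookup (Poly_Mapping.map_key f p) k = lookup p (f k)"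
  by (simp add: map_key.rep_eq)

text \<open>Relabelling variables by an involution s moves exponents by s as well, s being its own
  inverse.\<close>

lemma lookup_subst_perm:
  fixes p :: "('x, 'k::field) poly_over"
  assumes "\<And>n. s (s n) = n"
  shows "lookup (subst (\<lambda>i. Var (s i)) p) m = lookup p (Poly_Mapping.map_key s m)"
proof (induction p rule: poly_induct)
  case (single m0 c)
  have inj: "inj s" by (metis assms injI)
  have meval: "meval (\<lambda>i. Var (s i)) m0 = (single (Poly_Mapping.map_key s m0) 1 :: ('x, 'k) poly_over)"
  proof -
    have "(\<Prod>x\<in>A. Var (s x) ^ lookup m0 x) = (single (\<Sum>x\<in>A. single (s x) (lookup m0 x)) 1 :: ('x, 'k) poly_over)"
      if "finite A" for A
      using that by (induction A) (auto simp: Var_power mult_single)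
    moreover have "(\<Sum>x\<in>keys m0. single (s x) (lookup m0 x)) = Poly_Mapping.map_key s m0"
    proof (rule poly_mapping_eqI)
      fix k
      have "lookup (\<Sum>x\<in>keys m0. single (s x) (lookup m0 x)) k = (\<Sum>x\<in>keys m0. if x = s k then lookup m0 x else 0)"
        unfolding lookup_sum using assms by (intro sum.cong) (auto simp: lookup_single when_def)
      then show "lookup (\<Sum>x\<in>keys m0. single (s x) (lookup m0 x)) k = lookup (Poly_Mapping.map_key s m0) k"
        by (simp add: lookup_map_key[OF inj] in_keys_iff)
    qed
    ultimately show ?thesis unfolding meval_def by simp
  qed
  have "Poly_Mapping.map_key s m0 = m \<longleftrightarrow> m0 = Poly_Mapping.map_key s m"
    by (metis (no_types, lifting) assms lookup_map_key[OF inj] poly_mapping_eqI)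
  then show ?case
    by (simp add: subst_single meval Cst_times_single lookup_single when_def)
qed (simp add: subst_add lookup_add)

lemma mon_eqI:
  assumes "keys m \<subseteq> {0, 1, 2, 3 :: nat}" "keys m' \<subseteq> {0, 1, 2, 3}" "lookup m 0 = lookup m' 0"
    "lookup m 1 = lookup m' 1" "lookup m 2 = lookup m' 2" "lookup m 3 = lookup m' 3"
  shows "m = m'"
proof (rule poly_mapping_eqI)
  fix n
  show "lookup m n = lookup m' n"
  proof (cases "n \<in> {0, 1, 2, 3}")
    case False
    then have "n \<notin> keys m" "n \<notin> keys m'" using assms(1,2) by auto
    then show ?thesis by (simp add: in_keys_iff)
  qed (use assms in auto)
qed

section \<open>Monomials and their orbits under the regular action\<close>

definition oa :: "nat \<Rightarrow> nat" where "oa k = (if k = 1 then 2 else 1)"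
definition ob :: "nat \<Rightarrow> nat" where "ob k = (if k = 3 then 2 else 3)"
definition pm :: "nat \<Rightarrow> nat \<Rightarrow> nat \<Rightarrow>\<^sub>0 nat" where "pm k d = single 0 d + single k d"
definition qm :: "nat \<Rightarrow> nat \<Rightarrow> nat \<Rightarrow>\<^sub>0 nat" where "qm k d = single (oa k) d + single (ob k) d"
definition ee :: "nat \<Rightarrow>\<^sub>0 nat" where "ee = single 0 1 + single 1 1 + single 2 1 + single 3 1"

abbreviation mp1 where "mp1 \<equiv> Poly_Mapping.map_key sw1"
abbreviation mp2 where "mp2 \<equiv> Poly_Mapping.map_key sw2"

lemma lookup_mp [simp]: "lookup (mp1 m) n = lookup m (sw1 n)" "lookup (mp2 m) n = lookup m (sw2 n)"
  using inj_sw by (simp_all add: lookup_map_key)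

lemma mp_simps [simp]: "mp1 (mp1 m) = m" "mp2 (mp2 m) = m" "mp1 (mp2 m) = mp2 (mp1 m)"
  by (rule poly_mapping_eqI, simp)+

lemma mp_eq_iff: "mp1 a = b \<longleftrightarrow> a = mp1 b" "mp2 a = b \<longleftrightarrow> a = mp2 b"
  by (metis mp_simps)+

lemma mp_add: "mp1 (m + m') = mp1 m + mp1 m'" "mp2 (m + m') = mp2 m + mp2 m'"
  by (rule poly_mapping_eqI, simp add: lookup_add)+

lemma lookup_pq:
  "lookup (pm k d) n = (if n = 0 then d else 0) + (if n = k then d else 0)"
  "lookup (qm k d) n = (if n = oa k then d else 0) + (if n = ob k then d else 0)"
  "lookup ee n = (if n \<in> {0, 1, 2, 3} then 1 else 0)"
proof -
  have "lookup (single i 1) n = (if n = i then 1 else 0 :: nat)" for i by (auto simp: lookup_single when_def)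
  then show "lookup ee n = (if n \<in> {0, 1, 2, 3} then 1 else 0)"
    unfolding ee_def lookup_add by (simp del: single_one)
qed (auto simp: pm_def qm_def lookup_add lookup_single when_def)

lemma mp_pq:
  assumes "k \<in> {1, 2, 3}"
  shows "mp1 (pm k d) = (if k = 1 then pm k d else qm k d)" "mp1 (qm k d) = (if k = 1 then qm k d else pm k d)"
    "mp2 (pm k d) = (if k = 2 then pm k d else qm k d)" "mp2 (qm k d) = (if k = 2 then qm k d else pm k d)"
    "mp1 ee = ee" "mp2 ee = ee"
proof -
  have sw: "sw1 n = i \<longleftrightarrow> n = sw1 i" "sw2 n = i \<longleftrightarrow> n = sw2 i" for n i by (metis sw_simps(9,10))+
  from assms have "k = 1 \<or> k = 2 \<or> k = 3" by simp
  then show "mp1 (pm k d) = (if k = 1 then pm k d else qm k d)" "mp1 (qm k d) = (if k = 1 then qm k d else pm k d)"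
    "mp2 (pm k d) = (if k = 2 then pm k d else qm k d)" "mp2 (qm k d) = (if k = 2 then qm k d else pm k d)"
    by (elim disjE; simp; intro poly_mapping_eqI; simp add: lookup_pq oa_def ob_def sw ac_simps)+
qed (rule poly_mapping_eqI, simp add: lookup_pq sw1_def sw2_def)+

definition orb :: "(nat \<Rightarrow>\<^sub>0 nat) \<Rightarrow> (nat \<Rightarrow>\<^sub>0 nat) set" where
  "orb m = {m, mp1 m, mp2 m, mp2 (mp1 m)}"

lemma orb_mp: "mp1 m' \<in> orb m \<longleftrightarrow> m' \<in> orb m" "mp2 m' \<in> orb m \<longleftrightarrow> m' \<in> orb m"
  unfolding orb_def by (auto simp: mp_eq_iff)

lemma finite_orb [simp]: "finite (orb m)"
  by (simp add: orb_def)

definition osum :: "(nat \<Rightarrow>\<^sub>0 nat) \<Rightarrow> (nat, 'k::field) poly_over" where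
  "osum m = (\<Sum>m'\<in>orb m. single m' 1)"

lemma lookup_osum: "lookup (osum m :: (nat, 'k::field) poly_over) m' = (if m' \<in> orb m then 1 else 0)"
proof -
  have "lookup (osum m :: (nat, 'k) poly_over) m' = (\<Sum>n\<in>orb m. if n = m' then 1 else 0)"
    unfolding osum_def lookup_sum by (intro sum.cong) (auto simp: lookup_single when_def)
  then show ?thesis by simp
qed

text \<open>The three nontrivial group elements correspond to the pairings of 0 with k and of
  \<open>oa k\<close> with \<open>ob k\<close>. For d > 0 this is the orbit sum of a monomial fixed
  by the element with index k.\<close>

definition psum :: "nat \<Rightarrow> nat \<Rightarrow> (nat, 'k::field) poly_over" where
  "psum k d = (Var 0 * Var k) ^ d + (Var (oa k) * Var (ob k)) ^ d"

lemma psum_eq: "psum k d = single (pm k d) 1 + single (qm k d) 1"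
  by (simp add: psum_def power_mult_distrib Var_power mult_single pm_def qm_def)

locale klein_reg = klein "{0, 1, 2, 3}" h1 h2 for h1 h2 :: "nat \<Rightarrow> (nat, 'k::field) poly_over" +
  assumes h1_sw: "i \<in> {0, 1, 2, 3} \<Longrightarrow> h1 i = Var (sw1 i)"
    and h2_sw: "i \<in> {0, 1, 2, 3} \<Longrightarrow> h2 i = Var (sw2 i)"
begin

abbreviation "I \<equiv> {0, 1, 2, 3 :: nat}"
abbreviation "e \<equiv> single ee 1 :: (nat, 'k) poly_over"

lemma lookup_t: "p \<in> polys_in I \<Longrightarrow> lookup (t1 p) m = lookup p (mp1 m)"
  "p \<in> polys_in I \<Longrightarrow> lookup (t2 p) m = lookup p (mp2 m)"
proof -
  assume p: "p \<in> polys_in I"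
  have "t1 p = subst (\<lambda>i. Var (sw1 i)) p" "t2 p = subst (\<lambda>i. Var (sw2 i)) p"
    using h1_sw h2_sw by (auto intro!: subst_cong_in[OF p])
  then show "lookup (t1 p) m = lookup p (mp1 m)" "lookup (t2 p) m = lookup p (mp2 m)"
    by (simp_all add: lookup_subst_perm)
qed

lemma lookup_tr: "p \<in> polys_in I \<Longrightarrow>
    lookup (tr p) m = lookup p m + lookup p (mp1 m) + lookup p (mp2 m) + lookup p (mp2 (mp1 m))"
  unfolding tr_def by (simp add: lookup_add lookup_t t2_in)

lemma C_iff: "p \<in> C \<longleftrightarrow> p \<in> polys_in I \<and> (\<forall>m. lookup p (mp1 m) = lookup p m \<and> lookup p (mp2 m) = lookup p m)"
  unfolding C_def by (auto simp: poly_mapping_eq_iff fun_eq_iff lookup_t)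

lemma keys_mp: "keys m \<subseteq> I \<Longrightarrow> keys (mp1 m) \<subseteq> I" "keys m \<subseteq> I \<Longrightarrow> keys (mp2 m) \<subseteq> I"
proof -
  assume m: "keys m \<subseteq> I"
  have "n \<in> I" if "sw1 n \<in> I \<or> sw2 n \<in> I" for n
    using that by (auto simp: sw1_def sw2_def split: if_splits)
  then show "keys (mp1 m) \<subseteq> I" "keys (mp2 m) \<subseteq> I"
    using m by (auto simp: in_keys_iff subset_iff)
qed

lemma single_in: "keys m \<subseteq> I \<Longrightarrow> single m c \<in> polys_in I"
  by (auto simp: polys_in_def split: if_splits)

lemma osum_C: "keys m \<subseteq> I \<Longrightarrow> osum m \<in> C"
  unfolding C_iff
proof (intro conjI allI)
  assume m: "keys m \<subseteq> I"
  have "keys m' \<subseteq> I" if "m' \<in> orb m" for m'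
    using that m keys_mp[OF m] keys_mp(2)[OF keys_mp(1)[OF m]] unfolding orb_def by blast
  then show "osum m \<in> polys_in I" unfolding osum_def by (intro polys_in.sum_closed single_in) blast
qed (simp_all add: lookup_osum orb_mp)

lemma C_orb: "p \<in> C \<Longrightarrow> m' \<in> orb m \<Longrightarrow> lookup p m' = lookup p m"
  unfolding C_iff orb_def by auto

text \<open>Invariants are combinations of orbit sums; each step subtracts one orbit and shrinks the
  support.\<close>

lemma C_induct [consumes 1, case_names zero osum add]:
  assumes "f \<in> C" "Q 0" "\<And>m. m \<in> keys f \<Longrightarrow> Q (Cst (lookup f m) * osum m)" "\<And>p q. Q p \<Longrightarrow> Q q \<Longrightarrow> Q (p + q)"
  shows "Q f"
  using assms(1,3)
proof (induction "card (keys f)" arbitrary: f rule: less_induct)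
  case less
  show ?case
  proof (cases "f = 0")
    case False
    then have "keys f \<noteq> {}" by simp
    then obtain m where m: "m \<in> keys f" by blast
    have mI: "keys m \<subseteq> I" using less.prems(1) m C_sub by (auto simp: polys_in_def)
    define g where "g = f - Cst (lookup f m) * osum m"
    have gC: "g \<in> C" unfolding g_def using less.prems(1) osum_C[OF mI] by auto
    have lg: "lookup g m' = (if m' \<in> orb m then 0 else lookup f m')" for m'
      unfolding g_def using C_orb[OF less.prems(1), of m' m] by (simp add: lookup_minus lookup_Cst_times lookup_osum)
    have "keys g = keys f - orb m" by (auto simp: in_keys_iff lg split: if_splits)
    then have "keys g \<subset> keys f" using m unfolding orb_def by auto
    then have "card (keys g) < card (keys f)" by (intro psubset_card_mono) auto
    moreover have Qg: "Q (Cst (lookup g m') * osum m')" if "m' \<in> keys g" for m'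
    proof -
      have "lookup g m' = lookup f m'" "m' \<in> keys f"
        using that lg[of m'] by (auto simp: in_keys_iff split: if_splits)
      then show ?thesis using less.prems(2) by simp
    qed
    ultimately have "Q g" using less.hyps[OF _ gC] by blast
    then have "Q (g + Cst (lookup f m) * osum m)" using less.prems(2)[OF m] by (rule assms(4))
    then show ?thesis unfolding g_def by simp
  qed (use assms(2) in simp)
qed

text \<open>The orbit has four distinct elements, so its sum is the transfer of a single
  monomial.\<close>

lemma osum_free:
  assumes "keys m \<subseteq> I" "mp1 m \<noteq> m" "mp2 m \<noteq> m" "mp2 (mp1 m) \<noteq> m"
  shows "osum m \<in> T"
proof -
  have 1: "mp1 m \<noteq> mp2 m" "mp1 m \<noteq> mp2 (mp1 m)" "mp2 m \<noteq> mp2 (mp1 m)"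
    using assms by (metis mp_simps)+
  have 2: "m = mp1 m' \<longleftrightarrow> m' = mp1 m" "m = mp2 m' \<longleftrightarrow> m' = mp2 m" "m = mp2 (mp1 m') \<longleftrightarrow> m' = mp2 (mp1 m)" for m'
    by (metis mp_simps)+
  have "osum m = tr (single m 1)"
  proof (rule poly_mapping_eqI)
    fix m'
    have "lookup (tr (single m 1)) m' = (if m = m' then 1 else 0) + (if m' = mp1 m then 1 else 0)
        + (if m' = mp2 m then 1 else 0) + (if m' = mp2 (mp1 m) then 1 else (0 :: 'k))"
      unfolding lookup_tr[OF single_in[OF assms(1)]] lookup_single when_def 2[of m'] ..
    also have "\<dots> = lookup (osum m) m'"
      using 1 assms(2-4) by (auto simp: lookup_osum orb_def)
    finally show "lookup (osum m) m' = lookup (tr (single m 1)) m'" ..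
  qed
  then show ?thesis using tr_T[OF single_in[OF assms(1)]] by simp
qed

lemma keys_pq: "k \<in> {1, 2, 3} \<Longrightarrow> keys (pm k d) \<subseteq> I" "k \<in> {1, 2, 3} \<Longrightarrow> keys (qm k d) \<subseteq> I"
  by (auto simp: in_keys_iff lookup_pq oa_def ob_def split: if_splits)

lemma pq_ne: "k \<in> {1, 2, 3} \<Longrightarrow> 0 < d \<Longrightarrow> pm k d \<noteq> qm k d"
proof
  assume "k \<in> {1, 2, 3}" "0 < d" "pm k d = qm k d"
  then have "lookup (pm k d) 0 = lookup (qm k d) 0" by simp
  with \<open>0 < d\<close> show False by (simp add: lookup_pq oa_def ob_def split: if_splits)
qed

lemma osum_pq:
  assumes "k \<in> {1, 2, 3}" "0 < d" "m = pm k d \<or> m = qm k d"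
  shows "osum m = (psum k d :: (nat, 'k) poly_over)"
proof -
  have orb: "orb m = {pm k d, qm k d}"
    using assms(1,3) unfolding orb_def by (auto simp: mp_pq)
  show ?thesis
    unfolding osum_def orb psum_eq using pq_ne[OF assms(1,2)] by simp
qed

lemma osum_shift:
  assumes "m = ee + m'"
  shows "osum m = e * osum m'"
proof -
  have orb: "orb m = (+) ee ` orb m'"
    unfolding assms orb_def by (simp add: mp_add mp_pq[of 1])
  show ?thesis
    unfolding osum_def orb by (subst sum.reindex) (auto simp: inj_on_def sum_distrib_left mult_single)
qed

text \<open>A monomial fixed by the element with index k is constant on both pairs of k. If it is
  not divisible by the product of all variables, one pair has exponent 0, which leaves a power of a
  single pair.\<close>

lemma mon_cases:
  assumes "keys m \<subseteq> I"
  obtains (shift) m' where "m = ee + m'" "keys m' \<subseteq> I"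
  | (free) "mp1 m \<noteq> m" "mp2 m \<noteq> m" "mp2 (mp1 m) \<noteq> m"
  | (zero) "m = 0"
  | (pq) k d where "k \<in> {1, 2, 3}" "0 < d" "m = pm k d \<or> m = qm k d"
proof (cases "\<forall>i\<in>I. 0 < lookup m i")
  case True
  have "m = ee + (m - ee)"
    using True by (intro poly_mapping_eqI) (auto simp: lookup_add lookup_minus lookup_pq)
  moreover have "keys (m - ee) \<subseteq> I"
    using assms by (auto simp: in_keys_iff lookup_minus subset_iff)
  ultimately show ?thesis by (rule shift)
next
  case False
  have pq': "thesis" if k: "k \<in> {1, 2, 3}" and eq: "lookup m 0 = lookup m k" "lookup m (oa k) = lookup m (ob k)" for k
  proof -
    have "lookup m 0 = 0 \<or> lookup m (oa k) = 0"
      using False k eq by (auto simp: oa_def ob_def split: if_splits)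
    then have "m = pm k (lookup m 0) \<or> m = qm k (lookup m (oa k))"
    proof
      assume z: "lookup m 0 = 0"
      from k consider "k = 1" | "k = 2" | "k = 3" by auto
      then have "m = qm k (lookup m (oa k))"
        by cases (use eq z in \<open>intro mon_eqI[OF assms keys_pq(2)[OF k]]; simp add: lookup_pq oa_def ob_def\<close>)+
      then show ?thesis ..
    next
      assume z: "lookup m (oa k) = 0"
      from k consider "k = 1" | "k = 2" | "k = 3" by auto
      then have "m = pm k (lookup m 0)"
        by cases (use eq z in \<open>intro mon_eqI[OF assms keys_pq(1)[OF k]]; simp add: lookup_pq oa_def ob_def\<close>)+
      then show ?thesis ..
    qed
    moreover have "pm k 0 = 0" "qm k 0 = 0" by (simp_all add: pm_def qm_def)
    ultimately show thesis using pq[OF k] zero by (metis gr0I)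
  qed
  show ?thesis
  proof (cases "mp1 m = m \<or> mp2 m = m \<or> mp2 (mp1 m) = m")
    case True
    then show ?thesis
    proof (elim disjE)
      assume "mp1 m = m"
      then have "lookup (mp1 m) n = lookup m n" for n by simp
      from this[of 0] this[of 2] show ?thesis by (intro pq'[of 1]) (simp_all add: oa_def ob_def)
    next
      assume "mp2 m = m"
      then have "lookup (mp2 m) n = lookup m n" for n by simp
      from this[of 0] this[of 1] show ?thesis by (intro pq'[of 2]) (simp_all add: oa_def ob_def)
    next
      assume "mp2 (mp1 m) = m"
      then have "lookup (mp2 (mp1 m)) n = lookup m n" for n by simp
      from this[of 0] this[of 1] show ?thesis by (intro pq'[of 3]) (simp_all add: oa_def ob_def)
    qed
  next
    case False
    then show ?thesis by (intro free) auto
  qed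
qed

lemma e_C: "e \<in> C"
proof -
  have "keys ee \<subseteq> I" by (auto simp: in_keys_iff lookup_pq split: if_splits)
  moreover have "osum ee = e"
    unfolding osum_def orb_def using mp_pq(5,6)[of 1] by simp
  ultimately show ?thesis using osum_C[of ee] by simp
qed

lemma psum_C: "k \<in> {1, 2, 3} \<Longrightarrow> psum k d \<in> C"
proof (cases "d = 0")
  case True
  then show ?thesis by (simp add: psum_def)
next
  case False
  assume k: "k \<in> {1, 2, 3}"
  have "osum (pm k d) = (psum k d :: (nat, 'k) poly_over)" using osum_pq[of k d "pm k d"] k False by simp
  then show ?thesis using osum_C[OF keys_pq(1)[OF k]] by metis
qed

text \<open>Coefficientwise division by e that drops monomials not divisible by e. It is a left
  inverse of multiplication by e and commutes with the transfer, e being invariant; hence e is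
  regular modulo \<open>T\<close>.\<close>

definition qe :: "(nat, 'k) poly_over \<Rightarrow> (nat, 'k) poly_over" where
  "qe = Poly_Mapping.map_key (\<lambda>m. ee + m)"

lemma lookup_qe: "lookup (qe p) m = lookup p (ee + m)"
  unfolding qe_def by (rule lookup_map_key) (auto simp: inj_def)

lemma qe_e: "qe (e * p) = p"
  by (rule poly_mapping_eqI) (simp add: lookup_qe lookup_single_times)

lemma qe_in: "p \<in> polys_in I \<Longrightarrow> qe p \<in> polys_in I"
  unfolding polys_in_def mem_Collect_eq
proof
  fix m assume p: "\<forall>m\<in>keys p. keys m \<subseteq> I" and "m \<in> keys (qe p)"
  then have "ee + m \<in> keys p" by (simp add: in_keys_iff lookup_qe)
  then have "keys (ee + m) \<subseteq> I" using p by blast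
  then show "keys m \<subseteq> I" by (simp add: keys_add_nat)
qed

lemma qe_tr: "p \<in> polys_in I \<Longrightarrow> qe (tr p) = tr (qe p)"
  using mp_pq(5,6)[of 1]
  by (intro poly_mapping_eqI) (simp add: lookup_qe lookup_tr qe_in mp_add)

lemma nzd_e: "C.nzd T e"
  unfolding C.nzd_def
proof (intro ballI impI)
  fix a assume "a \<in> C" "e * a \<in> T"
  then obtain p where p: "p \<in> polys_in I" "e * a = tr p" unfolding T_def by blast
  then have "a = tr (qe p)" using qe_e[of a] qe_tr by simp
  then show "a \<in> T" using tr_T[OF qe_in[OF p(1)]] by simp
qed

text \<open>For different pairings the product is the orbit sum obtained as the transfer of one
  monomial.\<close>

lemma psum_mult_T:
  assumes "k \<in> {1, 2, 3}" "k' \<in> {1, 2, 3}" "k \<noteq> k'"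
  shows "psum k' 1 * psum k d \<in> T"
proof -
  let ?p = "(Var 0 * Var k) ^ d * (Var 0 * Var k') :: (nat, 'k) poly_over"
  have "tr ?p = psum k' 1 * psum k d"
    unfolding tr_def psum_def using assms
    by (auto simp: subst_mult subst_power h1_sw h2_sw oa_def ob_def algebra_simps power_mult_distrib)
  moreover have "?p \<in> polys_in I" using assms by (intro polys_in.mult_closed polys_in.power_closed) auto
  ultimately show ?thesis using tr_T by metis
qed

lemma lookup_e_mult_pq:
  assumes "k \<in> {1, 2, 3}"
  shows "lookup (c * e) (pm k d) = 0"
proof -
  have "pm k d \<notin> keys (c * e)"
  proof
    assume "pm k d \<in> keys (c * e)"
    then obtain a b where "b \<in> keys e" "pm k d = a + b" by (rule keys_mult_elim) blast
    then have "lookup (pm k d) (oa k) = lookup a (oa k) + lookup ee (oa k)" by (simp add: lookup_add)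
    then show False using assms by (auto simp: lookup_pq oa_def)
  qed
  then show ?thesis by (simp add: in_keys_iff)
qed

text \<open>The monomial has a nontrivial stabiliser, so the coefficients entering the transfer
  there occur an even number of times.\<close>

lemma lookup_T_pq:
  assumes "k \<in> {1, 2, 3}" "t \<in> T"
  shows "lookup t (pm k d) = 0"
proof -
  obtain p where p: "p \<in> polys_in I" "t = tr p" using assms unfolding T_def by blast
  have d2: "a + a = (0::'k)" for a using char2 by (metis mult_2 mult_zero_left)
  have "a + b + a + b = (a + a) + (b + b)" "a + b + b + a = (a + a) + (b + b)" "a + a + b + b = (a + a) + (b + b)" for a b :: 'k
    by (simp_all only: ac_simps)
  then have d4: "a + b + a + b = 0" "a + b + b + a = 0" "a + a + b + b = 0" for a b :: 'k
    unfolding d2 by simp_all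
  show ?thesis
    unfolding p(2) lookup_tr[OF p(1)] using assms(1) by (auto simp: mp_pq d4 char2)
qed

text \<open>Multiplication by \<open>psum k 1\<close> carries the coefficient of u at
  \<open>pm k d\<close> to \<open>pm k (Suc d)\<close>, where all elements of (T, e) vanish. So u
  has no such monomials; the remaining orbit sums are multiples of e or transfers, which puts u into
  (T, e).\<close>

lemma not_soc_e: "\<not> C.soc Pos (C.ext T e)"
proof
  assume "C.soc Pos (C.ext T e)"
  then obtain u where u: "u \<in> C" "u \<notin> C.ext T e" "\<And>f. f \<in> Pos \<Longrightarrow> f * u \<in> C.ext T e"
    unfolding C.soc_def by auto
  have idl: "C.idl (C.ext T e)" by (rule C.idl_ext[OF idl_T e_C])
  have coeff: "lookup u (pm k d) = 0" if k: "k \<in> {1, 2, 3}" for k d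
  proof -
    have "homog 2 (Var a * Var b :: (nat, 'k) poly_over)" for a b
      using homog_mult[OF homog_Var homog_Var, of a b] by (simp only: one_add_one)
    then have "homog 2 (psum k 1 :: (nat, 'k) poly_over)"
      unfolding psum_def by (auto intro: homog_add)
    then have "psum k 1 \<in> Pos" using homog_in_Pos[OF psum_C[OF k]] by simp
    then have "psum k 1 * u \<in> C.ext T e" by (rule u(3))
    then obtain t c where tc: "t \<in> T" "c \<in> C" "psum k 1 * u = t + c * e" by (rule C.extE) blast
    have "lookup (psum k 1 * u) (pm k (Suc d)) = 0"
      unfolding tc(3) lookup_add using lookup_T_pq[OF k tc(1)] lookup_e_mult_pq[OF k] by simp
    moreover have "lookup (single (pm k 1) 1 * u) (pm k (Suc d)) = lookup u (pm k d)"
    proof -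
      have "pm k (Suc d) = pm k 1 + pm k d" by (rule poly_mapping_eqI) (simp add: lookup_pq lookup_add)
      then show ?thesis by (simp add: lookup_single_times)
    qed
    moreover have "lookup (single (qm k 1) 1 * u) (pm k (Suc d)) = 0"
    proof -
      have "pm k (Suc d) \<notin> keys (single (qm k 1) 1 * u)"
      proof
        assume "pm k (Suc d) \<in> keys (single (qm k 1) 1 * u)"
        then obtain a b where "a \<in> keys (single (qm k 1) (1::'k))" "pm k (Suc d) = a + b" by (rule keys_mult_elim) blast
        then have "lookup (pm k (Suc d)) (oa k) = lookup (qm k 1) (oa k) + lookup b (oa k)"
          by (simp add: lookup_add)
        then show False using k by (auto simp: lookup_pq oa_def ob_def split: if_splits)
      qed
      then show ?thesis by (simp add: in_keys_iff)
    qed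
    ultimately show ?thesis by (simp add: psum_eq distrib_right lookup_add)
  qed
  have "u \<in> C.ext T e"
    using u(1)
  proof (induction rule: C_induct)
    case zero
    then show ?case using C.idlD(2)[OF idl] .
  next
    case (add p q)
    then show ?case using C.idlD(3)[OF idl] by blast
  next
    case (osum m)
    then have mI: "keys m \<subseteq> I" using u(1) C_sub by (auto simp: polys_in_def)
    then show ?case
    proof (cases rule: mon_cases)
      case (shift m')
      have "osum m \<in> C.ext T e"
        using C.extI[OF C.idlD(2)[OF idl_T] osum_C[OF shift(2)], of e] osum_shift[OF shift(1)] by (simp add: mult.commute)
      then show ?thesis by (intro C.idlD(4)[OF idl]) auto
    next
      case free
      then have "osum m \<in> C.ext T e" using osum_free[OF mI] C.ext_subset[OF idl_T] by blast
      then show ?thesis by (intro C.idlD(4)[OF idl]) auto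
    next
      case zero
      then have "lookup u m = 0" using coeff[of 1 0] by (simp add: pm_def)
      then show ?thesis using C.idlD(2)[OF idl] by simp
    next
      case (pq k d)
      have "qm k d \<in> orb (pm k d)" using pq(1) unfolding orb_def by (auto simp: mp_pq)
      then have "lookup u m = 0" using coeff[OF pq(1), of d] pq(3) C_orb[OF u(1)] by auto
      then show ?thesis using C.idlD(2)[OF idl] by simp
    qed
  qed
  with u(2) show False ..
qed

text \<open>The recursion \<open>psum k d = psum k 1 * psum k (d - 1) + e * psum k (d - 2)\<close>
  lowers d, and modulo \<open>T\<close> the factor \<open>psum k 1\<close> may be replaced by the
  sum over all three pairings.\<close>

lemma C_span: "C \<subseteq> C.fspan T {e, psum 1 1 + psum 2 1 + psum 3 1} {1, psum 1 1, psum 2 1, psum 3 1}"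
proof
  let ?s = "psum 1 1 + psum 2 1 + psum 3 1 :: (nat, 'k) poly_over"
  let ?L = "C.fspan T {e, ?s} {1, psum 1 1, psum 2 1, psum 3 1}"
  have zero: "0 \<in> ?L" using C.fspan.base C.idlD(2)[OF idl_T] by blast
  have ps: "psum k d \<in> ?L" if k: "k \<in> {1, 2, 3}" for k d
  proof (induction d rule: less_induct)
    case (less d)
    consider "d = 0" | "d = 1" | d' where "d = Suc (Suc d')" by (metis One_nat_def not0_implies_Suc)
    then show ?case
    proof cases
      case 1
      then show ?thesis using zero by (simp add: psum_def)
    next
      case 2
      then show ?thesis using k by (intro C.fspan.gen) auto
    next
      case (3 d')
      have eV: "e = (Var 0 * Var k) * (Var (oa k) * Var (ob k))"
        using k by (auto simp: Var_def mult_single ee_def oa_def ob_def ac_simps)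
      have "psum k d = psum k 1 * psum k (Suc d') + e * psum k d'"
        unfolding eV 3 psum_def by (simp add: algebra_simps two_poly)
      moreover have "psum k 1 = ?s + (\<Sum>k'\<in>{1, 2, 3} - {k}. psum k' 1)"
      proof -
        have *: "{1, 2, 3} - {1} = {2, 3::nat}" "{1, 2, 3} - {2} = {1, 3::nat}" "{1, 2, 3} - {3} = {1, 2::nat}" by auto
        show ?thesis using k by (auto simp: * ac_simps)
      qed
      ultimately have "psum k d = ?s * psum k (Suc d') + (\<Sum>k'\<in>{1, 2, 3} - {k}. psum k' 1 * psum k (Suc d')) + e * psum k d'"
        by (simp add: distrib_right sum_distrib_right)
      moreover have "(\<Sum>k'\<in>{1, 2, 3} - {k}. psum k' 1 * psum k (Suc d')) \<in> T"
        using psum_mult_T k by (intro C.idl_sum[OF idl_T]) auto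
      ultimately show ?thesis
        using less[of "Suc d'"] less[of d'] 3
        by (auto intro!: C.fspan.add C.fspan.mult intro: C.fspan.base)
    qed
  qed
  have os: "osum m \<in> ?L" if "keys m \<subseteq> I" for m
    using that
  proof (induction "mon_degree m" arbitrary: m rule: less_induct)
    case less
    from less.prems show ?case
    proof (cases rule: mon_cases)
      case (shift m')
      have "mon_degree m' < mon_degree m"
        unfolding shift(1) by (simp add: mon_degree_add ee_def)
      then have "osum m' \<in> ?L" using less.hyps shift(2) by blast
      then show ?thesis unfolding osum_shift[OF shift(1)] by (intro C.fspan.mult) auto
    next
      case free
      then show ?thesis using osum_free[OF less.prems] by (intro C.fspan.base) auto
    next
      case zero
      have "mp1 0 = (0 :: nat \<Rightarrow>\<^sub>0 nat)" "mp2 0 = (0 :: nat \<Rightarrow>\<^sub>0 nat)" by (rule poly_mapping_eqI, simp)+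
      then have "osum m = (1 :: (nat, 'k) poly_over)" unfolding zero osum_def orb_def by simp
      then show ?thesis by (simp add: C.fspan.gen)
    next
      case (pq k d)
      then show ?thesis using ps osum_pq by simp
    qed
  qed
  show "f \<in> ?L" if "f \<in> C" for f
    using that
  proof (induction rule: C_induct)
    case (osum m)
    then have "keys m \<subseteq> I" using that C_sub by (auto simp: polys_in_def)
    then show ?case using os by (intro C.fspan.cst) auto
  qed (use zero in \<open>auto intro: C.fspan.add\<close>)
qed

text \<open>In the basis \<open>X\<^sub>0, X\<^sub>0 + X\<^sub>1, X\<^sub>0 + X\<^sub>2, X\<^sub>0 + X\<^sub>1 + X\<^sub>2 + X\<^sub>3\<close> the action is triangular.\<close>

lemma noetherian_reg: "C.noetherian"
proof -
  \<comment> \<open>This change of variables is its own inverse in characteristic 2 and conjugates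
    the permutation action into the triangular one given by \<open>k1\<close> and
    \<open>k2\<close>.\<close>
  define al :: "nat \<Rightarrow> (nat, 'k) poly_over" where
    "al i = (if i = 0 then Var 0 else if i = 1 then Var 0 + Var 1 else if i = 2 then Var 0 + Var 2
      else Var 0 + Var 1 + Var 2 + Var 3)" for i
  define k1 :: "nat \<Rightarrow> (nat, 'k) poly_over" where
    "k1 i = (if i = 0 then Var 0 + Var 1 else if i = 2 then Var 2 + Var 3 else Var i)" for i
  define k2 :: "nat \<Rightarrow> (nat, 'k) poly_over" where
    "k2 i = (if i = 0 then Var 0 + Var 2 else if i = 1 then Var 1 + Var 3 else Var i)" for i
  have al_al: "subst al (al i) = Var i" if "i \<in> I" for i
    using that by (auto simp: al_def subst_add ac_simps)
  have homog: "homog 1 p \<Longrightarrow> homog 1 q \<Longrightarrow> homog 1 (p + q)" for p q :: "(nat, 'k) poly_over" by (rule homog_add)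
  interpret K: klein I k1 k2
  proof unfold_locales
    show "homog 1 (k1 i)" "homog 1 (k2 i)" for i
      unfolding k1_def k2_def by (auto intro!: homog)
  qed (use char2 in \<open>auto simp: k1_def k2_def subst_add ac_simps intro!: polys_in.add_closed\<close>)
  have tri: "K.triangular [0, 1, 2, 3]"
  proof -
    have L: "lead (pre @ v # post) (Var v + l) (single v 1)"
      if "l \<in> polys_in (set post)" "distinct (pre @ v # post)" for pre v post and l :: "(nat, 'k) poly_over"
      using that by (intro lead_Var_add) auto
    have V: "lead ws (Var v :: (nat, 'k) poly_over) (single v 1)" for ws v
      unfolding Var_def by (rule lead_single) simp
    have 0: "lead [0, 1, 2, 3] (Var 0 + l) (single 0 1)" if "l \<in> polys_in {1, 2, 3}" for l :: "(nat, 'k) poly_over"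
      using L[of l "[1, 2, 3]" "[]" 0] that by simp
    have 1: "lead [0, 1, 2, 3] (Var 1 + l) (single 1 1)" if "l \<in> polys_in {2, 3}" for l :: "(nat, 'k) poly_over"
      using L[of l "[2, 3]" "[0]" 1] that by simp
    have 2: "lead [0, 1, 2, 3] (Var 2 + l) (single 2 1)" if "l \<in> polys_in {3}" for l :: "(nat, 'k) poly_over"
      using L[of l "[3]" "[0, 1]" 2] that by simp
    have "lead [0, 1, 2, 3] (k1 i) (single i 1) \<and> lead [0, 1, 2, 3] (k2 i) (single i 1)
        \<and> lead [0, 1, 2, 3] (subst k1 (k2 i)) (single i 1)" if "i \<in> I" for i
    proof -
      from that consider "i = 0" | "i = 1" | "i = 2" | "i = 3" by auto
      then show ?thesis
      proof cases
        case 1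
        have "subst k1 (k2 i) = Var 0 + (Var 1 + (Var 2 + Var 3))" "k1 i = Var 0 + Var 1" "k2 i = Var 0 + Var 2"
          unfolding 1 by (simp_all add: k1_def k2_def subst_add ac_simps)
        moreover have "(Var 1 + (Var 2 + Var 3) :: (nat, 'k) poly_over) \<in> polys_in {1, 2, 3}"
            "(Var 1 :: (nat, 'k) poly_over) \<in> polys_in {1, 2, 3}" "(Var 2 :: (nat, 'k) poly_over) \<in> polys_in {1, 2, 3}"
          by (auto intro!: polys_in.add_closed)
        ultimately show ?thesis using 0 unfolding 1 by simp
      next
        case 2
        have "subst k1 (k2 i) = Var 1 + Var 3" "k1 i = Var 1" "k2 i = Var 1 + Var 3"
          unfolding 2 by (simp_all add: k1_def k2_def subst_add ac_simps)
        then show ?thesis using 1[of "Var 3"] V[of _ 1] unfolding 2 by auto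
      next
        case 3
        have "subst k1 (k2 i) = Var 2 + Var 3" "k1 i = Var 2 + Var 3" "k2 i = Var 2"
          unfolding 3 by (simp_all add: k1_def k2_def subst_add ac_simps)
        then show ?thesis using \<open>\<And>l. l \<in> polys_in {3} \<Longrightarrow> lead [0, 1, 2, 3] (Var 2 + l) (single 2 1)\<close>[of "Var 3"] V[of _ 2] unfolding 3 by auto
      next
        case 4
        then show ?thesis using V[of _ 3] by (simp add: k1_def k2_def)
      qed
    qed
    then show ?thesis unfolding K.triangular_def by auto
  qed
  have al_in: "p \<in> polys_in I \<Longrightarrow> subst al p \<in> polys_in I" for p :: "(nat, 'k) poly_over"
    by (rule subst_in_polys_in) (auto simp: al_def intro!: polys_in.add_closed)
  have al2: "subst al (subst al p) = p" if "p \<in> polys_in I" for p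
    unfolding subst_subst using subst_cong_in[OF that, of "\<lambda>x. subst al (al x)" Var] al_al by (simp add: subst_Var_id)
  have c1: "subst al (subst h1 p) = subst k1 (subst al p)" "subst al (subst h2 p) = subst k2 (subst al p)"
    if "p \<in> polys_in I" for p
    unfolding subst_subst
    by (rule subst_cong_in[OF that]; auto simp: al_def k1_def k2_def h1_sw h2_sw subst_add ac_simps)+
  have to_C: "subst al p \<in> K.C" if "p \<in> C" for p
    using that c1[of p] al_in[of p] unfolding C_def K.C_def by auto
  have from_C: "subst al p \<in> C" if "p \<in> K.C" for p
  proof -
    have p: "p \<in> polys_in I" "subst k1 p = p" "subst k2 p = p" using that unfolding K.C_def by auto
    have q: "subst al p \<in> polys_in I" using al_in p by blast
    have "subst al (subst h1 (subst al p)) = p" "subst al (subst h2 (subst al p)) = p"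
      using c1[OF q] al2[OF p(1)] p by simp_all
    then have "subst h1 (subst al p) = subst al p" "subst h2 (subst al p) = subst al p"
      using al2[OF t1_in[OF q]] al2[OF t2_in[OF q]] by metis+
    then show ?thesis using q unfolding C_def by auto
  qed
  show ?thesis
    unfolding C.noetherian_def
  proof (intro allI impI)
    fix a :: "nat \<Rightarrow> (nat, 'k) poly_over" assume a: "range a \<subseteq> C"
    \<comment> \<open>The noetherian property is transported through \<open>al\<close>, which
      exchanges the two rings of invariants.\<close>
    have "\<exists>n c. (\<forall>i<n. c i \<in> K.C) \<and> subst al (a n) = (\<Sum>i<n. c i * subst al (a i))"
      using a to_C by (intro K.C.noetherianD[OF K.noetherian_C[OF tri], of "\<lambda>i. subst al (a i)"]) auto
    then obtain n c where nc: "\<And>i. i < n \<Longrightarrow> c i \<in> K.C" "subst al (a n) = (\<Sum>i<n. c i * subst al (a i))" by blast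
    have ai: "subst al (subst al (a i)) = a i" for i using a C_sub by (intro al2) auto
    have "a n = (\<Sum>i<n. subst al (c i) * a i)"
      using arg_cong[OF nc(2), of "subst al"] by (simp add: ai subst_sum subst_mult)
    then show "\<exists>n c. (\<forall>i<n. c i \<in> C) \<and> a n = (\<Sum>i<n. c i * a i)"
      using from_C nc(1) by (intro exI[of _ n] exI[of _ "\<lambda>i. subst al (c i)"]) auto
  qed
qed

lemma depth_reg:
  assumes R: "presented_ring C R T h" and irr: "irrelevant_ideal R gr = h ` Pos"
  shows "depth R gr = 2 \<and> cohen_macaulay R gr"
proof -
  let ?s = "psum 1 1 + psum 2 1 + psum 3 1 :: (nat, 'k) poly_over"
  have eP: "e \<in> Pos"
  proof -
    have "ee \<noteq> 0" using lookup_pq(3)[of 0] by (metis insertI1 lookup_zero zero_neq_one)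
    then show ?thesis using e_C unfolding Pos_def by (simp add: lookup_single)
  qed
  have idl: "C.idl (C.ext T e)" by (rule C.idl_ext[OF idl_T e_C])
  obtain z where z: "z \<in> Pos" "C.nzd (C.ext T e) z"
    using not_soc_e C.soc_iff_no_nzd[OF noetherian_reg idl_Pos idl] by blast
  have ge: "enat 2 \<le> krull_dim R"
  proof (rule krull_dim_ge[OF R])
    \<comment> \<open>Restriction to the fixed points X_0 = X_1, X_2 = X_3 of the first generator,
      where the terms of the transfer cancel in pairs; then X_2 and finally X_0 are set to
      0.\<close>
    define k :: "nat \<Rightarrow> nat \<Rightarrow> (nat, 'k) poly_over" where
      "k i v = (if v \<le> 1 then (if i \<le> 1 then Var 0 else 0) else (if i \<le> 0 then Var 2 else 0))" for i v
    define w :: "nat \<Rightarrow> nat \<Rightarrow> (nat, 'k) poly_over" where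
      "w i v = (if i = 0 \<and> v = 2 \<or> i = 1 \<and> v = 0 then 0 else Var v)" for i v
    define g :: "nat \<Rightarrow> (nat, 'k) poly_over" where "g i = (if i = 0 then e else psum 1 1)" for i
    have eV: "e = Var 0 * Var 1 * Var 2 * Var 3" by (simp add: Var_def mult_single ee_def)
    have Vne: "Var v \<noteq> (0 :: (nat, 'k) poly_over)" for v by (metis Var_def lookup_single_eq lookup_zero zero_neq_one)
    show "k (Suc i) v = subst (w i) (k i v)" if "i < 2" for i v
      using that unfolding k_def w_def by (auto simp: less_2_cases_iff)
    show "subst (k 0) (tr p) = 0" if "p \<in> polys_in I" for p
    proof -
      have inv: "subst (k 0) (t1 q) = subst (k 0) q" if "q \<in> polys_in I" for q
        unfolding subst_subst by (rule subst_cong_in[OF that]) (auto simp: h1_sw k_def)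
      show ?thesis unfolding tr_def using inv[OF that] inv[OF t2_in[OF that]] by (simp add: subst_add add.assoc)
    qed
    show "g i \<in> C" for i unfolding g_def using e_C psum_C by auto
    show "subst (k (Suc i)) (g i) = 0" if "i < 2" for i
      using that unfolding g_def eV psum_def by (auto simp: less_2_cases_iff subst_mult subst_add k_def oa_def ob_def)
    show "subst (k i) (g i) \<noteq> 0" if "i < 2" for i
      using that Vne unfolding g_def eV psum_def by (auto simp: less_2_cases_iff subst_mult subst_add k_def oa_def ob_def)
  qed
  have sC: "?s \<in> C" using psum_C by auto
  have "set [e, ?s] = {e, ?s}" "length [e, ?s] = 2" by (simp_all add: numeral_2_eq_2)
  then show ?thesis
    using depth_CM[OF R irr noetherian_reg, of "[e, ?s]" "{1, psum 1 1, psum 2 1, psum 3 1}" "[e, z]"]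
      e_C sC psum_C C_span eP z nzd_e ge unfolding \<open>length [e, ?s] = 2\<close> by simp
qed

end

section \<open>The representations of the theorem\<close>

text \<open>A predicate on the pair of generators, because the parameters 1 and infinity are treated
  by changing that pair.\<close>

definition klein_gens :: "('g, 'b) monoid_scheme \<Rightarrow> 'g \<Rightarrow> 'g \<Rightarrow> bool" where
  "klein_gens G s t \<longleftrightarrow> s \<in> carrier G \<and> t \<in> carrier G \<and> s \<otimes>\<^bsub>G\<^esub> s = \<one>\<^bsub>G\<^esub> \<and> t \<otimes>\<^bsub>G\<^esub> t = \<one>\<^bsub>G\<^esub> \<and>
     s \<otimes>\<^bsub>G\<^esub> t = t \<otimes>\<^bsub>G\<^esub> s \<and> carrier G = {\<one>\<^bsub>G\<^esub>, s, t, s \<otimes>\<^bsub>G\<^esub> t} \<and> card (carrier G) = 4"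

lemma klein_gens_distinct:
  assumes "klein_gens G s t"
  shows "s \<noteq> \<one>\<^bsub>G\<^esub>" "t \<noteq> \<one>\<^bsub>G\<^esub>" "s \<noteq> t" "s \<otimes>\<^bsub>G\<^esub> t \<noteq> \<one>\<^bsub>G\<^esub>" "s \<otimes>\<^bsub>G\<^esub> t \<noteq> s" "s \<otimes>\<^bsub>G\<^esub> t \<noteq> t"
proof -
  have "card {\<one>\<^bsub>G\<^esub>, s, t, s \<otimes>\<^bsub>G\<^esub> t} = 4" using assms unfolding klein_gens_def by metis
  then show "s \<noteq> \<one>\<^bsub>G\<^esub>" "t \<noteq> \<one>\<^bsub>G\<^esub>" "s \<noteq> t" "s \<otimes>\<^bsub>G\<^esub> t \<noteq> \<one>\<^bsub>G\<^esub>" "s \<otimes>\<^bsub>G\<^esub> t \<noteq> s" "s \<otimes>\<^bsub>G\<^esub> t \<noteq> t"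
    by (auto simp: card_insert_if split: if_splits)
qed

lemma klein_gens_swap: "klein_gens G s t \<Longrightarrow> klein_gens G t s"
  unfolding klein_gens_def by auto

lemma klein_gens_shear:
  assumes "group G" "klein_gens G s t"
  shows "klein_gens G s (s \<otimes>\<^bsub>G\<^esub> t)"
proof -
  interpret group G by fact
  have st: "s \<in> carrier G" "t \<in> carrier G" "s \<otimes>\<^bsub>G\<^esub> s = \<one>\<^bsub>G\<^esub>" "t \<otimes>\<^bsub>G\<^esub> t = \<one>\<^bsub>G\<^esub>" "s \<otimes>\<^bsub>G\<^esub> t = t \<otimes>\<^bsub>G\<^esub> s"
    using assms(2) unfolding klein_gens_def by blast+
  have car: "carrier G = {\<one>\<^bsub>G\<^esub>, s, s \<otimes>\<^bsub>G\<^esub> t, t}" "card (carrier G) = 4"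
    using assms(2) unfolding klein_gens_def by blast+
  have 1: "s \<otimes>\<^bsub>G\<^esub> (s \<otimes>\<^bsub>G\<^esub> t) = t" using st by (metis m_assoc l_one)
  have 2: "s \<otimes>\<^bsub>G\<^esub> t \<otimes>\<^bsub>G\<^esub> s = t" using 1 st by (metis m_assoc)
  have 3: "s \<otimes>\<^bsub>G\<^esub> t \<otimes>\<^bsub>G\<^esub> (s \<otimes>\<^bsub>G\<^esub> t) = \<one>\<^bsub>G\<^esub>" using 2 st by (metis m_assoc m_closed)
  show ?thesis using st car m_closed[OF st(1,2)] unfolding klein_gens_def 1 2 3 by blast
qed

text \<open>Commutativity, exponent 2 and order 4 are pulled back along the isomorphism; the four
  listed words are then closed under multiplication.\<close>

lemma klein_gens_of_iso:
  assumes "group G" "s \<in> carrier G" "t \<in> carrier G" "carrier G = generate G {s, t}"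
    and "G \<cong> integer_mod_group 2 \<times>\<times> integer_mod_group 2"
  shows "klein_gens G s t"
proof -
  interpret group G by fact
  let ?H = "integer_mod_group 2 \<times>\<times> integer_mod_group 2"
  obtain f where f: "f \<in> iso G ?H" using assms(5) unfolding is_iso_def by blast
  have hom: "f (x \<otimes>\<^bsub>G\<^esub> y) = f x \<otimes>\<^bsub>?H\<^esub> f y" if "x \<in> carrier G" "y \<in> carrier G" for x y
    using f that unfolding iso_def hom_def by blast
  have bij: "bij_betw f (carrier G) (carrier ?H)" using f unfolding iso_def by blast
  have carH: "carrier ?H = {0, 1} \<times> {0, 1}"
    unfolding carrier_DirProd carrier_integer_mod_group by auto
  have inj: "x = y" if "f x = f y" "x \<in> carrier G" "y \<in> carrier G" for x y
    using bij that unfolding bij_betw_def inj_on_def by blast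
  have img: "f x \<in> {0, 1} \<times> {0, 1}" if "x \<in> carrier G" for x
    using bij that unfolding bij_betw_def carH by blast
  have commH: "a \<otimes>\<^bsub>?H\<^esub> b = b \<otimes>\<^bsub>?H\<^esub> a" for a b by (simp add: mult_DirProd' add.commute)
  have sqH: "a \<otimes>\<^bsub>?H\<^esub> a = (0, 0)" if "a \<in> {0, 1} \<times> {0, 1}" for a
    using that by (auto simp: mult_DirProd')
  have f1: "f \<one>\<^bsub>G\<^esub> = (0, 0)"
    using hom[of "\<one>\<^bsub>G\<^esub>" "\<one>\<^bsub>G\<^esub>"] sqH[OF img[of "\<one>\<^bsub>G\<^esub>"]] by simp
  have comm: "x \<otimes>\<^bsub>G\<^esub> y = y \<otimes>\<^bsub>G\<^esub> x" if "x \<in> carrier G" "y \<in> carrier G" for x y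
    using that hom commH by (intro inj) auto
  have sq: "x \<otimes>\<^bsub>G\<^esub> x = \<one>\<^bsub>G\<^esub>" if "x \<in> carrier G" for x
    using that hom sqH[OF img[OF that]] f1 by (intro inj) auto
  have card: "card (carrier G) = 4"
    using bij_betw_same_card[OF bij] unfolding carH by simp
  let ?K = "{\<one>\<^bsub>G\<^esub>, s, t, s \<otimes>\<^bsub>G\<^esub> t}"
  have inv: "inv\<^bsub>G\<^esub> x = x" if "x \<in> carrier G" for x using sq[OF that] that by (intro inv_equality)
  have "x \<in> ?K" if "x \<in> generate G {s, t}" for x
    using that
  proof (induction rule: generate.induct)
    case (inv h)
    then show ?case using inv assms(2,3) \<open>\<And>x. x \<in> carrier G \<Longrightarrow> inv\<^bsub>G\<^esub> x = x\<close> by auto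
  next
    case (eng g h)
    have st: "s \<otimes>\<^bsub>G\<^esub> (s \<otimes>\<^bsub>G\<^esub> t) = t" "t \<otimes>\<^bsub>G\<^esub> (s \<otimes>\<^bsub>G\<^esub> t) = s" "s \<otimes>\<^bsub>G\<^esub> t \<otimes>\<^bsub>G\<^esub> s = t" "s \<otimes>\<^bsub>G\<^esub> t \<otimes>\<^bsub>G\<^esub> t = s"
      "t \<otimes>\<^bsub>G\<^esub> s = s \<otimes>\<^bsub>G\<^esub> t" "s \<otimes>\<^bsub>G\<^esub> s = \<one>\<^bsub>G\<^esub>" "t \<otimes>\<^bsub>G\<^esub> t = \<one>\<^bsub>G\<^esub>" "s \<otimes>\<^bsub>G\<^esub> t \<otimes>\<^bsub>G\<^esub> (s \<otimes>\<^bsub>G\<^esub> t) = \<one>\<^bsub>G\<^esub>"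
      using assms(2,3) sq comm by (metis m_assoc m_closed l_one r_one)+
    show ?case using eng.IH st assms(2,3) by auto
  qed auto
  then have "carrier G \<subseteq> ?K" using assms(4) by blast
  then have "carrier G = ?K" using assms(2,3) m_closed[OF assms(2,3)] one_closed by blast
  then show ?thesis unfolding klein_gens_def using assms(2,3) comm sq card by blast
qed

lemma (in vector_space) is_basis_family_comp:
  assumes "is_basis_family b (g ` I)" "inj_on g I"
  shows "is_basis_family (b \<circ> g) I"
  using assms unfolding is_basis_family_def by (simp add: comp_inj_on image_comp)

lemma (in linear_rep) act_eq_id:
  assumes "is_basis_family b I" "\<sigma> \<in> carrier G" "\<And>i. i \<in> I \<Longrightarrow> \<rho> \<sigma> (b i) = b i"
  shows "\<rho> \<sigma> = (\<lambda>v. v)"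
proof
  fix v
  have "Vector_Spaces.linear scale scale (\<lambda>v. v)" using vector_space_axioms by (simp add: Vector_Spaces.linear_iff)
  moreover have "v \<in> span (b ` I)" using assms(1) unfolding is_basis_family_def by simp
  ultimately show "\<rho> \<sigma> v = v"
    using assms(3) vector_space_pair.linear_eq_on_span[of scale scale "\<rho> \<sigma>" "\<lambda>v. v" "b ` I" v] linear_action[OF assms(2)]
      vector_space_axioms by (auto simp: vector_space_pair_def)
qed

locale klein_rep = rep_basis scale G \<rho> b I
  for scale :: "'k::field \<Rightarrow> 'v::ab_group_add \<Rightarrow> 'v"
    and G :: "('g, 'b) monoid_scheme" (structure)
    and \<rho> :: "'g \<Rightarrow> 'v \<Rightarrow> 'v" and b :: "nat \<Rightarrow> 'v" and I +
  fixes s1 s2 :: 'g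
  assumes gens: "klein_gens G s1 s2" and two: "(2 :: 'k) = 0"
begin

lemma gens_simps [simp]:
  "s1 \<in> carrier G" "s2 \<in> carrier G" "s1 \<otimes> s1 = \<one>" "s2 \<otimes> s2 = \<one>" "s2 \<otimes> s1 = s1 \<otimes> s2" "inv s1 = s1" "inv s2 = s2"
  using gens group.inv_equality[OF group_hom.axioms(1)[OF group_hom]] unfolding klein_gens_def by auto

lemma W_expand: "f \<in> W \<Longrightarrow> f v = (\<Sum>j\<in>I. coord j v * f (b j))"
proof -
  assume f: "f \<in> W"
  have "f v = f (\<Sum>i\<in>I. scale (coord i v) (b i))" using expand[of v] by simp
  also have "\<dots> = (\<Sum>i\<in>I. coord i v * f (b i))" using f unfolding W_sum[OF f] mem_W by simp
  finally show ?thesis .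
qed

lemma Cst_sum: "Cst (sum f A) = (\<Sum>i\<in>A. Cst (f i))"
  by (induction A rule: infinite_finite_induct) (simp_all add: Cst_add)

lemma subst_act_act:
  assumes "\<sigma> \<in> carrier G" "\<tau> \<in> carrier G"
  shows "subst (act \<sigma>) (act \<tau> i) = act (\<sigma> \<otimes> \<tau>) i"
proof -
  have grp: "group G" by (rule group_hom.axioms(1)[OF group_hom])
  note [simp] = group.inv_closed[OF grp]
  let ?f = "coord i \<circ> \<rho> (inv \<tau>)"
  have fW: "?f \<in> W" using assms by (intro comp_in_W coord_in_W) simp
  have "subst (act \<sigma>) (act \<tau> i) = (\<Sum>j\<in>I. \<Sum>k\<in>I. Cst (coord j (\<rho> (inv \<sigma>) (b k)) * ?f (b j)) * Var k)"
    unfolding act_def by (simp add: subst_sum subst_mult sum_distrib_left Cst_mult ac_simps)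
  also have "\<dots> = (\<Sum>k\<in>I. Cst (\<Sum>j\<in>I. coord j (\<rho> (inv \<sigma>) (b k)) * ?f (b j)) * Var k)"
    by (subst sum.swap) (simp add: Cst_sum sum_distrib_right)
  also have "\<dots> = (\<Sum>k\<in>I. Cst (?f (\<rho> (inv \<sigma>) (b k))) * Var k)"
    by (simp only: W_expand[OF fW, symmetric])
  also have "\<dots> = act (\<sigma> \<otimes> \<tau>) i"
    unfolding act_def using assms composition_rule[of _ "inv \<tau>" "inv \<sigma>"] group.inv_mult_group[OF grp assms] by simp
  finally show ?thesis .
qed

lemma act_one: "i \<in> I \<Longrightarrow> act \<one> i = Var i"
proof -
  assume i: "i \<in> I"
  have "group G" by (rule group_hom.axioms(1)[OF group_hom])
  then have "\<rho> (inv \<one>) v = v" for v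
    using fun_cong[OF id_eq_one, of v] by (simp add: monoid.inv_one group.is_monoid)
  then have "act \<one> i = (\<Sum>j\<in>I. if i = j then Var j else 0)"
    unfolding act_def using coord_basis[OF i] by (intro sum.cong) auto
  then show ?thesis using finite_I i by simp
qed

sublocale K: klein I "act s1" "act s2"
  by unfold_locales (use finite_I two act_in homog_act subst_act_act act_one in auto)

lemma subst_act_one: "p \<in> polys_in I \<Longrightarrow> subst (act \<one>) p = p"
  using subst_cong_in[of p I "act \<one>" Var] act_one by (simp add: subst_Var_id)

lemma subst_act_st: "p \<in> polys_in I \<Longrightarrow> subst (act (s1 \<otimes> s2)) p = subst (act s1) (subst (act s2) p)"
  by (simp add: subst_subst subst_act_act)

lemma tr_eq: "p \<in> polys_in I \<Longrightarrow> tr p = K.tr p"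
proof -
  assume p: "p \<in> polys_in I"
  have car: "carrier G = {\<one>, s1, s2, s1 \<otimes> s2}" using gens unfolding klein_gens_def by blast
  show ?thesis
    unfolding tr_def K.tr_def car using klein_gens_distinct[OF gens] subst_act_one[OF p] subst_act_st[OF p]
    by (simp add: add.assoc eq_commute[of \<one>])
qed

lemma inv_polys_eq: "inv_polys = K.C"
proof -
  have car: "carrier G = {\<one>, s1, s2, s1 \<otimes> s2}" using gens unfolding klein_gens_def by blast
  show ?thesis unfolding inv_polys_def K.C_def car using subst_act_one subst_act_st by auto
qed

lemma tr_image_eq: "tr_image = K.T"
  unfolding tr_image_def K.T_def using tr_eq by (intro image_cong) auto

lemma pos_polys_eq: "pos_polys = K.Pos"
  unfolding pos_polys_def K.Pos_def inv_polys_eq ..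

lemma tr_inv: "p \<in> polys_in I \<Longrightarrow> tr p \<in> inv_polys"
  unfolding tr_eq inv_polys_eq using K.idl_T K.C.idlD(1) K.T_def by blast

lemmas presented = presented_transfer_quotient[OF tr_inv, unfolded inv_polys_eq tr_image_eq]
lemmas irrelevant = irrelevant_ideal_eq[OF tr_inv, unfolded pos_polys_eq]

end

text \<open>Interleaves the two families at even and odd indices, matching the numbering by
  \<open>yi\<close> and \<open>xi\<close>.\<close>

definition zip_basis :: "(nat \<Rightarrow> 'v) \<Rightarrow> (nat \<Rightarrow> 'v) \<Rightarrow> nat \<Rightarrow> 'v" where
  "zip_basis v w n = (if even n then v (n div 2) else w (n div 2))"

lemma zip_basis_simps [simp]: "zip_basis v w (yi j) = v j" "zip_basis v w (xi j) = w j"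
  by (simp_all add: zip_basis_def yi_def xi_def)

lemma (in vector_space) is_basis_zip:
  assumes "is_basis_family (case_sum v w) ({1..r} <+> {1..s})"
  shows "is_basis_family (zip_basis v w) (yi ` {1..r} \<union> xi ` {1..s})"
proof -
  let ?g = "\<lambda>n. if even n then Inl (n div 2) else Inr (n div 2) :: nat + nat"
  have g: "?g (yi j) = Inl j" "?g (xi j) = Inr j" for j by (simp_all add: yi_def xi_def)
  have "inj_on ?g A" for A by (rule inj_onI) (auto split: if_splits, presburger+)
  moreover have "?g ` (yi ` {1..r} \<union> xi ` {1..s}) = {1..r} <+> {1..s}"
    unfolding image_Un image_image g by (simp add: Plus_def)
  moreover have "zip_basis v w = case_sum v w \<circ> ?g" by (auto simp: zip_basis_def)
  ultimately show ?thesis using is_basis_family_comp[of "case_sum v w" ?g "yi ` {1..r} \<union> xi ` {1..s}"] assms by (simp only:)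
qed

text \<open>One pair of matrices covers all families of modules other than kG.\<close>

locale unip_rep = klein_rep scale G \<rho> "zip_basis v w" "yi ` {1..r} \<union> xi ` {1..s}" s1 s2
  for scale :: "'k::field \<Rightarrow> 'v::ab_group_add \<Rightarrow> 'v"
    and G :: "('g, 'b) monoid_scheme" (structure)
    and \<rho> :: "'g \<Rightarrow> 'v \<Rightarrow> 'v" and v w and r s :: nat and s1 s2 :: 'g +
  fixes M1 M2 :: "nat \<Rightarrow> nat \<Rightarrow> 'k"
  assumes \<rho>_v: "j \<in> {1..r} \<Longrightarrow> \<rho> s1 (v j) = v j" "j \<in> {1..r} \<Longrightarrow> \<rho> s2 (v j) = v j"
    and \<rho>_w: "i \<in> {1..s} \<Longrightarrow> \<rho> s1 (w i) = w i + (\<Sum>j\<in>{1..r}. scale (M1 i j) (v j))"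
      "i \<in> {1..s} \<Longrightarrow> \<rho> s2 (w i) = w i + (\<Sum>j\<in>{1..r}. scale (M2 i j) (v j))"
begin

lemma coord_vw:
  "j \<in> {1..r} \<Longrightarrow> j' \<in> {1..r} \<Longrightarrow> coord (yi j) (v j') = (if j = j' then 1 else 0)"
  "j \<in> {1..r} \<Longrightarrow> i \<in> {1..s} \<Longrightarrow> coord (yi j) (w i) = 0"
  "i \<in> {1..s} \<Longrightarrow> j \<in> {1..r} \<Longrightarrow> coord (xi i) (v j) = 0"
  "i \<in> {1..s} \<Longrightarrow> i' \<in> {1..s} \<Longrightarrow> coord (xi i) (w i') = (if i = i' then 1 else 0)"
  using coord_basis[of "yi j" "yi j'"] coord_basis[of "yi j" "xi i"] coord_basis[of "xi i" "yi j"] coord_basis[of "xi i" "xi i'"]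
  by simp_all

lemma sum_yx: "(\<Sum>n\<in>yi ` {1..r} \<union> xi ` {1..s}. f n) = (\<Sum>j\<in>{1..r}. f (yi j)) + (\<Sum>i\<in>{1..s}. f (xi i))"
  for f :: "nat \<Rightarrow> 'x::comm_monoid_add"
proof -
  have "inj_on yi A" "inj_on xi A" for A by (auto simp: inj_on_def)
  then show ?thesis by (subst sum.union_disjoint) (auto simp: sum.reindex)
qed

text \<open>Passing to the dual basis transposes the matrix: \<open>w i\<close> gains multiples of
  the \<open>v j\<close>, so the coordinate of \<open>v j\<close> gains multiples of those of the
  \<open>w i\<close>.\<close>

lemma act_unipotent:
  assumes "inv \<sigma> = \<sigma>" and v: "\<And>j. j \<in> {1..r} \<Longrightarrow> \<rho> \<sigma> (v j) = v j"
    and w: "\<And>i. i \<in> {1..s} \<Longrightarrow> \<rho> \<sigma> (w i) = w i + (\<Sum>j\<in>{1..r}. scale (M i j) (v j))"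
  shows "i \<in> {1..s} \<Longrightarrow> act \<sigma> (xi i) = Var (xi i)"
    and "j \<in> {1..r} \<Longrightarrow> act \<sigma> (yi j) = Var (yi j) + (\<Sum>i\<in>{1..s}. Cst (M i j) * Var (xi i))"
proof -
  have W: "f (\<rho> \<sigma> (w i)) = f (w i) + (\<Sum>j\<in>{1..r}. M i j * f (v j))" if "f \<in> W" "i \<in> {1..s}" for f i
    using that(1)[unfolded mem_W] unfolding w[OF that(2)] by (simp add: W_sum[OF that(1)])
  show "act \<sigma> (xi i) = Var (xi i)" if i: "i \<in> {1..s}"
  proof -
    have "Cst (coord (xi i) (\<rho> \<sigma> (w i'))) * Var (xi i') = (if i = i' then Var (xi i') else 0)" if i': "i' \<in> {1..s}" for i'
      using W[OF coord_in_W[of "xi i"] i'] coord_vw(3)[OF i] coord_vw(4)[OF i i'] by simp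
    then have "(\<Sum>i'\<in>{1..s}. Cst (coord (xi i) (\<rho> \<sigma> (w i'))) * Var (xi i')) = (\<Sum>i'\<in>{1..s}. if i = i' then Var (xi i') else 0)"
      by (rule sum.cong[OF refl])
    moreover have "(\<Sum>j\<in>{1..r}. Cst (coord (xi i) (\<rho> \<sigma> (v j))) * Var (yi j)) = (\<Sum>j\<in>{1..r}. 0)"
      using v coord_vw(3)[OF i] by (intro sum.cong) simp_all
    ultimately show ?thesis
      unfolding act_def assms(1) sum_yx zip_basis_simps using i by simp
  qed
  show "act \<sigma> (yi j) = Var (yi j) + (\<Sum>i\<in>{1..s}. Cst (M i j) * Var (xi i))" if j: "j \<in> {1..r}"
  proof -
    have 1: "coord (yi j) (\<rho> \<sigma> (w i)) = M i j" if i: "i \<in> {1..s}" for i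
    proof -
      have "(\<Sum>j'\<in>{1..r}. M i j' * coord (yi j) (v j')) = (\<Sum>j'\<in>{1..r}. if j' = j then M i j' else 0)"
        using coord_vw(1)[OF j] by (intro sum.cong) auto
      then show ?thesis using W[OF coord_in_W[of "yi j"] i] coord_vw(2)[OF j i] j by simp
    qed
    have "(\<Sum>j'\<in>{1..r}. Cst (coord (yi j) (\<rho> \<sigma> (v j'))) * Var (yi j')) = (\<Sum>j'\<in>{1..r}. if j = j' then Var (yi j') else 0)"
      using v coord_vw(1)[OF j] by (intro sum.cong) simp_all
    moreover have "(\<Sum>i\<in>{1..s}. Cst (coord (yi j) (\<rho> \<sigma> (w i))) * Var (xi i)) = (\<Sum>i\<in>{1..s}. Cst (M i j) * Var (xi i))"
      using 1 by (intro sum.cong) simp_all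
    ultimately show ?thesis
      unfolding act_def assms(1) sum_yx zip_basis_simps using j by simp
  qed
qed

sublocale U: unip "yi ` {1..r} \<union> xi ` {1..s}" "act s1" "act s2" r s
  "\<lambda>j. \<Sum>i\<in>{1..s}. Cst (M1 i j) * Var (xi i)" "\<lambda>j. \<Sum>i\<in>{1..s}. Cst (M2 i j) * Var (xi i)"
proof unfold_locales
  show "(\<Sum>i\<in>{1..s}. Cst (M i j) * Var (xi i)) \<in> polys_in (xi ` {1..s})" for M :: "nat \<Rightarrow> nat \<Rightarrow> 'k" and j
    by (intro polys_in.sum_closed) auto
qed (use act_unipotent[of s1 M1] act_unipotent[of s2 M2] \<rho>_v \<rho>_w in auto)

lemma sum_delta: "(\<Sum>i\<in>{1..s}. Cst (if i = j then c else 0) * Var (xi i)) = Cst c * U.xx j"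
proof -
  have "(\<Sum>i\<in>{1..s}. Cst (if i = j then c else 0) * Var (xi i)) = (\<Sum>i\<in>{1..s}. if i = j then Cst c * U.x i else 0)"
    by (intro sum.cong) auto
  then show ?thesis by (simp add: U.xx_def)
qed

abbreviation "depth_R \<equiv> depth transfer_quotient transfer_quotient_grading"
abbreviation "CM_R \<equiv> cohen_macaulay transfer_quotient transfer_quotient_grading"

lemma depth_V_rep:
  assumes "r = s" "lam \<noteq> 0" "lam \<noteq> 1" "\<And>i j. M1 i j = (if i = j then 1 else 0)"
    and "\<And>i j. M2 i j = (if i = j then lam else 0) + (if i = Suc j then 1 else 0)"
  shows "depth_R = r \<and> CM_R"
  using assms(1)
  by (intro U.depth_V[OF presented irrelevant assms(1-3)])
    (simp_all add: assms(4,5) sum_delta Cst_add distrib_right sum.distrib, simp_all add: U.xx_def)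

lemma depth_hankel_rep:
  assumes "2 \<le> r" "s = r \<or> s = Suc r" "\<And>i j. M1 i j = (if i = j then 1 else 0)"
    and "\<And>i j. M2 i j = (if i = Suc j then 1 else 0)"
  shows "depth_R = r \<and> \<not> CM_R"
  using assms(2)
  by (intro U.depth_hankel[OF presented irrelevant assms(1,2)])
    (simp_all add: assms(3,4) sum_delta, auto simp: U.xx_def)

lemma depth_Omega_neg_rep:
  assumes "r = Suc s" "\<And>i j. M1 i j = (if i = j then 1 else 0)"
    and "\<And>i j. M2 i j = (if i = j - 1 then 1 else 0)"
  shows "depth_R = r \<and> CM_R"
  by (intro U.depth_Omega_neg[OF presented irrelevant assms(1)]) (simp_all only: assms(2,3) sum_delta Cst_1 mult_1)

lemma depth_Omega_1_rep:
  assumes "r = 1" "s = 2" "\<And>i j. M1 i j = (if i = j then 1 else 0)"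
    and "\<And>i j. M2 i j = (if i = Suc j then 1 else 0)"
  shows "depth_R = 2 \<and> CM_R"
  by (intro U.depth_Omega_1[OF presented irrelevant assms(1,2)])
    (simp_all only: assms(3,4) sum_delta Cst_1 mult_1, simp_all only: U.xx_def, simp_all add: assms(1,2))

end

lemma (in vector_space) sum_scale_delta:
  "(\<Sum>j\<in>{1..r}. scale (if i = j then c else 0) (v j)) = (if i \<in> {1..r} then scale c (v i) else 0)" for i r :: nat
proof -
  have "(\<Sum>j\<in>{1..r}. scale (if i = j then c else 0) (v j)) = (\<Sum>j\<in>{1..r}. if i = j then scale c (v j) else 0)"
    by (intro sum.cong) auto
  then show ?thesis by simp
qed

context linear_rep
begin

lemma unip_repI:
  fixes M1 M2 :: "nat \<Rightarrow> nat \<Rightarrow> 'k"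
  assumes "klein_gens G s1 s2" "(2 :: 'k) = 0" "is_basis_family (case_sum v w) ({1..r} <+> {1..s})"
    and "\<And>j. j \<in> {1..r} \<Longrightarrow> \<rho> s1 (v j) = v j \<and> \<rho> s2 (v j) = v j"
    and "\<And>i. i \<in> {1..s} \<Longrightarrow> \<rho> s1 (w i) = w i + (\<Sum>j\<in>{1..r}. scale (M1 i j) (v j)) \<and>
       \<rho> s2 (w i) = w i + (\<Sum>j\<in>{1..r}. scale (M2 i j) (v j))"
  shows "unip_rep scale G \<rho> v w r s s1 s2 M1 M2"
proof -
  have "finite (carrier G)" using assms(1) card.infinite[of "carrier G"] unfolding klein_gens_def by fastforce
  then show ?thesis using assms is_basis_zip[OF assms(3)] by unfold_locales auto
qed

lemma depth_V_fin:
  assumes gens: "klein_gens G s1 s2" and two: "(2 :: 'k) = 0" and lam: "lam \<noteq> 0" "lam \<noteq> 1"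
    and iso: "iso_V_fin s1 s2 n lam"
  shows "depth transfer_quotient transfer_quotient_grading = n div 2 \<and>
    cohen_macaulay transfer_quotient transfer_quotient_grading"
proof -
  let ?r = "n div 2"
  let ?M1 = "\<lambda>i j. if i = j then 1 else 0" and ?M2 = "\<lambda>i j. (if i = j then lam else 0) + (if i = Suc j then 1 else 0)"
  obtain v w :: "nat \<Rightarrow> 'v" where
    bas: "is_basis_family (case_sum v w) ({1..?r} <+> {1..?r})" and v0: "v 0 = 0"
    and v: "\<And>j. j \<in> {1..?r} \<Longrightarrow> \<rho> s1 (v j) = v j \<and> \<rho> s2 (v j) = v j"
    and w: "\<And>i. i \<in> {1..?r} \<Longrightarrow> \<rho> s1 (w i) = w i + v i \<and> \<rho> s2 (w i) = w i + scale lam (v i) + v (i - 1)"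
    using iso unfolding iso_V_fin_def by blast
  have "unip_rep scale G \<rho> v w ?r ?r s1 s2 ?M1 ?M2"
  proof (rule unip_repI[OF gens two bas v])
    fix i assume i: "i \<in> {1..?r}"
    have "(\<Sum>j\<in>{1..?r}. scale (?M2 i j) (v j)) = scale lam (v i) + (\<Sum>j\<in>{1..?r}. scale (if i = Suc j then 1 else 0) (v j))"
      using sum_scale_delta[of i lam v ?r] i by (simp add: scale_left_distrib sum.distrib)
    also have "(\<Sum>j\<in>{1..?r}. scale (if i = Suc j then 1 else 0) (v j)) = (\<Sum>j\<in>{1..?r}. scale (if i - 1 = j then 1 else 0) (v j))"
      using i by (intro sum.cong) auto
    also have "\<dots> = v (i - 1)" using i v0 unfolding sum_scale_delta by (cases "i = 1") auto
    finally show "\<rho> s1 (w i) = w i + (\<Sum>j\<in>{1..?r}. scale (?M1 i j) (v j)) \<and> \<rho> s2 (w i) = w i + (\<Sum>j\<in>{1..?r}. scale (?M2 i j) (v j))"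
      using w[OF i] i unfolding sum_scale_delta by (simp add: add.assoc)
  qed
  then show ?thesis using lam by (rule unip_rep.depth_V_rep[OF _ refl]) simp_all
qed

text \<open>Serves the modules with lam = 0 (s = r) and the positive Omega modules (s = r + 1, with
  v_(r+1) = 0) alike.\<close>

lemma unip_rep_hankel:
  assumes gens: "klein_gens G s1 s2" and two: "(2 :: 'k) = 0"
    and bas: "is_basis_family (case_sum v w) ({1..r} <+> {1..s})" and v0: "v 0 = 0" and s: "s = r \<or> s = Suc r \<and> v (Suc r) = 0"
    and v: "\<And>j. j \<in> {1..r} \<Longrightarrow> \<rho> s1 (v j) = v j \<and> \<rho> s2 (v j) = v j"
    and w: "\<And>i. i \<in> {1..s} \<Longrightarrow> \<rho> s1 (w i) = w i + v i \<and> \<rho> s2 (w i) = w i + v (i - 1)"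
  shows "unip_rep scale G \<rho> v w r s s1 s2 (\<lambda>i j. if i = j then 1 else 0) (\<lambda>i j. if i = Suc j then 1 else 0)"
proof (rule unip_repI[OF gens two bas v])
  fix i assume i: "i \<in> {1..s}"
  have "(\<Sum>j\<in>{1..r}. scale (if i = Suc j then 1 else 0) (v j)) = (\<Sum>j\<in>{1..r}. scale (if i - 1 = j then 1 else 0) (v j))"
    using i by (intro sum.cong) auto
  also have "\<dots> = v (i - 1)" using i v0 s unfolding sum_scale_delta by (cases "i = 1") auto
  moreover have "(\<Sum>j\<in>{1..r}. scale (if i = j then 1 else 0) (v j)) = v i"
  proof (cases "i \<in> {1..r}")
    case False
    then have "i = Suc r" "v (Suc r) = 0" using i s by auto
    then show ?thesis unfolding sum_scale_delta by simp
  qed (simp only: sum_scale_delta if_True scale_one)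
  ultimately show "\<rho> s1 (w i) = w i + (\<Sum>j\<in>{1..r}. scale (if i = j then 1 else 0) (v j)) \<and>
      \<rho> s2 (w i) = w i + (\<Sum>j\<in>{1..r}. scale (if i = Suc j then 1 else 0) (v j))"
    using w[OF i] by simp
qed

text \<open>For n = 2 and lam = 0 the second generator acts trivially, against faithfulness; this
  forces at least two v.\<close>

lemma depth_V_zero:
  assumes gens: "klein_gens G s1 s2" and two: "(2 :: 'k) = 0" and faithful: "faithful_action G UNIV \<rho>"
    and n: "n \<ge> 2" and iso: "iso_V_fin s1 s2 n 0"
  shows "n \<ge> 4 \<and> depth transfer_quotient transfer_quotient_grading = n div 2 \<and>
    \<not> cohen_macaulay transfer_quotient transfer_quotient_grading"
proof -
  let ?r = "n div 2"
  obtain v w :: "nat \<Rightarrow> 'v" where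
    bas: "is_basis_family (case_sum v w) ({1..?r} <+> {1..?r})" and v0: "v 0 = 0"
    and v: "\<And>j. j \<in> {1..?r} \<Longrightarrow> \<rho> s1 (v j) = v j \<and> \<rho> s2 (v j) = v j"
    and w: "\<And>i. i \<in> {1..?r} \<Longrightarrow> \<rho> s1 (w i) = w i + v i \<and> \<rho> s2 (w i) = w i + v (i - 1)"
    using iso unfolding iso_V_fin_def by (auto simp: scale_zero_left)
  have "?r \<noteq> 1"
  proof
    assume r: "?r = 1"
    have fixed: "\<rho> s2 (case_sum v w i) = case_sum v w i" if "i \<in> {1..?r} <+> {1..?r}" for i
      using that v w v0 unfolding r by auto
    have s2: "s2 \<in> carrier G" using gens unfolding klein_gens_def by blast
    have "\<rho> s2 = (\<lambda>v. v)" by (rule act_eq_id[OF bas s2 fixed])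
    moreover have "\<rho> \<one> = (\<lambda>v. v)"
      using fun_cong[OF id_eq_one, symmetric] by (intro ext) simp
    moreover have "\<one> \<in> carrier G" using gens unfolding klein_gens_def by blast
    ultimately have "s2 = \<one>" using faithful_action.faithful[OF faithful] s2 unfolding inj_on_def by metis
    then show False using klein_gens_distinct(2)[OF gens] by blast
  qed
  then have r: "2 \<le> ?r" using n by linarith
  have "unip_rep scale G \<rho> v w ?r ?r s1 s2 (\<lambda>i j. if i = j then 1 else 0) (\<lambda>i j. if i = Suc j then 1 else 0)"
    using v w by (intro unip_rep_hankel[OF gens two bas v0]) auto
  from unip_rep.depth_hankel_rep[OF this r] r show ?thesis by simp
qed

text \<open>Replacing s2 by s1 s2 adds a second copy of \<open>v i\<close>, which cancels the term
  with lam = 1 in characteristic 2.\<close>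

lemma iso_V_fin_shear:
  assumes "(2 :: 'k) = 0" "s1 \<in> carrier G" "s2 \<in> carrier G" "iso_V_fin s1 s2 n 1"
  shows "iso_V_fin s1 (s1 \<otimes> s2) n 0"
proof -
  let ?r = "n div 2"
  obtain v w :: "nat \<Rightarrow> 'v" where
    bas: "is_basis_family (case_sum v w) ({1..?r} <+> {1..?r})" and v0: "v 0 = 0"
    and v: "\<And>j. j \<in> {1..?r} \<Longrightarrow> \<rho> s1 (v j) = v j \<and> \<rho> s2 (v j) = v j"
    and w: "\<And>i. i \<in> {1..?r} \<Longrightarrow> \<rho> s1 (w i) = w i + v i \<and> \<rho> s2 (w i) = w i + scale 1 (v i) + v (i - 1)"
    using assms(4) unfolding iso_V_fin_def by blast
  have comp: "\<rho> (s1 \<otimes> s2) u = \<rho> s1 (\<rho> s2 u)" for u using composition_rule[of u s1 s2] assms by simp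
  have add: "\<rho> s1 (u + u') = \<rho> s1 u + \<rho> s1 u'" for u u'
    using linear_action[OF assms(2)] by (simp add: Vector_Spaces.linear_iff)
  have vv: "u + u = 0" for u :: 'v
  proof -
    have "u + u = scale ((1::'k) + 1) u" by (simp only: scale_left_distrib scale_one)
    then show ?thesis using assms(1) by simp
  qed
  have v': "\<rho> s1 (v (i - 1)) = v (i - 1)" if "i \<in> {1..?r}" for i
  proof (cases "i = 1")
    case True
    have "\<rho> s1 0 + \<rho> s1 0 = \<rho> s1 0 + 0" using add[of 0 0] by simp
    then show ?thesis using True v0 by (simp only: add_left_cancel diff_self_eq_0)
  next
    case False
    then have "i - 1 \<in> {1..?r}" using that unfolding atLeastAtMost_iff by linarith
    then show ?thesis using v by blast
  qed
  have "\<rho> (s1 \<otimes> s2) (w i) = w i + v (i - 1)" if i: "i \<in> {1..?r}" for i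
  proof -
    have "\<rho> (s1 \<otimes> s2) (w i) = w i + (v i + v i) + v (i - 1)"
      using w[OF i] v[OF i] v'[OF i] by (simp add: comp add add.assoc)
    then show ?thesis by (simp only: vv add_0_right)
  qed
  then show ?thesis
    unfolding iso_V_fin_def using bas v0 v w comp by (intro exI[of _ v] exI[of _ w]) simp
qed

lemma depth_Omega_neg_fin:
  assumes gens: "klein_gens G s1 s2" and two: "(2 :: 'k) = 0" and iso: "iso_Omega_neg s1 s2 k"
  shows "depth transfer_quotient transfer_quotient_grading = k + 1 \<and>
    cohen_macaulay transfer_quotient transfer_quotient_grading"
proof -
  let ?M1 = "\<lambda>i j. if i = j then 1 else 0" and ?M2 = "\<lambda>i j. if i = j - 1 then 1 else 0"
  obtain v w :: "nat \<Rightarrow> 'v" where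
    bas: "is_basis_family (case_sum v w) ({1..k + 1} <+> {1..k})"
    and v: "\<And>j. j \<in> {1..k + 1} \<Longrightarrow> \<rho> s1 (v j) = v j \<and> \<rho> s2 (v j) = v j"
    and w: "\<And>i. i \<in> {1..k} \<Longrightarrow> \<rho> s1 (w i) = w i + v i \<and> \<rho> s2 (w i) = w i + v (i + 1)"
    using iso unfolding iso_Omega_neg_def by blast
  have "unip_rep scale G \<rho> v w (k + 1) k s1 s2 ?M1 ?M2"
  proof (rule unip_repI[OF gens two bas v])
    fix i assume i: "i \<in> {1..k}"
    have "(\<Sum>j\<in>{1..k + 1}. scale (?M2 i j) (v j)) = (\<Sum>j\<in>{1..k + 1}. scale (if i + 1 = j then 1 else 0) (v j))"
      using i by (intro sum.cong) auto
    then show "\<rho> s1 (w i) = w i + (\<Sum>j\<in>{1..k + 1}. scale (?M1 i j) (v j)) \<and> \<rho> s2 (w i) = w i + (\<Sum>j\<in>{1..k + 1}. scale (?M2 i j) (v j))"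
      using w[OF i] i unfolding sum_scale_delta by simp
  qed
  then show ?thesis by (rule unip_rep.depth_Omega_neg_rep) simp_all
qed

lemma depth_Omega_pos:
  assumes gens: "klein_gens G s1 s2" and two: "(2 :: 'k) = 0" and iso: "iso_Omega_pos s1 s2 m"
  shows "m \<ge> 2 \<Longrightarrow> depth transfer_quotient transfer_quotient_grading = m \<and>
      \<not> cohen_macaulay transfer_quotient transfer_quotient_grading"
    and "m = 1 \<Longrightarrow> depth transfer_quotient transfer_quotient_grading = 2 \<and>
      cohen_macaulay transfer_quotient transfer_quotient_grading"
proof -
  obtain v w :: "nat \<Rightarrow> 'v" where
    bas: "is_basis_family (case_sum v w) ({1..m} <+> {1..m + 1})" and v0: "v 0 = 0" and vm: "v (m + 1) = 0"
    and v: "\<And>j. j \<in> {1..m} \<Longrightarrow> \<rho> s1 (v j) = v j \<and> \<rho> s2 (v j) = v j"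
    and w: "\<And>i. i \<in> {1..m + 1} \<Longrightarrow> \<rho> s1 (w i) = w i + v i \<and> \<rho> s2 (w i) = w i + v (i - 1)"
    using iso unfolding iso_Omega_pos_def by blast
  have U: "unip_rep scale G \<rho> v w m (m + 1) s1 s2 (\<lambda>i j. if i = j then 1 else 0) (\<lambda>i j. if i = Suc j then 1 else 0)"
    using v w vm by (intro unip_rep_hankel[OF gens two bas v0]) (simp_all only: Suc_eq_plus1 simp_thms)
  show "m \<ge> 2 \<Longrightarrow> depth transfer_quotient transfer_quotient_grading = m \<and>
      \<not> cohen_macaulay transfer_quotient transfer_quotient_grading"
    by (rule unip_rep.depth_hankel_rep[OF U]) simp_all
  show "m = 1 \<Longrightarrow> depth transfer_quotient transfer_quotient_grading = 2 \<and>
      cohen_macaulay transfer_quotient transfer_quotient_grading"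
    by (rule unip_rep.depth_Omega_1_rep[OF U]) simp_all
qed

lemma depth_regular:
  assumes gens: "klein_gens G s1 s2" and two: "(2 :: 'k) = 0" and iso: "iso_regular"
  shows "depth transfer_quotient transfer_quotient_grading = 2 \<and>
    cohen_macaulay transfer_quotient transfer_quotient_grading"
proof -
  obtain b :: "'g \<Rightarrow> 'v" where b: "is_basis_family b (carrier G)"
    "\<And>\<sigma> \<tau>. \<sigma> \<in> carrier G \<Longrightarrow> \<tau> \<in> carrier G \<Longrightarrow> \<rho> \<sigma> (b \<tau>) = b (\<sigma> \<otimes> \<tau>)"
    using iso unfolding iso_regular_def by blast
  let ?I = "{0, 1, 2, 3 :: nat}"
  define g where "g n = (if n = 0 then \<one> else if n = 1 then s1 else if n = 2 then s2 else s1 \<otimes> s2)" for n :: nat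
  have g: "g 0 = \<one>" "g 1 = s1" "g 2 = s2" "g 3 = s1 \<otimes> s2" by (simp_all add: g_def)
  have car: "carrier G = {\<one>, s1, s2, s1 \<otimes> s2}" using gens unfolding klein_gens_def by blast
  have gI: "g ` ?I = carrier G" unfolding car image_insert image_empty g ..
  have ginj: "inj_on g ?I"
    using klein_gens_distinct[OF gens] by (auto simp: inj_on_def g_def)
  have fin: "finite (carrier G)" unfolding car by simp
  have grp: "group G" by (rule group_hom.axioms(1)[OF group_hom])
  then interpret grp: group G .
  have "is_basis_family (b \<circ> g) ?I" using b(1) ginj unfolding gI[symmetric] by (rule is_basis_family_comp)
  then interpret klein_rep scale G \<rho> "b \<circ> g" ?I s1 s2
    using gens two fin by unfold_locales auto
  have "s2 \<otimes> (s1 \<otimes> s2) = s1" "s1 \<otimes> (s1 \<otimes> s2) = s2"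
    by (metis gens_simps grp.m_assoc grp.r_one) (metis gens_simps grp.m_assoc grp.l_one)
  then have sg: "s1 \<otimes> g j = g (sw1 j)" "s2 \<otimes> g j = g (sw2 j)" if "j \<in> ?I" for j
    using that by (auto simp: g_def sw1_def sw2_def)
  have gcar: "g j \<in> carrier G" if "j \<in> ?I" for j using that gI by blast
  have coord: "coord i (b (g j)) = (if i = j then 1 else 0)" if "i \<in> ?I" "j \<in> ?I" for i j
    using coord_basis[OF that] by simp
  have swI: "sw1 j \<in> ?I" "sw2 j \<in> ?I" if "j \<in> ?I" for j using that by (auto simp: sw1_def sw2_def)
  \<comment> \<open>Multiplication by an involution permutes the basis, and the dual coordinates are
    permuted in the same way because the permutation is its own inverse.\<close>
  have swap: "act \<sigma> i = Var (sw i)"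
    if "i \<in> ?I" "\<sigma> \<in> carrier G" "inv \<sigma> = \<sigma>" "\<And>j. j \<in> ?I \<Longrightarrow> \<sigma> \<otimes> g j = g (sw j) \<and> sw j \<in> ?I" "\<And>j. sw (sw j) = j" for \<sigma> i sw
  proof -
    have "act \<sigma> i = (\<Sum>j\<in>?I. if sw i = j then Var j else 0)"
      unfolding act_def that(3)
    proof (rule sum.cong[OF refl])
      fix j assume j: "j \<in> ?I"
      have "\<rho> \<sigma> ((b \<circ> g) j) = b (g (sw j))" using b(2)[OF that(2) gcar[OF j]] that(4)[OF j] by simp
      then have "coord i (\<rho> \<sigma> ((b \<circ> g) j)) = (if i = sw j then 1 else 0)" using coord[OF that(1), of "sw j"] that(4)[OF j] by simp
      moreover have "i = sw j \<longleftrightarrow> sw i = j" using that(5) by metis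
      ultimately show "Cst (coord i (\<rho> \<sigma> ((b \<circ> g) j))) * Var j = (if sw i = j then Var j else 0)" by simp
    qed
    moreover have "sw i \<in> ?I" using that(4)[OF that(1)] by blast
    ultimately show ?thesis by (simp only: sum.delta' finite_I if_True)
  qed
  interpret klein_reg "act s1" "act s2"
  proof unfold_locales
    show "act s1 i = Var (sw1 i)" if "i \<in> ?I" for i using sg swI that by (intro swap) auto
    show "act s2 i = Var (sw2 i)" if "i \<in> ?I" for i using sg swI that by (intro swap) auto
  qed
  show ?thesis by (rule depth_reg[OF presented irrelevant])
qed

end

theorem mainTheorem2:
  fixes G :: "('g, 'b) monoid_scheme"
    and \<sigma>\<^sub>1 \<sigma>\<^sub>2 :: 'g
    and scale :: "'k::field \<Rightarrow> 'v::ab_group_add \<Rightarrow> 'v"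
    and \<rho> :: "'g \<Rightarrow> 'v \<Rightarrow> 'v"
  defines "R \<equiv> linear_rep.transfer_quotient scale G \<rho>"
    and "gr \<equiv> linear_rep.transfer_quotient_grading scale G \<rho>"
    and "isoV \<equiv> linear_rep.iso_V scale \<rho> \<sigma>\<^sub>1 \<sigma>\<^sub>2"
    and "isoOmega \<equiv> linear_rep.iso_Omega scale \<rho> \<sigma>\<^sub>1 \<sigma>\<^sub>2"
    and "isoRegular \<equiv> linear_rep.iso_regular scale G \<rho>"
  assumes "infinite (UNIV :: 'k set)" and "CHAR('k) = 2"
    and "group G" and "\<sigma>\<^sub>1 \<in> carrier G" and "\<sigma>\<^sub>2 \<in> carrier G"
    and "carrier G = generate G {\<sigma>\<^sub>1, \<sigma>\<^sub>2}"
    and "G \<cong> integer_mod_group 2 \<times>\<times> integer_mod_group 2"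
    and "linear_rep scale G \<rho>" and "faithful_action G UNIV \<rho>"
    and "(\<exists>n lam. n \<ge> 2 \<and> even n \<and> isoV n lam) \<or> (\<exists>m. m \<noteq> 0 \<and> isoOmega m) \<or> isoRegular"
  shows "(\<forall>n lam. n \<ge> 2 \<longrightarrow> even n \<longrightarrow> isoV n (Fin lam) \<longrightarrow> lam \<notin> {0, 1} \<longrightarrow>
            depth R gr = n div 2 \<and> cohen_macaulay R gr) \<and>
         (\<forall>n lam. n \<ge> 2 \<longrightarrow> even n \<longrightarrow> isoV n lam \<longrightarrow> lam \<in> {Fin 0, Fin 1, Infinity} \<longrightarrow>
            n \<ge> 4 \<and> depth R gr = n div 2 \<and> \<not> cohen_macaulay R gr) \<and>
         (\<forall>m. m < 0 \<longrightarrow> isoOmega m \<longrightarrow>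
            depth R gr = nat \<bar>m\<bar> + 1 \<and> cohen_macaulay R gr) \<and>
         (\<forall>m. m \<ge> 2 \<longrightarrow> isoOmega m \<longrightarrow>
            depth R gr = nat m \<and> \<not> cohen_macaulay R gr) \<and>
         (isoOmega 1 \<longrightarrow> depth R gr = 2 \<and> cohen_macaulay R gr) \<and>
         (isoRegular \<longrightarrow> depth R gr = 2 \<and> cohen_macaulay R gr)"
proof -
  interpret linear_rep scale G \<rho> by fact
  have two: "(2 :: 'k) = 0" using of_nat_CHAR[where ?'a = 'k] assms(7) by simp
  note gens = klein_gens_of_iso[OF assms(8-12)]
  note shear = klein_gens_shear[OF assms(8) gens]
  note defs = R_def gr_def isoV_def isoOmega_def isoRegular_def
  show ?thesis
  proof (intro conjI allI impI)
    fix n lam assume "isoV n (Fin lam)" "lam \<notin> {0, 1}"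
    then show "depth R gr = n div 2" "cohen_macaulay R gr"
      unfolding defs using depth_V_fin[OF gens two] by auto
  next
    fix n lam assume n: "n \<ge> 2" and V: "isoV n lam" and "lam \<in> {Fin 0, Fin 1, Infinity}"
    then consider "lam = Fin 0" | "lam = Fin 1" | "lam = Infinity" by blast
    then have "n \<ge> 4 \<and> depth R gr = n div 2 \<and> \<not> cohen_macaulay R gr"
    proof cases
      case 1
      then show ?thesis
        using V depth_V_zero[OF gens two assms(14) n] unfolding defs by simp
    next
      case 2
      then show ?thesis
        using V depth_V_zero[OF shear two assms(14) n] iso_V_fin_shear[OF two assms(9,10)] unfolding defs by simp
    next
      case 3
      then show ?thesis
        using V depth_V_zero[OF klein_gens_swap[OF gens] two assms(14) n] unfolding defs by simp
    qed
    then show "n \<ge> 4" "depth R gr = n div 2" "\<not> cohen_macaulay R gr" by auto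
  next
    fix m :: int assume "m < 0" "isoOmega m"
    then show "depth R gr = nat \<bar>m\<bar> + 1" "cohen_macaulay R gr"
      unfolding defs iso_Omega_def using depth_Omega_neg_fin[OF gens two, of "nat \<bar>m\<bar>"] by auto
  next
    fix m :: int assume "m \<ge> 2" "isoOmega m"
    then show "depth R gr = nat m" "\<not> cohen_macaulay R gr"
      unfolding defs iso_Omega_def using depth_Omega_pos(1)[OF gens two, of "nat m"] by auto
  next
    assume "isoOmega 1"
    then show "depth R gr = 2" "cohen_macaulay R gr"
      unfolding defs iso_Omega_def using depth_Omega_pos(2)[OF gens two, of 1] by (auto simp: One_nat_def)
  next
    assume "isoRegular"
    then show "depth R gr = 2" "cohen_macaulay R gr"
      unfolding defs using depth_regular[OF gens two] by auto
  qed
qed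

end
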